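(* Let $p\ge1$ and $K,L>0$. Assume $\|A^{1/2}Q^{1/2}\|_{\mathrm{HS}}\le K$ and \[ |X_h^0|_{-1,h}+J(X_h^0)+|Y_h^0|_1\le L\quad\text{for all }h>0 . \] Then there exist $C,k_0>0$, depending on $p,K,L,T$, such that for all $h>0$ and $0<k<k_0$, \[ \mathbf E\sup_{1\le j\le N}J(X_h^j)^p+\mathbf E\Big(\sum_{j=1}^Nk|Y_h^j|_1^2\Big)^p\le C . \]
   Context: Let $\mathcal D\subset\mathbb R^d$, $d\le 3$, be a bounded convex domain with polygonal boundary, $H=L_2(\mathcal D)$ with inner product $\langle\cdot,\cdot\rangle$ and norm $\|\cdot\|$, $\dot H=\{v\in H:\int_{\mathcal D}v\,dx=0\}$, and $P$ the orthogonal projector of $H$ onto $\dot H$. Let $A=-\Delta$ with homogeneous Neumann boundary conditions, $D(A)=\{v\in H^2(\mathcal D):\partial v/\partial n=0 \text{ on }\partial\mathcal D\}$, extended to $H$ by $Av=APv$; it has an orthonormal eigenbasis $\{\varphi_j\}_{j\ge0}$ of $H$ with eigenvalues $0=\lambda_0<\lambda_1\le\lambda_2\le\dots\to\infty$, $\varphi_0=|\mathcal D|^{-1/2}$. Powers $A^{s}$ act by $\varphi_j\mapsto\lambda_j^{s}\varphi_j$ on $j\ge1$ (and annihilate $\varphi_0$). For $\alpha\in\mathbb R$, $|v|_\alpha=(\sum_{j\ge1}\lambda_j^\alpha|\langle v,\varphi_j\rangle|^2)^{1/2}$; in particular $|v|_1=\|\nabla v\|$. Finite elements: $\{\mathcal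 T_h\}_{h>0}$ is a family of regular triangulations of $\mathcal D$ with maximal mesh size $h$, $S_h$ the continuous piecewise linear functions on $\mathcal T_h$, $\dot S_h=PS_h$. The discrete Laplacian $A_h:S_h\to S_h$ is defined by $\langle A_hv_h,w_h\rangle=\langle\nabla v_h,\nabla w_h\rangle$ for all $v_h,w_h\in S_h$; it has an orthonormal eigenbasis $\{\varphi_{h,j}\}_{j=0}^{N_h}$ of $S_h$ with eigenvalues $0=\lambda_{h,0}<\lambda_{h,1}\le\dots$, $\varphi_{h,0}=\varphi_0$, and $A_h^{s}$ acts by $\varphi_{h,j}\mapsto\lambda_{h,j}^s\varphi_{h,j}$ for $j\ge1$. For $v_h\in\dot S_h$, $|v_h|_{\alpha,h}=\|A_h^{\alpha/2}v_h\|$. $P_h:H\to S_h$ is the $L_2$-orthogonal projector. It is assumed throughout that $|P_hv|_1\le C|v|_1$ for $v\in\dot H^1$ with $C$ independent of $h$. Noise and nonlinearity: $T>0$; $W$ is an $H$-valued $Q$-Wiener process on a filtered probability space $(\Omega,\mathcal F,\mathbf P,\{\mathcal F_t\})$ (normal filtration), with $Q$ a selfadjoint positive semidefinite operator, and $\int_{\mathcal D}W(t)\,dx=0$ for all $t\ge0$. $\|\cdot\|_{\mathrm{HS}}$ is the Hilbert–Schmidt norm. $f=F'$ where $F$ is a real polynomial of degree 4 with leading term $c_0s^4$, $c_0>0$. The initial value $X_0\in\dot H$ is deterministic. Define $\mathcal F(u)=\int_{\mathcal D}F(u)\,dx$ and $J(u)=\tfrac12|u|_1^2+\mathcal F(u)$.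 Scheme: for $N\in\mathbb N$, $k=T/N$, $t_j=jk$, $\Delta W^j=W(t_j)-W(t_{j-1})$, the random variables $X_h^j\in S_h$ satisfy $X_h^0=P_hX_0$ and $X_h^j-X_h^{j-1}+kA_h^2X_h^j+kA_hP_hf(X_h^j)=P_h\Delta W^j$, $j=1,\dots,N$ (each $X_h^j$ lies in $\dot S_h$). The discrete chemical potential is $Y_h^j=A_hX_h^j+P_hf(X_h^j)$, $j=0,\dots,N$. *)

theory Defs
  imports "HOL-Analysis.Analysis" "HOL-Probability.Probability"
          "HOL-Computational_Algebra.Polynomial"
begin

type_synonym ('n) fn = "real^'n \<Rightarrow> real"

definition L2 :: "(real^'n::finite) set \<Rightarrow> 'n fn set" where
  "L2 D = {u. u \<in> borel_measurable (lebesgue_on D) \<and>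
               integrable (lebesgue_on D) (\<lambda>x. (u x)\<^sup>2)}"

definition ip :: "(real^'n::finite) set \<Rightarrow> 'n fn \<Rightarrow> 'n fn \<Rightarrow> real" where
  "ip D u v = integral\<^sup>L (lebesgue_on D) (\<lambda>x. u x * v x)"

definition nrm :: "(real^'n::finite) set \<Rightarrow> 'n fn \<Rightarrow> real" where
  "nrm D u = sqrt (ip D u u)"

definition mean_zero :: "(real^'n::finite) set \<Rightarrow> 'n fn \<Rightarrow> bool" where
  "mean_zero D u \<longleftrightarrow> integral\<^sup>L (lebesgue_on D) u = 0"

definition pd :: "'n::finite \<Rightarrow> 'n fn \<Rightarrow> 'n fn" where
  "pd i \<psi> = (\<lambda>x. frechet_derivative \<psi> (at x) (axis i 1))"

definition test_fun :: "(real^'n::finite) set \<Rightarrow> 'n fn \<Rightarrow> bool" where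
  "test_fun D \<psi> \<longleftrightarrow> (\<forall>is :: 'n list. \<forall>x. foldr pd is \<psi> differentiable at x) \<and>
     compact (closure {x. \<psi> x \<noteq> 0}) \<and> closure {x. \<psi> x \<noteq> 0} \<subseteq> D"

definition weak_grad :: "(real^'n::finite) set \<Rightarrow> 'n fn \<Rightarrow> (real^'n \<Rightarrow> real^'n) \<Rightarrow> bool" where
  "weak_grad D u g \<longleftrightarrow> (\<forall>i. (\<lambda>x. g x $ i) \<in> L2 D) \<and>
     (\<forall>\<psi>. test_fun D \<psi> \<longrightarrow> (\<forall>i.
        integral\<^sup>L (lebesgue_on D) (\<lambda>x. u x * pd i \<psi> x)
          = - integral\<^sup>L (lebesgue_on D) (\<lambda>x. g x $ i * \<psi> x)))"

definition H1 :: "(real^'n::finite) set \<Rightarrow> 'n fn set" where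
  "H1 D = {u \<in> L2 D. \<exists>g. weak_grad D u g}"

definition wgrad :: "(real^'n::finite) set \<Rightarrow> 'n fn \<Rightarrow> real^'n \<Rightarrow> real^'n" where
  "wgrad D u = (SOME g. weak_grad D u g)"

definition gip :: "(real^'n::finite) set \<Rightarrow> 'n fn \<Rightarrow> 'n fn \<Rightarrow> real" where
  "gip D u v = integral\<^sup>L (lebesgue_on D) (\<lambda>x. wgrad D u x \<bullet> wgrad D v x)"

definition sn1 :: "(real^'n::finite) set \<Rightarrow> 'n fn \<Rightarrow> real" where
  "sn1 D u = sqrt (gip D u u)"

definition neumann_eigenbasis ::
  "(real^'n) set \<Rightarrow> (nat \<Rightarrow> 'n fn) \<Rightarrow> (nat \<Rightarrow> real) \<Rightarrow> bool" where
  "neumann_eigenbasis D \<phi> lam \<longleftrightarrow>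
     (\<forall>j. \<phi> j \<in> H1 D \<and> (\<forall>v \<in> H1 D. gip D (\<phi> j) v = lam j * ip D (\<phi> j) v)) \<and>
     (\<forall>i j. ip D (\<phi> i) (\<phi> j) = (if i = j then 1 else 0)) \<and>
     (\<forall>v \<in> L2 D. (\<lambda>j. (ip D v (\<phi> j))\<^sup>2) sums ip D v v) \<and>
     lam 0 = 0 \<and> (\<forall>j. 0 < lam (Suc j)) \<and> mono lam"

text \<open>square of the Hilbert--Schmidt norm of A^(1/2) Q^(1/2), computed in the
  eigenbasis of A: sum_j lambda_j <Q phi_j, phi_j>  (= ||Q^(1/2) A^(1/2)||_HS^2)\<close>
definition HS_sq :: "(real^'n::finite) set \<Rightarrow> (nat \<Rightarrow> 'n fn) \<Rightarrow> (nat \<Rightarrow> real)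
                      \<Rightarrow> ('n fn \<Rightarrow> 'n fn) \<Rightarrow> ennreal" where
  "HS_sq D \<phi> lam Q = (\<Sum>j. ennreal (lam j * ip D (Q (\<phi> j)) (\<phi> j)))"

definition selfadj_psd :: "(real^'n::finite) set \<Rightarrow> ('n fn \<Rightarrow> 'n fn) \<Rightarrow> bool" where
  "selfadj_psd D Q \<longleftrightarrow>
     (\<forall>v \<in> L2 D. Q v \<in> L2 D) \<and>
     (\<forall>u \<in> L2 D. \<forall>v \<in> L2 D. \<forall>w \<in> L2 D. \<forall>a b.
         ip D (Q (\<lambda>x. a * u x + b * v x)) w = a * ip D (Q u) w + b * ip D (Q v) w) \<and>
     (\<exists>c. \<forall>v \<in> L2 D. nrm D (Q v) \<le> c * nrm D v) \<and>
     (\<forall>u \<in> L2 D. \<forall>v \<in> L2 D. ip D (Q u) v = ip D u (Q v)) \<and>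
     (\<forall>v \<in> L2 D. 0 \<le> ip D (Q v) v)"

definition normal_filtration :: "'w measure \<Rightarrow> (real \<Rightarrow> 'w set set) \<Rightarrow> bool" where
  "normal_filtration M Fl \<longleftrightarrow>
     (\<forall>t. sigma_algebra (space M) (Fl t) \<and> Fl t \<subseteq> sets M) \<and>
     (\<forall>s t. 0 \<le> s \<longrightarrow> s \<le> t \<longrightarrow> Fl s \<subseteq> Fl t) \<and>
     (\<forall>t \<ge> 0. Fl t = (\<Inter>s \<in> {t<..}. Fl s)) \<and>
     (\<forall>N \<in> null_sets M. \<forall>A \<subseteq> N. A \<in> Fl 0)"

definition gauss :: "real \<Rightarrow> real measure" where
  "gauss s2 = (if s2 = 0 then return borel 0 else density lborel (normal_density 0 (sqrt s2)))"

definition Q_wiener :: "(real^'n::finite) set \<Rightarrow> 'w measure \<Rightarrow> (real \<Rightarrow> 'w set set)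
     \<Rightarrow> ('n fn \<Rightarrow> 'n fn) \<Rightarrow> (real \<Rightarrow> 'w \<Rightarrow> 'n fn) \<Rightarrow> bool" where
  "Q_wiener D M Fl Q W \<longleftrightarrow>
     (\<forall>t \<ge> 0. \<forall>\<omega> \<in> space M. W t \<omega> \<in> L2 D) \<and>
     (\<forall>\<omega> \<in> space M. nrm D (W 0 \<omega>) = 0) \<and>
     (\<forall>\<omega> \<in> space M. \<forall>t \<ge> 0.
         ((\<lambda>s. nrm D (\<lambda>x. W s \<omega> x - W t \<omega> x)) \<longlongrightarrow> 0) (at t within {0..})) \<and>
     (\<forall>t \<ge> 0. \<forall>v \<in> L2 D. \<forall>U \<in> sets borel.
         {\<omega> \<in> space M. ip D (W t \<omega>) v \<in> U} \<in> Fl t) \<and>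
     (\<forall>s t. 0 \<le> s \<longrightarrow> s < t \<longrightarrow> (\<forall>v \<in> L2 D.
         distr M borel (\<lambda>\<omega>. ip D (\<lambda>x. W t \<omega> x - W s \<omega> x) v)
           = gauss ((t - s) * ip D (Q v) v))) \<and>
     (\<forall>s t. 0 \<le> s \<longrightarrow> s < t \<longrightarrow>
         prob_space.indep_set M (Fl s)
           (sigma_sets (space M)
              {{\<omega> \<in> space M. ip D (\<lambda>x. W t \<omega> x - W s \<omega> x) v \<in> U} | v U.
                   v \<in> L2 D \<and> U \<in> sets borel}))"

definition triangulation :: "(real^'n::finite) set \<Rightarrow> (real^'n) set set \<Rightarrow> bool" where
  "triangulation D \<T> \<longleftrightarrow> finite \<T> \<and> (\<forall>K \<in> \<T>. int CARD('n) simplex K) \<and>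
     \<Union>\<T> = closure D \<and>
     (\<forall>K1 \<in> \<T>. \<forall>K2 \<in> \<T>. (K1 \<inter> K2) face_of K1 \<and> (K1 \<inter> K2) face_of K2)"

definition meshsize :: "(real^'n::finite) set set \<Rightarrow> real" where
  "meshsize \<T> = Max (diameter ` \<T>)"

definition regular_family :: "(real^'n::finite) set \<Rightarrow> real set \<Rightarrow> (real \<Rightarrow> (real^'n) set set) \<Rightarrow> bool" where
  "regular_family D Hs Tr \<longleftrightarrow> Hs \<subseteq> {0<..} \<and>
     (\<forall>h \<in> Hs. triangulation D (Tr h) \<and> meshsize (Tr h) = h) \<and>
     (\<exists>\<sigma> > 0. \<forall>h \<in> Hs. \<forall>K \<in> Tr h. \<exists>z r. r > 0 \<and> ball z r \<subseteq> K \<and> diameter K \<le> \<sigma> * r)"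

definition Sh :: "(real^'n::finite) set \<Rightarrow> (real^'n) set set \<Rightarrow> 'n fn set" where
  "Sh D \<T> = {v. continuous_on (closure D) v \<and>
                (\<forall>K \<in> \<T>. \<exists>a b. \<forall>x \<in> K. v x = a \<bullet> x + b) \<and>
                (\<forall>x. x \<notin> closure D \<longrightarrow> v x = 0)}"

definition Ph :: "(real^'n::finite) set \<Rightarrow> (real^'n) set set \<Rightarrow> 'n fn \<Rightarrow> 'n fn" where
  "Ph D \<T> u = (THE w. w \<in> Sh D \<T> \<and> (\<forall>z \<in> Sh D \<T>. ip D (\<lambda>x. u x - w x) z = 0))"

definition Ah :: "(real^'n::finite) set \<Rightarrow> (real^'n) set set \<Rightarrow> 'n fn \<Rightarrow> 'n fn" where
  "Ah D \<T> v = (THE w. w \<in> Sh D \<T> \<and> (\<forall>z \<in> Sh D \<T>. ip D w z = gip D v z))"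

definition Ah_inv :: "(real^'n::finite) set \<Rightarrow> (real^'n) set set \<Rightarrow> 'n fn \<Rightarrow> 'n fn" where
  "Ah_inv D \<T> v = (THE w. w \<in> Sh D \<T> \<and> mean_zero D w \<and> Ah D \<T> w = v)"

text \<open>|v|_{-1,h} = ||A_h^{-1/2} v|| = <A_h^{-1} v, v>^{1/2}\<close>
definition dnorm_m1 :: "(real^'n::finite) set \<Rightarrow> (real^'n) set set \<Rightarrow> 'n fn \<Rightarrow> real" where
  "dnorm_m1 D \<T> v = sqrt (ip D (Ah_inv D \<T> v) v)"

definition Jfun :: "(real^'n::finite) set \<Rightarrow> real poly \<Rightarrow> 'n fn \<Rightarrow> real" where
  "Jfun D F u = (sn1 D u)\<^sup>2 / 2 + integral\<^sup>L (lebesgue_on D) (\<lambda>x. poly F (u x))"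

definition Yh :: "(real^'n::finite) set \<Rightarrow> (real^'n) set set \<Rightarrow> real poly \<Rightarrow> 'n fn \<Rightarrow> 'n fn" where
  "Yh D \<T> F v = (\<lambda>x. Ah D \<T> v x + Ph D \<T> (\<lambda>y. poly (pderiv F) (v y)) x)"

definition scheme :: "(real^'n::finite) set \<Rightarrow> (real^'n) set set \<Rightarrow> real poly \<Rightarrow> 'w measure
     \<Rightarrow> (real \<Rightarrow> 'w \<Rightarrow> 'n fn) \<Rightarrow> 'n fn \<Rightarrow> real \<Rightarrow> nat \<Rightarrow> (nat \<Rightarrow> 'w \<Rightarrow> 'n fn) \<Rightarrow> bool" where
  "scheme D \<T> F M W X0 k N X \<longleftrightarrow>
     (\<forall>\<omega> \<in> space M. X 0 \<omega> = Ph D \<T> X0) \<and>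
     (\<forall>j \<le> N. \<forall>\<omega> \<in> space M. X j \<omega> \<in> Sh D \<T>) \<and>
     (\<forall>j \<le> N. \<forall>x. (\<lambda>\<omega>. X j \<omega> x) \<in> borel_measurable M) \<and>
     (\<forall>j \<in> {1..N}. AE \<omega> in M. \<forall>x.
        X j \<omega> x - X (j - 1) \<omega> x + k * Ah D \<T> (Ah D \<T> (X j \<omega>)) x
          + k * Ah D \<T> (Ph D \<T> (\<lambda>y. poly (pderiv F) (X j \<omega> y))) x
        = Ph D \<T> (\<lambda>y. W (real j * k) \<omega> y - W (real (j - 1) * k) \<omega> y) x)"

end

theory Submission
  imports Defs
begin

text \<open>
  Testing the scheme with the chemical potential yields an energy inequality for one step.  The convexity
  surplus of the quartic potential, which is of order \<open>(a\<^sup>2 + b\<^sup>2) (a - b)\<^sup>2\<close> pointwise, controls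
  \<open>\<langle>\<Delta>W, f(X\<^sup>j) - f(X\<^sup>j\<^sup>-\<^sup>1)\<rangle>\<close>, so that the only embedding needed is \<open>H\<^sup>1 \<subseteq> L\<^sub>4\<close> for the projected noise.
  With \<open>S\<^sub>n = J(X\<^sup>n) + const + (k/2) \<Sum> \<bar>Y\<^sup>j\<bar>\<^sub>1\<^sup>2\<close> the inequality has the form
  \<open>S\<^sub>n \<le> S\<^sub>n\<^sub>-\<^sub>1 + m\<^sub>n + c (Z\<^sub>n + Z\<^sub>n\<^sup>2) S\<^sub>n\<^sub>-\<^sub>1\<close>, where \<open>Z\<^sub>n = \<parallel>A\<^sup>1\<^sup>/\<^sup>2 \<Delta>W\<^sup>n\<parallel>\<^sup>2\<close> is independent of the past with
  moments of order \<open>k\<close>, and \<open>m\<^sub>n\<close> is a martingale difference with \<open>\<bar>m\<^sub>n\<bar> \<le> c Z\<^sub>n\<^sup>1\<^sup>/\<^sup>2 S\<^sub>n\<^sub>-\<^sub>1\<close>.  Expanding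
  \<open>S\<^sub>n\<^sup>q\<close> gives all moments, uniformly in \<open>n\<close>, and Doob's inequality for the martingale part of \<open>S\<^sub>n\<^sup>q\<close>
  gives the supremum; both terms of the claim are bounded by \<open>sup S\<^sub>n\<close>.  The martingale property needs
  \<open>X\<^sup>n\<close> to be adapted, which holds because for small \<open>k\<close> the implicit step determines \<open>X\<^sup>n\<close> as a Lipschitz
  function of \<open>X\<^sup>n\<^sup>-\<^sup>1 + P\<^sub>h \<Delta>W\<^sup>n\<close>.
\<close>

section \<open>The space \<open>L2\<close>\<close>

text \<open>After the convexity surplus is spent, a multiple of the squared \<open>L2\<close> norm
  of the increment \<open>X^j - X^(j-1)\<close> remains, without a factor \<open>k\<close>. Testing
  the scheme with this increment bounds it by its gradient, the noise and the dissipation, at the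
  price of half of the dissipation; this is one source of the smallness of \<open>k\<close>, unique
  solvability of the implicit step is the other. The increment of \<open>W\<close> is only known to
  lie in \<open>L2\<close>, with a finite sum of \<open>lam j\<close> times its squared
  coefficients. The \<open>H1\<close> stability of \<open>P_h\<close> is therefore applied to
  eigenfunction truncations, and the finitely many functionals that determine the projection pass to
  the limit. Uniformity in \<open>h\<close> rests on a Sobolev constant of the domain, found by
  integrating along segments of the convex set \<open>D\<close>; all constants are fixed before the
  mesh. Since \<open>wgrad\<close> is chosen by \<open>SOME\<close> and \<open>Ph\<close>,
  \<open>Ah\<close> by \<open>THE\<close>, uniqueness of weak gradients and definiteness of the
  forms on \<open>Sh\<close> precede every computation. The scheme holds almost surely only, so
  adaptedness relies on the null sets in the filtration.\<close>

lemma L2_measurable: "u \<in> L2 D \<Longrightarrow> u \<in> borel_measurable (lebesgue_on D)"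
  by (simp add: L2_def)

lemma abs_mult_le_sq: "\<bar>a * b\<bar> \<le> a\<^sup>2 + (b::real)\<^sup>2"
proof -
  have "0 \<le> (\<bar>a\<bar> - \<bar>b\<bar>)\<^sup>2" by simp
  hence "2 * \<bar>a * b\<bar> \<le> a\<^sup>2 + b\<^sup>2" by (simp add: power2_diff abs_mult)
  moreover have "0 \<le> \<bar>a * b\<bar>" by simp
  ultimately show ?thesis by linarith
qed

lemma L2_mult_integrable:
  assumes "u \<in> L2 D" "v \<in> L2 D"
  shows "integrable (lebesgue_on D) (\<lambda>x. u x * v x)"
proof (rule Bochner_Integration.integrable_bound)
  show "integrable (lebesgue_on D) (\<lambda>x. (u x)\<^sup>2 + (v x)\<^sup>2)"
    using assms by (auto simp: L2_def)
  show "(\<lambda>x. u x * v x) \<in> borel_measurable (lebesgue_on D)"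
    using assms by (auto simp: L2_def)
  show "AE x in lebesgue_on D. norm (u x * v x) \<le> norm ((u x)\<^sup>2 + (v x)\<^sup>2)"
    by (rule AE_I2) (use abs_mult_le_sq in auto)
qed

lemma L2_lincomb:
  assumes "u \<in> L2 D" "v \<in> L2 D"
  shows "(\<lambda>x. a * u x + b * v x) \<in> L2 D"
proof -
  have "(\<lambda>x. (a * u x + b * v x)\<^sup>2) = (\<lambda>x. a\<^sup>2 * (u x)\<^sup>2 + b\<^sup>2 * (v x)\<^sup>2 + 2 * a * b * (u x * v x))"
    by (auto simp: power2_eq_square algebra_simps)
  moreover have "integrable (lebesgue_on D) \<dots>"
    using assms L2_mult_integrable[OF assms] by (auto simp: L2_def)
  ultimately show ?thesis using assms by (auto simp: L2_def)
qed

lemma L2_scale: "u \<in> L2 D \<Longrightarrow> (\<lambda>x. a * u x) \<in> L2 D"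
  using L2_lincomb[of u D u a 0] by simp

lemma L2_add: "u \<in> L2 D \<Longrightarrow> v \<in> L2 D \<Longrightarrow> (\<lambda>x. u x + v x) \<in> L2 D"
  using L2_lincomb[of u D v 1 1] by simp

lemma L2_diff: "u \<in> L2 D \<Longrightarrow> v \<in> L2 D \<Longrightarrow> (\<lambda>x. u x - v x) \<in> L2 D"
  using L2_lincomb[of u D v 1 "-1"] by simp

lemma L2_zero: "(\<lambda>x. 0) \<in> L2 D"
  by (simp add: L2_def)

lemma L2_sum:
  assumes "\<And>i. i \<in> I \<Longrightarrow> u i \<in> L2 D"
  shows "(\<lambda>x. \<Sum>i\<in>I. c i * u i x) \<in> L2 D"
  using assms
  by (induction I rule: infinite_finite_induct) (auto intro!: L2_add L2_scale L2_zero)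

lemma ip_commute: "ip D u v = ip D v u"
  by (simp add: ip_def mult.commute)

lemma ip_self_nonneg: "0 \<le> ip D u u"
  by (simp add: ip_def)

lemma ip_lincomb:
  assumes "u \<in> L2 D" "v \<in> L2 D" "w \<in> L2 D"
  shows "ip D (\<lambda>x. a * u x + b * v x) w = a * ip D u w + b * ip D v w"
proof -
  have "(\<lambda>x. (a * u x + b * v x) * w x) = (\<lambda>x. a * (u x * w x) + b * (v x * w x))"
    by (auto simp: algebra_simps)
  thus ?thesis
    using L2_mult_integrable[OF assms(1,3)] L2_mult_integrable[OF assms(2,3)]
    by (simp add: ip_def)
qed

lemma ip_scale: "ip D (\<lambda>x. a * u x) w = a * ip D u w"
  by (simp add: ip_def mult.assoc)

lemma ip_add: "u \<in> L2 D \<Longrightarrow> v \<in> L2 D \<Longrightarrow> w \<in> L2 D \<Longrightarrow>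
    ip D (\<lambda>x. u x + v x) w = ip D u w + ip D v w"
  using ip_lincomb[of u D v w 1 1] by simp

lemma ip_diff: "u \<in> L2 D \<Longrightarrow> v \<in> L2 D \<Longrightarrow> w \<in> L2 D \<Longrightarrow>
    ip D (\<lambda>x. u x - v x) w = ip D u w - ip D v w"
  using ip_lincomb[of u D v w 1 "-1"] by simp

lemma ip_zero: "ip D (\<lambda>x. 0) w = 0"
  by (simp add: ip_def)

lemma ip_sum:
  assumes "\<And>i. i \<in> I \<Longrightarrow> u i \<in> L2 D" "w \<in> L2 D"
  shows "ip D (\<lambda>x. \<Sum>i\<in>I. c i * u i x) w = (\<Sum>i\<in>I. c i * ip D (u i) w)"
  using assms
proof (induction I rule: infinite_finite_induct)
  case (insert i I)
  have "ip D (\<lambda>x. c i * u i x + (\<Sum>i\<in>I. c i * u i x)) w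
      = ip D (\<lambda>x. c i * u i x) w + ip D (\<lambda>x. \<Sum>i\<in>I. c i * u i x) w"
    using insert by (intro ip_add L2_scale L2_sum) auto
  thus ?case using insert by (simp add: ip_scale)
qed (auto simp: ip_zero)

text \<open>Common to the Cauchy-Schwarz inequalities of \<open>ip\<close> and \<open>gip\<close>.
  Both forms are only semidefinite, so the case \<open>C = 0\<close> must be covered.\<close>

lemma quadratic_nonneg_imp_discr:
  fixes A B C :: real
  assumes "\<And>t. 0 \<le> A + 2 * t * B + t\<^sup>2 * C" "0 \<le> C"
  shows "B\<^sup>2 \<le> A * C"
proof (cases "C = 0")
  case True
  have "B = 0"
  proof (rule ccontr)
    assume "B \<noteq> 0"
    \<comment> \<open>At this \<open>t\<close> the affine function \<open>A + 2 * t * B\<close>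
      equals -1.\<close>
    with assms(1)[of "- (A + 1) / (2 * B)"] True show False by (simp add: field_simps)
  qed
  thus ?thesis using assms True by simp
next
  case False
  hence C: "0 < C" using assms(2) by simp
  have "0 \<le> A + 2 * (-B/C) * B + (-B/C)\<^sup>2 * C" by (rule assms(1))
  also have "\<dots> = A - B\<^sup>2 / C" using C by (simp add: field_simps power2_eq_square)
  finally show ?thesis using C by (simp add: field_simps)
qed

lemma ip_cauchy_schwarz:
  assumes "u \<in> L2 D" "v \<in> L2 D"
  shows "(ip D u v)\<^sup>2 \<le> ip D u u * ip D v v"
proof (rule quadratic_nonneg_imp_discr)
  fix t :: real
  have "0 \<le> ip D (\<lambda>x. 1 * u x + t * v x) (\<lambda>x. 1 * u x + t * v x)" by (rule ip_self_nonneg)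
  also have "\<dots> = ip D u (\<lambda>x. 1 * u x + t * v x) + t * ip D v (\<lambda>x. 1 * u x + t * v x)"
    using assms L2_lincomb[OF assms, of 1 t] by (subst ip_lincomb) auto
  also have "\<dots> = ip D u u + t * ip D v u + t * (ip D u v + t * ip D v v)"
    unfolding ip_commute[of D u "\<lambda>x. 1 * u x + t * v x"] ip_commute[of D v "\<lambda>x. 1 * u x + t * v x"]
    using ip_lincomb[OF assms(1,2,1), of 1 t] ip_lincomb[OF assms(1,2,2), of 1 t] by (simp add: ip_commute[of D v u])
  finally show "0 \<le> ip D u u + 2 * t * ip D u v + t\<^sup>2 * ip D v v"
    by (simp add: ip_commute[of D v u] algebra_simps power2_eq_square)
qed (rule ip_self_nonneg)

section \<open>Smooth functions with support in a box\<close>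

text \<open>Infinite differentiability as a greatest fixed point: every family of functions closed
  under differentiation consists of smooth functions.\<close>

coinductive smooth1 :: "(real \<Rightarrow> real) \<Rightarrow> bool" where
  smooth1I: "(\<And>x. (f has_real_derivative f' x) (at x)) \<Longrightarrow> smooth1 f' \<Longrightarrow> smooth1 f"

lemma smooth1_E:
  assumes "smooth1 f"
  obtains f' where "\<And>x. (f has_real_derivative f' x) (at x)" "smooth1 f'"
  using assms by (cases rule: smooth1.cases) blast

lemma smooth1_deriv:
  assumes "smooth1 f"
  shows "(f has_real_derivative deriv f x) (at x)" "smooth1 (deriv f)"
proof -
  obtain f' where f': "\<And>x. (f has_real_derivative f' x) (at x)" "smooth1 f'"
    using assms by (rule smooth1_E) blast
  have "deriv f = f'" using f'(1) by (auto intro!: DERIV_imp_deriv)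
  thus "(f has_real_derivative deriv f x) (at x)" "smooth1 (deriv f)" using f' by auto
qed

text \<open>The derivative of a product is a sum of two products, so sums of products, kept as lists
  of pairs of factors, form a family closed under differentiation.\<close>

definition sum_of_products :: "((real \<Rightarrow> real) \<times> (real \<Rightarrow> real)) list \<Rightarrow> real \<Rightarrow> real" where
  "sum_of_products l = (\<lambda>x. \<Sum>p\<leftarrow>l. fst p x * snd p x)"

lemma smooth1_sum_of_products:
  assumes "\<forall>p\<in>set l. smooth1 (fst p) \<and> smooth1 (snd p)"
  shows "smooth1 (sum_of_products l)"
  using assms
proof (coinduction arbitrary: l)
  case (smooth1 l)
  note d = smooth1_deriv
  define l' where "l' = concat (map (\<lambda>p. [(deriv (fst p), snd p), (fst p, deriv (snd p))]) l)"
  have "(sum_of_products l has_real_derivative sum_of_products l' x) (at x)" for x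
    using smooth1 unfolding l'_def sum_of_products_def
  proof (induction l)
    case (Cons p l)
    have 1: "(fst p has_real_derivative deriv (fst p) x) (at x)" "(snd p has_real_derivative deriv (snd p) x) (at x)"
      using Cons.prems d by auto
    show ?case using Cons 
      by (auto intro!: derivative_eq_intros 1 simp: algebra_simps)
  qed auto
  moreover have "\<forall>p\<in>set l'. smooth1 (fst p) \<and> smooth1 (snd p)"
    using smooth1 d by (auto simp: l'_def)
  ultimately show ?case by blast
qed

lemma smooth1_mult: "smooth1 f \<Longrightarrow> smooth1 g \<Longrightarrow> smooth1 (\<lambda>x. f x * g x)"
  using smooth1_sum_of_products[of "[(f, g)]"] by (simp add: sum_of_products_def)

lemma smooth1_affine: "smooth1 f \<Longrightarrow> smooth1 (\<lambda>x. f (a * x + b))"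
proof -
  assume f: "smooth1 f"
  \<comment> \<open>The chain rule multiplies by \<open>a\<close>, hence the coinduction runs over
    an arbitrary factor \<open>c\<close>.\<close>
  have "smooth1 (\<lambda>x. c * f (a * x + b))" for c
    using f
  proof (coinduction arbitrary: f c)
    case (smooth1 f c)
    then obtain f' where f': "\<And>x. (f has_real_derivative f' x) (at x)" "smooth1 f'"
      by (auto elim: smooth1_E)
    have "((\<lambda>x. c * f (a * x + b)) has_real_derivative (c * a) * f' (a * x + b)) (at x)" for x
      by (auto intro!: derivative_eq_intros DERIV_chain'[where g = f, OF _ f'(1)])
    thus ?case using f'(2)
      by (intro exI[of _ "\<lambda>x. c * f (a * x + b)"] exI[of _ "\<lambda>x. c * a * f' (a * x + b)"]) blast
  qed
  from this[of 1] show ?thesis by simp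
qed

section \<open>The flat function exp(-1/x) and its derivatives\<close>

definition flat_exp :: "real poly \<Rightarrow> real \<Rightarrow> real" where
  "flat_exp p = (\<lambda>x. if x > 0 then poly p (1 / x) * exp (- (1 / x)) else 0)"

lemma poly_exp_tendsto_0: "((\<lambda>y. poly p y * exp (- y)) \<longlongrightarrow> 0) (at_top::real filter)"
proof -
  have "((\<lambda>y. \<Sum>i\<le>degree p. coeff p i * (y ^ i / exp y)) \<longlongrightarrow> (\<Sum>i\<le>degree p. coeff p i * 0)) (at_top::real filter)"
    by (intro tendsto_sum tendsto_mult tendsto_const tendsto_power_div_exp_0)
  thus ?thesis
    by (simp add: poly_altdef sum_distrib_right sum_divide_distrib exp_minus field_simps)
qed

text \<open>The difference quotient at 0 stays within the family, so differentiability at 0 reduces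
  to the limit of another member.\<close>

lemma flat_exp_over_x:
  "flat_exp p x / x = flat_exp ([:0, 1:] * p) x"
  by (auto simp: flat_exp_def)

lemma flat_exp_tendsto_0: "(flat_exp p \<longlongrightarrow> 0) (at 0)"
proof -
  have "((\<lambda>x. poly p (inverse x) * exp (- inverse x)) \<longlongrightarrow> 0) (at_right 0)"
    using filterlim_compose[OF poly_exp_tendsto_0[of p] filterlim_inverse_at_top_right] .
  hence "(flat_exp p \<longlongrightarrow> 0) (at_right 0)"
    by (rule Lim_transform_eventually)
       (auto simp: flat_exp_def eventually_at_right_field inverse_eq_divide intro!: exI[of _ 1])
  moreover have "(flat_exp p \<longlongrightarrow> 0) (at_left 0)"
    by (rule Lim_transform_eventually[OF tendsto_const])
       (auto simp: flat_exp_def eventually_at_left_field intro!: exI[of _ "-1"])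
  ultimately show ?thesis by (simp add: filterlim_at_split)
qed

text \<open>With y = 1/x, the derivative of p(y) exp(-y) in x is y^2 (p - p')(y) exp(-y), so the
  family over all polynomials is closed under differentiation.\<close>

lemma flat_exp_deriv:
  "(flat_exp p has_real_derivative flat_exp ([:0,0,1:] * (p - pderiv p)) x) (at x)"
proof -
  consider "x > 0" | "x < 0" | "x = 0" by linarith
  thus ?thesis
  proof cases
    case 1
    have "((\<lambda>x. poly p (1 / x) * exp (- (1 / x))) has_real_derivative 
        flat_exp ([:0,0,1:] * (p - pderiv p)) x) (at x)"
      using 1 by (auto intro!: derivative_eq_intros simp: flat_exp_def field_simps power2_eq_square)
    thus ?thesis
      by (rule has_field_derivative_transform_within_open[where S="{0<..}"])
         (use 1 in \<open>auto simp: flat_exp_def\<close>)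
  next
    case 2
    have "((\<lambda>x. 0) has_real_derivative flat_exp ([:0,0,1:] * (p - pderiv p)) x) (at x)"
      using 2 by (auto simp: flat_exp_def)
    thus ?thesis
      by (rule has_field_derivative_transform_within_open[where S="{..<0}"])
         (use 2 in \<open>auto simp: flat_exp_def\<close>)
  next
    case 3
    have "((\<lambda>h. flat_exp p h / h) \<longlongrightarrow> 0) (at 0)"
      unfolding flat_exp_over_x by (rule flat_exp_tendsto_0)
    moreover have "flat_exp q 0 = 0" for q by (simp add: flat_exp_def)
    ultimately show ?thesis using 3 by (simp only: DERIV_def add_0 diff_zero)
  qed
qed

lemma smooth1_flat_exp: "smooth1 (flat_exp p)"
  by (coinduction arbitrary: p) (use flat_exp_deriv in blast)


section \<open>Tensor products as test functions\<close>

definition tens :: "('n \<Rightarrow> real \<Rightarrow> real) \<Rightarrow> real^'n::finite \<Rightarrow> real" where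
  "tens f = (\<lambda>x. \<Prod>i\<in>UNIV. f i (x $ i))"

lemma tens_has_derivative:
  assumes "\<And>i x. (f i has_real_derivative f' i x) (at x)"
  shows "(tens f has_derivative (\<lambda>h. \<Sum>i\<in>UNIV. (f' i (x $ i) * h $ i) * (\<Prod>j\<in>UNIV - {i}. f j (x $ j)))) (at x)"
  unfolding tens_def
proof (rule has_derivative_prod)
  fix i
  have "((\<lambda>x. x $ i) has_derivative (\<lambda>h. h $ i)) (at x)"
    by (rule bounded_linear_imp_has_derivative) (rule bounded_linear_vec_nth)
  from has_derivative_compose[OF this assms[unfolded has_field_derivative_def]]
  show "((\<lambda>x. f i (x $ i)) has_derivative (\<lambda>h. f' i (x $ i) * h $ i)) (at x)"
    by simp
qed

lemma pd_tens:
  assumes "\<And>i x. (f i has_real_derivative f' i x) (at x)"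
  shows "pd k (tens f) = tens (f(k := f' k))"
proof
  fix x
  have "pd k (tens f) x = (\<Sum>i\<in>UNIV. (f' i (x $ i) * axis k 1 $ i) * (\<Prod>j\<in>UNIV - {i}. f j (x $ j)))"
    unfolding pd_def by (subst frechet_derivative_at[OF tens_has_derivative[OF assms], symmetric]) simp
  also have "\<dots> = (\<Sum>i\<in>UNIV. if i = k then f' k (x $ k) * (\<Prod>j\<in>UNIV - {k}. f j (x $ j)) else 0)"
    by (intro sum.cong) (auto simp: axis_def)
  also have "\<dots> = f' k (x $ k) * (\<Prod>j\<in>UNIV - {k}. f j (x $ j))" by simp
  also have "\<dots> = tens (f(k := f' k)) x"
    unfolding tens_def by (subst (2) prod.remove[of _ k]) (auto intro!: prod.cong)
  finally show "pd k (tens f) x = tens (f(k := f' k)) x" .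
qed

text \<open>Each partial derivative replaces one factor by its derivative, so iterated partial
  derivatives remain tensor products of smooth factors.\<close>

lemma foldr_pd_tens:
  assumes "\<And>i. smooth1 (f i)"
  shows "\<exists>f'. (\<forall>i. smooth1 (f' i)) \<and> foldr pd is (tens f) = tens f'"
proof (induction "is")
  case (Cons k "is")
  then obtain g where g: "\<And>i. smooth1 (g i)" "foldr pd is (tens f) = tens g" by auto
  show ?case
  proof (intro exI conjI allI)
    show "smooth1 ((g(k := deriv (g k))) i)" for i using g(1) by (simp add: smooth1_deriv)
    show "foldr pd (k # is) (tens f) = tens (g(k := deriv (g k)))"
      using pd_tens[of g "\<lambda>i. deriv (g i)" k, OF smooth1_deriv(1)[OF g(1)]] g(2) by (simp del: fun_upd_apply)
  qed
qed (use assms in auto)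

lemma test_fun_tens:
  assumes "\<And>i. smooth1 (f i)" "compact S" "S \<subseteq> D" "\<And>x. x \<notin> S \<Longrightarrow> tens f x = 0"
  shows "test_fun D (tens f)"
  unfolding test_fun_def
proof (intro conjI allI)
  fix "is" :: "'a list" and x :: "real^'a"
  obtain f' where f': "\<forall>i. smooth1 (f' i)" "foldr pd is (tens f) = tens f'"
    using foldr_pd_tens[of f "is"] assms(1) by blast
  have "(tens f' has_derivative (\<lambda>h. \<Sum>i\<in>UNIV. (deriv (f' i) (x $ i) * h $ i) * (\<Prod>j\<in>UNIV - {i}. f' j (x $ j)))) (at x)"
    by (rule tens_has_derivative) (use f' smooth1_deriv in blast)
  thus "foldr pd is (tens f) differentiable at x"
    unfolding f'(2) differentiable_def by blast
next
  have "closure {x. tens f x \<noteq> 0} \<subseteq> S"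
    using assms by (intro closure_minimal) (auto intro: compact_imp_closed)
  thus "compact (closure {x. tens f x \<noteq> 0})" "closure {x. tens f x \<noteq> 0} \<subseteq> D"
    using assms(2,3) by (auto simp: compact_eq_bounded_closed intro: bounded_subset)
qed

text \<open>As \<open>n\<close> grows, the two flat factors steepen at the endpoints: the bumps stay
  between 0 and 1 and tend pointwise to the indicator of the open interval.\<close>

definition bump1 :: "nat \<Rightarrow> real \<Rightarrow> real \<Rightarrow> real \<Rightarrow> real" where
  "bump1 n a b = (\<lambda>t. flat_exp 1 (real n * (t - a)) * flat_exp 1 (real n * (b - t)))"

lemma smooth1_bump1: "smooth1 (bump1 n a b)"
proof -
  have "smooth1 (\<lambda>t. flat_exp 1 (real n * t + (- real n * a)) * flat_exp 1 ((- real n) * t + real n * b))"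
    by (intro smooth1_mult smooth1_affine smooth1_flat_exp)
  thus ?thesis by (simp add: bump1_def algebra_simps)
qed

lemma flat_exp_1_bounds: "0 \<le> flat_exp 1 x" "flat_exp 1 x \<le> 1" "x \<le> 0 \<Longrightarrow> flat_exp 1 x = 0"
  by (auto simp: flat_exp_def)

lemma bump1_bounds: "0 \<le> bump1 n a b t" "bump1 n a b t \<le> 1"
  by (auto simp: bump1_def flat_exp_1_bounds intro!: mult_nonneg_nonneg mult_le_one)

lemma bump1_outside: "t \<le> a \<or> b \<le> t \<Longrightarrow> bump1 n a b t = 0"
  by (auto simp: bump1_def flat_exp_1_bounds(3) mult_nonneg_nonpos)

lemma flat_exp_1_tendsto: 
  assumes "c > 0"
  shows "(\<lambda>n. flat_exp 1 (real n * c)) \<longlonglongrightarrow> 1"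
proof (rule Lim_transform_eventually)
  have "(\<lambda>n. exp (- ((1 / c) * (1 / real n)))) \<longlonglongrightarrow> exp (- ((1 / c) * 0))"
    by (intro tendsto_intros lim_1_over_n)
  thus "(\<lambda>n. exp (- ((1 / c) * (1 / real n)))) \<longlonglongrightarrow> 1" by simp
  show "\<forall>\<^sub>F n in sequentially. exp (- ((1 / c) * (1 / real n))) = flat_exp 1 (real n * c)"
    using eventually_gt_at_top[of 0] by eventually_elim (use assms in \<open>auto simp: flat_exp_def\<close>)
qed

lemma bump1_tendsto: "(\<lambda>n. bump1 n a b t) \<longlonglongrightarrow> indicat_real {a<..<b} t"
proof (cases "a < t \<and> t < b")
  case True
  have "(\<lambda>n. bump1 n a b t) \<longlonglongrightarrow> 1 * 1"
    unfolding bump1_def by (intro tendsto_mult flat_exp_1_tendsto) (use True in auto)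
  thus ?thesis using True by simp
next
  case False
  hence "bump1 n a b t = 0" for n by (intro bump1_outside) auto
  thus ?thesis using False by simp
qed

lemma tens_bump_tendsto: 
  "(\<lambda>n. tens (\<lambda>i. bump1 n (a $ i) (b $ i)) x) \<longlonglongrightarrow> indicat_real (box a b) x"
proof -
  have "(\<lambda>n. tens (\<lambda>i. bump1 n (a $ i) (b $ i)) x) \<longlonglongrightarrow> (\<Prod>i\<in>UNIV. indicat_real {a $ i<..<b $ i} (x $ i))"
    unfolding tens_def by (intro tendsto_prod bump1_tendsto)
  also have "(\<Prod>i\<in>UNIV. indicat_real {a $ i<..<b $ i} (x $ i)) = indicat_real (box a b) x"
    by (auto simp: indicator_def mem_box_cart)
  finally show ?thesis .
qed

text \<open>Fundamental lemma of the calculus of variations. Tensor bumps converge to indicators of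
  boxes, so \<open>g\<close> integrates to zero over every closed box inside \<open>D\<close>;
  Lebesgue differentiation along shrinking cubes then recovers the values of
  \<open>g\<close>.\<close>

lemma test_fun_zero_imp_AE_zero:
  fixes D :: "(real^'n::finite) set"
  assumes D: "open D" and g: "integrable (lebesgue_on D) g"
    and zero: "\<And>\<psi>. test_fun D \<psi> \<Longrightarrow> integral\<^sup>L (lebesgue_on D) (\<lambda>x. g x * \<psi> x) = 0"
  shows "AE x in lebesgue_on D. g x = 0"
proof -
  have Dm: "D \<in> sets lebesgue" using D by auto
  have box0: "integral\<^sup>L (lebesgue_on D) (\<lambda>x. g x * indicat_real (box a b) x) = 0" if "cbox a b \<subseteq> D" for a b
  proof -
    have "(\<lambda>n. integral\<^sup>L (lebesgue_on D) (\<lambda>x. g x * tens (\<lambda>i. bump1 n (a $ i) (b $ i)) x)) 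
        \<longlonglongrightarrow> integral\<^sup>L (lebesgue_on D) (\<lambda>x. g x * indicat_real (box a b) x)"
    proof (rule integral_dominated_convergence[where w="\<lambda>x. norm (g x)"])
      fix n
      have "continuous_on UNIV (tens (\<lambda>i. bump1 n (a $ i) (b $ i)))"
      proof -
        note tens_has_derivative[of "\<lambda>i. bump1 n (a $ i) (b $ i)", OF smooth1_deriv(1)[OF smooth1_bump1]]
        thus ?thesis by (auto intro!: continuous_at_imp_continuous_on has_derivative_continuous)
      qed
      hence "tens (\<lambda>i. bump1 n (a $ i) (b $ i)) \<in> borel_measurable borel"
        by (rule borel_measurable_continuous_onI)
      hence "tens (\<lambda>i. bump1 n (a $ i) (b $ i)) \<in> borel_measurable (lebesgue_on D)"
        by (intro measurable_restrict_space1 measurable_completion) auto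
      thus "(\<lambda>x. g x * tens (\<lambda>i. bump1 n (a $ i) (b $ i)) x) \<in> borel_measurable (lebesgue_on D)"
        using g by auto
      have "\<bar>tens (\<lambda>i. bump1 n (a $ i) (b $ i)) x\<bar> \<le> 1" for x
        unfolding tens_def abs_prod by (rule prod_le_1) (use bump1_bounds in \<open>auto simp: abs_of_nonneg\<close>)
      thus "AE x in lebesgue_on D. norm (g x * tens (\<lambda>i. bump1 n (a $ i) (b $ i)) x) \<le> norm (g x)"
        by (intro AE_I2) (auto simp: abs_mult mult_left_le)
    next
      show "AE x in lebesgue_on D. (\<lambda>n. g x * tens (\<lambda>i. bump1 n (a $ i) (b $ i)) x) 
          \<longlonglongrightarrow> g x * indicat_real (box a b) x"
        by (intro AE_I2 tendsto_intros tens_bump_tendsto)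
      have "box a b \<in> sets borel" by simp
      hence "indicat_real (box a b) \<in> borel_measurable (lebesgue_on D)"
        by (intro measurable_restrict_space1 measurable_completion) auto
      thus "(\<lambda>x. g x * indicat_real (box a b) x) \<in> borel_measurable (lebesgue_on D)" using g by auto
    qed (use g in auto)
    moreover have "integral\<^sup>L (lebesgue_on D) (\<lambda>x. g x * tens (\<lambda>i. bump1 n (a $ i) (b $ i)) x) = 0" for n
    proof (rule zero, rule test_fun_tens[where S="cbox a b"])
      fix x assume "x \<notin> cbox a b"
      then obtain i where "x $ i < a $ i \<or> b $ i < x $ i"
        by (auto simp: mem_box_cart not_le)
      hence "bump1 n (a $ i) (b $ i) (x $ i) = 0" by (intro bump1_outside) auto
      thus "tens (\<lambda>i. bump1 n (a $ i) (b $ i)) x = 0"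
        unfolding tens_def by (intro prod_zero) auto
    qed (use that smooth1_bump1 in auto)
    ultimately show ?thesis by (simp add: LIMSEQ_const_iff)
  qed
  \<comment> \<open>Extension by zero, to which differentiation of integrals on the whole space
    applies.\<close>
  define f where "f = (\<lambda>x. indicat_real D x *\<^sub>R g x)"
  have f: "integrable lebesgue f"
    using g Dm by (subst (asm) integrable_restrict_space) (auto simp: f_def)
  hence fa: "f absolutely_integrable_on UNIV" by (simp add: set_integrable_def)
  have fi: "f absolutely_integrable_on cbox a b" for a b
    by (rule set_integrable_subset[OF fa]) auto
  hence "f integrable_on cbox a b" for a b using set_lebesgue_integral_eq_integral(1) by blast
  \<comment> \<open>Lebesgue differentiation over cubes with lower corner \<open>x\<close>.\<close>
  then obtain N where N: "negligible N" 
    "\<And>x e. \<lbrakk>x \<notin> N; 0 < e\<rbrakk> \<Longrightarrow> \<exists>d>0. \<forall>h. 0 < h \<and> h < d \<longrightarrow>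
       norm(integral (cbox x (x + h *\<^sub>R One)) f /\<^sub>R h ^ DIM(real^'n) - f x) < e"
    using integrable_ccontinuous_explicit by blast
  have int0: "integral (cbox a b) f = 0" if "cbox a b \<subseteq> D" for a b
  proof -
    have "integral (cbox a b) f = (LINT x:cbox a b|lebesgue. f x)"
      using set_lebesgue_integral_eq_integral(2)[OF fi] by simp
    also have "\<dots> = integral\<^sup>L lebesgue (\<lambda>x. indicat_real D x *\<^sub>R (g x * indicat_real (box a b) x))"
      unfolding set_lebesgue_integral_def
    proof (rule integral_cong_AE)
      have "AE x in lebesgue. x \<notin> cbox a b - box a b"
        using negligible_frontier_interval[of a b] 
        by (simp add: AE_iff_null_sets negligible_iff_null_sets AE_not_in)
      thus "AE x in lebesgue. indicat_real (cbox a b) x *\<^sub>R f x = indicat_real D x *\<^sub>R (g x * indicat_real (box a b) x)"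
        by eventually_elim (use box_subset_cbox[of a b] in \<open>auto simp: indicator_def f_def\<close>)
      have "g \<in> borel_measurable (lebesgue_on D)" using g by auto
      moreover have "indicat_real (box a b) \<in> borel_measurable (lebesgue_on D)"
        by (intro measurable_restrict_space1 measurable_completion) auto
      ultimately show "(\<lambda>x. indicat_real D x *\<^sub>R (g x * indicat_real (box a b) x)) \<in> borel_measurable lebesgue"
        using Dm by (subst borel_measurable_restrict_space_iff[symmetric]) auto
      show "(\<lambda>x. indicat_real (cbox a b) x *\<^sub>R f x) \<in> borel_measurable lebesgue"
        using f by (intro borel_measurable_scaleR borel_measurable_indicator fmeasurableD lmeasurable_cbox borel_measurable_integrable)
    qed
    also have "\<dots> = 0" using box0[OF that] Dm by (subst (asm) integral_restrict_space) auto
    finally show ?thesis .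
  qed
  have "f x = 0" if "x \<in> D" and xN: "x \<notin> N" for x
  proof (rule ccontr)
    assume "f x \<noteq> 0"
    then obtain d where d: "d > 0" "\<And>h. 0 < h \<and> h < d \<Longrightarrow> 
       norm(integral (cbox x (x + h *\<^sub>R One)) f /\<^sub>R h ^ DIM(real^'n) - f x) < norm (f x)"
      using N(2)[OF xN, of "norm (f x)"] by auto
    obtain e where e: "e > 0" "cball x e \<subseteq> D" using D \<open>x \<in> D\<close> open_contains_cball by blast
    \<comment> \<open>Small enough for the differentiation estimate and for the cube with corner
      \<open>x\<close> to fit into the ball of radius \<open>e\<close>.\<close>
    define h where "h = min (d / 2) (e / (norm (One :: real^'n) + 1))"
    have h: "0 < h" "h < d" using d e by (auto simp: h_def field_simps add_pos_nonneg intro!: divide_pos_pos)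
    have "cbox x (x + h *\<^sub>R One) \<subseteq> cball x e"
    proof
      fix y assume y: "y \<in> cbox x (x + h *\<^sub>R One)"
      have "norm (y - x) \<le> norm (h *\<^sub>R (One :: real^'n))"
        by (rule norm_le_componentwise) (use y in \<open>auto simp: mem_box inner_diff_left inner_add_left\<close>)
      also have "\<dots> = h * norm (One :: real^'n)" using h by simp
      also have "\<dots> \<le> e / (norm (One :: real^'n) + 1) * norm (One :: real^'n)"
        by (intro mult_right_mono) (auto simp: h_def)
      also have "\<dots> \<le> e" using e by (simp add: field_simps add_pos_nonneg)
      finally show "y \<in> cball x e" by (simp add: dist_norm norm_minus_commute)
    qed
    hence "integral (cbox x (x + h *\<^sub>R One)) f = 0" using e by (intro int0) auto
    with d(2)[of h] h show False by simp
  qed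
  moreover have "AE x in lebesgue. x \<notin> N" using N(1) by (simp add: negligible_iff_null_sets AE_not_in)
  ultimately have "AE x in lebesgue. x \<in> D \<longrightarrow> g x = 0"
    by (auto simp: f_def elim!: eventually_mono)
  thus ?thesis using Dm by (simp add: AE_restrict_space_iff)
qed

section \<open>Weak gradients\<close>

locale bounded_domain =
  fixes D :: "(real^'n::finite) set"
  assumes D_open: "open D" and D_bounded: "bounded D" and D_convex: "convex D" and D_nonempty: "D \<noteq> {}"
begin

abbreviation "\<mu> \<equiv> lebesgue_on D"

lemma D_sets [simp, intro]: "D \<in> sets lebesgue" and D_borel [simp, intro]: "D \<in> sets borel"
  using D_open by auto

lemma D_fmeasurable: "D \<in> lmeasurable"
  using D_open D_bounded by (intro lmeasurable_open)

sublocale finite_measure \<mu>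
  using D_fmeasurable by (intro finite_measure_lebesgue_on)

lemma measure_D_pos: "0 < measure lebesgue D"
proof -
  have "\<not> negligible D" using D_open D_nonempty open_not_negligible by blast
  hence "measure lebesgue D \<noteq> 0"
    using D_fmeasurable by (auto simp: negligible_iff_measure)
  thus ?thesis by (simp add: zero_less_measure_iff)
qed

lemma measurable_muI: "f \<in> borel_measurable borel \<Longrightarrow> f \<in> borel_measurable \<mu>"
  by (intro measurable_restrict_space1 measurable_completion) auto

lemma continuous_on_imp_measurable: "continuous_on D f \<Longrightarrow> f \<in> borel_measurable \<mu>"
  for f :: "real^'n \<Rightarrow> real"
  by (rule continuous_imp_measurable_on_sets_lebesgue) auto

lemma integrable_bounded:
  assumes "f \<in> borel_measurable \<mu>" "\<And>x. x \<in> D \<Longrightarrow> \<bar>f x\<bar> \<le> B"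
  shows "integrable \<mu> (f :: _ \<Rightarrow> real)"
  using assms by (intro integrable_const_bound[where B=B]) (auto intro!: AE_I2)

lemma L2_bounded:
  assumes "f \<in> borel_measurable \<mu>" "\<And>x. x \<in> D \<Longrightarrow> \<bar>f x\<bar> \<le> B"
  shows "f \<in> L2 D"
proof -
  have "(f x)\<^sup>2 \<le> B\<^sup>2" if "x \<in> D" for x
    using power_mono[OF assms(2)[OF that], of 2] by simp
  thus ?thesis unfolding L2_def using assms by (auto intro!: integrable_bounded[where B="B\<^sup>2"])
qed

lemma L2_const: "(\<lambda>x. c) \<in> L2 D"
  by (rule L2_bounded[where B="\<bar>c\<bar>"]) auto

lemma L2_integrable: "u \<in> L2 D \<Longrightarrow> integrable \<mu> u"
  using L2_mult_integrable[of u D "\<lambda>x. 1"] L2_const by simp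

lemma continuous_on_cball_bounded:
  fixes f :: "real^'n \<Rightarrow> real"
  assumes "continuous_on UNIV f"
  obtains B where "B \<ge> 0" "\<And>x. x \<in> D \<Longrightarrow> \<bar>f x\<bar> \<le> B"
proof -
  obtain R where R: "D \<subseteq> cball 0 R"
    using bounded_subset_ballD[OF D_bounded, of 0] ball_subset_cball by blast
  have "bounded (f ` cball 0 R)"
    by (rule compact_imp_bounded, rule compact_continuous_image) (auto intro: continuous_on_subset[OF assms])
  then obtain B where "\<forall>y\<in>f ` cball 0 R. norm y \<le> B" by (auto simp: bounded_iff)
  hence "\<bar>f x\<bar> \<le> max B 0" if "x \<in> D" for x using R that by (metis image_eqI max.coboundedI1 real_norm_def subsetD)
  thus ?thesis by (intro that[of "max B 0"]) auto
qed

lemma test_fun_continuous: "test_fun D \<psi> \<Longrightarrow> continuous_on UNIV (foldr pd is \<psi>)"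
  by (auto simp: test_fun_def intro!: differentiable_imp_continuous_on continuous_at_imp_continuous_on differentiable_imp_continuous_within)

lemma test_fun_L2:
  assumes "test_fun D \<psi>"
  shows "\<psi> \<in> L2 D" "pd i \<psi> \<in> L2 D"
proof -
  have *: "foldr pd is \<psi> \<in> L2 D" for "is"
  proof -
    obtain B where "\<And>x. x \<in> D \<Longrightarrow> \<bar>foldr pd is \<psi> x\<bar> \<le> B"
      using continuous_on_cball_bounded[OF test_fun_continuous[OF assms, of "is"]] by blast
    thus ?thesis
      by (intro L2_bounded measurable_muI borel_measurable_continuous_onI test_fun_continuous[OF assms])
  qed
  from *[of "[]"] *[of "[i]"] show "\<psi> \<in> L2 D" "pd i \<psi> \<in> L2 D" by simp_all
qed

text \<open>\<open>wgrad\<close> is an arbitrary choice; uniqueness almost everywhere makes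
  \<open>gip\<close> independent of it.\<close>

lemma weak_grad_unique:
  assumes "weak_grad D u g" "weak_grad D u g'"
  shows "AE x in \<mu>. g x = g' x"
proof -
  have "AE x in \<mu>. g x $ i - g' x $ i = 0" for i
  proof (rule test_fun_zero_imp_AE_zero[OF D_open])
    have L: "(\<lambda>x. g x $ i) \<in> L2 D" "(\<lambda>x. g' x $ i) \<in> L2 D"
      using assms by (auto simp: weak_grad_def)
    thus "integrable \<mu> (\<lambda>x. g x $ i - g' x $ i)" by (intro L2_integrable L2_diff)
    fix \<psi> assume psi: "test_fun D \<psi>"
    have "integral\<^sup>L \<mu> (\<lambda>x. g x $ i * \<psi> x) = integral\<^sup>L \<mu> (\<lambda>x. g' x $ i * \<psi> x)"
      using assms psi by (simp add: weak_grad_def)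
    thus "integral\<^sup>L \<mu> (\<lambda>x. (g x $ i - g' x $ i) * \<psi> x) = 0"
      using L2_mult_integrable[OF L(1) test_fun_L2(1)[OF psi]] L2_mult_integrable[OF L(2) test_fun_L2(1)[OF psi]]
      by (simp add: left_diff_distrib)
  qed
  hence "AE x in \<mu>. \<forall>i. g x $ i - g' x $ i = 0" by (intro AE_finite_allI[of UNIV, simplified]) auto
  thus ?thesis by eventually_elim (simp add: vec_eq_iff)
qed

lemma weak_grad_lincomb:
  assumes "u \<in> L2 D" "v \<in> L2 D" "weak_grad D u g" "weak_grad D v g'"
  shows "weak_grad D (\<lambda>x. a * u x + b * v x) (\<lambda>x. a *\<^sub>R g x + b *\<^sub>R g' x)"
  unfolding weak_grad_def
proof (intro conjI allI impI)
  have L: "(\<lambda>x. g x $ i) \<in> L2 D" "(\<lambda>x. g' x $ i) \<in> L2 D" for i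
    using assms by (auto simp: weak_grad_def)
  fix i from L2_lincomb[OF L] show "(\<lambda>x. (a *\<^sub>R g x + b *\<^sub>R g' x) $ i) \<in> L2 D" by simp
next
  fix \<psi> i assume psi: "test_fun D \<psi>"
  have L: "(\<lambda>x. g x $ i) \<in> L2 D" "(\<lambda>x. g' x $ i) \<in> L2 D" for i
    using assms by (auto simp: weak_grad_def)
  have "integral\<^sup>L \<mu> (\<lambda>x. (a * u x + b * v x) * pd i \<psi> x)
      = a * integral\<^sup>L \<mu> (\<lambda>x. u x * pd i \<psi> x) + b * integral\<^sup>L \<mu> (\<lambda>x. v x * pd i \<psi> x)"
    using ip_lincomb[OF assms(1,2) test_fun_L2(2)[OF psi]] by (simp add: ip_def)
  also have "\<dots> = - (a * integral\<^sup>L \<mu> (\<lambda>x. g x $ i * \<psi> x) + b * integral\<^sup>L \<mu> (\<lambda>x. g' x $ i * \<psi> x))"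
    using assms psi by (simp add: weak_grad_def)
  also have "\<dots> = - integral\<^sup>L \<mu> (\<lambda>x. (a *\<^sub>R g x + b *\<^sub>R g' x) $ i * \<psi> x)"
    using ip_lincomb[OF L(1)[of i] L(2)[of i] test_fun_L2(1)[OF psi], of a b] by (simp add: ip_def)
  finally show "integral\<^sup>L \<mu> (\<lambda>x. (a * u x + b * v x) * pd i \<psi> x)
     = - integral\<^sup>L \<mu> (\<lambda>x. (a *\<^sub>R g x + b *\<^sub>R g' x) $ i * \<psi> x)" .
qed

lemma H1_L2: "u \<in> H1 D \<Longrightarrow> u \<in> L2 D" by (simp add: H1_def)

lemma weak_grad_wgrad: "u \<in> H1 D \<Longrightarrow> weak_grad D u (wgrad D u)"
  unfolding H1_def wgrad_def by (simp add: someI_ex)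

lemma H1_lincomb: "u \<in> H1 D \<Longrightarrow> v \<in> H1 D \<Longrightarrow> (\<lambda>x. a * u x + b * v x) \<in> H1 D"
  using weak_grad_lincomb L2_lincomb unfolding H1_def by fast

lemma wgrad_eq: "u \<in> L2 D \<Longrightarrow> weak_grad D u g \<Longrightarrow> AE x in \<mu>. wgrad D u x = g x"
  using weak_grad_unique weak_grad_wgrad unfolding H1_def by blast

lemma wgrad_lincomb:
  "u \<in> H1 D \<Longrightarrow> v \<in> H1 D \<Longrightarrow> AE x in \<mu>. wgrad D (\<lambda>x. a * u x + b * v x) x = a *\<^sub>R wgrad D u x + b *\<^sub>R wgrad D v x"
  by (intro wgrad_eq weak_grad_lincomb weak_grad_wgrad L2_lincomb H1_L2)

lemma wgrad_measurable: "u \<in> H1 D \<Longrightarrow> wgrad D u \<in> borel_measurable \<mu>"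
proof -
  assume "u \<in> H1 D"
  hence "(\<lambda>x. wgrad D u x $ i) \<in> borel_measurable \<mu>" for i
    using weak_grad_wgrad by (auto simp: weak_grad_def L2_def)
  thus ?thesis by (subst borel_measurable_euclidean_space) (auto simp: Basis_vec_def inner_axis)
qed

lemma wgrad_inner_integrable:
  assumes "u \<in> H1 D" "v \<in> H1 D"
  shows "integrable \<mu> (\<lambda>x. wgrad D u x \<bullet> wgrad D v x)"
proof -
  have "(\<lambda>x. wgrad D u x $ i) \<in> L2 D" "(\<lambda>x. wgrad D v x $ i) \<in> L2 D" for i
    using assms weak_grad_wgrad by (auto simp: weak_grad_def)
  thus ?thesis unfolding inner_vec_def by (auto intro!: L2_mult_integrable)
qed

text \<open>Allows \<open>gip\<close> to be computed from any measurable representatives of the two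
  gradients.\<close>

lemma gip_eq:
  assumes "u \<in> H1 D" "v \<in> H1 D" "AE x in \<mu>. wgrad D u x = g x" "AE x in \<mu>. wgrad D v x = g' x"
    "g \<in> borel_measurable \<mu>" "g' \<in> borel_measurable \<mu>"
  shows "gip D u v = integral\<^sup>L \<mu> (\<lambda>x. g x \<bullet> g' x)"
  unfolding gip_def
proof (rule integral_cong_AE)
  show "AE x in \<mu>. wgrad D u x \<bullet> wgrad D v x = g x \<bullet> g' x" using assms(3,4) by eventually_elim simp
qed (use assms wgrad_measurable in auto)

lemma gip_commute: "gip D u v = gip D v u"
  by (simp add: gip_def inner_commute)

lemma gip_self_nonneg: "0 \<le> gip D u u"
  by (simp add: gip_def)

lemma gip_lincomb:
  assumes "u \<in> H1 D" "v \<in> H1 D" "w \<in> H1 D"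
  shows "gip D (\<lambda>x. a * u x + b * v x) w = a * gip D u w + b * gip D v w"
proof -
  have "gip D (\<lambda>x. a * u x + b * v x) w 
      = integral\<^sup>L \<mu> (\<lambda>x. (a *\<^sub>R wgrad D u x + b *\<^sub>R wgrad D v x) \<bullet> wgrad D w x)"
    using assms wgrad_measurable by (intro gip_eq wgrad_lincomb H1_lincomb) auto
  thus ?thesis using assms wgrad_inner_integrable by (simp add: gip_def inner_add_left)
qed

lemma gip_cauchy_schwarz:
  assumes "u \<in> H1 D" "v \<in> H1 D"
  shows "(gip D u v)\<^sup>2 \<le> gip D u u * gip D v v"
proof (rule quadratic_nonneg_imp_discr)
  fix t :: real
  have "0 \<le> gip D (\<lambda>x. 1 * u x + t * v x) (\<lambda>x. 1 * u x + t * v x)" by (rule gip_self_nonneg)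
  also have "\<dots> = gip D u (\<lambda>x. 1 * u x + t * v x) + t * gip D v (\<lambda>x. 1 * u x + t * v x)"
    using assms H1_lincomb[OF assms, of 1 t] by (subst gip_lincomb) auto
  also have "\<dots> = gip D u u + t * gip D v u + t * (gip D u v + t * gip D v v)"
    unfolding gip_commute[of u "\<lambda>x. 1 * u x + t * v x"] gip_commute[of v "\<lambda>x. 1 * u x + t * v x"]
    using gip_lincomb[OF assms(1,2,1), of 1 t] gip_lincomb[OF assms(1,2,2), of 1 t] by (simp add: gip_commute[of v u])
  finally show "0 \<le> gip D u u + 2 * t * gip D u v + t\<^sup>2 * gip D v v"
    by (simp add: gip_commute[of v u] algebra_simps power2_eq_square)
qed (rule gip_self_nonneg)

lemma sn1_sq: "(sn1 D u)\<^sup>2 = gip D u u"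
  by (simp add: sn1_def gip_self_nonneg)

lemma sn1_nonneg: "0 \<le> sn1 D u"
  by (simp add: sn1_def gip_self_nonneg)

lemma gip_le_sn1: "u \<in> H1 D \<Longrightarrow> v \<in> H1 D \<Longrightarrow> \<bar>gip D u v\<bar> \<le> sn1 D u * sn1 D v"
  using gip_cauchy_schwarz[of u v] gip_self_nonneg
  by (metis real_le_rsqrt power2_abs real_sqrt_mult sn1_def)

section \<open>Weak gradients of Lipschitz functions\<close>

lemma integral_translation_diff:
  fixes u :: "real^'n \<Rightarrow> real"
  assumes "integrable lborel u" "t \<noteq> 0"
  shows "integral\<^sup>L lborel (\<lambda>x. (u (x + e) - u x) / t) = 0"
proof -
  have m: "u \<in> borel_measurable borel" using borel_measurable_integrable[OF assms(1)] by simp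
  have "integral\<^sup>L lborel u = integral\<^sup>L (distr lborel borel ((+) e)) u"
    by (simp add: lborel_distr_plus)
  also have "\<dots> = integral\<^sup>L lborel (\<lambda>x. u (e + x))"
    using m by (subst integral_distr) auto
  finally have eq: "integral\<^sup>L lborel (\<lambda>x. u (x + e)) = integral\<^sup>L lborel u" by (simp add: add.commute)
  have "integrable (distr lborel borel ((+) e)) u"
    using assms by (simp add: lborel_distr_plus)
  hence "integrable lborel (\<lambda>x. u (e + x))" using m by (subst (asm) integrable_distr_eq) auto
  hence "integrable lborel (\<lambda>x. u (x + e))" by (simp add: add.commute)
  thus ?thesis using assms eq by simp
qed

text \<open>The product of \<open>v\<close> with a test function, extended by zero, has difference
  quotients of integral zero by translation invariance. Dominated convergence turns this into the
  integrated product rule, which is the weak gradient identity. Applied to piecewise linear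
  functions, it avoids boundary terms on element faces.\<close>

lemma weak_grad_lipschitz:
  assumes lip: "\<And>x y. x \<in> D \<Longrightarrow> y \<in> D \<Longrightarrow> \<bar>v x - v y\<bar> \<le> M * norm (x - y)"
    and gL2: "\<And>i. (\<lambda>x. g x $ i) \<in> L2 D"
    and lim: "AE x in \<mu>. \<forall>i. ((\<lambda>t. (v (x + t *\<^sub>R axis i 1) - v x) / t) \<longlongrightarrow> g x $ i) (at 0)"
  shows "weak_grad D v g"
  unfolding weak_grad_def
proof (intro conjI allI impI)
  fix i show "(\<lambda>x. g x $ i) \<in> L2 D" by fact
next
  fix \<psi> i assume psi: "test_fun D \<psi>"
  define e where "e = (axis i 1 :: real^'n)"
  have ne: "norm e = 1" unfolding e_def by simp
  define K where "K = closure {x. \<psi> x \<noteq> 0}"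
  have K: "compact K" "K \<subseteq> D" using psi by (auto simp: test_fun_def K_def)
  have psi0: "\<psi> x = 0" if "x \<notin> K" for x using that closure_subset[of "{x. \<psi> x \<noteq> 0}"] by (auto simp: K_def)
  \<comment> \<open>A margin that separates the support of the test function from the complement of
    \<open>D\<close>.\<close>
  obtain d where d: "d > 0" "(\<Union>x\<in>K. ball x d) \<subseteq> D"
    using compact_subset_open_imp_ball_epsilon_subset[OF K(1) D_open K(2)] by blast
  have vcont: "continuous_on D v"
  proof (rule continuous_on_iff[THEN iffD2], intro ballI allI impI)
    fix x :: "real^'n" and \<epsilon> :: real assume x: "x \<in> D" and eps: "\<epsilon> > 0"
    show "\<exists>d>0. \<forall>x'\<in>D. dist x' x < d \<longrightarrow> dist (v x') (v x) < \<epsilon>"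
    proof (intro exI conjI ballI impI)
      show "\<epsilon> / (\<bar>M\<bar> + 1) > 0" using eps by simp
      fix y assume y: "y \<in> D" "dist y x < \<epsilon> / (\<bar>M\<bar> + 1)"
      have "\<bar>v y - v x\<bar> \<le> M * norm (y - x)" by (rule lip) fact+
      also have "\<dots> \<le> (\<bar>M\<bar> + 1) * norm (y - x)" by (intro mult_right_mono) auto
      also have "\<dots> < \<epsilon>" using y(2) by (simp add: dist_norm field_simps)
      finally show "dist (v y) (v x) < \<epsilon>" by (simp add: dist_real_def)
    qed
  qed
  obtain z where z: "z \<in> D" using D_nonempty by blast
  obtain R where R: "\<And>x. x \<in> D \<Longrightarrow> norm x \<le> R" using D_bounded by (auto simp: bounded_iff)
  define V where "V = \<bar>v z\<bar> + \<bar>M\<bar> * (2 * R)"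
  have V: "\<bar>v x\<bar> \<le> V" if "x \<in> D" for x
  proof -
    have "\<bar>v x - v z\<bar> \<le> M * norm (x - z)" by (rule lip) (use that z in auto)
    also have "\<dots> \<le> \<bar>M\<bar> * (2 * R)"
      using R[OF that] R[OF z] norm_triangle_ineq4[of x z] by (intro mult_mono) auto
    finally show ?thesis by (simp add: V_def)
  qed
  have V0: "V \<ge> 0" using V[OF z] by linarith
  obtain B0 where B0: "B0 \<ge> 0" "\<And>x. x \<in> D \<Longrightarrow> \<bar>\<psi> x\<bar> \<le> B0"
    using continuous_on_cball_bounded[OF test_fun_continuous[OF psi, of "[]"]] by auto
  obtain B1 where B1: "B1 \<ge> 0" "\<And>x. x \<in> D \<Longrightarrow> \<bar>pd i \<psi> x\<bar> \<le> B1"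
    using continuous_on_cball_bounded[OF test_fun_continuous[OF psi, of "[i]"]] by auto
  have psi_line: "((\<lambda>t. \<psi> (x + t *\<^sub>R e)) has_real_derivative pd i \<psi> (x + t *\<^sub>R e)) (at t)" for x t
  proof -
    have "(\<psi> has_derivative frechet_derivative \<psi> (at (x + t *\<^sub>R e))) (at (x + t *\<^sub>R e))"
    proof -
      have "\<forall>y. foldr pd [] \<psi> differentiable at y" using psi unfolding test_fun_def by blast
      thus ?thesis by (simp add: frechet_derivative_works)
    qed
    moreover have "((\<lambda>t. x + t *\<^sub>R e) has_derivative (\<lambda>h. h *\<^sub>R e)) (at t)"
      by (auto intro!: derivative_eq_intros)
    ultimately have "((\<lambda>t. \<psi> (x + t *\<^sub>R e)) has_derivative (\<lambda>h. frechet_derivative \<psi> (at (x + t *\<^sub>R e)) (h *\<^sub>R e))) (at t)"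
      using has_derivative_compose by blast
    moreover have "frechet_derivative \<psi> (at (x + t *\<^sub>R e)) (h *\<^sub>R e) = pd i \<psi> (x + t *\<^sub>R e) * h" for h
      using \<open>(\<psi> has_derivative _) _\<close> unfolding pd_def e_def
      by (simp add: linear_cmul[OF has_derivative_linear])
    ultimately show ?thesis by (simp add: has_field_derivative_def)
  qed
  have psi_diff: "\<bar>\<psi> (x + t *\<^sub>R e) - \<psi> x\<bar> \<le> B1 * t" if xt: "x \<in> D" "x + t *\<^sub>R e \<in> D" "t > 0" for x t
  proof -
    obtain s where s: "0 < s" "s < t" "\<psi> (x + t *\<^sub>R e) - \<psi> (x + 0 *\<^sub>R e) = (t - 0) * pd i \<psi> (x + s *\<^sub>R e)"
      using MVT2[OF xt(3), of "\<lambda>t. \<psi> (x + t *\<^sub>R e)" "\<lambda>t. pd i \<psi> (x + t *\<^sub>R e)"] psi_line by auto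
    have "x + s *\<^sub>R e = (1 - s / t) *\<^sub>R x + (s / t) *\<^sub>R (x + t *\<^sub>R e)"
      using that(3) by (simp add: algebra_simps)
    also have "\<dots> \<in> D" using D_convex that s by (intro convexD) auto
    finally show ?thesis using B1(2) s(3) that(3) by (simp add: abs_mult mult.commute mult_right_mono)
  qed
  define u where "u = (\<lambda>x. indicat_real D x *\<^sub>R (v x * \<psi> x))"
  have psi_cont: "continuous_on UNIV \<psi>" using test_fun_continuous[OF psi, of "[]"] by simp
  have um: "u \<in> borel_measurable borel"
    unfolding u_def by (intro borel_measurable_continuous_on_indicator continuous_on_mult vcont continuous_on_subset[OF psi_cont]) auto
  have fin: "emeasure lborel D < \<infinity>" using D_bounded emeasure_bounded_finite by blast
  have ui: "integrable lborel u"
  proof (rule Bochner_Integration.integrable_bound)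
    show "integrable lborel (\<lambda>x. indicat_real D x * (V * B0))"
      using fin by (intro integrable_mult_left) (auto intro!: integrable_real_indicator)
    show "AE x in lborel. norm (u x) \<le> norm (indicat_real D x * (V * B0))"
      using V B0 V0 by (intro AE_I2) (auto simp: u_def indicator_def abs_mult intro!: mult_mono)
  qed (use um in auto)
  \<comment> \<open>Shifts shorter than the margin: if one end lies outside \<open>D\<close>, the
    other lies off the support.\<close>
  define t where "t = (\<lambda>n. d / (real n + 2))"
  have t: "0 < t n" "t n < d" for n using d by (auto simp: t_def field_simps add_pos_nonneg)
  have tlim: "t \<longlonglongrightarrow> 0" unfolding t_def by real_asymp
  have tfl: "filterlim t (at 0) sequentially"
    using tlim t(1) by (auto simp: filterlim_at intro!: always_eventually) (metis less_irrefl)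
  define s where "s = (\<lambda>n x. (u (x + t n *\<^sub>R e) - u x) / t n)"
  define l where "l = (\<lambda>x. indicat_real D x *\<^sub>R (g x $ i * \<psi> x + v x * pd i \<psi> x))"
  have uK: "u x = 0" if "x \<notin> K" for x using psi0[OF that] by (simp add: u_def)
  have near: "x \<in> D" if "y \<in> K" "norm (x - y) < d" for x y
    using d(2) that by (auto simp: dist_norm norm_minus_commute subset_iff)
  have sn0: "s n x = 0" if "x \<notin> D" for n x
  proof -
    have "x + t n *\<^sub>R e \<notin> K" using near[of "x + t n *\<^sub>R e" x] that t[of n] ne by auto
    thus ?thesis using uK that by (auto simp: s_def u_def)
  qed
  have snb: "\<bar>s n x\<bar> \<le> indicat_real D x * (\<bar>M\<bar> * B0 + V * B1)" for n x
  proof (cases "x \<in> D")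
    case False thus ?thesis using sn0 by simp
  next
    case xD: True
    show ?thesis
    proof (cases "x + t n *\<^sub>R e \<in> D")
      case True
      \<comment> \<open>Discrete product rule; one increment is bounded by the Lipschitz constant,
        the other by the mean value theorem.\<close>
      have "u (x + t n *\<^sub>R e) - u x = (v (x + t n *\<^sub>R e) - v x) * \<psi> (x + t n *\<^sub>R e) + v x * (\<psi> (x + t n *\<^sub>R e) - \<psi> x)"
        using True xD by (simp add: u_def algebra_simps)
      also have "\<bar>\<dots>\<bar> \<le> \<bar>v (x + t n *\<^sub>R e) - v x\<bar> * \<bar>\<psi> (x + t n *\<^sub>R e)\<bar> + \<bar>v x\<bar> * \<bar>\<psi> (x + t n *\<^sub>R e) - \<psi> x\<bar>"
        by (simp add: abs_mult[symmetric] abs_triangle_ineq)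
      also have "\<dots> \<le> (\<bar>M\<bar> * t n) * B0 + V * (B1 * t n)"
      proof (intro add_mono mult_mono)
        have "\<bar>v (x + t n *\<^sub>R e) - v x\<bar> \<le> M * norm (x + t n *\<^sub>R e - x)" by (rule lip) fact+
        also have "\<dots> \<le> \<bar>M\<bar> * t n" using t(1)[of n] ne by (auto intro!: mult_right_mono)
        finally show "\<bar>v (x + t n *\<^sub>R e) - v x\<bar> \<le> \<bar>M\<bar> * t n" .
      qed (use True xD t[of n] V B0 psi_diff V0 in auto)
      also have "\<dots> = t n * (\<bar>M\<bar> * B0 + V * B1)" by (simp add: algebra_simps)
      finally have "\<bar>u (x + t n *\<^sub>R e) - u x\<bar> / t n \<le> \<bar>M\<bar> * B0 + V * B1"
        using t(1)[of n] by (simp add: field_simps)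
      thus ?thesis using xD t(1)[of n] by (simp add: s_def)
    next
      case False
      have "x \<notin> K" using near[of x "x + t n *\<^sub>R e"] False t[of n] ne by auto
      hence "s n x = 0" using False uK by (auto simp: s_def u_def)
      thus ?thesis using B0 B1 V0 xD by simp
    qed
  qed
  have lm: "l \<in> borel_measurable lebesgue"
  proof -
    have "(\<lambda>x. g x $ i * \<psi> x + v x * pd i \<psi> x) \<in> borel_measurable \<mu>"
      by (intro borel_measurable_add borel_measurable_times L2_measurable gL2 test_fun_L2[OF psi]
          continuous_on_imp_measurable[OF vcont])
    thus ?thesis unfolding l_def by (subst borel_measurable_restrict_space_iff[symmetric]) auto
  qed
  have sm: "s n \<in> borel_measurable borel" for n unfolding s_def using um by measurable
  have "(\<lambda>n. integral\<^sup>L lebesgue (s n)) \<longlonglongrightarrow> integral\<^sup>L lebesgue l"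
  proof (rule integral_dominated_convergence[where w = "\<lambda>x. indicat_real D x * (\<bar>M\<bar> * B0 + V * B1)"])
    show "integrable lebesgue (\<lambda>x. indicat_real D x * (\<bar>M\<bar> * B0 + V * B1))"
      using D_fmeasurable by (intro integrable_mult_left) (auto simp: fmeasurable_def intro!: integrable_real_indicator)
    show "AE x in lebesgue. norm (s n x) \<le> indicat_real D x * (\<bar>M\<bar> * B0 + V * B1)" for n
      using snb by (intro AE_I2) auto
    show "s n \<in> borel_measurable lebesgue" for n using sm by (intro measurable_completion) auto
    have "AE x in lebesgue. x \<in> D \<longrightarrow> ((\<lambda>t. (v (x + t *\<^sub>R e) - v x) / t) \<longlongrightarrow> g x $ i) (at 0)"
      using lim unfolding e_def by (auto simp: AE_restrict_space_iff elim!: eventually_mono)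
    thus "AE x in lebesgue. (\<lambda>n. s n x) \<longlonglongrightarrow> l x"
    proof eventually_elim
      case (elim x)
      show ?case
      proof (cases "x \<in> D")
        case False
        thus ?thesis using sn0 by (simp add: l_def)
      next
        case True
        have 1: "(\<lambda>n. (v (x + t n *\<^sub>R e) - v x) / t n) \<longlonglongrightarrow> g x $ i"
          using filterlim_compose[OF elim[rule_format, OF True] tfl] .
        have "((\<lambda>t. (\<psi> (x + t *\<^sub>R e) - \<psi> x) / t) \<longlongrightarrow> pd i \<psi> x) (at 0)"
          using psi_line[of x 0] by (simp add: DERIV_def)
        from filterlim_compose[OF this tfl] 
        have 2: "(\<lambda>n. (\<psi> (x + t n *\<^sub>R e) - \<psi> x) / t n) \<longlonglongrightarrow> pd i \<psi> x" .
        have xlim: "(\<lambda>n. x + t n *\<^sub>R e) \<longlonglongrightarrow> x"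
          using tendsto_add[OF tendsto_const[of x] tendsto_scaleR[OF tlim tendsto_const[of e]]] by simp
        have 3: "(\<lambda>n. \<psi> (x + t n *\<^sub>R e)) \<longlonglongrightarrow> \<psi> x"
          by (rule continuous_on_tendsto_compose[OF psi_cont xlim]) auto
        have "(\<lambda>n. (v (x + t n *\<^sub>R e) - v x) / t n * \<psi> (x + t n *\<^sub>R e) + v x * ((\<psi> (x + t n *\<^sub>R e) - \<psi> x) / t n))
          \<longlonglongrightarrow> g x $ i * \<psi> x + v x * pd i \<psi> x"
          by (intro tendsto_intros 1 2 3)
        moreover have "\<forall>\<^sub>F n in sequentially. x + t n *\<^sub>R e \<in> D"
          using topological_tendstoD[OF xlim D_open True] .
        hence "\<forall>\<^sub>F n in sequentially. (v (x + t n *\<^sub>R e) - v x) / t n * \<psi> (x + t n *\<^sub>R e) + v x * ((\<psi> (x + t n *\<^sub>R e) - \<psi> x) / t n) = s n x"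
          by eventually_elim (use True in \<open>auto simp: s_def u_def algebra_simps add_divide_distrib[symmetric] diff_divide_distrib[symmetric]\<close>)
        ultimately show ?thesis using True by (auto simp: l_def intro: Lim_transform_eventually)
      qed
    qed
  qed (fact lm)
  moreover have "integral\<^sup>L lebesgue (s n) = 0" for n
  proof -
    have "integral\<^sup>L lebesgue (s n) = integral\<^sup>L lborel (s n)"
      using sm[of n] by (intro integral_completion) simp
    also have "\<dots> = 0" unfolding s_def using t(1)[of n] by (intro integral_translation_diff ui) simp
    finally show ?thesis .
  qed
  ultimately have "integral\<^sup>L lebesgue l = 0" by (simp add: LIMSEQ_const_iff)
  hence "integral\<^sup>L \<mu> (\<lambda>x. g x $ i * \<psi> x + v x * pd i \<psi> x) = 0"
    by (simp add: l_def integral_restrict_space)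
  moreover have "v \<in> L2 D"
    by (rule L2_bounded[OF continuous_on_imp_measurable[OF vcont] V])
  ultimately show "integral\<^sup>L \<mu> (\<lambda>x. v x * pd i \<psi> x) = - integral\<^sup>L \<mu> (\<lambda>x. g x $ i * \<psi> x)"
    using L2_mult_integrable[OF gL2[of i] test_fun_L2(1)[OF psi]] L2_mult_integrable[OF _ test_fun_L2(2)[OF psi]]
    by simp
qed

lemma weak_grad_const: "weak_grad D (\<lambda>x. c) (\<lambda>x. 0)"
  by (rule weak_grad_lipschitz[where M = 0]) (auto simp: L2_zero)

lemma H1_const: "(\<lambda>x. c) \<in> H1 D"
  using weak_grad_const L2_const by (auto simp: H1_def)

lemma gip_const_right: "u \<in> H1 D \<Longrightarrow> gip D u (\<lambda>x. c) = 0"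
  using gip_eq[of u "\<lambda>x. c" "wgrad D u" "\<lambda>x. 0"] wgrad_eq[OF L2_const weak_grad_const] H1_const wgrad_measurable
  by simp

end

section \<open>Piecewise linear functions\<close>

locale fe_mesh = bounded_domain D for D :: "(real^'n::finite) set" +
  fixes \<T> :: "(real^'n) set set"
  assumes mesh: "triangulation D \<T>"
begin

lemma mesh_finite: "finite \<T>" and mesh_cover: "\<Union>\<T> = closure D"
  using mesh by (auto simp: triangulation_def)

lemma mesh_hull: "K \<in> \<T> \<Longrightarrow> \<exists>V. finite V \<and> K = convex hull V"
proof -
  assume "K \<in> \<T>"
  then obtain V where V: "int (card V) = int CARD('n) + 1" "K = convex hull V"
    using mesh unfolding triangulation_def simplex_def by blast
  hence "card V \<noteq> 0" by linarith
  hence "finite V" by (rule contrapos_np) simp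
  thus ?thesis using V by blast
qed

lemma mesh_closed: "K \<in> \<T> \<Longrightarrow> closed K" and mesh_convex: "K \<in> \<T> \<Longrightarrow> convex K"
  using mesh_hull by (auto intro!: compact_imp_closed finite_imp_compact_convex_hull)

lemma mesh_nonempty: "\<T> \<noteq> {}"
  using mesh_cover D_nonempty closure_subset[of D] by auto

lemma closure_D_convex: "convex (closure D)"
  using D_convex by (rule convex_closure)

lemma Sh_affine:
  assumes "v \<in> Sh D \<T>"
  obtains a b where "\<And>K x. K \<in> \<T> \<Longrightarrow> x \<in> K \<Longrightarrow> v x = a K \<bullet> x + b K"
proof -
  have "\<forall>K\<in>\<T>. \<exists>p. \<forall>x\<in>K. v x = fst p \<bullet> x + snd p"
    using assms unfolding Sh_def by auto
  then obtain p where "\<forall>K\<in>\<T>. \<forall>x\<in>K. v x = fst (p K) \<bullet> x + snd (p K)" by metis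
  thus ?thesis by (intro that[of "\<lambda>K. fst (p K)" "\<lambda>K. snd (p K)"]) auto
qed

lemma Sh_continuous: "v \<in> Sh D \<T> \<Longrightarrow> continuous_on (closure D) v"
  by (simp add: Sh_def)

lemma Sh_outside: "v \<in> Sh D \<T> \<Longrightarrow> x \<notin> closure D \<Longrightarrow> v x = 0"
  by (simp add: Sh_def)

lemma Sh_lincomb:
  assumes "u \<in> Sh D \<T>" "v \<in> Sh D \<T>"
  shows "(\<lambda>x. \<alpha> * u x + \<beta> * v x) \<in> Sh D \<T>"
proof -
  obtain a b where u: "\<And>K x. K \<in> \<T> \<Longrightarrow> x \<in> K \<Longrightarrow> u x = a K \<bullet> x + b K" using Sh_affine[OF assms(1)] by metis
  obtain a' b' where v: "\<And>K x. K \<in> \<T> \<Longrightarrow> x \<in> K \<Longrightarrow> v x = a' K \<bullet> x + b' K" using Sh_affine[OF assms(2)] by metis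
  show ?thesis unfolding Sh_def
  proof (intro CollectI conjI ballI)
    show "continuous_on (closure D) (\<lambda>x. \<alpha> * u x + \<beta> * v x)"
      using assms by (intro continuous_intros Sh_continuous)
    fix K assume "K \<in> \<T>"
    show "\<exists>a b. \<forall>x\<in>K. \<alpha> * u x + \<beta> * v x = a \<bullet> x + b"
      by (rule exI[of _ "\<alpha> *\<^sub>R a K + \<beta> *\<^sub>R a' K"], rule exI[of _ "\<alpha> * b K + \<beta> * b' K"])
         (auto simp: u[OF \<open>K \<in> \<T>\<close>] v[OF \<open>K \<in> \<T>\<close>] inner_add_left algebra_simps)
  qed (use assms in \<open>auto simp: Sh_outside\<close>)
qed

lemma Sh_indicator: "indicat_real (closure D) \<in> Sh D \<T>"
proof -
  have "\<exists>a b. \<forall>x\<in>K. indicat_real (closure D) x = a \<bullet> x + b" if "K \<in> \<T>" for K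
    using that mesh_cover by (intro exI[of _ 0] exI[of _ 1]) (auto simp: indicator_def)
  moreover have "continuous_on (closure D) (indicat_real (closure D))"
    by (rule continuous_on_cong[THEN iffD2, of _ _ _ "\<lambda>x. 1"]) auto
  ultimately show ?thesis by (auto simp: Sh_def)
qed

lemma Sh_bounded:
  assumes "v \<in> Sh D \<T>"
  obtains B where "B \<ge> 0" "\<And>x. \<bar>v x\<bar> \<le> B"
proof -
  have "compact (v ` closure D)"
    using D_bounded by (intro compact_continuous_image Sh_continuous assms) auto
  then obtain B where "\<forall>y\<in>v ` closure D. norm y \<le> B"
    using compact_imp_bounded bounded_iff by metis
  hence B: "\<And>x. x \<in> closure D \<Longrightarrow> \<bar>v x\<bar> \<le> B" by simp
  have "\<bar>v x\<bar> \<le> max B 0" for x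
    using B[of x] Sh_outside[OF assms, of x] by (cases "x \<in> closure D") auto
  thus ?thesis by (intro that[of "max B 0"]) auto
qed

lemma Sh_measurable: "v \<in> Sh D \<T> \<Longrightarrow> v \<in> borel_measurable \<mu>"
  by (intro continuous_on_imp_measurable continuous_on_subset[OF Sh_continuous closure_subset])

lemma Sh_L2: "v \<in> Sh D \<T> \<Longrightarrow> v \<in> L2 D"
  by (rule Sh_bounded) (auto intro: L2_bounded Sh_measurable)

section \<open>Slopes on elements and along segments\<close>

lemma affine_eq_on_ball_imp_slope_eq:
  fixes a a' :: "real^'n"
  assumes "e > 0" "\<And>x. x \<in> ball z e \<Longrightarrow> a \<bullet> x + b = a' \<bullet> x + b'"
  shows "a = a'"
proof -
  define t where "t = e / (2 * (norm (a - a') + 1))"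
  have t: "t > 0" using assms(1) by (simp add: t_def add_nonneg_pos)
  have "t * norm (a - a') \<le> t * (norm (a - a') + 1)" using t by simp
  also have "\<dots> = e / 2" using add_nonneg_pos[OF norm_ge_zero[of "a - a'"] zero_less_one] 
    unfolding t_def by (simp add: field_simps)
  finally have "z + t *\<^sub>R (a - a') \<in> ball z e" using assms(1) t by (simp add: dist_norm)
  from assms(2)[OF this] assms(2)[of z] assms(1)
  have "t * ((a - a') \<bullet> (a - a')) = 0" by (simp add: inner_add_right inner_diff_left algebra_simps)
  thus ?thesis using t by simp
qed

text \<open>Frontiers of convex sets are null sets, and there are finitely many elements.\<close>

lemma AE_interior: "AE x in \<mu>. (\<exists>K\<in>\<T>. x \<in> interior K) \<and> (\<forall>K\<in>\<T>. x \<in> K \<longrightarrow> x \<in> interior K)"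
proof -
  have "negligible (\<Union>K\<in>\<T>. frontier K)"
    using mesh_finite by (intro negligible_Union) (auto intro: negligible_convex_frontier mesh_convex)
  hence "AE x in lebesgue. x \<notin> (\<Union>K\<in>\<T>. frontier K)"
    unfolding negligible_iff_null_sets by (rule AE_not_in)
  hence "AE x in lebesgue. x \<in> D \<longrightarrow> (\<exists>K\<in>\<T>. x \<in> interior K) \<and> (\<forall>K\<in>\<T>. x \<in> K \<longrightarrow> x \<in> interior K)"
  proof eventually_elim
    case (elim x)
    have *: "x \<in> interior K" if "K \<in> \<T>" "x \<in> K" for K
      using elim that mesh_closed[OF that(1)] by (auto simp: frontier_def)
    show ?case using * mesh_cover closure_subset[of D] by blast
  qed
  thus ?thesis by (subst AE_restrict_space_iff) auto
qed

text \<open>Fundamental theorem of calculus along the segment from \<open>x\<close> to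
  \<open>y\<close>, with \<open>G\<close> an upper gradient. The parametrisation by
  \<open>s ^ 4\<close> instead of \<open>s\<close> brings in the weight \<open>s ^ 3\<close>, which
  later compensates the Jacobian of contractions towards \<open>x\<close>. \<open>G\<close> is
  defined everywhere because a segment may run inside a face, where \<open>v\<close> may have no
  gradient.\<close>

lemma Sh_upper_gradient_line:
  assumes v: "v \<in> Sh D \<T>" and a: "\<And>K x. K \<in> \<T> \<Longrightarrow> x \<in> K \<Longrightarrow> v x = a K \<bullet> x + b K"
    and G: "\<And>K x. K \<in> \<T> \<Longrightarrow> x \<in> K \<Longrightarrow> norm (a K) \<le> G x" and Gm: "G \<in> borel_measurable borel"
    and G0: "\<And>x. 0 \<le> G x" and GB: "\<And>x. G x \<le> B"
    and xy: "x \<in> closure D" "y \<in> closure D"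
  shows "ennreal \<bar>v y - v x\<bar> \<le> 
    (\<integral>\<^sup>+s. ennreal (4 * s ^ 3 * norm (y - x) * G (x + s ^ 4 *\<^sub>R (y - x))) * indicator {0..1} s \<partial>lborel)"
proof -
  define \<gamma> where "\<gamma> = (\<lambda>t. x + t *\<^sub>R (y - x))"
  define U where "U = (\<lambda>K. {t \<in> {0..1}. \<gamma> t \<in> K})"
  have gamma_D: "\<gamma> t \<in> closure D" if "t \<in> {0..1}" for t
  proof -
    have "\<gamma> t = (1 - t) *\<^sub>R x + t *\<^sub>R y" by (simp add: \<gamma>_def algebra_simps)
    thus ?thesis using closure_D_convex xy that by (auto intro: convexD)
  qed
  \<comment> \<open>Endpoints of the parameter intervals cut out by the convex elements. Away from
    them \<open>v\<close> is affine along the segment near the parameter; an interval reduced to one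
    point is exceptional as a whole.\<close>
  define S where "S = (\<Union>K\<in>\<T>. {Inf (U K), Sup (U K)})"
  have finS: "finite S" using mesh_finite by (simp add: S_def)
  have Uconv: "convex (U K)" if "K \<in> \<T>" for K
  proof (rule convexI)
    fix s t p q :: real assume h: "s \<in> U K" "t \<in> U K" "0 \<le> p" "0 \<le> q" "p + q = 1"
    have "\<gamma> (p *\<^sub>R s + q *\<^sub>R t) = (p + q) *\<^sub>R x + (p * s + q * t) *\<^sub>R (y - x)" using h by (simp add: \<gamma>_def)
    also have "\<dots> = p *\<^sub>R \<gamma> s + q *\<^sub>R \<gamma> t" by (simp add: \<gamma>_def algebra_simps)
    also have "\<dots> \<in> K" using h mesh_convex[OF that] by (auto simp: U_def intro: convexD)
    finally have "\<gamma> (p *\<^sub>R s + q *\<^sub>R t) \<in> K" .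
    moreover have "p *\<^sub>R s + q *\<^sub>R t \<in> {0..1}"
      using h by (intro convexD) (auto simp: U_def)
    ultimately show "p *\<^sub>R s + q *\<^sub>R t \<in> U K" by (simp add: U_def)
  qed
  have Uder: "((\<lambda>t. v (\<gamma> t)) has_real_derivative a K \<bullet> (y - x)) (at t)"
    if K: "K \<in> \<T>" and t: "t \<in> U K" "t \<notin> S" for K t
  proof -
    have bdd: "bdd_below (U K)" "bdd_above (U K)" by (auto simp: U_def bdd_below_def bdd_above_def)
    have ne: "U K \<noteq> {}" using t by auto
    have "Inf (U K) < t" "t < Sup (U K)"
      using t K cInf_lower[OF t(1) bdd(1)] cSup_upper[OF t(1) bdd(2)] by (auto simp: S_def less_le)
    then obtain l r where lr: "l \<in> U K" "r \<in> U K" "l < t" "t < r"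
      using cInf_less_iff[OF ne bdd(1)] less_cSup_iff[OF ne bdd(2)] by blast
    have sub: "{l<..<r} \<subseteq> U K"
      using Uconv[OF K] lr by (meson is_interval_convex_1 greaterThanLessThan_iff less_imp_le mem_is_interval_1_I subsetI)
    have "((\<lambda>t. a K \<bullet> \<gamma> t + b K) has_real_derivative a K \<bullet> (y - x)) (at t)"
      unfolding \<gamma>_def by (auto intro!: derivative_eq_intros simp: inner_add_right)
    thus ?thesis
      by (rule has_field_derivative_transform_within_open[where S = "{l<..<r}"])
         (use lr sub a[OF K] in \<open>auto simp: U_def\<close>)
  qed
  define kk where "kk = (\<lambda>t. SOME K. K \<in> \<T> \<and> t \<in> U K)"
  have kk: "kk t \<in> \<T>" "t \<in> U (kk t)" if t01: "t \<in> {0..1}" for t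
  proof -
    have "\<gamma> t \<in> \<Union>\<T>" using gamma_D[OF t01] mesh_cover by simp
    then obtain K where "K \<in> \<T> \<and> t \<in> U K" using t01 by (auto simp: U_def)
    hence "kk t \<in> \<T> \<and> t \<in> U (kk t)" unfolding kk_def by (rule someI)
    thus "kk t \<in> \<T>" "t \<in> U (kk t)" by auto
  qed
  \<comment> \<open>The exceptional parameters pulled back through the fourth power, still finitely
    many.\<close>
  define S' where "S' = {s. 0 \<le> s \<and> s ^ 4 \<in> S}"
  have "finite S'"
  proof (rule inj_on_finite[of "\<lambda>s. s ^ 4"])
    show "inj_on (\<lambda>s::real. s ^ 4) S'" by (auto simp: S'_def inj_on_def intro: power_eq_imp_eq_base)
  qed (use finS in \<open>auto simp: S'_def\<close>)
  define h' where "h' = (\<lambda>s. a (kk (s ^ 4)) \<bullet> (y - x) * (4 * s ^ 3))"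
  have s01: "s ^ 4 \<in> {0..1}" if "s \<in> {0..1}" for s :: real using that by (auto intro: power_le_one)
  have "(h' has_integral (v (\<gamma> (1 ^ 4)) - v (\<gamma> (0 ^ 4)))) {0..1}"
  proof (rule fundamental_theorem_of_calculus_interior_strong[OF \<open>finite S'\<close>])
    fix s :: real assume s: "s \<in> {0<..<1} - S'"
    hence s4: "s ^ 4 \<in> {0..1}" by (intro s01) auto
    have "((\<lambda>t. v (\<gamma> t)) has_real_derivative a (kk (s ^ 4)) \<bullet> (y - x)) (at (s ^ 4))"
      using kk[OF s4] s by (intro Uder) (auto simp: S'_def)
    moreover have "((\<lambda>s. s ^ 4) has_real_derivative 4 * s ^ 3) (at s)"
      by (auto intro!: derivative_eq_intros)
    ultimately have "((\<lambda>s. v (\<gamma> (s ^ 4))) has_real_derivative h' s) (at s)"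
      unfolding h'_def by (rule DERIV_chain2)
    thus "((\<lambda>s. v (\<gamma> (s ^ 4))) has_vector_derivative h' s) (at s)"
      by (simp add: has_real_derivative_iff_has_vector_derivative)
  next
    have "continuous_on {0..1} (\<lambda>s. \<gamma> (s ^ 4))" unfolding \<gamma>_def by (intro continuous_intros)
    moreover have "(\<lambda>s. \<gamma> (s ^ 4)) ` {0..1} \<subseteq> closure D" using gamma_D s01 by auto
    ultimately show "continuous_on {0..1} (\<lambda>s. v (\<gamma> (s ^ 4)))"
      using continuous_on_compose2[OF Sh_continuous[OF v]] by blast
  qed simp
  hence h'int: "(h' has_integral (v y - v x)) {0..1}" by (simp add: \<gamma>_def)
  define k where "k = (\<lambda>s. 4 * s ^ 3 * norm (y - x) * G (x + s ^ 4 *\<^sub>R (y - x)))"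
  have km: "k \<in> borel_measurable borel" unfolding k_def using Gm by measurable
  have B0: "0 \<le> B" using G0[of x] GB[of x] by linarith
  have k0: "0 \<le> k s" if "s \<in> {0..1}" for s using that G0 by (auto simp: k_def)
  have kB: "k s \<le> 4 * 1 * norm (y - x) * B" if "s \<in> {0..1}" for s
    unfolding k_def using that G0 GB B0 by (intro mult_mono) (auto intro: power_le_one)
  have ki: "integrable lborel (\<lambda>s. indicat_real {0..1} s * k s)"
  proof (rule Bochner_Integration.integrable_bound)
    show "integrable lborel (\<lambda>s::real. indicat_real {0..1} s * (4 * 1 * norm (y - x) * B))"
      using integrable_real_indicator[of "{0..1::real}" lborel] by (intro integrable_mult_left) simp
    show "AE s in lborel. norm (indicat_real {0..1} s * k s) \<le> norm (indicat_real {0..1} s * (4 * 1 * norm (y - x) * B))"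
      using k0 kB B0 by (intro AE_I2) (auto simp: indicator_def)
  qed (use km in auto)
  have "set_integrable lborel {0..1} k" using ki by (simp add: set_integrable_def)
  hence khk: "k integrable_on {0..1}" "(LINT s:{0..1}|lborel. k s) = integral {0..1} k"
    using set_borel_integral_eq_integral by auto
  have "norm (integral {0..1} h') \<le> integral {0..1} k"
  proof (rule integral_norm_bound_integral)
    fix s :: real assume s: "s \<in> {0..1}"
    have "norm (h' s) \<le> norm (a (kk (s ^ 4))) * norm (y - x) * (4 * s ^ 3)"
      unfolding h'_def real_norm_def abs_mult using s Cauchy_Schwarz_ineq2 by (intro mult_mono) auto
    also have "\<dots> \<le> G (\<gamma> (s ^ 4)) * norm (y - x) * (4 * s ^ 3)"
      using s kk[OF s01[OF s]] by (intro mult_right_mono G) (auto simp: U_def)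
    also have "\<dots> = k s" by (simp add: k_def \<gamma>_def)
    finally show "norm (h' s) \<le> k s" .
  qed (use h'int khk in auto)
  hence "\<bar>v y - v x\<bar> \<le> (LINT s:{0..1}|lborel. k s)"
    using h'int khk by (simp add: integral_unique)
  hence "ennreal \<bar>v y - v x\<bar> \<le> ennreal (integral\<^sup>L lborel (\<lambda>s. indicat_real {0..1} s * k s))"
    by (simp add: set_lebesgue_integral_def ennreal_leI)
  also have "\<dots> = (\<integral>\<^sup>+s. ennreal (indicat_real {0..1} s * k s) \<partial>lborel)"
    using k0 by (intro nn_integral_eq_integral[symmetric] ki AE_I2) (auto simp: indicator_def)
  also have "\<dots> = (\<integral>\<^sup>+s. ennreal (k s) * indicator {0..1} s \<partial>lborel)"
    by (intro nn_integral_cong) (auto simp: indicator_def)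
  finally show ?thesis by (simp add: k_def)
qed

text \<open>The witness \<open>G\<close> is the largest slope norm among the elements containing a
  point. It dominates the slope of each of them, is Borel and bounded, and agrees almost everywhere
  with the norm of the gradient.\<close>

lemma Sh_gradient:
  assumes v: "v \<in> Sh D \<T>"
  shows "v \<in> H1 D"
    and "\<exists>G B. G \<in> borel_measurable borel \<and> (\<forall>x. 0 \<le> G x \<and> G x \<le> B) \<and> gip D v v = integral\<^sup>L \<mu> (\<lambda>x. (G x)\<^sup>2) \<and>
      (\<forall>x\<in>closure D. \<forall>y\<in>closure D. ennreal \<bar>v y - v x\<bar> \<le> 
        (\<integral>\<^sup>+s. ennreal (4 * s ^ 3 * norm (y - x) * G (x + s ^ 4 *\<^sub>R (y - x))) * indicator {0..1} s \<partial>lborel))"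
proof -
  obtain a b where a: "\<And>K x. K \<in> \<T> \<Longrightarrow> x \<in> K \<Longrightarrow> v x = a K \<bullet> x + b K" using Sh_affine[OF v] by metis
  define G where "G = (\<lambda>x. Max ((\<lambda>K. indicat_real K x * norm (a K)) ` \<T>))"
  define B where "B = Max ((\<lambda>K. norm (a K)) ` \<T>)"
  have Gge: "norm (a K) \<le> G x" if "K \<in> \<T>" "x \<in> K" for K x
    unfolding G_def using mesh_finite that by (intro Max_ge) (auto intro!: image_eqI[of _ _ K])
  have GB: "G x \<le> B" for x
    unfolding G_def
  proof (intro Max.boundedI)
    fix c assume "c \<in> (\<lambda>K. indicat_real K x * norm (a K)) ` \<T>"
    then obtain K where K: "K \<in> \<T>" "c = indicat_real K x * norm (a K)" by auto
    have "c \<le> norm (a K)" using K by (auto simp: indicator_def)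
    also have "\<dots> \<le> B" unfolding B_def using mesh_finite K by (intro Max_ge) auto
    finally show "c \<le> B" .
  qed (use mesh_finite mesh_nonempty in auto)
  have G0: "0 \<le> G x" for x
  proof -
    obtain K where K: "K \<in> \<T>" using mesh_nonempty by auto
    have "0 \<le> indicat_real K x * norm (a K)" by simp
    also have "\<dots> \<le> G x" unfolding G_def using mesh_finite K by (intro Max_ge) auto
    finally show ?thesis .
  qed
  have Gm: "G \<in> borel_measurable borel"
    unfolding G_def using mesh_finite mesh_closed
    by (intro borel_measurable_Max borel_measurable_times borel_measurable_const borel_measurable_indicator) auto
  have line: "\<forall>x\<in>closure D. \<forall>y\<in>closure D. ennreal \<bar>v y - v x\<bar> \<le> 
        (\<integral>\<^sup>+s. ennreal (4 * s ^ 3 * norm (y - x) * G (x + s ^ 4 *\<^sub>R (y - x))) * indicator {0..1} s \<partial>lborel)"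
  proof (intro ballI)
    fix x y assume "x \<in> closure D" "y \<in> closure D"
    with v a Gge Gm G0 GB show "ennreal \<bar>v y - v x\<bar> \<le> 
        (\<integral>\<^sup>+s. ennreal (4 * s ^ 3 * norm (y - x) * G (x + s ^ 4 *\<^sub>R (y - x))) * indicator {0..1} s \<partial>lborel)"
      by (rule Sh_upper_gradient_line)
  qed
  \<comment> \<open>Average of the slopes over the elements with \<open>x\<close> in the interior.
    Slopes on overlapping interiors coincide, so this is the slope of any of them; elsewhere the
    value is 0.\<close>
  define g where "g = (\<lambda>x. (\<Sum>K\<in>\<T>. indicat_real (interior K) x *\<^sub>R a K) /\<^sub>R (\<Sum>K\<in>\<T>. indicat_real (interior K) x))"
  have slope: "a K' = a K" if "K \<in> \<T>" "K' \<in> \<T>" "x \<in> interior K" "x \<in> interior K'" for K K' x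
  proof -
    have "x \<in> interior K \<inter> interior K'" using that by simp
    then obtain e where e: "e > 0" "ball x e \<subseteq> interior K \<inter> interior K'"
      by (meson open_Int open_contains_ball open_interior)
    have "a K' \<bullet> y + b K' = a K \<bullet> y + b K" if "y \<in> ball x e" for y
    proof -
      have "y \<in> K" "y \<in> K'" using e that interior_subset by blast+
      thus ?thesis using a[OF \<open>K \<in> \<T>\<close>, of y] a[OF \<open>K' \<in> \<T>\<close>, of y] by simp
    qed
    thus ?thesis using e(1) affine_eq_on_ball_imp_slope_eq by blast
  qed
  have g: "g x = a K" if "K \<in> \<T>" "x \<in> interior K" for K x
  proof -
    have "(\<Sum>K'\<in>\<T>. indicat_real (interior K') x *\<^sub>R a K') = (\<Sum>K'\<in>\<T>. indicat_real (interior K') x *\<^sub>R a K)"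
    proof (rule sum.cong[OF refl])
      fix K' assume "K' \<in> \<T>"
      thus "indicat_real (interior K') x *\<^sub>R a K' = indicat_real (interior K') x *\<^sub>R a K"
        using slope[OF that(1) _ that(2), of K'] by (cases "x \<in> interior K'") auto
    qed
    also have "\<dots> = (\<Sum>K'\<in>\<T>. indicat_real (interior K') x) *\<^sub>R a K" by (simp add: scaleR_sum_left)
    finally have "g x = (\<Sum>K'\<in>\<T>. indicat_real (interior K') x) *\<^sub>R a K /\<^sub>R (\<Sum>K'\<in>\<T>. indicat_real (interior K') x)"
      by (simp add: g_def)
    moreover have "(\<Sum>K'\<in>\<T>. indicat_real (interior K') x) > 0"
      using mesh_finite that by (intro sum_pos2[of _ K]) auto
    ultimately show ?thesis by simp
  qed
  have gm: "g \<in> borel_measurable borel"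
    unfolding g_def by (intro borel_measurable_scaleR borel_measurable_inverse borel_measurable_sum borel_measurable_indicator) auto
  have gi: "(\<lambda>x. g x $ i) \<in> L2 D" for i
  proof -
    have m: "(\<lambda>x. g x $ i) \<in> borel_measurable \<mu>"
    proof -
      have "(\<lambda>x. g x \<bullet> axis i 1) \<in> borel_measurable borel" using gm by measurable
      thus ?thesis by (intro measurable_muI) (simp add: inner_axis)
    qed
    have gB: "norm (g x) \<le> B" for x
    proof (cases "\<exists>K\<in>\<T>. x \<in> interior K")
      case True
      then obtain K where K: "K \<in> \<T>" "x \<in> interior K" by blast
      have "norm (g x) \<le> G x" using g[OF K] Gge[OF K(1)] K interior_subset by auto
      thus ?thesis using GB[of x] by linarith
    next
      case False
      hence "g x = 0" unfolding g_def by (auto simp: indicator_def)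
      thus ?thesis using G0[of x] GB[of x] by simp
    qed
    have "\<bar>g x $ i\<bar> \<le> B" for x using component_le_norm_cart[of "g x" i] gB[of x] by linarith
    thus ?thesis by (intro L2_bounded m)
  qed
  have lip: "\<bar>v x - v y\<bar> \<le> B * norm (x - y)" if "x \<in> D" "y \<in> D" for x y
  proof -
    have xy: "x \<in> closure D" "y \<in> closure D" using that closure_subset by auto
    define U where "U = (\<lambda>K. {t \<in> {0..1::real}. x + t *\<^sub>R (y - x) \<in> K})"
    \<comment> \<open>Finitely many closed parameter sets cover the interval, and a common Lipschitz
      bound on each of them extends to the whole.\<close>
    have "lipschitz_on (B * norm (x - y)) {0..1} (\<lambda>t. v (x + t *\<^sub>R (y - x)))"
    proof (rule lipschitz_on_closed_Union[where U = U and I = \<T>])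
      fix K assume K: "K \<in> \<T>"
      show "(B * norm (x - y))-lipschitz_on (U K) (\<lambda>t. v (x + t *\<^sub>R (y - x)))"
      proof (rule lipschitz_onI)
        fix s t assume st: "s \<in> U K" "t \<in> U K"
        have "v (x + s *\<^sub>R (y - x)) - v (x + t *\<^sub>R (y - x)) = (s - t) * (a K \<bullet> (y - x))"
          using st a[OF K] by (simp add: U_def inner_add_right algebra_simps)
        hence "\<bar>v (x + s *\<^sub>R (y - x)) - v (x + t *\<^sub>R (y - x))\<bar> = \<bar>s - t\<bar> * \<bar>a K \<bullet> (y - x)\<bar>" by (simp add: abs_mult)
        also have "\<dots> \<le> \<bar>s - t\<bar> * (B * norm (y - x))"
        proof (rule mult_left_mono)
          have "\<bar>a K \<bullet> (y - x)\<bar> \<le> norm (a K) * norm (y - x)" by (rule Cauchy_Schwarz_ineq2)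
          also have "\<dots> \<le> B * norm (y - x)"
            unfolding B_def using mesh_finite K by (intro mult_right_mono Max_ge) auto
          finally show "\<bar>a K \<bullet> (y - x)\<bar> \<le> B * norm (y - x)" .
        qed simp
        finally show "dist (v (x + s *\<^sub>R (y - x))) (v (x + t *\<^sub>R (y - x))) \<le> B * norm (x - y) * dist s t"
          by (simp add: dist_real_def norm_minus_commute mult_ac)
      qed (use GB[of x] G0[of x] in auto)
      have "U K = {0..1} \<inter> (\<lambda>t. x + t *\<^sub>R (y - x)) -` K" by (auto simp: U_def)
      moreover have "closed \<dots>"
        by (intro closed_Int closed_vimage mesh_closed K) (auto intro!: continuous_intros)
      ultimately show "closed (U K)" by simp
    next
      show "{0..1} \<subseteq> (\<Union>K\<in>\<T>. U K)"
      proof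
        fix t :: real assume t: "t \<in> {0..1}"
        have "x + t *\<^sub>R (y - x) = (1 - t) *\<^sub>R x + t *\<^sub>R y" by (simp add: algebra_simps)
        also have "\<dots> \<in> closure D" using closure_D_convex xy t by (auto intro: convexD)
        finally show "t \<in> (\<Union>K\<in>\<T>. U K)" using t mesh_cover by (auto simp: U_def)
      qed
    qed (use mesh_finite GB[of x] G0[of x] in auto)
    from lipschitz_onD[OF this, of 0 1] show ?thesis by (simp add: dist_real_def)
  qed
  have wg: "weak_grad D v g"
  proof (rule weak_grad_lipschitz[OF lip gi])
    show "AE x in \<mu>. \<forall>i. ((\<lambda>t. (v (x + t *\<^sub>R axis i 1) - v x) / t) \<longlongrightarrow> g x $ i) (at 0)"
      using AE_interior
    proof eventually_elim
      case (elim x)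
      then obtain K where K: "K \<in> \<T>" "x \<in> interior K" by blast
      then obtain e where e: "e > 0" "ball x e \<subseteq> K" by (meson mem_interior)
      show ?case
      proof
        fix i
        show "((\<lambda>t. (v (x + t *\<^sub>R axis i 1) - v x) / t) \<longlongrightarrow> g x $ i) (at 0)"
        proof (rule Lim_transform_eventually[OF tendsto_const])
          show "\<forall>\<^sub>F t in at 0. g x $ i = (v (x + t *\<^sub>R axis i 1) - v x) / t"
            unfolding eventually_at
          proof (intro exI conjI ballI impI)
            fix t :: real assume t: "t \<noteq> 0 \<and> dist t 0 < e"
            hence "x + t *\<^sub>R axis i 1 \<in> K" "x \<in> K" using e by (auto simp: dist_norm subset_iff)
            thus "g x $ i = (v (x + t *\<^sub>R axis i 1) - v x) / t"
              using t by (simp add: a[OF K(1)] g[OF K] inner_add_right inner_axis)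
          qed (use e in auto)
        qed
      qed
    qed
  qed
  show H1: "v \<in> H1 D" using wg Sh_L2[OF v] by (auto simp: H1_def)
  have "gip D v v = integral\<^sup>L \<mu> (\<lambda>x. g x \<bullet> g x)"
    using H1 wgrad_eq[OF Sh_L2[OF v] wg] measurable_muI gm
    by (intro gip_eq) (auto intro!: measurable_restrict_space1 measurable_completion)
  also have "\<dots> = integral\<^sup>L \<mu> (\<lambda>x. (G x)\<^sup>2)"
  proof (rule integral_cong_AE)
    show "AE x in \<mu>. g x \<bullet> g x = (G x)\<^sup>2" using AE_interior
    proof eventually_elim
      case (elim x)
      then obtain K where K: "K \<in> \<T>" "x \<in> interior K" by blast
      have "G x \<le> norm (a K)" unfolding G_def
      proof (intro Max.boundedI)
        fix c assume "c \<in> (\<lambda>K. indicat_real K x * norm (a K)) ` \<T>"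
        then obtain K' where K': "K' \<in> \<T>" "c = indicat_real K' x * norm (a K')" by auto
        have "a K' = a K" if "x \<in> K'" using elim K K' that by (intro slope) auto
        thus "c \<le> norm (a K)" using K' by (cases "x \<in> K'") auto
      qed (use mesh_finite mesh_nonempty in auto)
      moreover have "norm (a K) \<le> G x" using K interior_subset by (intro Gge) auto
      ultimately have "G x = norm (a K)" by simp
      thus ?case using g[OF K] by (simp add: power2_norm_eq_inner)
    qed
  qed (use Gm gm measurable_muI in \<open>auto intro!: borel_measurable_inner measurable_restrict_space1 measurable_completion\<close>)
  finally have "gip D v v = integral\<^sup>L \<mu> (\<lambda>x. (G x)\<^sup>2)" .
  thus "\<exists>G B. G \<in> borel_measurable borel \<and> (\<forall>x. 0 \<le> G x \<and> G x \<le> B) \<and> gip D v v = integral\<^sup>L \<mu> (\<lambda>x. (G x)\<^sup>2) \<and>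
      (\<forall>x\<in>closure D. \<forall>y\<in>closure D. ennreal \<bar>v y - v x\<bar> \<le> 
        (\<integral>\<^sup>+s. ennreal (4 * s ^ 3 * norm (y - x) * G (x + s ^ 4 *\<^sub>R (y - x))) * indicator {0..1} s \<partial>lborel))"
    using Gm G0 GB line by blast
qed

end

section \<open>A Sobolev inequality\<close>

context bounded_domain begin

lemma emeasure_D: "emeasure lborel D = ennreal (measure lebesgue D)"
proof -
  have "emeasure lborel D = emeasure lebesgue D" using D_borel by (subst emeasure_completion) auto
  thus ?thesis using emeasure_eq_measure2[OF D_fmeasurable] by simp
qed

text \<open>The contraction towards \<open>x\<close> by the factor \<open>t\<close> maps the convex
  set \<open>D\<close> into itself, and its Jacobian is \<open>t\<close> to the power of the
  dimension.\<close>

lemma nn_integral_scaled_le: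
  fixes f :: "real^'n \<Rightarrow> ennreal"
  assumes f: "f \<in> borel_measurable borel" and t: "0 < t" "t \<le> 1" and x: "x \<in> D"
  shows "(\<integral>\<^sup>+y. f (x + t *\<^sub>R (y - x)) * indicator D y \<partial>lborel) \<le> ennreal ((1 / t) ^ CARD('n)) * (\<integral>\<^sup>+z. f z * indicator D z \<partial>lborel)"
proof -
  let ?c = "(1 - t) *\<^sub>R x"
  have [measurable]: "D \<in> sets borel" by (rule D_borel)
  have fD: "(\<lambda>z. f z * indicator D z) \<in> borel_measurable borel" using f by measurable
  have "(\<integral>\<^sup>+z. f z * indicator D z \<partial>lborel) 
     = (\<integral>\<^sup>+z. f z * indicator D z \<partial>(density (distr lborel borel (\<lambda>y. ?c + t *\<^sub>R y)) (\<lambda>_. ennreal (\<bar>t\<bar> ^ DIM(real^'n)))))"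
    using t by (subst lborel_affine[of t ?c, symmetric]) auto
  also have "\<dots> = (\<integral>\<^sup>+y. ennreal (t ^ CARD('n)) * (f (?c + t *\<^sub>R y) * indicator D (?c + t *\<^sub>R y)) \<partial>lborel)"
    using fD t by (subst nn_integral_density) (auto simp: nn_integral_distr)
  also have "\<dots> = ennreal (t ^ CARD('n)) * (\<integral>\<^sup>+y. f (?c + t *\<^sub>R y) * indicator D (?c + t *\<^sub>R y) \<partial>lborel)"
    by (intro nn_integral_cmult measurable_compose[OF _ fD]) measurable
  also have "\<dots> \<ge> ennreal (t ^ CARD('n)) * (\<integral>\<^sup>+y. f (x + t *\<^sub>R (y - x)) * indicator D y \<partial>lborel)"
  proof (intro mult_left_mono nn_integral_mono)
    fix y
    have eq: "?c + t *\<^sub>R y = x + t *\<^sub>R (y - x)" by (simp add: algebra_simps)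
    have "?c + t *\<^sub>R y \<in> D" if "y \<in> D" using D_convex x that t by (intro convexD) auto
    thus "f (x + t *\<^sub>R (y - x)) * indicator D y \<le> f (?c + t *\<^sub>R y) * indicator D (?c + t *\<^sub>R y)"
      unfolding eq[symmetric] by (auto simp: indicator_def)
  qed simp
  finally have "ennreal ((1 / t) ^ CARD('n)) * (ennreal (t ^ CARD('n)) * (\<integral>\<^sup>+y. f (x + t *\<^sub>R (y - x)) * indicator D y \<partial>lborel))
      \<le> ennreal ((1 / t) ^ CARD('n)) * (\<integral>\<^sup>+z. f z * indicator D z \<partial>lborel)"
    by (intro mult_left_mono) auto
  moreover have "ennreal ((1 / t) ^ CARD('n)) * ennreal (t ^ CARD('n)) = 1"
    using t by (simp add: ennreal_mult[symmetric] power_mult_distrib[symmetric])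
  ultimately show ?thesis by (simp add: mult.assoc[symmetric])
qed

text \<open>Jensen's inequality for the fourth power, as Cauchy-Schwarz applied twice.\<close>

lemma nn_integral_unit_interval_power4:
  fixes f :: "real \<Rightarrow> ennreal"
  assumes [measurable]: "f \<in> borel_measurable borel"
  shows "(\<integral>\<^sup>+s. f s * indicator {0..1} s \<partial>lborel) ^ 4 \<le> (\<integral>\<^sup>+s. f s ^ 4 * indicator {0..1} s \<partial>lborel)"
proof -
  have sq: "(\<integral>\<^sup>+s. h s * indicator {0..1} s \<partial>lborel)\<^sup>2 \<le> (\<integral>\<^sup>+s. (h s)\<^sup>2 * indicator {0..1} s \<partial>lborel)"
    if [measurable]: "h \<in> borel_measurable borel" for h :: "real \<Rightarrow> ennreal"
  proof -
    have "(\<integral>\<^sup>+s. (h s * indicator {0..1} s) * indicator {0..1} s \<partial>lborel)\<^sup>2 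
      \<le> (\<integral>\<^sup>+s. (h s * indicator {0..1} s)\<^sup>2 \<partial>lborel) * (\<integral>\<^sup>+s. (indicator {0..1} s)\<^sup>2 \<partial>(lborel :: real measure))"
      by (rule Cauchy_Schwarz_nn_integral) measurable
    also have "(\<integral>\<^sup>+s. (indicator {0..1} s)\<^sup>2 \<partial>(lborel :: real measure)) = (\<integral>\<^sup>+s. indicator {0..1} s \<partial>(lborel :: real measure))"
      by (intro nn_integral_cong) (auto simp: indicator_def)
    also have "\<dots> = 1" by (simp add: nn_integral_indicator)
    also have "(\<integral>\<^sup>+s. (h s * indicator {0..1} s)\<^sup>2 \<partial>lborel) = (\<integral>\<^sup>+s. (h s)\<^sup>2 * indicator {0..1} s \<partial>lborel)"
      by (intro nn_integral_cong) (auto simp: indicator_def)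
    also have "(\<lambda>s. (h s * indicator {0..1} s) * indicator {0..1} s) = (\<lambda>s. h s * indicator {0..1::real} s)"
      by (auto simp: indicator_def)
    finally show ?thesis by simp
  qed
  have "(\<integral>\<^sup>+s. f s * indicator {0..1} s \<partial>lborel) ^ 4 = ((\<integral>\<^sup>+s. f s * indicator {0..1} s \<partial>lborel)\<^sup>2)\<^sup>2"
    by (simp add: power_mult[symmetric])
  also have "\<dots> \<le> (\<integral>\<^sup>+s. (f s)\<^sup>2 * indicator {0..1} s \<partial>lborel)\<^sup>2" by (intro power_mono sq) auto
  also have "\<dots> \<le> (\<integral>\<^sup>+s. ((f s)\<^sup>2)\<^sup>2 * indicator {0..1} s \<partial>lborel)" by (intro sq) auto
  also have "\<dots> = (\<integral>\<^sup>+s. f s ^ 4 * indicator {0..1} s \<partial>lborel)"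
    by (simp add: power_mult[symmetric])
  finally show ?thesis .
qed

text \<open>By mean zero, \<open>m * v x\<close> is the integral of \<open>v x - v y\<close> over
  \<open>y\<close>. After the segment bound, Fubini and Jensen in \<open>s\<close>, the fourth power
  of \<open>A t x\<close> is at most \<open>m^2 * (B t x)^2\<close>; one factor \<open>B t x\<close>
  is bounded uniformly in \<open>x\<close> at the cost of \<open>t^(-d)\<close>, the other is
  integrated over \<open>x\<close>. For \<open>t = s ^ 4\<close> the weight contributes
  \<open>s ^ 12\<close>, which compensates \<open>s^(-4 d)\<close> for
  \<open>d \<le> 3\<close>.\<close>

lemma nn_sobolev_L4:
  assumes dim: "CARD('n) \<le> 3" and diam: "\<And>x y. x \<in> D \<Longrightarrow> y \<in> D \<Longrightarrow> norm (y - x) \<le> \<delta>" and "\<delta> \<ge> 0"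
    and [measurable]: "G \<in> borel_measurable borel" and G0: "\<And>x. 0 \<le> G x"
    and vm: "(\<lambda>x. indicat_real D x * v x) \<in> borel_measurable borel"
    and vi: "integrable lborel (\<lambda>x. indicat_real D x * v x)"
    and mean: "integral\<^sup>L lborel (\<lambda>x. indicat_real D x * v x) = 0"
    and line: "\<And>x y. x \<in> D \<Longrightarrow> y \<in> D \<Longrightarrow> ennreal \<bar>v y - v x\<bar> \<le> 
        (\<integral>\<^sup>+s. ennreal (4 * s ^ 3 * norm (y - x) * G (x + s ^ 4 *\<^sub>R (y - x))) * indicator {0..1} s \<partial>lborel)"
  defines "m \<equiv> measure lebesgue D"
  shows "(\<integral>\<^sup>+x. ennreal ((m * \<bar>v x\<bar>) ^ 4) * indicator D x \<partial>lborel) 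
    \<le> ennreal ((4 * \<delta>) ^ 4 * 2 ^ CARD('n) * m ^ 3) * (\<integral>\<^sup>+x. ennreal ((G x)\<^sup>2) * indicator D x \<partial>lborel)\<^sup>2"
proof -
  have m: "m > 0" using measure_D_pos by (simp add: m_def)
  have [measurable]: "D \<in> sets borel" by (rule D_borel)
  define A where "A = (\<lambda>t x. \<integral>\<^sup>+y. ennreal (G (x + t *\<^sub>R (y - x))) * indicator D y \<partial>lborel)"
  define B where "B = (\<lambda>t x. \<integral>\<^sup>+y. ennreal ((G (x + t *\<^sub>R (y - x)))\<^sup>2) * indicator D y \<partial>lborel)"
  define I2 where "I2 = (\<integral>\<^sup>+x. ennreal ((G x)\<^sup>2) * indicator D x \<partial>lborel)"
  have AB: "(A t x)\<^sup>2 \<le> ennreal m * B t x" for t x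
  proof -
    have "(A t x)\<^sup>2 = (\<integral>\<^sup>+y. (ennreal (G (x + t *\<^sub>R (y - x))) * indicator D y) * indicator D y \<partial>lborel)\<^sup>2"
      unfolding A_def by (intro arg_cong[where f = "\<lambda>x. x\<^sup>2"] nn_integral_cong) (auto simp: indicator_def)
    also have "\<dots> \<le> (\<integral>\<^sup>+y. (ennreal (G (x + t *\<^sub>R (y - x))) * indicator D y)\<^sup>2 \<partial>lborel) * (\<integral>\<^sup>+y. (indicator D y)\<^sup>2 \<partial>lborel)"
      by (rule Cauchy_Schwarz_nn_integral) measurable
    also have "(\<integral>\<^sup>+y. (ennreal (G (x + t *\<^sub>R (y - x))) * indicator D y)\<^sup>2 \<partial>lborel) = B t x"
      unfolding B_def by (intro nn_integral_cong) (auto simp: indicator_def ennreal_power G0)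
    also have "(\<integral>\<^sup>+y. (indicator D y)\<^sup>2 \<partial>lborel) = (\<integral>\<^sup>+y. indicator D y \<partial>lborel)"
      by (intro nn_integral_cong) (auto simp: indicator_def)
    also have "\<dots> = ennreal m" by (simp add: emeasure_D m_def)
    finally show ?thesis by (simp add: mult.commute)
  qed
  have Bsup: "B t x \<le> ennreal ((1 / t) ^ CARD('n)) * I2" if "0 < t" "t \<le> 1" "x \<in> D" for t x
    unfolding B_def I2_def using that by (intro nn_integral_scaled_le) auto
  \<comment> \<open>Uniform in \<open>t\<close>: for \<open>t \<ge> 1 / 2\<close> the contraction
    towards \<open>x\<close> is used; for smaller \<open>t\<close> the integrals are exchanged and
    the contraction towards \<open>y\<close> has factor \<open>1 - t > 1 / 2\<close>.\<close>
  have Bint: "(\<integral>\<^sup>+x. B t x * indicator D x \<partial>lborel) \<le> ennreal (2 ^ CARD('n) * m) * I2" if t: "0 < t" "t \<le> 1" for t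
  proof (cases "t \<ge> 1 / 2")
    case True
    have "(\<integral>\<^sup>+x. B t x * indicator D x \<partial>lborel) \<le> (\<integral>\<^sup>+x. (ennreal (2 ^ CARD('n)) * I2) * indicator D x \<partial>lborel)"
    proof (intro nn_integral_mono)
      fix x
      have "B t x \<le> ennreal (2 ^ CARD('n)) * I2" if "x \<in> D"
      proof -
        have "(1 / t) ^ CARD('n) \<le> 2 ^ CARD('n)" using True t by (intro power_mono) (auto simp: field_simps)
        thus ?thesis by (intro order_trans[OF Bsup[OF t that]] mult_right_mono ennreal_leI) auto
      qed
      thus "B t x * indicator D x \<le> (ennreal (2 ^ CARD('n)) * I2) * indicator D x" by (auto simp: indicator_def)
    qed
    also have "\<dots> = ennreal (2 ^ CARD('n)) * I2 * ennreal m"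
      by (subst nn_integral_cmult_indicator) (auto simp: emeasure_D m_def)
    also have "\<dots> = ennreal (2 ^ CARD('n) * m) * I2" using m by (simp add: ennreal_mult mult_ac)
    finally show ?thesis .
  next
    case False
    have "(\<integral>\<^sup>+x. B t x * indicator D x \<partial>lborel) 
      = (\<integral>\<^sup>+x. \<integral>\<^sup>+y. (ennreal ((G (x + t *\<^sub>R (y - x)))\<^sup>2) * indicator D y) * indicator D x \<partial>lborel \<partial>lborel)"
      unfolding B_def by (subst nn_integral_multc) measurable
    also have "\<dots> = (\<integral>\<^sup>+y. \<integral>\<^sup>+x. (ennreal ((G (x + t *\<^sub>R (y - x)))\<^sup>2) * indicator D y) * indicator D x \<partial>lborel \<partial>lborel)"
      by (intro lborel_pair.Fubini') measurable
    also have "\<dots> \<le> (\<integral>\<^sup>+y. (ennreal (2 ^ CARD('n)) * I2) * indicator D y \<partial>lborel)"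
    proof (intro nn_integral_mono)
      fix y
      show "(\<integral>\<^sup>+x. (ennreal ((G (x + t *\<^sub>R (y - x)))\<^sup>2) * indicator D y) * indicator D x \<partial>lborel) \<le> (ennreal (2 ^ CARD('n)) * I2) * indicator D y"
      proof (cases "y \<in> D")
        case True
        have "(\<integral>\<^sup>+x. (ennreal ((G (x + t *\<^sub>R (y - x)))\<^sup>2) * indicator D y) * indicator D x \<partial>lborel)
          = (\<integral>\<^sup>+x. ennreal ((G (y + (1 - t) *\<^sub>R (x - y)))\<^sup>2) * indicator D x \<partial>lborel)"
          using True by (intro nn_integral_cong) (simp add: algebra_simps)
        also have "\<dots> \<le> ennreal ((1 / (1 - t)) ^ CARD('n)) * I2"
          unfolding I2_def using False t True by (intro nn_integral_scaled_le) auto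
        also have "\<dots> \<le> ennreal (2 ^ CARD('n)) * I2"
          using False t by (intro mult_right_mono ennreal_leI power_mono) (auto simp: field_simps)
        finally show ?thesis using True by simp
      qed simp
    qed
    also have "\<dots> = ennreal (2 ^ CARD('n)) * I2 * ennreal m"
      by (subst nn_integral_cmult_indicator) (auto simp: emeasure_D m_def)
    also have "\<dots> = ennreal (2 ^ CARD('n) * m) * I2" using m by (simp add: ennreal_mult mult_ac)
    finally show ?thesis .
  qed
  have A4: "(\<integral>\<^sup>+x. A t x ^ 4 * indicator D x \<partial>lborel) \<le> ennreal ((1 / t) ^ CARD('n) * 2 ^ CARD('n) * m ^ 3) * I2\<^sup>2"
    if t: "0 < t" "t \<le> 1" for t
  proof -
    have [measurable]: "B t \<in> borel_measurable borel" unfolding B_def by measurable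
    have "(\<integral>\<^sup>+x. A t x ^ 4 * indicator D x \<partial>lborel) 
      \<le> (\<integral>\<^sup>+x. (ennreal (m\<^sup>2 * (1 / t) ^ CARD('n)) * I2) * (B t x * indicator D x) \<partial>lborel)"
    proof (intro nn_integral_mono)
      fix x
      show "A t x ^ 4 * indicator D x \<le> (ennreal (m\<^sup>2 * (1 / t) ^ CARD('n)) * I2) * (B t x * indicator D x)"
      proof (cases "x \<in> D")
        case True
        have "A t x ^ 4 = ((A t x)\<^sup>2)\<^sup>2" by (simp add: power_mult[symmetric])
        also have "\<dots> \<le> (ennreal m * B t x)\<^sup>2" by (intro power_mono AB) auto
        also have "\<dots> = (ennreal m)\<^sup>2 * B t x * B t x" by (simp add: power2_eq_square mult_ac)
        also have "\<dots> \<le> (ennreal m)\<^sup>2 * (ennreal ((1 / t) ^ CARD('n)) * I2) * B t x"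
          using True t by (intro mult_left_mono mult_right_mono Bsup) auto
        also have "\<dots> = (ennreal (m\<^sup>2 * (1 / t) ^ CARD('n)) * I2) * B t x"
          using m t by (simp add: ennreal_mult ennreal_power mult_ac)
        finally show ?thesis using True by simp
      qed simp
    qed
    also have "\<dots> = (ennreal (m\<^sup>2 * (1 / t) ^ CARD('n)) * I2) * (\<integral>\<^sup>+x. B t x * indicator D x \<partial>lborel)"
      by (intro nn_integral_cmult) measurable
    also have "\<dots> \<le> (ennreal (m\<^sup>2 * (1 / t) ^ CARD('n)) * I2) * (ennreal (2 ^ CARD('n) * m) * I2)"
      using t by (intro mult_left_mono Bint) auto
    also have "\<dots> = (ennreal (m\<^sup>2 * (1 / t) ^ CARD('n)) * ennreal (2 ^ CARD('n) * m)) * I2\<^sup>2"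
      by (simp add: power2_eq_square mult_ac)
    also have "ennreal (m\<^sup>2 * (1 / t) ^ CARD('n)) * ennreal (2 ^ CARD('n) * m) = ennreal ((1 / t) ^ CARD('n) * 2 ^ CARD('n) * m ^ 3)"
      using m t by (subst ennreal_mult[symmetric]) (auto simp: power2_eq_square power3_eq_cube mult_ac)
    finally show ?thesis .
  qed
  have A_meas [measurable]: "(\<lambda>(t, x). A t x) \<in> borel_measurable (borel \<Otimes>\<^sub>M borel)"
    unfolding A_def by measurable
  have pw: "ennreal (m * \<bar>v x\<bar>) \<le> (\<integral>\<^sup>+s. (ennreal (4 * \<delta> * s ^ 3) * A (s ^ 4) x) * indicator {0..1} s \<partial>lborel)" if x: "x \<in> D" for x
  proof -
    have i1: "integrable lborel (\<lambda>y. indicat_real D y * v x)"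
      using D_fmeasurable by (intro integrable_mult_left integrable_real_indicator) (auto simp: emeasure_D)
    have "integral\<^sup>L lborel (\<lambda>y. indicat_real D y * v y - indicat_real D y * v x) = - (m * v x)"
    proof -
      have "measure lborel D = m"
        using emeasure_D m unfolding m_def by (simp only: measure_def[of lborel] enn2real_ennreal less_imp_le)
      thus ?thesis using i1 vi mean by simp
    qed
    hence "m * \<bar>v x\<bar> = norm (integral\<^sup>L lborel (\<lambda>y. indicat_real D y * v y - indicat_real D y * v x))"
      using m by (simp add: abs_mult)
    hence "ennreal (m * \<bar>v x\<bar>) \<le> (\<integral>\<^sup>+y. norm (indicat_real D y * v y - indicat_real D y * v x) \<partial>lborel)"
      using integral_norm_bound_ennreal[OF Bochner_Integration.integrable_diff[OF vi i1]] by simp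
    also have "\<dots> \<le> (\<integral>\<^sup>+y. \<integral>\<^sup>+s. (ennreal (4 * \<delta> * s ^ 3) * (ennreal (G (x + s ^ 4 *\<^sub>R (y - x))) * indicator D y)) * indicator {0..1} s \<partial>lborel \<partial>lborel)"
    proof (intro nn_integral_mono)
      fix y
      show "ennreal (norm (indicat_real D y * v y - indicat_real D y * v x)) 
        \<le> (\<integral>\<^sup>+s. (ennreal (4 * \<delta> * s ^ 3) * (ennreal (G (x + s ^ 4 *\<^sub>R (y - x))) * indicator D y)) * indicator {0..1} s \<partial>lborel)"
      proof (cases "y \<in> D")
        case True
        have "ennreal \<bar>v y - v x\<bar> \<le> (\<integral>\<^sup>+s. ennreal (4 * s ^ 3 * norm (y - x) * G (x + s ^ 4 *\<^sub>R (y - x))) * indicator {0..1} s \<partial>lborel)"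
          by (rule line) fact+
        also have "\<dots> \<le> (\<integral>\<^sup>+s. (ennreal (4 * \<delta> * s ^ 3) * (ennreal (G (x + s ^ 4 *\<^sub>R (y - x))) * indicator D y)) * indicator {0..1} s \<partial>lborel)"
        proof (intro nn_integral_mono)
          fix s :: real
          have "4 * s ^ 3 * norm (y - x) * G (x + s ^ 4 *\<^sub>R (y - x)) \<le> 4 * \<delta> * s ^ 3 * G (x + s ^ 4 *\<^sub>R (y - x))" if "s \<in> {0..1}"
          proof (rule mult_right_mono[OF _ G0])
            show "4 * s ^ 3 * norm (y - x) \<le> 4 * \<delta> * s ^ 3"
              using diam[OF x True] that mult_left_mono[of "norm (y - x)" \<delta> "4 * s ^ 3"] by (simp add: mult_ac)
          qed
          thus "ennreal (4 * s ^ 3 * norm (y - x) * G (x + s ^ 4 *\<^sub>R (y - x))) * indicator {0..1} s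
            \<le> (ennreal (4 * \<delta> * s ^ 3) * (ennreal (G (x + s ^ 4 *\<^sub>R (y - x))) * indicator D y)) * indicator {0..1} s"
            using True G0 \<open>\<delta> \<ge> 0\<close> by (auto simp: indicator_def ennreal_mult[symmetric] ennreal_leI)
        qed
        finally show ?thesis using True by simp
      qed simp
    qed
    also have "\<dots> = (\<integral>\<^sup>+s. \<integral>\<^sup>+y. (ennreal (4 * \<delta> * s ^ 3) * (ennreal (G (x + s ^ 4 *\<^sub>R (y - x))) * indicator D y)) * indicator {0..1} s \<partial>lborel \<partial>lborel)"
      by (intro lborel_pair.Fubini') measurable
    also have "\<dots> = (\<integral>\<^sup>+s. (ennreal (4 * \<delta> * s ^ 3) * A (s ^ 4) x) * indicator {0..1} s \<partial>lborel)"
    proof (intro nn_integral_cong)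
      fix s :: real
      have "(\<integral>\<^sup>+y. (ennreal (4 * \<delta> * s ^ 3) * (ennreal (G (x + s ^ 4 *\<^sub>R (y - x))) * indicator D y)) * indicator {0..1} s \<partial>lborel)
        = (\<integral>\<^sup>+y. (ennreal (4 * \<delta> * s ^ 3) * (ennreal (G (x + s ^ 4 *\<^sub>R (y - x))) * indicator D y)) \<partial>lborel) * indicator {0..1} s"
        by (intro nn_integral_multc) measurable
      also have "(\<integral>\<^sup>+y. (ennreal (4 * \<delta> * s ^ 3) * (ennreal (G (x + s ^ 4 *\<^sub>R (y - x))) * indicator D y)) \<partial>lborel) 
        = ennreal (4 * \<delta> * s ^ 3) * A (s ^ 4) x"
        unfolding A_def by (intro nn_integral_cmult) measurable
      finally show "(\<integral>\<^sup>+y. (ennreal (4 * \<delta> * s ^ 3) * (ennreal (G (x + s ^ 4 *\<^sub>R (y - x))) * indicator D y)) * indicator {0..1} s \<partial>lborel)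
        = (ennreal (4 * \<delta> * s ^ 3) * A (s ^ 4) x) * indicator {0..1} s" .
    qed
    finally show ?thesis .
  qed
  have "(\<integral>\<^sup>+x. ennreal ((m * \<bar>v x\<bar>) ^ 4) * indicator D x \<partial>lborel) 
    \<le> (\<integral>\<^sup>+x. \<integral>\<^sup>+s. ((ennreal (4 * \<delta> * s ^ 3) * A (s ^ 4) x) ^ 4 * indicator {0..1} s) * indicator D x \<partial>lborel \<partial>lborel)"
  proof (intro nn_integral_mono)
    fix x
    show "ennreal ((m * \<bar>v x\<bar>) ^ 4) * indicator D x \<le> (\<integral>\<^sup>+s. ((ennreal (4 * \<delta> * s ^ 3) * A (s ^ 4) x) ^ 4 * indicator {0..1} s) * indicator D x \<partial>lborel)"
    proof (cases "x \<in> D")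
      case True
      have "ennreal ((m * \<bar>v x\<bar>) ^ 4) = ennreal (m * \<bar>v x\<bar>) ^ 4" using m by (simp add: ennreal_power)
      also have "\<dots> \<le> (\<integral>\<^sup>+s. (ennreal (4 * \<delta> * s ^ 3) * A (s ^ 4) x) * indicator {0..1} s \<partial>lborel) ^ 4"
        by (intro power_mono pw True) auto
      also have "\<dots> \<le> (\<integral>\<^sup>+s. (ennreal (4 * \<delta> * s ^ 3) * A (s ^ 4) x) ^ 4 * indicator {0..1} s \<partial>lborel)"
        by (intro nn_integral_unit_interval_power4) measurable
      finally show ?thesis using True by simp
    qed simp
  qed
  also have "\<dots> = (\<integral>\<^sup>+s. \<integral>\<^sup>+x. ((ennreal (4 * \<delta> * s ^ 3) * A (s ^ 4) x) ^ 4 * indicator {0..1} s) * indicator D x \<partial>lborel \<partial>lborel)"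
    by (intro lborel_pair.Fubini') measurable
  also have "\<dots> \<le> (\<integral>\<^sup>+(s::real). (ennreal ((4 * \<delta>) ^ 4 * 2 ^ CARD('n) * m ^ 3) * I2\<^sup>2) * indicator {0..1} s \<partial>lborel)"
  proof (intro nn_integral_mono)
    fix s :: real
    show "(\<integral>\<^sup>+x. ((ennreal (4 * \<delta> * s ^ 3) * A (s ^ 4) x) ^ 4 * indicator {0..1} s) * indicator D x \<partial>lborel) 
      \<le> (ennreal ((4 * \<delta>) ^ 4 * 2 ^ CARD('n) * m ^ 3) * I2\<^sup>2) * indicator {0..1} s"
    proof (cases "s \<in> {0<..1}")
      case False
      hence *: "((ennreal (4 * \<delta> * s ^ 3) * A (s ^ 4) x) ^ 4 * indicator {0..1} s) * indicator D x = 0" for x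
        by (cases "s = 0") (simp_all add: indicator_def)
      show ?thesis unfolding * by simp
    next
      case True
      hence s: "0 < s ^ 4" "s ^ 4 \<le> 1" by (auto intro: power_le_one)
      have "(\<integral>\<^sup>+x. ((ennreal (4 * \<delta> * s ^ 3) * A (s ^ 4) x) ^ 4 * indicator {0..1} s) * indicator D x \<partial>lborel)
        = (\<integral>\<^sup>+x. ennreal (4 * \<delta> * s ^ 3) ^ 4 * (A (s ^ 4) x ^ 4 * indicator D x) \<partial>lborel)"
        using True by (intro nn_integral_cong) (simp add: power_mult_distrib mult_ac)
      also have "\<dots> = ennreal (4 * \<delta> * s ^ 3) ^ 4 * (\<integral>\<^sup>+x. A (s ^ 4) x ^ 4 * indicator D x \<partial>lborel)"
        by (intro nn_integral_cmult) measurable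
      also have "\<dots> \<le> ennreal (4 * \<delta> * s ^ 3) ^ 4 * (ennreal ((1 / s ^ 4) ^ CARD('n) * 2 ^ CARD('n) * m ^ 3) * I2\<^sup>2)"
        by (intro mult_left_mono A4 s) auto
      also have "\<dots> = ennreal ((4 * \<delta> * s ^ 3) ^ 4 * ((1 / s ^ 4) ^ CARD('n) * 2 ^ CARD('n) * m ^ 3)) * I2\<^sup>2"
        using True \<open>\<delta> \<ge> 0\<close> m by (simp add: ennreal_power ennreal_mult[symmetric] mult.assoc[symmetric])
      also have "\<dots> \<le> ennreal ((4 * \<delta>) ^ 4 * 2 ^ CARD('n) * m ^ 3) * I2\<^sup>2"
      proof (intro mult_right_mono ennreal_leI)
        \<comment> \<open>The restriction on the dimension enters here.\<close>
        have "s ^ 12 \<le> s ^ (4 * CARD('n))" using True dim by (intro power_decreasing) auto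
        hence *: "s ^ 12 * (1 / s ^ 4) ^ CARD('n) \<le> 1"
          using True by (simp add: power_one_over power_mult[symmetric] field_simps)
        have "(4 * \<delta> * s ^ 3) ^ 4 * ((1 / s ^ 4) ^ CARD('n) * 2 ^ CARD('n) * m ^ 3)
          = (s ^ 12 * (1 / s ^ 4) ^ CARD('n)) * ((4 * \<delta>) ^ 4 * 2 ^ CARD('n) * m ^ 3)"
          by (simp add: power_mult_distrib power_mult[symmetric] mult_ac)
        also have "\<dots> \<le> 1 * ((4 * \<delta>) ^ 4 * 2 ^ CARD('n) * m ^ 3)"
          using m \<open>\<delta> \<ge> 0\<close> by (intro mult_right_mono *) auto
        finally show "(4 * \<delta> * s ^ 3) ^ 4 * ((1 / s ^ 4) ^ CARD('n) * 2 ^ CARD('n) * m ^ 3) \<le> (4 * \<delta>) ^ 4 * 2 ^ CARD('n) * m ^ 3" by simp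
      qed auto
      finally show ?thesis using True by simp
    qed
  qed
  also have "\<dots> = ennreal ((4 * \<delta>) ^ 4 * 2 ^ CARD('n) * m ^ 3) * I2\<^sup>2"
    by (subst nn_integral_cmult_indicator) auto
  finally show ?thesis by (simp add: I2_def)
qed

text \<open>The constant of the preceding estimate divided by the fourth power of the measure. It
  depends on \<open>D\<close> only, hence not on the mesh.\<close>

definition sobolev_const :: real where
  "sobolev_const = (4 * diameter D) ^ 4 * 2 ^ CARD('n) / measure lebesgue D"

lemma sobolev_const_nonneg: "0 \<le> sobolev_const"
  unfolding sobolev_const_def
  by (intro divide_nonneg_nonneg mult_nonneg_nonneg zero_le_power diameter_ge_0 D_bounded) auto

lemma nn_integral_mu: 
  "f \<in> borel_measurable borel \<Longrightarrow> (\<integral>\<^sup>+x. f x \<partial>\<mu>) = (\<integral>\<^sup>+x. f x * indicator D x \<partial>lborel)"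
  by (simp add: nn_integral_restrict_space nn_integral_completion)

lemma sobolev_L4:
  assumes dim: "CARD('n) \<le> 3"
    and G: "G \<in> borel_measurable borel" "\<And>x. 0 \<le> G x" "\<And>x. G x \<le> B"
    and v: "continuous_on D v" "\<And>x. x \<in> D \<Longrightarrow> \<bar>v x\<bar> \<le> V" and mean: "mean_zero D v"
    and line: "\<And>x y. x \<in> D \<Longrightarrow> y \<in> D \<Longrightarrow> ennreal \<bar>v y - v x\<bar> \<le> 
        (\<integral>\<^sup>+s. ennreal (4 * s ^ 3 * norm (y - x) * G (x + s ^ 4 *\<^sub>R (y - x))) * indicator {0..1} s \<partial>lborel)"
  shows "integral\<^sup>L \<mu> (\<lambda>x. v x ^ 4) \<le> sobolev_const * (integral\<^sup>L \<mu> (\<lambda>x. (G x)\<^sup>2))\<^sup>2"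
proof -
  define m where "m = measure lebesgue D"
  have m: "m > 0" using measure_D_pos by (simp add: m_def)
  have vm: "(\<lambda>x. indicat_real D x * v x) \<in> borel_measurable borel"
    using borel_measurable_continuous_on_indicator[OF _ v(1)] by simp
  have vm': "v \<in> borel_measurable \<mu>" using v(1) by (rule continuous_on_imp_measurable)
  have "integrable \<mu> v" using v(2) by (intro integrable_bounded vm') auto
  hence "integrable lebesgue (\<lambda>x. indicat_real D x * v x)"
    by (subst (asm) integrable_restrict_space) auto
  hence vi: "integrable lborel (\<lambda>x. indicat_real D x * v x)"
    using vm by (subst (asm) integrable_completion) auto
  have "integral\<^sup>L lborel (\<lambda>x. indicat_real D x * v x) = integral\<^sup>L lebesgue (\<lambda>x. indicat_real D x * v x)"
    using vm by (subst integral_completion) auto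
  also have "\<dots> = 0" using mean by (simp add: mean_zero_def integral_restrict_space)
  finally have mean': "integral\<^sup>L lborel (\<lambda>x. indicat_real D x * v x) = 0" .
  have "(\<integral>\<^sup>+x. ennreal ((m * \<bar>v x\<bar>) ^ 4) * indicator D x \<partial>lborel) 
    \<le> ennreal ((4 * diameter D) ^ 4 * 2 ^ CARD('n) * m ^ 3) * (\<integral>\<^sup>+x. ennreal ((G x)\<^sup>2) * indicator D x \<partial>lborel)\<^sup>2"
    unfolding m_def using diameter_bounded_bound[OF D_bounded] diameter_ge_0[OF D_bounded]
    by (intro nn_sobolev_L4 dim G line vm vi mean') (auto simp: dist_norm norm_minus_commute)
  also have "(\<integral>\<^sup>+x. ennreal ((G x)\<^sup>2) * indicator D x \<partial>lborel) = (\<integral>\<^sup>+x. ennreal ((G x)\<^sup>2) \<partial>\<mu>)"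
    using G by (subst nn_integral_mu) auto
  also have "\<dots> = ennreal (integral\<^sup>L \<mu> (\<lambda>x. (G x)\<^sup>2))"
  proof (rule nn_integral_eq_integral)
    have "\<bar>(G x)\<^sup>2\<bar> \<le> B\<^sup>2" for x using power_mono[OF G(3)[of x] G(2)[of x], of 2] by simp
    thus "integrable \<mu> (\<lambda>x. (G x)\<^sup>2)" using G(1) by (intro integrable_bounded[where B = "B\<^sup>2"] measurable_muI) auto
  qed auto
  also have "(\<integral>\<^sup>+x. ennreal ((m * \<bar>v x\<bar>) ^ 4) * indicator D x \<partial>lborel) = (\<integral>\<^sup>+x. ennreal ((m * \<bar>indicat_real D x * v x\<bar>) ^ 4) * indicator D x \<partial>lborel)"
    by (intro nn_integral_cong) (auto simp: indicator_def)
  also have "\<dots> = (\<integral>\<^sup>+x. ennreal ((m * \<bar>indicat_real D x * v x\<bar>) ^ 4) \<partial>\<mu>)"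
    using vm by (subst nn_integral_mu) auto
  also have "\<dots> = (\<integral>\<^sup>+x. ennreal (m ^ 4 * v x ^ 4) \<partial>\<mu>)"
    by (intro nn_integral_cong) (auto simp: power_mult_distrib)
  also have "\<dots> = ennreal (integral\<^sup>L \<mu> (\<lambda>x. m ^ 4 * v x ^ 4))"
  proof (rule nn_integral_eq_integral)
    have "\<bar>v x ^ 4\<bar> \<le> V ^ 4" if "x \<in> D" for x using power_mono[OF v(2)[OF that], of 4] by (simp add: power_abs)
    thus "integrable \<mu> (\<lambda>x. m ^ 4 * v x ^ 4)" using vm' by (intro integrable_mult_right integrable_bounded[where B = "V ^ 4"]) auto
  qed auto
  finally have "ennreal (m ^ 4 * integral\<^sup>L \<mu> (\<lambda>x. v x ^ 4)) \<le> ennreal ((4 * diameter D) ^ 4 * 2 ^ CARD('n) * m ^ 3 * (integral\<^sup>L \<mu> (\<lambda>x. (G x)\<^sup>2))\<^sup>2)"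
    using diameter_ge_0[OF D_bounded] m by (simp add: ennreal_mult ennreal_power)
  hence "m ^ 4 * integral\<^sup>L \<mu> (\<lambda>x. v x ^ 4) \<le> (4 * diameter D) ^ 4 * 2 ^ CARD('n) * m ^ 3 * (integral\<^sup>L \<mu> (\<lambda>x. (G x)\<^sup>2))\<^sup>2"
    using m diameter_ge_0[OF D_bounded] by (subst (asm) ennreal_le_iff) auto
  also have "\<dots> = m ^ 4 * (sobolev_const * (integral\<^sup>L \<mu> (\<lambda>x. (G x)\<^sup>2))\<^sup>2)"
    using m unfolding sobolev_const_def m_def[symmetric] by (simp add: field_simps eval_nat_numeral)
  finally show ?thesis using m by simp
qed

end

section \<open>Finite-dimensional function spaces\<close>

text \<open>Also serves for linear functionals, by taking a form that ignores its second
  argument.\<close>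

lemma bilinear_sum:
  fixes B :: "('a \<Rightarrow> real) \<Rightarrow> ('a \<Rightarrow> real) \<Rightarrow> real"
  assumes lin: "\<And>u v a b. u \<in> V \<Longrightarrow> v \<in> V \<Longrightarrow> (\<lambda>x. a * u x + b * v x) \<in> V"
    and B: "\<And>u v w a b. u \<in> V \<Longrightarrow> v \<in> V \<Longrightarrow> w \<in> V \<Longrightarrow> B (\<lambda>x. a * u x + b * v x) w = a * B u w + b * B v w"
    and V: "\<And>i. i \<in> I \<Longrightarrow> e i \<in> V" "w \<in> V"
  shows "(\<lambda>x. \<Sum>i\<in>I. c i * e i x) \<in> V \<and> B (\<lambda>x. \<Sum>i\<in>I. c i * e i x) w = (\<Sum>i\<in>I. c i * B (e i) w)"
proof -
  have z: "(\<lambda>x. 0) \<in> V \<and> B (\<lambda>x. 0) w = 0"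
    using lin[OF V(2) V(2), of 0 0] B[OF V(2) V(2) V(2), of 0 0] by simp
  show ?thesis
    using V(1)
  proof (induction I rule: infinite_finite_induct)
    case (insert i I)
    have "(\<lambda>x. \<Sum>i\<in>insert i I. c i * e i x) = (\<lambda>x. c i * e i x + 1 * (\<Sum>i\<in>I. c i * e i x))"
      using insert by auto
    moreover have "(\<lambda>x. \<Sum>i\<in>I. c i * e i x) \<in> V" "B (\<lambda>x. \<Sum>i\<in>I. c i * e i x) w = (\<Sum>i\<in>I. c i * B (e i) w)" "e i \<in> V"
      using insert by auto
    ultimately show ?case
      using lin[of "e i" "\<lambda>x. \<Sum>i\<in>I. c i * e i x" "c i" 1] B[of "e i" "\<lambda>x. \<Sum>i\<in>I. c i * e i x" w "c i" 1] insert V(2)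
      by simp
  qed (use z in auto)
qed

(* Gram-Schmidt, one evaluation point at a time: the functions vanishing at s have codimension at most one. *)
lemma finite_orthonormal_basis:
  fixes B :: "('a \<Rightarrow> real) \<Rightarrow> ('a \<Rightarrow> real) \<Rightarrow> real"
  assumes "finite S" and ne: "V \<noteq> {}"
    and lin: "\<And>u v a b. u \<in> V \<Longrightarrow> v \<in> V \<Longrightarrow> (\<lambda>x. a * u x + b * v x) \<in> V"
    and B: "\<And>u v w a b. u \<in> V \<Longrightarrow> v \<in> V \<Longrightarrow> w \<in> V \<Longrightarrow> B (\<lambda>x. a * u x + b * v x) w = a * B u w + b * B v w"
    and sym: "\<And>u v. B u v = B v u"
    and pos: "\<And>v. v \<in> V \<Longrightarrow> v \<noteq> (\<lambda>x. 0) \<Longrightarrow> 0 < B v v"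
    and S: "\<And>v. v \<in> V \<Longrightarrow> (\<forall>s\<in>S. v s = 0) \<Longrightarrow> v = (\<lambda>x. 0)"
  shows "\<exists>(m::nat) e. (\<forall>i<m. e i \<in> V) \<and> (\<forall>i<m. \<forall>j<m. B (e i) (e j) = (if i = j then 1 else 0)) \<and>
    (\<forall>v\<in>V. v = (\<lambda>x. \<Sum>i<m. B v (e i) * e i x))"
  using \<open>finite S\<close> ne lin B pos S
proof (induction S arbitrary: V rule: finite_induct)
  case empty
  thus ?case by (intro exI[of _ 0]) auto
next
  case (insert s S V)
  note ne = insert.prems(1) and lin = insert.prems(2) and B = insert.prems(3) and pos = insert.prems(4) and S = insert.prems(5)
  define V' where "V' = {v \<in> V. v s = 0}"
  obtain v0 where "v0 \<in> V" using ne by auto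
  hence "(\<lambda>x. 0) \<in> V" using lin[of v0 v0 0 0] by simp
  hence "V' \<noteq> {}" by (auto simp: V'_def)
  moreover have "(\<lambda>x. a * u x + b * v x) \<in> V'" if "u \<in> V'" "v \<in> V'" for u v a b
    using that lin by (auto simp: V'_def)
  ultimately have "\<exists>(m::nat) e. (\<forall>i<m. e i \<in> V') \<and> (\<forall>i<m. \<forall>j<m. B (e i) (e j) = (if i = j then 1 else 0)) \<and>
    (\<forall>v\<in>V'. v = (\<lambda>x. \<Sum>i<m. B v (e i) * e i x))"
    using B pos S by (intro insert.IH) (auto simp: V'_def)
  then obtain m :: nat and e where e: "\<And>i. i < m \<Longrightarrow> e i \<in> V'" "\<And>i j. i < m \<Longrightarrow> j < m \<Longrightarrow> B (e i) (e j) = (if i = j then 1 else 0)"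
    "\<And>v. v \<in> V' \<Longrightarrow> v = (\<lambda>x. \<Sum>i<m. B v (e i) * e i x)" by blast
  have eV: "e i \<in> V" if "i < m" for i using e(1)[OF that] by (simp add: V'_def)
  show ?case
  proof (cases "V' = V")
    case True
    thus ?thesis using e by (intro exI[of _ m] exI[of _ e]) auto
  next
    case False
    then obtain v where v: "v \<in> V" "v s \<noteq> 0" by (auto simp: V'_def)
    \<comment> \<open>Every \<open>e i\<close> vanishes at \<open>s\<close>, hence so does the
      projection, and subtracting it leaves the value of \<open>v\<close> at \<open>s\<close>
      nonzero.\<close>
    define p where "p = (\<lambda>x. \<Sum>i<m. B v (e i) * e i x)"
    have sumV: "(\<lambda>x. \<Sum>i<m. c i * e i x) \<in> V \<and> B (\<lambda>x. \<Sum>i<m. c i * e i x) w = (\<Sum>i<m. c i * B (e i) w)"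
      if "w \<in> V" for c w
      by (rule bilinear_sum[OF lin B _ that]) (use eV in auto)
    have p: "p \<in> V" "\<And>w. w \<in> V \<Longrightarrow> B p w = (\<Sum>i<m. B v (e i) * B (e i) w)"
      unfolding p_def by (rule sumV[OF v(1), THEN conjunct1], rule sumV[THEN conjunct2])
    have ps: "p s = 0" using e(1) by (auto simp: p_def V'_def intro!: sum.neutral)
    define w where "w = (\<lambda>x. 1 * v x + (-1) * p x)"
    have w: "w \<in> V" "w s \<noteq> 0" using lin[OF v(1) p(1), of 1 "-1"] ps v by (auto simp: w_def)
    have wnz: "w \<noteq> (\<lambda>x. 0)" using w by auto
    have we: "B w (e i) = 0" if i: "i < m" for i
    proof -
      have "B p (e i) = (\<Sum>j<m. B v (e j) * (if j = i then 1 else 0))"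
        unfolding p(2)[OF eV[OF i]] by (intro sum.cong) (use e(2) i in auto)
      also have "\<dots> = (\<Sum>j<m. if j = i then B v (e j) else 0)" by (intro sum.cong) auto
      also have "\<dots> = B v (e i)" using i by simp
      finally show ?thesis unfolding w_def using B[OF v(1) p(1) eV[OF i], of 1 "-1"] by simp
    qed
    define n where "n = sqrt (B w w)"
    have n: "n > 0" "n * n = B w w" using pos[OF w(1) wnz] by (auto simp: n_def)
    define f where "f = (\<lambda>x. (1 / n) * w x + 0 * w x)"
    have f: "f \<in> V" unfolding f_def by (rule lin[OF w(1) w(1)])
    have fB: "B f u = B w u / n" if "u \<in> V" for u unfolding f_def using B[OF w(1) w(1) that, of "1 / n" 0] by simp
    have ff: "B f f = 1"
    proof -
      have "B f f = B f w / n" using fB[OF f] sym[of w f] by simp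
      also have "\<dots> = B w w / (n * n)" using fB[OF w(1)] by simp
      also have "\<dots> = 1" using n(1) by (simp add: n(2)[symmetric])
      finally show ?thesis .
    qed
    have fe: "B f (e i) = 0" if "i < m" for i using fB[OF eV[OF that]] we[OF that] by simp
    define e' where "e' = e(m := f)"
    have e'V: "e' i \<in> V" if "i < Suc m" for i using that eV f by (auto simp: e'_def less_Suc_eq)
    have e'on: "B (e' i) (e' j) = (if i = j then 1 else 0)" if "i < Suc m" "j < Suc m" for i j
      using that ff fe e(2) sym[of "e i" f] by (auto simp: e'_def less_Suc_eq)
    have span: "u = (\<lambda>x. \<Sum>i<Suc m. B u (e' i) * e' i x)" if u: "u \<in> V" for u
    proof -
      \<comment> \<open>Chosen so that \<open>u - c * w\<close> vanishes at \<open>s\<close> and the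
        induction hypothesis applies to it.\<close>
      define c where "c = u s / w s"
      define u' where "u' = (\<lambda>x. 1 * u x + (- c) * w x)"
      have u'V: "u' \<in> V" unfolding u'_def by (rule lin[OF u w(1)])
      have u': "u' \<in> V'" using u'V w(2) by (auto simp: V'_def u'_def c_def)
      have u'B: "B u' z = B u z - c * B w z" if "z \<in> V" for z
        unfolding u'_def using B[OF u w(1) that, of 1 "- c"] by simp
      have u'f: "B u' f = 0"
      proof -
        have "B u' f = B (\<lambda>x. \<Sum>i<m. B u' (e i) * e i x) f" using e(3)[OF u'] by simp
        also have "\<dots> = (\<Sum>i<m. B u' (e i) * B (e i) f)"
          by (rule sumV[OF f, THEN conjunct2])
        also have "\<dots> = 0" using fe sym by (intro sum.neutral) auto
        finally show ?thesis .
      qed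
      have Bf: "B u f * f x = c * w x" for x
      proof -
        have "B u f = c * B w f" using u'B[OF f] u'f by simp
        also have "B w f = n" using fB[OF w(1)] sym[of w f] n(1) by (simp add: n(2)[symmetric])
        finally show ?thesis using n(1) by (simp add: f_def)
      qed
      have eq: "B u' (e i) = B u (e i)" if "i < m" for i using u'B[OF eV[OF that]] we[OF that] by simp
      show ?thesis
      proof
        fix x
        have "u x = u' x + c * w x" by (simp add: u'_def)
        also have "u' x = (\<Sum>i<m. B u' (e i) * e i x)" using fun_cong[OF e(3)[OF u'], of x] by simp
        also have "\<dots> = (\<Sum>i<m. B u (e i) * e i x)" using eq by simp
        finally show "u x = (\<Sum>i<Suc m. B u (e' i) * e' i x)" using Bf[of x] by (simp add: e'_def)
      qed
    qed
    show ?thesis using e'V e'on span by (intro exI[of _ "Suc m"] exI[of _ e']) blast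
  qed
qed

section \<open>Discrete operators\<close>

context bounded_domain begin

text \<open>Functions of \<open>Sh\<close> vanish off the closure of \<open>D\<close>, so the
  indicator of the closure takes the part of the constant function.\<close>

lemma mean_zero_ip: "mean_zero D u \<longleftrightarrow> ip D u (indicat_real (closure D)) = 0"
proof -
  have "ip D u (indicat_real (closure D)) = integral\<^sup>L \<mu> u"
    unfolding ip_def using closure_subset[of D] by (intro Bochner_Integration.integral_cong) (auto simp: indicator_def)
  thus ?thesis by (simp add: mean_zero_def)
qed

lemma weak_grad_cong:
  assumes "\<And>x. x \<in> D \<Longrightarrow> u x = v x"
  shows "weak_grad D u g \<longleftrightarrow> weak_grad D v g"
proof -
  have "integral\<^sup>L \<mu> (\<lambda>x. u x * pd i \<psi> x) = integral\<^sup>L \<mu> (\<lambda>x. v x * pd i \<psi> x)" for i \<psi>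
    using assms by (intro Bochner_Integration.integral_cong) auto
  thus ?thesis by (simp add: weak_grad_def)
qed

lemma L2_indicator_closure: "indicat_real (closure D) \<in> L2 D"
  by (rule L2_bounded[where B = 1]) (auto intro!: measurable_muI simp: indicator_def)

lemma weak_grad_indicator_closure: "weak_grad D (indicat_real (closure D)) (\<lambda>x. 0)"
proof -
  have "indicat_real (closure D) x = 1" if "x \<in> D" for x using that closure_subset[of D] by auto
  thus ?thesis using weak_grad_const[of 1] weak_grad_cong[of "indicat_real (closure D)" "\<lambda>x. 1"] by blast
qed

lemma gip_indicator_closure: "u \<in> H1 D \<Longrightarrow> gip D u (indicat_real (closure D)) = 0"
proof -
  assume u: "u \<in> H1 D"
  have "indicat_real (closure D) \<in> H1 D" using weak_grad_indicator_closure L2_indicator_closure by (auto simp: H1_def)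
  thus ?thesis
    using gip_eq[OF u, of _ "wgrad D u" "\<lambda>x. 0"] u wgrad_measurable
      wgrad_eq[OF L2_indicator_closure weak_grad_indicator_closure] by simp
qed

end

section \<open>Definiteness and bases of the finite element spaces\<close>

locale fe_mesh3 = fe_mesh D \<T> for D :: "(real^'n::finite) set" and \<T> +
  assumes dim: "CARD('n) \<le> 3"
begin

abbreviation "S \<equiv> Sh D \<T>"

definition S0 :: "(real^'n \<Rightarrow> real) set" where
  "S0 = {v \<in> S. mean_zero D v}"

abbreviation "A \<equiv> Ah D \<T>"
abbreviation "proj \<equiv> Ph D \<T>"

lemma S0_S: "v \<in> S0 \<Longrightarrow> v \<in> S" by (simp add: S0_def)

lemma S_H1: "v \<in> S \<Longrightarrow> v \<in> H1 D" by (rule Sh_gradient(1))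

lemma S_L2: "v \<in> S \<Longrightarrow> v \<in> L2 D" by (rule Sh_L2)

lemma S0_lincomb: "u \<in> S0 \<Longrightarrow> v \<in> S0 \<Longrightarrow> (\<lambda>x. a * u x + b * v x) \<in> S0"
  unfolding S0_def mean_zero_ip by (auto simp: Sh_lincomb ip_lincomb[OF S_L2 S_L2 L2_indicator_closure])

text \<open>Continuity removes null sets in \<open>D\<close> and extends the result to the closure;
  outside, the values are zero by convention. Equality at every point is needed because
  \<open>Ph\<close> and \<open>Ah\<close> rest on unique existence of a function, not of a
  class.\<close>

lemma Sh_AE_zero_imp_zero:
  assumes "v \<in> S" "AE x in \<mu>. v x = 0"
  shows "v = (\<lambda>x. 0)"
proof -
  have cont: "continuous_on D v" using Sh_continuous[OF assms(1)] closure_subset continuous_on_subset by blast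
  have zD: "v x = 0" if "x \<in> D" for x
  proof (rule ccontr)
    assume "v x \<noteq> 0"
    define U where "U = D \<inter> v -` (- {0})"
    have "open U" unfolding U_def using cont D_open by (intro continuous_open_preimage) auto
    moreover have "U \<noteq> {}" using \<open>v x \<noteq> 0\<close> that by (auto simp: U_def)
    ultimately have "\<not> negligible U" using open_not_negligible by blast
    moreover have "AE x in lebesgue. x \<notin> U"
      using assms(2) by (auto simp: AE_restrict_space_iff U_def elim!: eventually_mono)
    hence "U \<in> null_sets lebesgue" using \<open>open U\<close> by (subst AE_iff_null_sets) auto
    ultimately show False by (simp add: negligible_iff_null_sets)
  qed
  have "v x = 0" for x
  proof (cases "x \<in> closure D")
    case True
    from continuous_constant_on_closure[OF Sh_continuous[OF assms(1)] zD True] show ?thesis .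
  qed (use assms Sh_outside in auto)
  thus ?thesis by auto
qed

lemma Sh_power_integrable: "v \<in> S \<Longrightarrow> integrable \<mu> (\<lambda>x. v x ^ n)"
proof -
  assume v: "v \<in> S"
  then obtain B where B: "B \<ge> 0" "\<And>x. \<bar>v x\<bar> \<le> B" using Sh_bounded by blast
  have "\<bar>v x ^ n\<bar> \<le> B ^ n" for x using power_mono[OF B(2), of x n] by (simp add: power_abs)
  thus ?thesis using Sh_measurable[OF v] by (intro integrable_bounded[where B = "B ^ n"]) auto
qed

lemma Sh_ip_pos: "v \<in> S \<Longrightarrow> v \<noteq> (\<lambda>x. 0) \<Longrightarrow> 0 < ip D v v"
proof (rule ccontr)
  assume v: "v \<in> S" "v \<noteq> (\<lambda>x. 0)" "\<not> 0 < ip D v v"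
  hence "ip D v v = 0" using ip_self_nonneg[of D v] by linarith
  hence "integral\<^sup>L \<mu> (\<lambda>x. (v x)\<^sup>2) = 0" by (simp add: ip_def power2_eq_square)
  hence "AE x in \<mu>. (v x)\<^sup>2 = 0" using Sh_power_integrable[OF v(1)] by (subst (asm) integral_nonneg_eq_0_iff_AE) auto
  hence "AE x in \<mu>. v x = 0" by simp
  thus False using Sh_AE_zero_imp_zero v by blast
qed

lemma Sh_sobolev:
  assumes "v \<in> S0"
  shows "integral\<^sup>L \<mu> (\<lambda>x. v x ^ 4) \<le> sobolev_const * (gip D v v)\<^sup>2"
proof -
  have v: "v \<in> S" "mean_zero D v" using assms by (auto simp: S0_def)
  obtain G B where G: "G \<in> borel_measurable borel" "\<And>x. 0 \<le> G x \<and> G x \<le> B" "gip D v v = integral\<^sup>L \<mu> (\<lambda>x. (G x)\<^sup>2)"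
      "\<forall>x\<in>closure D. \<forall>y\<in>closure D. ennreal \<bar>v y - v x\<bar> \<le> 
        (\<integral>\<^sup>+s. ennreal (4 * s ^ 3 * norm (y - x) * G (x + s ^ 4 *\<^sub>R (y - x))) * indicator {0..1} s \<partial>lborel)"
    using Sh_gradient(2)[OF v(1)] by blast
  obtain V where V: "\<And>x. \<bar>v x\<bar> \<le> V" using Sh_bounded[OF v(1)] by blast
  show ?thesis unfolding G(3)
  proof (rule sobolev_L4[OF dim G(1)])
    show "continuous_on D v" using Sh_continuous[OF v(1)] closure_subset continuous_on_subset by blast
    fix x y assume "x \<in> D" "y \<in> D"
    hence "x \<in> closure D" "y \<in> closure D" using closure_subset by auto
    thus "ennreal \<bar>v y - v x\<bar> \<le> 
        (\<integral>\<^sup>+s. ennreal (4 * s ^ 3 * norm (y - x) * G (x + s ^ 4 *\<^sub>R (y - x))) * indicator {0..1} s \<partial>lborel)"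
      using G(4) by blast
  qed (use G V v in auto)
qed

text \<open>A zero gradient forces the \<open>L4\<close> norm to vanish: the Sobolev inequality
  takes the place of the Poincare inequality.\<close>

lemma S0_gip_pos: "v \<in> S0 \<Longrightarrow> v \<noteq> (\<lambda>x. 0) \<Longrightarrow> 0 < gip D v v"
proof (rule ccontr)
  assume v: "v \<in> S0" "v \<noteq> (\<lambda>x. 0)" "\<not> 0 < gip D v v"
  hence "gip D v v = 0" using gip_self_nonneg[of v] by simp
  hence "integral\<^sup>L \<mu> (\<lambda>x. v x ^ 4) \<le> 0" using Sh_sobolev[OF v(1)] by simp
  moreover have "0 \<le> integral\<^sup>L \<mu> (\<lambda>x. v x ^ 4)" by simp
  ultimately have "integral\<^sup>L \<mu> (\<lambda>x. v x ^ 4) = 0" by linarith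
  hence "AE x in \<mu>. v x ^ 4 = 0" using Sh_power_integrable[OF S0_S[OF v(1)]]
    by (subst (asm) integral_nonneg_eq_0_iff_AE) auto
  hence "AE x in \<mu>. v x = 0" by simp
  thus False using Sh_AE_zero_imp_zero[OF S0_S[OF v(1)]] v by blast
qed

text \<open>An affine function that vanishes at the vertices vanishes on their convex hull. The
  vertices are the finite point set on which the basis construction operates.\<close>

lemma Sh_nodes: "\<exists>N. finite N \<and> (\<forall>v\<in>S. (\<forall>s\<in>N. v s = 0) \<longrightarrow> v = (\<lambda>x. 0))"
proof -
  obtain V where V: "\<And>K. K \<in> \<T> \<Longrightarrow> finite (V K) \<and> K = convex hull V K" using mesh_hull by metis
  show ?thesis
  proof (intro exI[of _ "\<Union>K\<in>\<T>. V K"] conjI ballI impI)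
    show "finite (\<Union>K\<in>\<T>. V K)" using mesh_finite V by auto
    fix v assume v: "v \<in> S" and z: "\<forall>s\<in>\<Union>K\<in>\<T>. V K. v s = 0"
    obtain a b where a: "\<And>K x. K \<in> \<T> \<Longrightarrow> x \<in> K \<Longrightarrow> v x = a K \<bullet> x + b K" using Sh_affine[OF v] by metis
    have "v x = 0" if "x \<in> K" "K \<in> \<T>" for x K
    proof -
      have "V K \<subseteq> {x. a K \<bullet> x = - b K}"
      proof
        fix s assume s: "s \<in> V K"
        hence "s \<in> K" using V[OF that(2)] hull_inc[of s "V K" convex] by simp
        moreover have "v s = 0" using z s that by blast
        ultimately have "a K \<bullet> s + b K = 0" using a[OF that(2)] by force
        thus "s \<in> {x. a K \<bullet> x = - b K}" by simp
      qed
      hence "convex hull V K \<subseteq> {x. a K \<bullet> x = - b K}" by (rule hull_minimal) (rule convex_hyperplane)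
      hence "x \<in> {x. a K \<bullet> x = - b K}" using that V[OF that(2)] by blast
      thus ?thesis using a[OF that(2,1)] by simp
    qed
    thus "v = (\<lambda>x. 0)" using mesh_cover Sh_outside[OF v] by (metis UnionE)
  qed
qed

lemma S_basis: "\<exists>(m::nat) e. (\<forall>i<m. e i \<in> S) \<and> (\<forall>i<m. \<forall>j<m. ip D (e i) (e j) = (if i = j then 1 else 0)) \<and>
    (\<forall>v\<in>S. v = (\<lambda>x. \<Sum>i<m. ip D v (e i) * e i x))"
proof -
  obtain N where "finite N" "\<forall>v\<in>S. (\<forall>s\<in>N. v s = 0) \<longrightarrow> v = (\<lambda>x. 0)" using Sh_nodes by blast
  thus ?thesis
    by (intro finite_orthonormal_basis[of N]) (use Sh_indicator in \<open>auto intro: Sh_lincomb ip_lincomb S_L2 ip_commute Sh_ip_pos\<close>)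
qed

text \<open>Orthonormal in the gradient product, because \<open>A\<close> is inverted in this
  product and the projected noise is measured in its norm.\<close>

lemma S0_basis: "\<exists>(m::nat) e. (\<forall>i<m. e i \<in> S0) \<and> (\<forall>i<m. \<forall>j<m. gip D (e i) (e j) = (if i = j then 1 else 0)) \<and>
    (\<forall>v\<in>S0. v = (\<lambda>x. \<Sum>i<m. gip D v (e i) * e i x))"
proof -
  obtain N where "finite N" "\<forall>v\<in>S. (\<forall>s\<in>N. v s = 0) \<longrightarrow> v = (\<lambda>x. 0)" using Sh_nodes by blast
  moreover have "(\<lambda>x. 0 * indicat_real (closure D) x + 0 * indicat_real (closure D) x) \<in> S0"
    unfolding S0_def using Sh_lincomb[OF Sh_indicator Sh_indicator, of 0 0] by (simp add: mean_zero_def)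
  ultimately show ?thesis
    by (intro finite_orthonormal_basis[of N]) (auto intro: S0_lincomb gip_lincomb S_H1 S0_S gip_commute S0_gip_pos)
qed

section \<open>Projector, discrete Laplacian and its inverse\<close>

lemma S_zero: "(\<lambda>x. 0) \<in> S"
  using Sh_lincomb[OF Sh_indicator Sh_indicator, of 0 0] by simp

lemma S_sum: "(\<And>i. i \<in> I \<Longrightarrow> e i \<in> S) \<Longrightarrow> (\<lambda>x. \<Sum>i\<in>I. c i * e i x) \<in> S"
proof (induction I rule: infinite_finite_induct)
  case (insert i I)
  thus ?case using Sh_lincomb[of "e i" "\<lambda>x. \<Sum>i\<in>I. c i * e i x" "c i" 1] by auto
qed (auto intro: S_zero)

lemma S_diff: "u \<in> S \<Longrightarrow> v \<in> S \<Longrightarrow> (\<lambda>x. u x - v x) \<in> S"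
  using Sh_lincomb[of u v 1 "-1"] by simp

lemma S_add: "u \<in> S \<Longrightarrow> v \<in> S \<Longrightarrow> (\<lambda>x. u x + v x) \<in> S"
  using Sh_lincomb[of u v 1 1] by simp

lemma S_eqI:
  assumes "u \<in> S" "v \<in> S" "\<And>z. z \<in> S \<Longrightarrow> ip D u z = ip D v z"
  shows "u = v"
proof -
  have d: "(\<lambda>x. u x - v x) \<in> S" using assms by (intro S_diff)
  have "ip D (\<lambda>x. u x - v x) (\<lambda>x. u x - v x) = 0"
    using assms(3)[OF d] assms(1,2) d by (subst ip_diff) (auto intro: S_L2)
  hence "(\<lambda>x. u x - v x) = (\<lambda>x. 0)" using Sh_ip_pos[OF d] by fastforce
  thus ?thesis by (auto simp: fun_eq_iff)
qed

text \<open>The representer has the values of \<open>l\<close> as coefficients in an orthonormal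
  basis. This justifies the definite descriptions in \<open>Ph\<close> and
  \<open>Ah\<close>.\<close>

lemma riesz:
  assumes "\<And>u v a b. u \<in> S \<Longrightarrow> v \<in> S \<Longrightarrow> l (\<lambda>x. a * u x + b * v x) = a * l u + b * l v"
  shows "\<exists>!w. w \<in> S \<and> (\<forall>z\<in>S. ip D w z = l z)"
proof -
  obtain m :: nat and e where e': "\<forall>i<m. e i \<in> S" "\<forall>i<m. \<forall>j<m. ip D (e i) (e j) = (if i = j then 1 else 0)" 
    "\<forall>v\<in>S. v = (\<lambda>x. \<Sum>i<m. ip D v (e i) * e i x)" using S_basis by (elim exE conjE)
  note e = e'(1)[rule_format] e'(2) e'(3)[rule_format]
  define w where "w = (\<lambda>x. \<Sum>i<m. l (e i) * e i x)"
  have w: "w \<in> S" unfolding w_def using e(1) by (intro S_sum) auto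
  have "ip D w z = l z" if z: "z \<in> S" for z
  proof -
    have "ip D w z = (\<Sum>i<m. l (e i) * ip D (e i) z)"
      unfolding w_def using e(1) z by (intro ip_sum) (auto intro: S_L2)
    also have "\<dots> = (\<Sum>i<m. ip D z (e i) * l (e i))" by (simp add: ip_commute[of D z] mult.commute)
    also have "\<dots> = l (\<lambda>x. \<Sum>i<m. ip D z (e i) * e i x)"
      by (rule bilinear_sum[where V = S and B = "\<lambda>u w. l u" and w = z, THEN conjunct2, symmetric])
        (simp_all add: Sh_lincomb assms e(1) z)
    also have "(\<lambda>x. \<Sum>i<m. ip D z (e i) * e i x) = z" using e(3)[OF z] by simp
    finally show ?thesis .
  qed
  thus ?thesis using w S_eqI by (intro ex1I[of _ w]) auto
qed

lemma Ph:
  assumes "u \<in> L2 D"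
  shows Ph_S: "proj u \<in> S" and ip_Ph: "\<And>z. z \<in> S \<Longrightarrow> ip D (proj u) z = ip D u z"
proof -
  have eq: "(w \<in> S \<and> (\<forall>z\<in>S. ip D (\<lambda>x. u x - w x) z = 0)) \<longleftrightarrow> (w \<in> S \<and> (\<forall>z\<in>S. ip D w z = ip D u z))" for w
    using assms by (auto simp: ip_diff S_L2)
  have "\<exists>!w. w \<in> S \<and> (\<forall>z\<in>S. ip D w z = ip D u z)"
    using riesz[of "\<lambda>z. ip D u z"] assms by (simp add: ip_commute[of D u] ip_lincomb S_L2)
  from theI'[OF this] show "proj u \<in> S" "\<And>z. z \<in> S \<Longrightarrow> ip D (proj u) z = ip D u z"
    unfolding Ph_def eq by auto
qed

lemma Ah:
  assumes "v \<in> S"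
  shows Ah_S: "A v \<in> S" and ip_Ah: "\<And>z. z \<in> S \<Longrightarrow> ip D (A v) z = gip D v z"
proof -
  have "\<exists>!w. w \<in> S \<and> (\<forall>z\<in>S. ip D w z = gip D v z)"
    using riesz[of "\<lambda>z. gip D v z"] assms by (simp add: gip_commute[of v] gip_lincomb S_H1)
  from theI'[OF this] show "A v \<in> S" "\<And>z. z \<in> S \<Longrightarrow> ip D (A v) z = gip D v z"
    unfolding Ah_def by auto
qed

lemma Ph_S0: "u \<in> L2 D \<Longrightarrow> mean_zero D u \<Longrightarrow> proj u \<in> S0"
  by (simp add: S0_def mean_zero_ip Ph_S ip_Ph Sh_indicator)

lemma gip_ip: "v \<in> S \<Longrightarrow> z \<in> S \<Longrightarrow> gip D z v = ip D z (A v)"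
  using ip_Ah[of v z] gip_commute ip_commute by metis

text \<open>In the gradient-orthonormal basis the coefficients solve the equation for test functions
  of mean zero. It extends to all test functions because both sides vanish on constants.\<close>

lemma Ah_inv_exists:
  assumes v: "v \<in> S0"
  obtains w where "w \<in> S0" "A w = v"
proof -
  obtain m :: nat and g where g': "\<forall>i<m. g i \<in> S0" "\<forall>i<m. \<forall>j<m. gip D (g i) (g j) = (if i = j then 1 else 0)" 
    "\<forall>v\<in>S0. v = (\<lambda>x. \<Sum>i<m. gip D v (g i) * g i x)" using S0_basis by (elim exE conjE)
  note g = g'(1)[rule_format] g'(2) g'(3)[rule_format]
  define w where "w = (\<lambda>x. \<Sum>i<m. ip D v (g i) * g i x)"
  have sumS0: "(\<lambda>x. \<Sum>i<m. c i * g i x) \<in> S0 \<and> gip D (\<lambda>x. \<Sum>i<m. c i * g i x) z = (\<Sum>i<m. c i * gip D (g i) z)" if "z \<in> S0" for c z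
    using g(1) that by (intro bilinear_sum S0_lincomb gip_lincomb) (auto intro: S_H1 S0_S)
  have w: "w \<in> S0" unfolding w_def by (rule sumS0[OF v, THEN conjunct1])
  have gw: "gip D w z = ip D v z" if z: "z \<in> S0" for z
  proof -
    have "gip D w z = (\<Sum>i<m. ip D v (g i) * gip D (g i) z)" unfolding w_def by (rule sumS0[OF z, THEN conjunct2])
    also have "\<dots> = (\<Sum>i<m. gip D z (g i) * ip D (g i) v)" by (simp add: gip_commute[of z] ip_commute[of D v] mult.commute)
    also have "\<dots> = ip D (\<lambda>x. \<Sum>i<m. gip D z (g i) * g i x) v"
      using g(1) v by (intro ip_sum[symmetric]) (auto intro: S_L2 S0_S)
    also have "(\<lambda>x. \<Sum>i<m. gip D z (g i) * g i x) = z" using g(3)[OF z] by simp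
    finally show ?thesis by (simp add: ip_commute)
  qed
  have "ip D (A w) z = ip D v z" if z: "z \<in> S" for z
  proof -
    let ?o = "indicat_real (closure D)"
    \<comment> \<open>The mean of \<open>z\<close>, expressed through the indicator.\<close>
    define c where "c = ip D z ?o / ip D ?o ?o"
    have o: "0 < ip D ?o ?o"
    proof (rule Sh_ip_pos[OF Sh_indicator])
      obtain x where "x \<in> D" using D_nonempty by auto
      hence "?o x \<noteq> 0" using closure_subset[of D] by (auto simp: indicator_def)
      thus "?o \<noteq> (\<lambda>x. 0)" by metis
    qed
    define z' where "z' = (\<lambda>x. 1 * z x + (- c) * ?o x)"
    have z'S: "z' \<in> S" unfolding z'_def by (intro Sh_lincomb z Sh_indicator)
    have "ip D z' ?o = ip D z ?o - c * ip D ?o ?o"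
      unfolding z'_def using ip_lincomb[OF S_L2[OF z] L2_indicator_closure L2_indicator_closure, of 1 "- c"] by simp
    also have "\<dots> = 0" using o by (simp add: c_def)
    finally have z': "z' \<in> S0" using z'S by (simp add: S0_def mean_zero_ip)
    have vo: "ip D v ?o = 0" using v by (simp add: S0_def mean_zero_ip)
    have zz: "z = (\<lambda>x. 1 * z' x + c * ?o x)" by (auto simp: z'_def)
    have "ip D z v = ip D z' v + c * ip D ?o v"
      using ip_lincomb[OF S_L2[OF z'S] L2_indicator_closure S_L2[OF S0_S[OF v]], of 1 c] zz by simp
    hence 1: "ip D v z = ip D v z'" using vo by (simp add: ip_commute)
    have "gip D z w = gip D z' w + c * gip D ?o w"
      using gip_lincomb[OF S_H1[OF z'S] S_H1[OF Sh_indicator] S_H1[OF S0_S[OF w]], of 1 c] zz by simp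
    hence 2: "gip D w z = gip D w z'" using gip_indicator_closure[OF S_H1[OF S0_S[OF w]]] by (simp add: gip_commute)
    show ?thesis using 1 2 gw[OF z'] ip_Ah[OF S0_S[OF w] z] by simp
  qed
  hence "A w = v" using S_eqI[OF Ah_S[OF S0_S[OF w]] S0_S[OF v]] by blast
  thus thesis using that w by blast
qed

lemma Ah_inj_S0:
  assumes "u \<in> S0" "v \<in> S0" "A u = A v"
  shows "u = v"
proof -
  have d: "(\<lambda>x. 1 * u x + (-1) * v x) \<in> S0" by (intro S0_lincomb assms)
  have "gip D (\<lambda>x. 1 * u x + (-1) * v x) z = 0" if "z \<in> S" for z
    using gip_lincomb[of u v z 1 "-1"] ip_Ah[of u z] ip_Ah[of v z] assms that by (simp add: S_H1 S0_S)
  hence "gip D (\<lambda>x. 1 * u x + (-1) * v x) (\<lambda>x. 1 * u x + (-1) * v x) = 0" using S0_S[OF d] by blast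
  hence "(\<lambda>x. 1 * u x + (-1) * v x) = (\<lambda>x. 0)" using S0_gip_pos[OF d] by fastforce
  thus ?thesis by (auto simp: fun_eq_iff)
qed

lemma Ah_inv:
  assumes "v \<in> S0"
  shows "Ah_inv D \<T> v \<in> S0" "A (Ah_inv D \<T> v) = v"
proof -
  have "\<exists>!w. w \<in> S0 \<and> A w = v"   proof -
    obtain w where w: "w \<in> S0" "A w = v" by (rule Ah_inv_exists[OF assms])
    show ?thesis by (rule ex1I[of _ w]) (use w Ah_inj_S0 in auto)
  qed
  from theI'[OF this] show "Ah_inv D \<T> v \<in> S0" "A (Ah_inv D \<T> v) = v"
    unfolding Ah_inv_def S0_def by (auto simp: conj_assoc)
qed

text \<open>With \<open>w\<close> the inverse image of \<open>v\<close> under \<open>A\<close>, the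
  radicand is \<open>gip D w w\<close>. This lets the bound on the sum of the initial quantities
  control the initial energy from above.\<close>

lemma dnorm_m1_nonneg: "v \<in> S0 \<Longrightarrow> 0 \<le> dnorm_m1 D \<T> v"
proof -
  assume v: "v \<in> S0"
  let ?w = "Ah_inv D \<T> v"
  have "ip D ?w v = gip D ?w ?w"
    using ip_Ah[OF S0_S[OF Ah_inv(1)[OF v]] S0_S[OF Ah_inv(1)[OF v]]] Ah_inv(2)[OF v] by (simp add: ip_commute)
  thus ?thesis by (simp add: dnorm_m1_def gip_self_nonneg)
qed

end

section \<open>Quartic potentials\<close>

lemma young: "0 < \<epsilon> \<Longrightarrow> x * y \<le> \<epsilon> * x\<^sup>2 + y\<^sup>2 / (4 * \<epsilon>)" for x y \<epsilon> :: real
proof -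
  assume e: "0 < \<epsilon>"
  have "0 \<le> (2 * \<epsilon> * x - y)\<^sup>2 / (4 * \<epsilon>)" using e by simp
  also have "\<dots> = \<epsilon> * x\<^sup>2 - x * y + y\<^sup>2 / (4 * \<epsilon>)"
    using e by (simp add: power2_eq_square field_simps)
  finally show ?thesis by simp
qed

locale quartic =
  fixes F :: "real poly"
  assumes deg: "degree F = 4" and lead: "lead_coeff F > 0"
begin

abbreviation "f \<equiv> poly (pderiv F)"

definition "a0 = coeff F 0"
definition "a1 = coeff F 1"
definition "a2 = coeff F 2"
definition "a3 = coeff F 3"
definition "a4 = coeff F 4"

lemma a4_pos: "a4 > 0"
  using lead by (simp add: a4_def deg)

lemma F_eq: "poly F s = a4 * s ^ 4 + a3 * s ^ 3 + a2 * s\<^sup>2 + a1 * s + a0"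
  by (simp add: poly_altdef deg a0_def a1_def a2_def a3_def a4_def eval_nat_numeral atMost_Suc algebra_simps)

lemma f_eq: "f s = 4 * a4 * s ^ 3 + 3 * a3 * s\<^sup>2 + 2 * a2 * s + a1"
  by (simp add: poly_altdef degree_pderiv deg coeff_pderiv a1_def a2_def a3_def a4_def eval_nat_numeral atMost_Suc algebra_simps)

lemma F_lower: "\<exists>c\<ge>0. \<forall>s. a4 / 2 * s ^ 4 - c \<le> poly F s"
proof -
  \<comment> \<open>The coefficient of \<open>s^2\<close> to be absorbed: contributions of the
    quadratic term, of the Young remainder of the cubic term and of the linear term.\<close>
  define M where "M = \<bar>a2\<bar> + 2 * a3\<^sup>2 / a4 + 1"
  have "a4 / 2 * s ^ 4 - (2 * M\<^sup>2 / a4 + a1\<^sup>2 + \<bar>a0\<bar>) \<le> poly F s" for s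
  proof -
    have 1: "s\<^sup>2 * (- (a3 * s)) \<le> a4 / 8 * (s\<^sup>2)\<^sup>2 + (- (a3 * s))\<^sup>2 / (4 * (a4 / 8))" by (rule young) (use a4_pos in simp)
    have 2: "s\<^sup>2 * M \<le> a4 / 8 * (s\<^sup>2)\<^sup>2 + M\<^sup>2 / (4 * (a4 / 8))" by (rule young) (use a4_pos in simp)
    have 3: "s * (- a1) \<le> 1 * s\<^sup>2 + (- a1)\<^sup>2 / (4 * 1)" by (rule young) simp
    have 4: "- (a2 * s\<^sup>2) \<le> \<bar>a2\<bar> * s\<^sup>2" by (metis abs_ge_minus_self minus_mult_left mult_right_mono zero_le_power2)
    have e1: "(- (a3 * s))\<^sup>2 / (4 * (a4 / 8)) = (2 * a3\<^sup>2 / a4) * s\<^sup>2" by (simp add: power_mult_distrib)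
    have e2: "M\<^sup>2 / (4 * (a4 / 8)) = 2 * M\<^sup>2 / a4" by simp
    have e3: "s\<^sup>2 * M = \<bar>a2\<bar> * s\<^sup>2 + (2 * a3\<^sup>2 / a4) * s\<^sup>2 + s\<^sup>2" by (simp add: M_def algebra_simps)
    have e4: "(s\<^sup>2)\<^sup>2 = s ^ 4" by (simp add: power_mult[symmetric])
    have e5: "s\<^sup>2 * (- (a3 * s)) = - (a3 * s ^ 3)" by (simp add: power2_eq_square power3_eq_cube)
    have 5: "0 \<le> a4 * s ^ 4" using a4_pos by simp
    have 6: "0 \<le> a1\<^sup>2" "- \<bar>a0\<bar> \<le> a0" by simp_all
    have e6: "s * (- a1) = - (a1 * s)" "1 * s\<^sup>2 + (- a1)\<^sup>2 / (4 * 1) = s\<^sup>2 + a1\<^sup>2 / 4" by simp_all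
    show ?thesis unfolding F_eq using 1 2 3 4 5 6 unfolding e1 e2 e3 e4 e5 e6 by linarith
  qed
  moreover have "0 \<le> 2 * M\<^sup>2 / a4 + a1\<^sup>2 + \<bar>a0\<bar>" using a4_pos by simp
  ultimately show ?thesis by blast
qed

lemma f_growth: "\<exists>c\<ge>0. \<forall>s. \<bar>f s\<bar> \<le> c * (1 + \<bar>s\<bar> ^ 3)"
proof (intro exI conjI allI)
  let ?c = "4 * a4 + 3 * \<bar>a3\<bar> + 2 * \<bar>a2\<bar> + \<bar>a1\<bar>"
  show "0 \<le> ?c" using a4_pos by simp
  fix s :: real
  have 1: "s\<^sup>2 \<le> 1 + \<bar>s\<bar> ^ 3" 
  proof (cases "\<bar>s\<bar> \<le> 1")
    case True
    hence "s\<^sup>2 \<le> 1" by (simp add: abs_square_le_1)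
    moreover have "0 \<le> \<bar>s\<bar> ^ 3" by simp
    ultimately show ?thesis by linarith
  next
    case False
    hence "\<bar>s\<bar>\<^sup>2 \<le> \<bar>s\<bar> ^ 3" by (intro power_increasing) auto
    thus ?thesis by simp
  qed
  have 2: "\<bar>s\<bar> \<le> 1 + \<bar>s\<bar> ^ 3"
  proof (cases "\<bar>s\<bar> \<le> 1")
    case False
    hence "\<bar>s\<bar> ^ 1 \<le> \<bar>s\<bar> ^ 3" by (intro power_increasing) auto
    thus ?thesis by simp
  next
    case True
    moreover have "0 \<le> \<bar>s\<bar> ^ 3" by simp
    ultimately show ?thesis by linarith
  qed
  have "\<bar>f s\<bar> \<le> \<bar>4 * a4 * s ^ 3\<bar> + \<bar>3 * a3 * s\<^sup>2\<bar> + \<bar>2 * a2 * s\<bar> + \<bar>a1\<bar>" unfolding f_eq by linarith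
  also have "\<dots> = 4 * a4 * \<bar>s\<bar> ^ 3 + 3 * \<bar>a3\<bar> * s\<^sup>2 + 2 * \<bar>a2\<bar> * \<bar>s\<bar> + \<bar>a1\<bar> * 1"
    using a4_pos by (simp add: abs_mult power_abs)
  also have "\<dots> \<le> 4 * a4 * (1 + \<bar>s\<bar> ^ 3) + 3 * \<bar>a3\<bar> * (1 + \<bar>s\<bar> ^ 3) + 2 * \<bar>a2\<bar> * (1 + \<bar>s\<bar> ^ 3) + \<bar>a1\<bar> * (1 + \<bar>s\<bar> ^ 3)"
    using a4_pos 1 2 by (intro add_mono mult_left_mono) auto
  finally show "\<bar>f s\<bar> \<le> ?c * (1 + \<bar>s\<bar> ^ 3)" by (simp add: algebra_simps)
qed

text \<open>The product factors as \<open>(a - b)^2\<close> times a quadratic polynomial in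
  \<open>a\<close> and \<open>b\<close> whose leading form is positive definite, hence bounded
  below.\<close>

lemma f_semimonotone: "\<exists>\<beta>\<ge>0. \<forall>a b. - \<beta> * (a - b)\<^sup>2 \<le> (f a - f b) * (a - b)"
proof (intro exI conjI allI)
  let ?\<beta> = "9 * a3\<^sup>2 / (4 * a4) + 2 * \<bar>a2\<bar>"
  show "0 \<le> ?\<beta>" using a4_pos by simp
  fix a b :: real
  define r where "r = 4 * a4 * (a\<^sup>2 + a * b + b\<^sup>2) + 3 * a3 * (a + b) + 2 * a2"
  have eq: "(f a - f b) * (a - b) = (a - b)\<^sup>2 * r"
    unfolding f_eq r_def by (simp add: power2_eq_square power3_eq_cube algebra_simps)
  have 1: "a * (- (3 * a3)) \<le> (2 * a4) * a\<^sup>2 + (- (3 * a3))\<^sup>2 / (4 * (2 * a4))" by (rule young) (use a4_pos in simp)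
  have 2: "b * (- (3 * a3)) \<le> (2 * a4) * b\<^sup>2 + (- (3 * a3))\<^sup>2 / (4 * (2 * a4))" by (rule young) (use a4_pos in simp)
  have e: "(- (3 * a3))\<^sup>2 / (4 * (2 * a4)) = 9 * a3\<^sup>2 / (4 * a4) / 2" by (simp add: power2_eq_square)
  have "0 \<le> 2 * a4 * (a + b)\<^sup>2" using a4_pos by simp
  hence 3: "2 * a4 * (a\<^sup>2 + b\<^sup>2) \<le> 4 * a4 * (a\<^sup>2 + a * b + b\<^sup>2)" by (simp add: power2_eq_square algebra_simps)
  have "- ?\<beta> \<le> r" unfolding r_def using 1 2 3 unfolding e by (simp add: algebra_simps)
  hence "(a - b)\<^sup>2 * (- ?\<beta>) \<le> (a - b)\<^sup>2 * r" by (intro mult_left_mono) auto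
  thus "- ?\<beta> * (a - b)\<^sup>2 \<le> (f a - f b) * (a - b)" unfolding eq by (simp add: mult.commute)
qed

(* The convexity surplus of the quartic term, of order (a^2 + b^2) (a - b)^2, absorbs the cubic growth of f a - f b. *)
lemma energy_pointwise:
  "\<exists>c\<ge>0. \<forall>a b w. poly F a - poly F b - f a * (a - b) + w * (f a - f b) \<le> c * ((a - b)\<^sup>2 + w\<^sup>2 + w\<^sup>2 * b\<^sup>2 + w ^ 4)"
proof -
  define K1 where "K1 = 5 * a3\<^sup>2 / a4 + \<bar>a2\<bar>"
  define K2 where "K2 = 3 * (6 * a4 + 3 * \<bar>a3\<bar> + 2 * \<bar>a2\<bar>)"
  \<comment> \<open>Makes the remainder of the second Young inequality below exactly
    \<open>d^2 * (M * w^2)\<close>, to which Young's inequality is applied once more.\<close>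
  define M where "M = 8 * K2\<^sup>2 / a4"
  define C where "C = K1 + 1 + K2\<^sup>2 + 2 * K2\<^sup>2 / a4 + 8 / a4 * M\<^sup>2"
  have nn: "0 \<le> K1" "0 \<le> K2" "0 \<le> M" using a4_pos by (auto simp: K1_def K2_def M_def)
  have nnC: "K1 + 1 \<le> C" "K2\<^sup>2 \<le> C" "2 * K2\<^sup>2 / a4 \<le> C" "8 / a4 * M\<^sup>2 \<le> C"
  proof -
    have *: "0 \<le> K2\<^sup>2" "0 \<le> 2 * K2\<^sup>2 / a4" "0 \<le> 8 / a4 * M\<^sup>2" using a4_pos by auto
    show "K1 + 1 \<le> C" "K2\<^sup>2 \<le> C" "2 * K2\<^sup>2 / a4 \<le> C" "8 / a4 * M\<^sup>2 \<le> C" unfolding C_def using * nn by linarith+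
  qed
  have "poly F a - poly F b - f a * (a - b) + w * (f a - f b) \<le> C * ((a - b)\<^sup>2 + w\<^sup>2 + w\<^sup>2 * b\<^sup>2 + w ^ 4)" for a b w
  proof -
    define d where "d = a - b"
    \<comment> \<open>The Taylor remainder of \<open>F\<close> is \<open>- d^2 * q\<close> and the
      difference of \<open>f\<close> is \<open>d * r\<close>; \<open>q\<close> has a quadratic lower
      bound, \<open>r\<close> a quadratic upper bound.\<close>
    define q where "q = a4 * (3 * a\<^sup>2 + 2 * a * b + b\<^sup>2) + a3 * (2 * a + b) + a2"
    define r where "r = 4 * a4 * (a\<^sup>2 + a * b + b\<^sup>2) + 3 * a3 * (a + b) + 2 * a2"
    have eq1: "poly F a - poly F b - f a * (a - b) = - (d\<^sup>2 * q)"
      unfolding F_eq f_eq q_def d_def by (simp add: eval_nat_numeral algebra_simps)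
    have eq2: "f a - f b = d * r"
      unfolding f_eq r_def d_def by (simp add: power2_eq_square power3_eq_cube algebra_simps)
    have q: "a4 / 4 * (a\<^sup>2 + b\<^sup>2) - K1 \<le> q"
    proof -
      have 1: "a * (- (2 * a3)) \<le> (a4 / 4) * a\<^sup>2 + (- (2 * a3))\<^sup>2 / (4 * (a4 / 4))" by (rule young) (use a4_pos in simp)
      have 2: "b * (- a3) \<le> (a4 / 4) * b\<^sup>2 + (- a3)\<^sup>2 / (4 * (a4 / 4))" by (rule young) (use a4_pos in simp)
      have e: "(- (2 * a3))\<^sup>2 / (4 * (a4 / 4)) = 4 * (a3\<^sup>2 / a4)" "(- a3)\<^sup>2 / (4 * (a4 / 4)) = a3\<^sup>2 / a4" by (simp_all add: power2_eq_square)
      have "0 \<le> a4 * ((2 * a + b)\<^sup>2 + a\<^sup>2) / 2" using a4_pos by simp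
      moreover have "a4 * (3 * a\<^sup>2 + 2 * a * b + b\<^sup>2) - a4 / 2 * (a\<^sup>2 + b\<^sup>2) = a4 * ((2 * a + b)\<^sup>2 + a\<^sup>2) / 2"
        by (simp add: power2_eq_square field_simps)
      ultimately have 3: "a4 / 2 * (a\<^sup>2 + b\<^sup>2) \<le> a4 * (3 * a\<^sup>2 + 2 * a * b + b\<^sup>2)" by linarith
      have K1e: "K1 = 5 * (a3\<^sup>2 / a4) + \<bar>a2\<bar>" by (simp add: K1_def)
      show ?thesis unfolding q_def K1e using 1 2 3 unfolding e by (simp add: algebra_simps)
    qed
    have r: "\<bar>r\<bar> \<le> K2 * (1 + d\<^sup>2 + b\<^sup>2)"
    proof -
      have ab: "\<bar>a * b\<bar> \<le> (a\<^sup>2 + b\<^sup>2) / 2"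
      proof -
        have "0 \<le> (\<bar>a\<bar> - \<bar>b\<bar>)\<^sup>2" by simp
        thus ?thesis by (simp add: power2_diff abs_mult)
      qed
      have apb: "\<bar>a + b\<bar> \<le> 1 + a\<^sup>2 + b\<^sup>2"
      proof -
        have "0 \<le> (\<bar>a\<bar> - 1)\<^sup>2" "0 \<le> (\<bar>b\<bar> - 1)\<^sup>2" by simp_all
        hence "2 * \<bar>a\<bar> \<le> a\<^sup>2 + 1" "2 * \<bar>b\<bar> \<le> b\<^sup>2 + 1" by (simp_all add: power2_diff)
        moreover have "0 \<le> a\<^sup>2" "0 \<le> b\<^sup>2" by simp_all
        ultimately show ?thesis by linarith
      qed
      have "\<bar>r\<bar> \<le> \<bar>4 * a4 * (a\<^sup>2 + a * b + b\<^sup>2)\<bar> + \<bar>3 * a3 * (a + b)\<bar> + \<bar>2 * a2\<bar>" unfolding r_def by linarith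
      also have "\<dots> = 4 * a4 * \<bar>a\<^sup>2 + a * b + b\<^sup>2\<bar> + 3 * \<bar>a3\<bar> * \<bar>a + b\<bar> + 2 * \<bar>a2\<bar> * 1"
        using a4_pos by (simp add: abs_mult)
      also have "\<dots> \<le> 4 * a4 * (3 / 2 * (1 + a\<^sup>2 + b\<^sup>2)) + 3 * \<bar>a3\<bar> * (1 + a\<^sup>2 + b\<^sup>2) + 2 * \<bar>a2\<bar> * (1 + a\<^sup>2 + b\<^sup>2)"
      proof (intro add_mono mult_left_mono apb)
        have "\<bar>a\<^sup>2 + a * b + b\<^sup>2\<bar> \<le> a\<^sup>2 + b\<^sup>2 + \<bar>a * b\<bar>" by (simp add: abs_le_iff) (smt (verit) zero_le_power2)
        also have "\<dots> \<le> a\<^sup>2 + b\<^sup>2 + (a\<^sup>2 + b\<^sup>2) / 2" using ab by simp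
        also have "\<dots> \<le> 3 / 2 * (1 + a\<^sup>2 + b\<^sup>2)" by (simp add: field_simps)
        finally show "\<bar>a\<^sup>2 + a * b + b\<^sup>2\<bar> \<le> 3 / 2 * (1 + a\<^sup>2 + b\<^sup>2)" .
      qed (use a4_pos in auto)
      also have "\<dots> = (K2 / 3) * (1 + a\<^sup>2 + b\<^sup>2)" by (simp add: K2_def algebra_simps)
      also have "\<dots> \<le> (K2 / 3) * (3 * (1 + d\<^sup>2 + b\<^sup>2))"
      proof (rule mult_left_mono)
        have "2 * (d * b) \<le> d\<^sup>2 + b\<^sup>2" using sum_squares_bound[of d b] by simp
        moreover have "a\<^sup>2 = d\<^sup>2 + 2 * (d * b) + b\<^sup>2" by (simp add: d_def power2_eq_square algebra_simps)
        moreover have "0 \<le> d\<^sup>2" by simp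
        ultimately show "1 + a\<^sup>2 + b\<^sup>2 \<le> 3 * (1 + d\<^sup>2 + b\<^sup>2)" unfolding distrib_left by linarith
      qed (use nn in simp)
      also have "\<dots> = K2 * (1 + d\<^sup>2 + b\<^sup>2)" by (simp add: field_simps)
      finally show ?thesis .
    qed
    have "w * (f a - f b) \<le> \<bar>w\<bar> * \<bar>d\<bar> * \<bar>r\<bar>" unfolding eq2 by (metis abs_ge_self abs_mult mult.assoc)
    also have "\<dots> \<le> \<bar>w\<bar> * \<bar>d\<bar> * (K2 * (1 + d\<^sup>2 + b\<^sup>2))" by (intro mult_left_mono r) auto
    also have "\<dots> = \<bar>d\<bar> * (K2 * \<bar>w\<bar>) + d\<^sup>2 * (K2 * (\<bar>w\<bar> * \<bar>d\<bar>)) + \<bar>d\<bar> * (K2 * \<bar>w\<bar>) * (\<bar>b\<bar> * \<bar>b\<bar>)"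
      by (simp add: power2_eq_square algebra_simps)
    also have "\<bar>d\<bar> * (K2 * \<bar>w\<bar>) * (\<bar>b\<bar> * \<bar>b\<bar>) = (\<bar>d\<bar> * \<bar>b\<bar>) * (K2 * (\<bar>w\<bar> * \<bar>b\<bar>))" by (simp only: mult_ac)
    finally have i1: "w * (f a - f b) \<le> \<bar>d\<bar> * (K2 * \<bar>w\<bar>) + d\<^sup>2 * (K2 * (\<bar>w\<bar> * \<bar>d\<bar>)) + (\<bar>d\<bar> * \<bar>b\<bar>) * (K2 * (\<bar>w\<bar> * \<bar>b\<bar>))" .
    \<comment> \<open>Half of \<open>a^2 + b^2\<close> is kept as \<open>d^2 / 4\<close> and half as
      \<open>b^2 / 2\<close>, which gives the surplus a \<open>d^4\<close> part and a
      \<open>d^2 * b^2\<close> part.\<close>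
    have i2: "- (d\<^sup>2 * q) \<le> K1 * d\<^sup>2 - a4 / 16 * d ^ 4 - a4 / 8 * (d\<^sup>2 * b\<^sup>2)"
    proof -
      have "0 \<le> (a + b)\<^sup>2" by simp
      hence "d\<^sup>2 / 2 \<le> a\<^sup>2 + b\<^sup>2" by (simp add: d_def power2_eq_square algebra_simps)
      hence "d\<^sup>2 / 4 + b\<^sup>2 / 2 \<le> a\<^sup>2 + b\<^sup>2" using zero_le_power2[of a] by linarith
      hence "a4 / 4 * (d\<^sup>2 / 4 + b\<^sup>2 / 2) - K1 \<le> q" using q a4_pos
        by (intro order_trans[OF diff_right_mono q] mult_left_mono) auto
      hence "d\<^sup>2 * (a4 / 4 * (d\<^sup>2 / 4 + b\<^sup>2 / 2) - K1) \<le> d\<^sup>2 * q" by (intro mult_left_mono) auto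
      moreover have "d\<^sup>2 * (a4 / 4 * (d\<^sup>2 / 4 + b\<^sup>2 / 2) - K1) = a4 / 16 * d ^ 4 + a4 / 8 * (d\<^sup>2 * b\<^sup>2) - K1 * d\<^sup>2"
        by (simp add: eval_nat_numeral algebra_simps)
      ultimately show ?thesis by linarith
    qed
    \<comment> \<open>The weights spend the surplus exactly: \<open>a4 / 32\<close> twice on
      \<open>d^4\<close> and \<open>a4 / 8\<close> on \<open>d^2 * b^2\<close>.\<close>
    have y1: "\<bar>d\<bar> * (K2 * \<bar>w\<bar>) \<le> 1 * \<bar>d\<bar>\<^sup>2 + (K2 * \<bar>w\<bar>)\<^sup>2 / (4 * 1)" by (rule young) simp
    have y2: "d\<^sup>2 * (K2 * (\<bar>w\<bar> * \<bar>d\<bar>)) \<le> a4 / 32 * (d\<^sup>2)\<^sup>2 + (K2 * (\<bar>w\<bar> * \<bar>d\<bar>))\<^sup>2 / (4 * (a4 / 32))" by (rule young) (use a4_pos in simp)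
    have y3: "d\<^sup>2 * (M * w\<^sup>2) \<le> a4 / 32 * (d\<^sup>2)\<^sup>2 + (M * w\<^sup>2)\<^sup>2 / (4 * (a4 / 32))" by (rule young) (use a4_pos in simp)
    have y4: "(\<bar>d\<bar> * \<bar>b\<bar>) * (K2 * (\<bar>w\<bar> * \<bar>b\<bar>)) \<le> a4 / 8 * (\<bar>d\<bar> * \<bar>b\<bar>)\<^sup>2 + (K2 * (\<bar>w\<bar> * \<bar>b\<bar>))\<^sup>2 / (4 * (a4 / 8))" by (rule young) (use a4_pos in simp)
    have e1: "(K2 * \<bar>w\<bar>)\<^sup>2 / (4 * 1) = K2\<^sup>2 * w\<^sup>2 / 4" by (simp add: power_mult_distrib)
    have e2: "(K2 * (\<bar>w\<bar> * \<bar>d\<bar>))\<^sup>2 / (4 * (a4 / 32)) = d\<^sup>2 * (M * w\<^sup>2)" by (simp add: power_mult_distrib M_def)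
    have e3: "(M * w\<^sup>2)\<^sup>2 / (4 * (a4 / 32)) = (8 / a4 * M\<^sup>2) * w ^ 4" by (simp add: power_mult_distrib power_mult[symmetric])
    have e4: "(K2 * (\<bar>w\<bar> * \<bar>b\<bar>))\<^sup>2 / (4 * (a4 / 8)) = (2 * K2\<^sup>2 / a4) * (w\<^sup>2 * b\<^sup>2)" by (simp add: power_mult_distrib)
    have e5: "(d\<^sup>2)\<^sup>2 = d ^ 4" by (simp add: power_mult[symmetric])
    have e6: "(\<bar>d\<bar> * \<bar>b\<bar>)\<^sup>2 = d\<^sup>2 * b\<^sup>2" by (simp add: power_mult_distrib)
    have "poly F a - poly F b - f a * (a - b) + w * (f a - f b) 
      \<le> K1 * d\<^sup>2 + d\<^sup>2 + K2\<^sup>2 * w\<^sup>2 / 4 + (8 / a4 * M\<^sup>2) * w ^ 4 + (2 * K2\<^sup>2 / a4) * (w\<^sup>2 * b\<^sup>2)"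
      using i1 i2 y1 y2 y3 y4 unfolding e1 e2 e3 e4 e5 e6 eq1 by simp
    also have "\<dots> \<le> C * d\<^sup>2 + C * w\<^sup>2 + C * w ^ 4 + C * (w\<^sup>2 * b\<^sup>2)"
    proof -
      have "K1 * d\<^sup>2 + d\<^sup>2 = (K1 + 1) * d\<^sup>2" by (simp add: algebra_simps)
      also have "\<dots> \<le> C * d\<^sup>2" by (intro mult_right_mono nnC) auto
      finally have 1: "K1 * d\<^sup>2 + d\<^sup>2 \<le> C * d\<^sup>2" .
      have "K2\<^sup>2 * w\<^sup>2 / 4 \<le> K2\<^sup>2 * w\<^sup>2" by simp
      also have "\<dots> \<le> C * w\<^sup>2" by (intro mult_right_mono nnC) auto
      finally have 2: "K2\<^sup>2 * w\<^sup>2 / 4 \<le> C * w\<^sup>2" .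
      have 3: "(8 / a4 * M\<^sup>2) * w ^ 4 \<le> C * w ^ 4" by (intro mult_right_mono nnC) auto
      have 4: "(2 * K2\<^sup>2 / a4) * (w\<^sup>2 * b\<^sup>2) \<le> C * (w\<^sup>2 * b\<^sup>2)" by (intro mult_right_mono nnC) auto
      show ?thesis using 1 2 3 4 by linarith
    qed
    finally show ?thesis by (simp add: d_def algebra_simps)
  qed
  moreover have "0 \<le> C" using nnC nn by linarith
  ultimately show ?thesis by blast
qed

end

section \<open>Energy estimate and stability of one step\<close>

context quartic begin

text \<open>Constants that depend on \<open>F\<close> alone, chosen once so that the final constant
  can be written down before any mesh or noise is given.\<close>

definition "c_low = (SOME c. c \<ge> 0 \<and> (\<forall>s. a4 / 2 * s ^ 4 - c \<le> poly F s))"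
definition "c_gr = (SOME c. c \<ge> 0 \<and> (\<forall>s. \<bar>f s\<bar> \<le> c * (1 + \<bar>s\<bar> ^ 3)))"
definition "\<beta> = (SOME \<beta>. \<beta> \<ge> 0 \<and> (\<forall>a b. - \<beta> * (a - b)\<^sup>2 \<le> (f a - f b) * (a - b)))"
definition "c_en = (SOME c. c \<ge> 0 \<and> (\<forall>a b w. poly F a - poly F b - f a * (a - b) + w * (f a - f b) 
    \<le> c * ((a - b)\<^sup>2 + w\<^sup>2 + w\<^sup>2 * b\<^sup>2 + w ^ 4)))"

lemma c_low: "c_low \<ge> 0" "a4 / 2 * s ^ 4 - c_low \<le> poly F s"
  using someI_ex[OF F_lower[unfolded Bex_def]] unfolding c_low_def[symmetric] by auto

lemma c_gr: "c_gr \<ge> 0" "\<bar>f s\<bar> \<le> c_gr * (1 + \<bar>s\<bar> ^ 3)"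
  using someI_ex[OF f_growth[unfolded Bex_def]] unfolding c_gr_def[symmetric] by auto

lemma beta: "\<beta> \<ge> 0" "- \<beta> * (a - b)\<^sup>2 \<le> (f a - f b) * (a - b)"
  using someI_ex[OF f_semimonotone[unfolded Bex_def]] unfolding \<beta>_def[symmetric] by auto

lemma c_en: "c_en \<ge> 0" "poly F a - poly F b - f a * (a - b) + w * (f a - f b) 
    \<le> c_en * ((a - b)\<^sup>2 + w\<^sup>2 + w\<^sup>2 * b\<^sup>2 + w ^ 4)"
  using someI_ex[OF energy_pointwise[unfolded Bex_def]] unfolding c_en_def[symmetric] by auto

end

section \<open>Integrals of bounded measurable functions\<close>

context bounded_domain begin

text \<open>A class closed under polynomial operations, so that the integrals built from finite
  element functions exist without separate arguments.\<close>

definition bm :: "(real^'n \<Rightarrow> real) \<Rightarrow> bool" where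
  "bm u \<longleftrightarrow> u \<in> borel_measurable \<mu> \<and> (\<exists>B. \<forall>x\<in>D. \<bar>u x\<bar> \<le> B)"

lemma bmI: "u \<in> borel_measurable \<mu> \<Longrightarrow> (\<And>x. x \<in> D \<Longrightarrow> \<bar>u x\<bar> \<le> B) \<Longrightarrow> bm u"
  by (auto simp: bm_def)

lemma bmE:
  assumes "bm u"
  obtains B where "B \<ge> 0" "u \<in> borel_measurable \<mu>" "\<And>x. x \<in> D \<Longrightarrow> \<bar>u x\<bar> \<le> B"
proof -
  obtain B where B: "u \<in> borel_measurable \<mu>" "\<forall>x\<in>D. \<bar>u x\<bar> \<le> B" using assms by (auto simp: bm_def)
  have "\<bar>u x\<bar> \<le> max B 0" if "x \<in> D" for x using B(2) that by fastforce
  thus thesis using B(1) by (intro that[of "max B 0"]) auto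
qed

lemma bm_const [intro, simp]: "bm (\<lambda>x. c)"
  by (rule bmI[where B = "\<bar>c\<bar>"]) auto

lemma bm_add [intro]: 
  assumes "bm u" "bm v" shows "bm (\<lambda>x. u x + v x)"
proof -
  obtain B where B: "B \<ge> 0" "u \<in> borel_measurable \<mu>" "\<And>x. x \<in> D \<Longrightarrow> \<bar>u x\<bar> \<le> B" by (rule bmE[OF assms(1)], rule that)
  obtain B' where B': "B' \<ge> 0" "v \<in> borel_measurable \<mu>" "\<And>x. x \<in> D \<Longrightarrow> \<bar>v x\<bar> \<le> B'" by (rule bmE[OF assms(2)], rule that)
  show ?thesis
  proof (rule bmI[where B = "B + B'"])
    fix x assume "x \<in> D"
    show "\<bar>u x + v x\<bar> \<le> B + B'" using B(3)[OF \<open>x \<in> D\<close>] B'(3)[OF \<open>x \<in> D\<close>] by linarith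
  qed (use B B' in auto)
qed

lemma bm_mult [intro]: 
  assumes "bm u" "bm v" shows "bm (\<lambda>x. u x * v x)"
proof -
  obtain B where B: "B \<ge> 0" "u \<in> borel_measurable \<mu>" "\<And>x. x \<in> D \<Longrightarrow> \<bar>u x\<bar> \<le> B" by (rule bmE[OF assms(1)], rule that)
  obtain B' where B': "B' \<ge> 0" "v \<in> borel_measurable \<mu>" "\<And>x. x \<in> D \<Longrightarrow> \<bar>v x\<bar> \<le> B'" by (rule bmE[OF assms(2)], rule that)
  show ?thesis
  proof (rule bmI[where B = "B * B'"])
    fix x assume "x \<in> D"
    show "\<bar>u x * v x\<bar> \<le> B * B'" unfolding abs_mult 
      using B(1) B(3)[OF \<open>x \<in> D\<close>] B'(3)[OF \<open>x \<in> D\<close>] by (intro mult_mono) auto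
  qed (use B B' in auto)
qed

lemma bm_uminus [intro]: "bm u \<Longrightarrow> bm (\<lambda>x. - u x)"
  using bm_mult[of "\<lambda>x. -1" u] by simp

lemma bm_diff [intro]: "bm u \<Longrightarrow> bm v \<Longrightarrow> bm (\<lambda>x. u x - v x)"
  using bm_add[of u "\<lambda>x. - v x"] bm_uminus[of v] by simp

lemma bm_abs [intro]: "bm u \<Longrightarrow> bm (\<lambda>x. \<bar>u x\<bar>)"
  by (auto simp: bm_def)

lemma bm_power [intro]: "bm u \<Longrightarrow> bm (\<lambda>x. u x ^ n)"
  by (induction n) auto

lemma bm_poly [intro]: "bm u \<Longrightarrow> bm (\<lambda>x. poly p (u x))"
  by (induction p) auto

lemma bm_integrable: "bm u \<Longrightarrow> integrable \<mu> u"
  by (auto simp: bm_def intro: integrable_bounded)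

lemma bm_L2: "bm u \<Longrightarrow> u \<in> L2 D"
  by (auto simp: bm_def intro: L2_bounded)

lemma bm_cauchy_schwarz:
  assumes "bm u" "bm v"
  shows "(integral\<^sup>L \<mu> (\<lambda>x. u x * v x))\<^sup>2 \<le> integral\<^sup>L \<mu> (\<lambda>x. (u x)\<^sup>2) * integral\<^sup>L \<mu> (\<lambda>x. (v x)\<^sup>2)"
  using ip_cauchy_schwarz[OF bm_L2[OF assms(1)] bm_L2[OF assms(2)]] by (simp add: ip_def power2_eq_square)

lemma bm_cauchy_schwarz_le:
  assumes "bm u" "bm v" "integral\<^sup>L \<mu> (\<lambda>x. (u x)\<^sup>2) \<le> a\<^sup>2" "integral\<^sup>L \<mu> (\<lambda>x. (v x)\<^sup>2) \<le> b\<^sup>2" "0 \<le> a" "0 \<le> b"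
  shows "integral\<^sup>L \<mu> (\<lambda>x. u x * v x) \<le> a * b"
proof (rule power2_le_imp_le)
  have "(integral\<^sup>L \<mu> (\<lambda>x. u x * v x))\<^sup>2 \<le> integral\<^sup>L \<mu> (\<lambda>x. (u x)\<^sup>2) * integral\<^sup>L \<mu> (\<lambda>x. (v x)\<^sup>2)"
    by (rule bm_cauchy_schwarz) fact+
  also have "\<dots> \<le> a\<^sup>2 * b\<^sup>2" using assms by (intro mult_mono) auto
  finally show "(integral\<^sup>L \<mu> (\<lambda>x. u x * v x))\<^sup>2 \<le> (a * b)\<^sup>2" by (simp add: power_mult_distrib)
qed (use assms in auto)

end

section \<open>Energy and constants of the domain\<close>

locale ch_domain = bounded_domain D + quartic F for D :: "(real^'n::finite) set" and F
begin

abbreviation "vol \<equiv> measure lebesgue D"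
abbreviation "I4 v \<equiv> integral\<^sup>L \<mu> (\<lambda>x. v x ^ 4)"

text \<open>The shift makes \<open>\<Phi>\<close> at least 1, so terms free of the energy may be
  multiplied by it. \<open>c_2\<close> is a Poincare constant, \<open>C_r\<close> belongs to the
  remainder of the energy step and \<open>C_m\<close> to the martingale term. \<open>k_1\<close>
  combines the step size at which the energy step absorbs the squared increment with the one at
  which the implicit step is stable. None of them depends on the mesh.\<close>

definition "c_\<Phi> = c_low * vol + 1"
definition "\<Phi> v = Jfun D F v + c_\<Phi>"
definition "c_q = 1 + 2 / a4"
definition "c_2 = sqrt (vol * sobolev_const)"
definition "c_4 = sqrt sobolev_const"
definition "C_r = 1 + 2 * c_en * c_2 + c_en * c_4 * c_q + c_en * sobolev_const"
definition "C_m = 1 + c_gr * (sqrt (vol * c_2) + sqrt c_4 * c_q)"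
definition "k_1 = min (1 / (8 * c_en\<^sup>2 + 1)) (2 / (\<beta>\<^sup>2 + 1))"

lemma c_nonneg: "0 \<le> c_2" "0 \<le> c_4" "0 \<le> C_r" "0 \<le> C_m" "1 \<le> c_q" "1 \<le> c_\<Phi>"
proof -
  show c2: "0 \<le> c_2" "0 \<le> c_4" using sobolev_const_nonneg by (auto simp: c_2_def c_4_def)
  show cq: "1 \<le> c_q" using a4_pos by (simp add: c_q_def)
  show "0 \<le> C_r" unfolding C_r_def using c2 cq c_en(1) sobolev_const_nonneg by (intro add_nonneg_nonneg mult_nonneg_nonneg) auto
  show "0 \<le> C_m" unfolding C_m_def using c2 cq c_gr(1) by (intro add_nonneg_nonneg mult_nonneg_nonneg) auto
  show "1 \<le> c_\<Phi>" unfolding c_\<Phi>_def using c_low(1) by simp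
qed

lemma c_sq: "c_2\<^sup>2 = vol * sobolev_const" "c_4\<^sup>2 = sobolev_const"
  using sobolev_const_nonneg by (auto simp: c_2_def c_4_def)

lemma k_1_pos: "0 < k_1" by (simp add: k_1_def add_nonneg_pos)

lemma k_1_le: 
  assumes "0 < k" "k \<le> k_1" shows "4 * c_en\<^sup>2 * k \<le> 1 / 2" "k * \<beta>\<^sup>2 \<le> 2"
proof -
  have "k \<le> 1 / (8 * c_en\<^sup>2 + 1)" using assms by (simp add: k_1_def)
  hence "k * (8 * c_en\<^sup>2 + 1) \<le> 1" by (simp add: pos_le_divide_eq add_nonneg_pos)
  thus "4 * c_en\<^sup>2 * k \<le> 1 / 2" using assms by (simp add: algebra_simps)
  have "k \<le> 2 / (\<beta>\<^sup>2 + 1)" using assms by (simp add: k_1_def)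
  hence "k * (\<beta>\<^sup>2 + 1) \<le> 2" by (simp add: pos_le_divide_eq add_nonneg_pos)
  thus "k * \<beta>\<^sup>2 \<le> 2" using assms by (simp add: algebra_simps)
qed

lemma Phi_lower:
  assumes "bm v"
  shows "gip D v v / 2 + a4 / 2 * I4 v + 1 \<le> \<Phi> v"
proof -
  have "integral\<^sup>L \<mu> (\<lambda>x. a4 / 2 * v x ^ 4 - c_low) \<le> integral\<^sup>L \<mu> (\<lambda>x. poly F (v x))"
    by (intro integral_mono bm_integrable c_low bm_diff bm_mult bm_const bm_power bm_poly assms)
  moreover have "integral\<^sup>L \<mu> (\<lambda>x. a4 / 2 * v x ^ 4 - c_low) = a4 / 2 * I4 v - c_low * vol"
    using bm_integrable[OF bm_power[OF assms, of 4]] by (simp add: measure_restrict_space)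
  ultimately show ?thesis by (simp add: \<Phi>_def Jfun_def sn1_sq c_\<Phi>_def)
qed

lemma I4_nonneg: "0 \<le> I4 v" for v :: "real^'n \<Rightarrow> real" by simp

lemma Phi_bounds:
  assumes "bm v"
  shows "1 \<le> \<Phi> v" "1 + I4 v \<le> c_q * \<Phi> v" "sn1 D v \<le> \<Phi> v"
proof -
  have g: "0 \<le> gip D v v" by (rule gip_self_nonneg)
  have i: "0 \<le> a4 / 2 * I4 v" using a4_pos by simp
  show 1: "1 \<le> \<Phi> v" using Phi_lower[OF assms] g i by linarith
  have "a4 / 2 * I4 v \<le> \<Phi> v" using Phi_lower[OF assms] g by linarith
  hence "I4 v \<le> 2 / a4 * \<Phi> v" using a4_pos by (simp add: field_simps)
  thus "1 + I4 v \<le> c_q * \<Phi> v" using 1 by (simp add: c_q_def algebra_simps)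
  have "0 \<le> (sn1 D v - 1)\<^sup>2" by simp
  hence "2 * sn1 D v \<le> gip D v v + 1" by (simp add: power2_diff sn1_sq)
  thus "sn1 D v \<le> \<Phi> v" using Phi_lower[OF assms] g i by linarith
qed

text \<open>The energy may be negative, so its powers are estimated through its absolute value and
  the shifted energy.\<close>

lemma abs_J_le: 
  assumes "bm v" shows "\<bar>Jfun D F v\<bar> \<le> c_\<Phi> * \<Phi> v"
proof -
  have "1 * c_\<Phi> \<le> \<Phi> v * c_\<Phi>" "1 * \<Phi> v \<le> c_\<Phi> * \<Phi> v" 
    using Phi_bounds(1)[OF assms] c_nonneg(6) by (intro mult_right_mono; simp)+
  thus ?thesis using Phi_bounds(1)[OF assms] c_nonneg(6) by (simp add: \<Phi>_def abs_le_iff algebra_simps)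
qed

end

section \<open>One step of the scheme on a mesh\<close>

locale ch_mesh = fe_mesh3 D \<T> + ch_domain D F for D :: "(real^'n::finite) set" and \<T> F
begin

abbreviation "Y \<equiv> Yh D \<T> F"

lemma S_bm: "v \<in> S \<Longrightarrow> bm v"
  by (rule Sh_bounded) (auto intro: bmI Sh_measurable)

lemma S0_bm: "v \<in> S0 \<Longrightarrow> bm v"
  by (intro S_bm S0_S)

lemma fS_L2: "v \<in> S \<Longrightarrow> (\<lambda>x. f (v x)) \<in> L2 D"
  by (intro bm_L2 bm_poly S_bm)

lemma Y_S: "v \<in> S \<Longrightarrow> Y v \<in> S"
  unfolding Yh_def by (intro S_add Ah_S Ph_S fS_L2)

lemma ip_Y: "v \<in> S \<Longrightarrow> z \<in> S \<Longrightarrow> ip D (Y v) z = gip D v z + ip D (\<lambda>x. f (v x)) z"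
  unfolding Yh_def by (subst ip_add) (auto intro: S_L2 Ah_S Ph_S fS_L2 simp: ip_Ah ip_Ph fS_L2)

text \<open>The two terms with an outer \<open>A\<close> add up to \<open>A\<close> applied to
  \<open>Y a\<close>, which a test function turns into the gradient product.\<close>

lemma scheme_weak:
  assumes a: "a \<in> S" and b: "b \<in> S" and z: "z \<in> S"
    and w: "\<And>x. a x - b x + k * A (A a) x + k * A (proj (\<lambda>y. f (a y))) x = w x"
  shows "ip D (\<lambda>x. a x - b x) z + k * gip D (Y a) z = ip D w z"
proof -
  have m: "A a \<in> S" "A (A a) \<in> S" "proj (\<lambda>y. f (a y)) \<in> S" "A (proj (\<lambda>y. f (a y))) \<in> S"
    using a by (auto intro: Ah_S Ph_S fS_L2)
  have d: "(\<lambda>x. a x - b x) \<in> S" using a b by (rule S_diff)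
  have "w = (\<lambda>x. 1 * (a x - b x) + k * (A (A a) x + A (proj (\<lambda>y. f (a y))) x))"
    using w by (auto simp: algebra_simps)
  hence "ip D w z = ip D (\<lambda>x. 1 * (a x - b x) + k * (A (A a) x + A (proj (\<lambda>y. f (a y))) x)) z" by simp
  also have "\<dots> = 1 * ip D (\<lambda>x. a x - b x) z + k * ip D (\<lambda>x. A (A a) x + A (proj (\<lambda>y. f (a y))) x) z"
    by (intro ip_lincomb S_L2 d z S_add m)
  also have "ip D (\<lambda>x. A (A a) x + A (proj (\<lambda>y. f (a y))) x) z = gip D (A a) z + gip D (proj (\<lambda>y. f (a y))) z"
    using m z by (subst ip_add) (auto intro: S_L2 simp: ip_Ah)
  also have "\<dots> = gip D (Y a) z"
    unfolding Yh_def using gip_lincomb[OF S_H1[OF m(1)] S_H1[OF m(3)] S_H1[OF z], of 1 1] by simp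
  finally show ?thesis by simp
qed

text \<open>Poincare inequality, from the \<open>L4\<close> estimate by Cauchy-Schwarz on a set of
  finite measure.\<close>

lemma int_sq_le:
  assumes "w \<in> S0" shows "integral\<^sup>L \<mu> (\<lambda>x. (w x)\<^sup>2) \<le> c_2 * gip D w w"
proof -
  have "integral\<^sup>L \<mu> (\<lambda>x. (w x)\<^sup>2 * 1) \<le> (c_4 * gip D w w) * sqrt vol"
  proof (rule bm_cauchy_schwarz_le)
    show "integral\<^sup>L \<mu> (\<lambda>x. ((w x)\<^sup>2)\<^sup>2) \<le> (c_4 * gip D w w)\<^sup>2"
      using Sh_sobolev[OF assms] by (simp add: power_mult[symmetric] power_mult_distrib c_sq)
  qed (use S0_bm[OF assms] c_nonneg gip_self_nonneg in \<open>auto simp: measure_restrict_space\<close>)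
  also have "\<dots> = c_2 * gip D w w" by (simp add: c_2_def c_4_def real_sqrt_mult)
  finally show ?thesis by simp
qed

lemma int_sq_sq_le:
  assumes "w \<in> S0" "bm b" shows "integral\<^sup>L \<mu> (\<lambda>x. (w x)\<^sup>2 * (b x)\<^sup>2) \<le> c_4 * gip D w w * (1 + I4 b)"
proof (rule bm_cauchy_schwarz_le)
  show "integral\<^sup>L \<mu> (\<lambda>x. ((w x)\<^sup>2)\<^sup>2) \<le> (c_4 * gip D w w)\<^sup>2"
    using Sh_sobolev[OF assms(1)] by (simp add: power_mult[symmetric] power_mult_distrib c_sq)
  \<comment> \<open>Replaces the square root of \<open>I4 b\<close> by \<open>1 + I4 b\<close>,
    which the energy bounds linearly.\<close>
  have "I4 b \<le> 1 + 2 * I4 b + (I4 b)\<^sup>2" using I4_nonneg[of b] zero_le_power2[of "I4 b"] by linarith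
  thus "integral\<^sup>L \<mu> (\<lambda>x. ((b x)\<^sup>2)\<^sup>2) \<le> (1 + I4 b)\<^sup>2" 
    by (simp add: power_mult[symmetric] power2_sum)
qed (use S0_bm[OF assms(1)] assms(2) c_nonneg gip_self_nonneg in \<open>auto intro!: add_nonneg_nonneg\<close>)

text \<open>Splitting \<open>\<bar>z\<bar> * \<bar>b\<bar>^3\<close> as
  \<open>\<bar>z * b\<bar>\<close> times \<open>b^2\<close> leaves only fourth powers, so the bound
  is linear in the energy of \<open>b\<close>. With \<open>z\<close> the projected noise, this
  bounds the martingale difference.\<close>

lemma abs_ip_Y_le:
  assumes z: "z \<in> S0" and b: "b \<in> S"
  shows "\<bar>ip D z (Y b)\<bar> \<le> C_m * sn1 D z * \<Phi> b"
proof -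
  have bz: "bm z" and bb: "bm b" using z b by (auto intro: S0_bm S_bm)
  have Ph: "1 \<le> \<Phi> b" by (rule Phi_bounds[OF bb])
  have sz: "0 \<le> sn1 D z" by (rule sn1_nonneg)
  have "integral\<^sup>L \<mu> (\<lambda>x. \<bar>z x\<bar> * 1) \<le> (sqrt c_2 * sn1 D z) * sqrt vol"
    by (rule bm_cauchy_schwarz_le)
       (use int_sq_le[OF z] bz c_nonneg sz in \<open>auto simp: power_mult_distrib sn1_sq measure_restrict_space\<close>)
  also have "\<dots> = sqrt (vol * c_2) * sn1 D z * 1" by (simp add: real_sqrt_mult)
  also have "\<dots> \<le> sqrt (vol * c_2) * sn1 D z * \<Phi> b" using Ph c_nonneg sz by (intro mult_left_mono) auto
  finally have i1: "integral\<^sup>L \<mu> (\<lambda>x. \<bar>z x\<bar>) \<le> sqrt (vol * c_2) * sn1 D z * \<Phi> b" by simp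
  have "integral\<^sup>L \<mu> (\<lambda>x. \<bar>z x * b x\<bar> * (b x)\<^sup>2) \<le> sqrt (c_4 * gip D z z * (1 + I4 b)) * sqrt (1 + I4 b)"
    by (rule bm_cauchy_schwarz_le)
       (use int_sq_sq_le[OF z bb] bz bb c_nonneg I4_nonneg[of b] gip_self_nonneg[of z] in 
         \<open>auto simp: power_mult_distrib power_mult[symmetric]\<close>)
  also have "\<dots> = sqrt c_4 * sn1 D z * (1 + I4 b)"
    using I4_nonneg[of b] by (simp add: real_sqrt_mult sn1_def)
  also have "\<dots> \<le> sqrt c_4 * sn1 D z * (c_q * \<Phi> b)"
    using Phi_bounds(2)[OF bb] c_nonneg sz by (intro mult_left_mono) auto
  finally have i2: "integral\<^sup>L \<mu> (\<lambda>x. \<bar>z x\<bar> * \<bar>b x\<bar> ^ 3) \<le> sqrt c_4 * c_q * sn1 D z * \<Phi> b"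
    by (simp add: abs_mult power3_eq_cube power2_eq_square mult_ac)
  have "\<bar>ip D z (\<lambda>x. f (b x))\<bar> \<le> integral\<^sup>L \<mu> (\<lambda>x. \<bar>z x * f (b x)\<bar>)"
    unfolding ip_def using integral_abs_bound by blast
  also have "\<dots> \<le> integral\<^sup>L \<mu> (\<lambda>x. c_gr * (\<bar>z x\<bar> + \<bar>z x\<bar> * \<bar>b x\<bar> ^ 3))"
  proof (intro integral_mono bm_integrable)
    fix x
    have "\<bar>z x * f (b x)\<bar> \<le> \<bar>z x\<bar> * (c_gr * (1 + \<bar>b x\<bar> ^ 3))" unfolding abs_mult by (intro mult_left_mono c_gr) auto
    thus "\<bar>z x * f (b x)\<bar> \<le> c_gr * (\<bar>z x\<bar> + \<bar>z x\<bar> * \<bar>b x\<bar> ^ 3)" by (simp add: algebra_simps)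
  qed (use bz bb in \<open>auto intro!: bm_abs bm_add bm_mult bm_power bm_poly\<close>)
  also have "\<dots> = c_gr * (integral\<^sup>L \<mu> (\<lambda>x. \<bar>z x\<bar>) + integral\<^sup>L \<mu> (\<lambda>x. \<bar>z x\<bar> * \<bar>b x\<bar> ^ 3))"
    using bm_integrable[OF bm_abs[OF bz]] bm_integrable[OF bm_mult[OF bm_abs[OF bz] bm_power[OF bm_abs[OF bb], of 3]]] by simp
  also have "\<dots> \<le> c_gr * (sqrt (vol * c_2) * sn1 D z * \<Phi> b + sqrt c_4 * c_q * sn1 D z * \<Phi> b)"
    by (intro mult_left_mono add_mono i1 i2 c_gr)
  finally have i3: "\<bar>ip D z (\<lambda>x. f (b x))\<bar> \<le> c_gr * (sqrt (vol * c_2) * sn1 D z * \<Phi> b + sqrt c_4 * c_q * sn1 D z * \<Phi> b)" .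
  have "\<bar>gip D b z\<bar> \<le> sn1 D b * sn1 D z" using z b by (intro gip_le_sn1 S_H1) (auto intro: S0_S)
  also have "\<dots> \<le> \<Phi> b * sn1 D z" by (intro mult_right_mono Phi_bounds bb sz)
  finally have i4: "\<bar>gip D b z\<bar> \<le> \<Phi> b * sn1 D z" .
  have "ip D z (Y b) = gip D b z + ip D z (\<lambda>x. f (b x))"
    using ip_Y[OF b S0_S[OF z]] by (simp add: ip_commute)
  hence "\<bar>ip D z (Y b)\<bar> \<le> \<Phi> b * sn1 D z + c_gr * (sqrt (vol * c_2) * sn1 D z * \<Phi> b + sqrt c_4 * c_q * sn1 D z * \<Phi> b)"
    using i3 i4 by linarith
  also have "\<dots> = C_m * sn1 D z * \<Phi> b" by (simp add: C_m_def algebra_simps)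
  finally show ?thesis .
qed

text \<open>Polarisation supplies half of the squared gradient norm of \<open>a - b\<close>: one
  quarter pays for its pairing with \<open>w\<close>, one quarter for the squared increment. Half of
  the dissipation also goes to the squared increment, the other half stays on the left.\<close>

lemma energy_step:
  assumes a: "a \<in> S" and b: "b \<in> S" and w: "w \<in> S0" and k: "0 < k" "k \<le> k_1"
    and weak: "\<And>z. z \<in> S \<Longrightarrow> ip D (\<lambda>x. a x - b x) z + k * gip D (Y a) z = ip D w z"
  shows "\<Phi> a + k / 2 * gip D (Y a) (Y a) \<le> \<Phi> b + ip D w (Y b) + C_r * (gip D w w + (gip D w w)\<^sup>2) * \<Phi> b"
proof -
  define d where "d = (\<lambda>x. a x - b x)"
  have wS: "w \<in> S" using w by (rule S0_S)
  have d: "d \<in> S" unfolding d_def using a b by (rule S_diff)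
  have ba: "bm a" and bb: "bm b" and bw: "bm w" and bd: "bm d" using a b wS d by (auto intro: S_bm)
  have y: "Y a \<in> S" "Y b \<in> S" using a b by (auto intro: Y_S)
  have d1: "gip D a d = gip D a a - gip D a b"
    unfolding d_def using gip_lincomb[OF S_H1[OF a] S_H1[OF b] S_H1[OF a], of 1 "-1"]
    by (simp add: gip_commute[of a "\<lambda>x. a x - b x"] gip_commute[of a b])
  have "gip D d d = gip D a d - gip D b d"
    using gip_lincomb[OF S_H1[OF a] S_H1[OF b] S_H1[OF d], of 1 "-1"] by (simp add: d_def)
  moreover have "gip D b d = gip D a b - gip D b b"
    unfolding d_def using gip_lincomb[OF S_H1[OF a] S_H1[OF b] S_H1[OF b], of 1 "-1"]
    by (simp add: gip_commute[of b "\<lambda>x. a x - b x"])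
  ultimately have polar: "gip D a d = gip D a a / 2 - gip D b b / 2 + gip D d d / 2" using d1 by linarith
  have e1: "ip D d (Y a) = gip D a d + ip D (\<lambda>x. f (a x)) d"
    using ip_Y[OF a d] by (simp add: ip_commute)
  \<comment> \<open>Replacing \<open>Y a\<close> by \<open>Y b\<close> isolates
    \<open>ip D w (Y b)\<close>, in which the factor \<open>Y b\<close> belongs to the past.\<close>
  have e2: "ip D w (Y a) = ip D w (Y b) + gip D d w + (ip D (\<lambda>x. f (a x)) w - ip D (\<lambda>x. f (b x)) w)"
  proof -
    have "gip D d w = gip D a w - gip D b w"
      using gip_lincomb[OF S_H1[OF a] S_H1[OF b] S_H1[OF wS], of 1 "-1"] by (simp add: d_def)
    thus ?thesis using ip_Y[OF a wS] ip_Y[OF b wS] by (simp add: ip_commute[of D w])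
  qed
  have e3: "ip D d (Y a) + k * gip D (Y a) (Y a) = ip D w (Y a)" using weak[OF y(1)] by (simp add: d_def)
  define E where "E = integral\<^sup>L \<mu> (\<lambda>x. (d x)\<^sup>2 + (w x)\<^sup>2 + (w x)\<^sup>2 * (b x)\<^sup>2 + w x ^ 4)"
  have e4: "integral\<^sup>L \<mu> (\<lambda>x. poly F (a x)) - integral\<^sup>L \<mu> (\<lambda>x. poly F (b x)) - ip D (\<lambda>x. f (a x)) d 
      + (ip D (\<lambda>x. f (a x)) w - ip D (\<lambda>x. f (b x)) w) \<le> c_en * E"
  proof -
    note I = bm_integrable[OF bm_poly[OF ba, of F]] bm_integrable[OF bm_poly[OF bb, of F]]
      bm_integrable[OF bm_mult[OF bm_poly[OF ba, of "pderiv F"] bd]]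
      bm_integrable[OF bm_mult[OF bm_poly[OF ba, of "pderiv F"] bw]] bm_integrable[OF bm_mult[OF bm_poly[OF bb, of "pderiv F"] bw]]
    have "integral\<^sup>L \<mu> (\<lambda>x. poly F (a x)) - integral\<^sup>L \<mu> (\<lambda>x. poly F (b x)) - ip D (\<lambda>x. f (a x)) d 
      + (ip D (\<lambda>x. f (a x)) w - ip D (\<lambda>x. f (b x)) w) 
      = integral\<^sup>L \<mu> (\<lambda>x. poly F (a x) - poly F (b x) - f (a x) * d x + (f (a x) * w x - f (b x) * w x))"
      unfolding ip_def using I by simp
    also have "\<dots> \<le> integral\<^sup>L \<mu> (\<lambda>x. c_en * ((d x)\<^sup>2 + (w x)\<^sup>2 + (w x)\<^sup>2 * (b x)\<^sup>2 + w x ^ 4))"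
    proof (intro integral_mono bm_integrable)
      fix x
      show "poly F (a x) - poly F (b x) - f (a x) * d x + (f (a x) * w x - f (b x) * w x) \<le> c_en * ((d x)\<^sup>2 + (w x)\<^sup>2 + (w x)\<^sup>2 * (b x)\<^sup>2 + w x ^ 4)"
        using c_en(2)[of "a x" "b x" "w x"] by (simp add: d_def algebra_simps)
    qed (use ba bb bw bd in \<open>auto intro!: bm_add bm_diff bm_mult bm_power bm_poly\<close>)
    also have "\<dots> = c_en * E" unfolding E_def by simp
    finally show ?thesis .
  qed
  have E: "E = ip D d d + ip D w w + integral\<^sup>L \<mu> (\<lambda>x. (w x)\<^sup>2 * (b x)\<^sup>2) + I4 w"
  proof -
    note I = bm_integrable[OF bm_power[OF bd, of 2]] bm_integrable[OF bm_power[OF bw, of 2]]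
      bm_integrable[OF bm_mult[OF bm_power[OF bw, of 2] bm_power[OF bb, of 2]]] bm_integrable[OF bm_power[OF bw, of 4]]
    show ?thesis unfolding E_def ip_def using I by (simp add: power2_eq_square)
  qed
  define Yn Dn Wn where "Yn = sn1 D (Y a)" and "Dn = sn1 D d" and "Wn = sn1 D w"
  have sq: "gip D (Y a) (Y a) = Yn\<^sup>2" "gip D d d = Dn\<^sup>2" "gip D w w = Wn\<^sup>2" by (simp_all add: Yn_def Dn_def Wn_def sn1_sq)
  have nn: "0 \<le> Yn" "0 \<le> Dn" "0 \<le> Wn" by (simp_all add: Yn_def Dn_def Wn_def sn1_nonneg)
  \<comment> \<open>The pointwise estimate leaves the squared increment without a factor
    \<open>k\<close>; the scheme tested with \<open>d\<close> itself bounds it.\<close>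
  have dd: "c_en * ip D d d \<le> Dn\<^sup>2 / 4 + k / 2 * Yn\<^sup>2 + c_en * ip D w w"
  proof -
    have 1: "ip D d d + k * gip D (Y a) d = ip D w d" using weak[OF d] by (simp add: d_def)
    have "ip D w d \<le> ip D w w / 2 + ip D d d / 2"
    proof -
      have "0 \<le> ip D (\<lambda>x. 1 * w x + (-1) * d x) (\<lambda>x. 1 * w x + (-1) * d x)" by (rule ip_self_nonneg)
      also have "\<dots> = ip D w (\<lambda>x. 1 * w x + (-1) * d x) - ip D d (\<lambda>x. 1 * w x + (-1) * d x)"
        using ip_lincomb[OF S_L2[OF wS] S_L2[OF d] S_L2[OF Sh_lincomb[OF wS d, of 1 "-1"]], of 1 "-1"] by simp
      also have "\<dots> = ip D w w - 2 * ip D w d + ip D d d"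
        unfolding ip_commute[of D w "\<lambda>x. 1 * w x + (-1) * d x"] ip_commute[of D d "\<lambda>x. 1 * w x + (-1) * d x"]
        using ip_lincomb[OF S_L2[OF wS] S_L2[OF d] S_L2[OF wS], of 1 "-1"] ip_lincomb[OF S_L2[OF wS] S_L2[OF d] S_L2[OF d], of 1 "-1"]
        by (simp add: ip_commute[of D d w])
      finally show ?thesis by simp
    qed
    moreover have "\<bar>gip D (Y a) d\<bar> \<le> Yn * Dn" unfolding Yn_def Dn_def using y d by (intro gip_le_sn1 S_H1)
    hence "- (k * gip D (Y a) d) \<le> k * (Yn * Dn)" using k mult_left_mono[of "- gip D (Y a) d" "Yn * Dn" k] by (simp add: abs_le_iff)
    ultimately have "ip D d d \<le> 2 * (k * (Yn * Dn)) + ip D w w" using 1 by linarith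
    hence "c_en * ip D d d \<le> c_en * (2 * (k * (Yn * Dn)) + ip D w w)" by (intro mult_left_mono c_en)
    also have "\<dots> = Dn * (2 * c_en * k * Yn) + c_en * ip D w w" by (simp add: algebra_simps)
    also have "Dn * (2 * c_en * k * Yn) \<le> 1 / 4 * Dn\<^sup>2 + (2 * c_en * k * Yn)\<^sup>2 / (4 * (1 / 4))" by (rule young) simp
    also have "(2 * c_en * k * Yn)\<^sup>2 / (4 * (1 / 4)) = (4 * c_en\<^sup>2 * k) * (k * Yn\<^sup>2)" by (simp add: power2_eq_square)
    \<comment> \<open>Uses the first restriction contained in \<open>k_1\<close>.\<close>
    also have "\<dots> \<le> 1 / 2 * (k * Yn\<^sup>2)" using k by (intro mult_right_mono k_1_le) auto
    finally show ?thesis by simp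
  qed
  have gdw: "gip D d w \<le> Dn\<^sup>2 / 4 + Wn\<^sup>2"
  proof -
    have "gip D d w \<le> Dn * Wn" using gip_le_sn1[OF S_H1[OF d] S_H1[OF wS]] by (simp add: Dn_def Wn_def)
    also have "\<dots> \<le> 1 / 4 * Dn\<^sup>2 + Wn\<^sup>2 / (4 * (1 / 4))" by (rule young) simp
    finally show ?thesis by simp
  qed
  have ww: "ip D w w \<le> c_2 * Wn\<^sup>2" using int_sq_le[OF w] by (simp add: ip_def power2_eq_square[symmetric] sq)
  have wb: "integral\<^sup>L \<mu> (\<lambda>x. (w x)\<^sup>2 * (b x)\<^sup>2) \<le> c_4 * Wn\<^sup>2 * (c_q * \<Phi> b)"
  proof -
    have "integral\<^sup>L \<mu> (\<lambda>x. (w x)\<^sup>2 * (b x)\<^sup>2) \<le> c_4 * Wn\<^sup>2 * (1 + I4 b)" using int_sq_sq_le[OF w bb] by (simp add: sq)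
    also have "\<dots> \<le> c_4 * Wn\<^sup>2 * (c_q * \<Phi> b)" using c_nonneg by (intro mult_left_mono Phi_bounds bb) auto
    finally show ?thesis .
  qed
  have w4: "I4 w \<le> sobolev_const * (Wn\<^sup>2)\<^sup>2" using Sh_sobolev[OF w] by (simp add: sq)
  have P1: "1 \<le> \<Phi> b" by (rule Phi_bounds[OF bb])
  define P where "P = \<Phi> b"
  define U where "U = Wn\<^sup>2"
  have U0: "0 \<le> U" by (simp add: U_def)
  have step: "\<Phi> a + k / 2 * Yn\<^sup>2 \<le> \<Phi> b + ip D w (Y b) + U + 2 * (c_en * ip D w w) + c_en * integral\<^sup>L \<mu> (\<lambda>x. (w x)\<^sup>2 * (b x)\<^sup>2) + c_en * I4 w"
  proof -
    have cE: "c_en * E = c_en * ip D d d + c_en * ip D w w + c_en * integral\<^sup>L \<mu> (\<lambda>x. (w x)\<^sup>2 * (b x)\<^sup>2) + c_en * I4 w"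
      unfolding E by (simp add: distrib_left)
    have Pa: "\<Phi> a = gip D a a / 2 + integral\<^sup>L \<mu> (\<lambda>x. poly F (a x)) + c_\<Phi>"
      and Pb: "\<Phi> b = gip D b b / 2 + integral\<^sup>L \<mu> (\<lambda>x. poly F (b x)) + c_\<Phi>" by (simp_all add: \<Phi>_def Jfun_def sn1_sq)
    show ?thesis using e1 e2 e3 e4 polar dd gdw unfolding cE Pa Pb sq U_def by linarith
  qed
  \<comment> \<open>Since \<open>P\<close> is at least 1, every term can be brought to the
    multiplicative form that the Gronwall argument requires.\<close>
  have "U + 2 * (c_en * ip D w w) + c_en * integral\<^sup>L \<mu> (\<lambda>x. (w x)\<^sup>2 * (b x)\<^sup>2) + c_en * I4 w
     \<le> U * P + 2 * (c_en * (c_2 * U)) * P + c_en * (c_4 * U * (c_q * P)) + c_en * (sobolev_const * U\<^sup>2) * P"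
  proof (intro add_mono)
    have m: "x \<le> x * P" if "0 \<le> x" for x using mult_left_mono[OF P1 that] by (simp add: P_def)
    show "U \<le> U * P" using U0 by (rule m)
    have "2 * (c_en * ip D w w) \<le> 2 * (c_en * (c_2 * U))" using ww c_en(1) by (intro mult_left_mono) (auto simp: U_def)
    also have "\<dots> \<le> \<dots> * P" using c_en(1) c_nonneg U0 by (intro m) auto
    finally show "2 * (c_en * ip D w w) \<le> 2 * (c_en * (c_2 * U)) * P" .
    show "c_en * integral\<^sup>L \<mu> (\<lambda>x. (w x)\<^sup>2 * (b x)\<^sup>2) \<le> c_en * (c_4 * U * (c_q * P))"
      using wb unfolding U_def P_def by (intro mult_left_mono c_en)
    have "c_en * I4 w \<le> c_en * (sobolev_const * U\<^sup>2)" using w4 unfolding U_def by (intro mult_left_mono c_en)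
    also have "\<dots> \<le> \<dots> * P" using c_en(1) sobolev_const_nonneg by (intro m) auto
    finally show "c_en * I4 w \<le> c_en * (sobolev_const * U\<^sup>2) * P" .
  qed
  also have "\<dots> \<le> C_r * (U + U\<^sup>2) * P"
  proof -
    have "C_r * (U + U\<^sup>2) * P - (U * P + 2 * (c_en * (c_2 * U)) * P + c_en * (c_4 * U * (c_q * P)) + c_en * (sobolev_const * U\<^sup>2) * P)
      = (1 + 2 * c_en * c_2 + c_en * c_4 * c_q) * U\<^sup>2 * P + c_en * sobolev_const * U * P"
      by (simp add: C_r_def algebra_simps)
    moreover have "0 \<le> \<dots>" using c_nonneg c_en(1) sobolev_const_nonneg U0 P1 by (auto simp: P_def intro!: add_nonneg_nonneg mult_nonneg_nonneg)
    ultimately show ?thesis by linarith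
  qed
  finally show ?thesis using step unfolding sq by (simp add: U_def P_def)
qed

text \<open>The difference of the two equations is tested with \<open>Ah_inv\<close> of the
  difference \<open>d\<close> of the solutions. The defect of monotonicity is a multiple of the
  squared \<open>L2\<close> norm of \<open>d\<close>, which interpolates between the gradient norms
  of \<open>d\<close> and of its inverse image; \<open>k * \<beta>^2 \<le> 2\<close> leaves half of
  the left-hand side.\<close>

lemma solution_stability:
  assumes a: "a \<in> S0" "a' \<in> S0" and r: "r \<in> S0" "r' \<in> S0" and k: "0 < k" "k \<le> k_1"
    and weak: "\<And>z. z \<in> S \<Longrightarrow> ip D a z + k * gip D (Y a) z = ip D r z"
      "\<And>z. z \<in> S \<Longrightarrow> ip D a' z + k * gip D (Y a') z = ip D r' z"
  shows "gip D (Ah_inv D \<T> (\<lambda>x. a x - a' x)) (Ah_inv D \<T> (\<lambda>x. a x - a' x)) \<le> 2 * ip D (\<lambda>x. r x - r' x) (Ah_inv D \<T> (\<lambda>x. a x - a' x))"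
proof -
  define d where "d = (\<lambda>x. a x - a' x)"
  define G where "G = Ah_inv D \<T> d"
  have aS: "a \<in> S" "a' \<in> S" "r \<in> S" "r' \<in> S" using a r by (auto intro: S0_S)
  have d0: "d \<in> S0" unfolding d_def using S0_lincomb[OF a, of 1 "-1"] by simp
  have d: "d \<in> S" using d0 by (rule S0_S)
  have G: "G \<in> S" "A G = d" using Ah_inv[OF d0] by (auto simp: G_def intro: S0_S)
  have y: "Y a \<in> S" "Y a' \<in> S" using aS by (auto intro: Y_S)
  have E1: "ip D d G + k * (gip D (Y a) G - gip D (Y a') G) = ip D (\<lambda>x. r x - r' x) G"
    unfolding d_def using weak(1)[OF G(1)] weak(2)[OF G(1)] aS G(1)
    by (simp add: ip_diff S_L2 algebra_simps)
  have E2: "gip D (Y a) G - gip D (Y a') G = ip D (Y a) d - ip D (Y a') d"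
    using gip_ip[OF G(1) y(1)] gip_ip[OF G(1) y(2)] G(2) by simp
  have E3: "ip D (Y a) d - ip D (Y a') d = gip D d d + (ip D (\<lambda>x. f (a x)) d - ip D (\<lambda>x. f (a' x)) d)"
    using ip_Y[OF aS(1) d] ip_Y[OF aS(2) d] gip_lincomb[OF S_H1[OF aS(1)] S_H1[OF aS(2)] S_H1[OF d], of 1 "-1"]
    by (simp add: d_def)
  have E4: "- \<beta> * ip D d d \<le> ip D (\<lambda>x. f (a x)) d - ip D (\<lambda>x. f (a' x)) d"
  proof -
    have B: "bm a" "bm a'" "bm d" using aS d by (auto intro: S_bm)
    have "- \<beta> * ip D d d = integral\<^sup>L \<mu> (\<lambda>x. - \<beta> * (d x)\<^sup>2)" by (simp add: ip_def power2_eq_square)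
    also have "\<dots> \<le> integral\<^sup>L \<mu> (\<lambda>x. f (a x) * d x - f (a' x) * d x)"
    proof (intro integral_mono bm_integrable)
      fix x show "- \<beta> * (d x)\<^sup>2 \<le> f (a x) * d x - f (a' x) * d x"
        using beta(2)[of "a x" "a' x"] by (simp add: d_def algebra_simps)
    qed (use B in \<open>auto intro!: bm_diff bm_mult bm_power bm_poly\<close>)
    also have "\<dots> = ip D (\<lambda>x. f (a x)) d - ip D (\<lambda>x. f (a' x)) d"
      unfolding ip_def using bm_integrable[OF bm_mult[OF bm_poly[OF B(1), of "pderiv F"] B(3)]] bm_integrable[OF bm_mult[OF bm_poly[OF B(2), of "pderiv F"] B(3)]] by simp
    finally show ?thesis .
  qed
  have "k * (gip D d d - \<beta> * ip D d d) \<le> k * (gip D (Y a) G - gip D (Y a') G)"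
    unfolding E2 E3 using E4 k by (intro mult_left_mono) auto
  hence 1: "ip D d G + k * (gip D d d - \<beta> * ip D d d) \<le> ip D (\<lambda>x. r x - r' x) G" using E1 by linarith
  have 2: "ip D d G = gip D G G" using ip_Ah[OF G(1) G(1)] G(2) by simp
  have "ip D d d = gip D G d" using ip_Ah[OF G(1) d] G(2) by simp
  also have "\<dots> \<le> sn1 D d * sn1 D G" using gip_le_sn1[OF S_H1[OF G(1)] S_H1[OF d]] by (simp add: mult.commute)
  finally have "\<beta> * ip D d d \<le> \<beta> * (sn1 D d * sn1 D G)" using beta(1) by (intro mult_left_mono)
  also have "\<dots> = sn1 D d * (\<beta> * sn1 D G)" by simp
  also have "\<dots> \<le> 1 * (sn1 D d)\<^sup>2 + (\<beta> * sn1 D G)\<^sup>2 / (4 * 1)" by (rule young) simp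
  also have "\<dots> = gip D d d + \<beta>\<^sup>2 * gip D G G / 4" by (simp add: sn1_sq power_mult_distrib)
  finally have "k * (\<beta> * ip D d d) \<le> k * (gip D d d + \<beta>\<^sup>2 * gip D G G / 4)" using k by (intro mult_left_mono) auto
  hence 3: "- (k * \<beta>\<^sup>2) * gip D G G / 4 \<le> k * (gip D d d - \<beta> * ip D d d)" by (simp add: algebra_simps)
  have "(k * \<beta>\<^sup>2) * gip D G G \<le> 2 * gip D G G" using k by (intro mult_right_mono k_1_le gip_self_nonneg)
  hence "gip D G G \<le> 2 * ip D (\<lambda>x. r x - r' x) G" using 1 2 3 by simp
  thus ?thesis by (simp add: G_def d_def)
qed

end

section \<open>A stochastic Gronwall inequality\<close>

text \<open>The linear term is kept exact because it will carry a martingale difference of mean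
  zero; only the remainder is estimated.\<close>

lemma bernoulli_upper:
  fixes x :: real
  assumes "0 \<le> 1 + x"
  shows "(1 + x) ^ q \<le> 1 + real q * x + (real q)\<^sup>2 * x\<^sup>2 * (1 + \<bar>x\<bar>) ^ q"
proof (induction q)
  case (Suc q)
  define E where "E = (1 + \<bar>x\<bar>) ^ Suc q"
  have E1: "1 \<le> E" unfolding E_def by (rule one_le_power) simp
  have "(1 + x) ^ Suc q = (1 + x) * (1 + x) ^ q" by simp
  also have "\<dots> \<le> (1 + x) * (1 + real q * x + (real q)\<^sup>2 * x\<^sup>2 * (1 + \<bar>x\<bar>) ^ q)"
    by (intro mult_left_mono Suc.IH assms)
  also have "\<dots> = 1 + real (Suc q) * x + real q * x\<^sup>2 * 1 + (real q)\<^sup>2 * x\<^sup>2 * ((1 + x) * (1 + \<bar>x\<bar>) ^ q)"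
    by (simp add: algebra_simps power2_eq_square)
  also have "\<dots> \<le> 1 + real (Suc q) * x + real q * x\<^sup>2 * E + (real q)\<^sup>2 * x\<^sup>2 * E"
  proof (intro add_mono mult_left_mono order_refl E1)
    show "(1 + x) * (1 + \<bar>x\<bar>) ^ q \<le> E" unfolding E_def power_Suc by (intro mult_right_mono) auto
  qed auto
  also have "\<dots> = 1 + real (Suc q) * x + (real q + (real q)\<^sup>2) * x\<^sup>2 * E" by (simp add: algebra_simps)
  also have "\<dots> \<le> 1 + real (Suc q) * x + (real (Suc q))\<^sup>2 * x\<^sup>2 * E"
    using E1 by (intro add_left_mono mult_right_mono) (auto simp: power2_eq_square algebra_simps)
  finally show ?case by (simp add: E_def)
qed simp

lemma power_double_Suc: "x ^ Suc (Suc (2 * p)) = (x ^ Suc p)\<^sup>2" for x :: real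
proof -
  have "Suc (Suc (2 * p)) = Suc p + Suc p" by simp
  thus ?thesis by (simp only: power_add power2_eq_square)
qed

text \<open>Coefficient of the random factor in the expansion of a power: the first summand comes
  from the drift, the second from the quadratic remainder.\<close>

definition gr_H :: "real \<Rightarrow> nat \<Rightarrow> real" where
  "gr_H c q = 2 * real q * c + 9 * (real q)\<^sup>2 * c\<^sup>2 * (1 + 3 * c) ^ q"

lemma gr_H_nonneg: "0 \<le> c \<Longrightarrow> 0 \<le> gr_H c q"
  by (simp add: gr_H_def)

text \<open>Expansion around \<open>u\<close> in the relative increment \<open>x\<close>. For
  \<open>z \<le> 1\<close> the remainder is of order \<open>z\<close>; for \<open>z \<ge> 1\<close>
  it is of order \<open>z^4\<close> times \<open>(z^2)^(p + 1)\<close>, which is the origin of the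
  exponent \<open>2 * p + 6\<close>.\<close>

lemma power_step:
  fixes u m s z c :: real
  assumes u: "0 < u" and s: "0 \<le> s" "s \<le> u + m + c * (z + z\<^sup>2) * u" and m: "\<bar>m\<bar> \<le> c * sqrt z * u"
    and z: "0 \<le> z" and c: "0 \<le> c"
  shows "s ^ Suc p \<le> u ^ Suc p + real (Suc p) * u ^ p * m + gr_H c (Suc p) * (u ^ Suc p * (z + z ^ (2 * p + 6)))"
proof -
  define q where "q = Suc p"
  define Z where "Z = z + z ^ (2 * p + 6)"
  define x where "x = m / u + c * (z + z\<^sup>2)"
  have ux: "u * (1 + x) = u + m + c * (z + z\<^sup>2) * u" using u by (simp add: x_def field_simps)
  have x1: "0 \<le> 1 + x" using s u unfolding ux[symmetric] by (metis order_trans zero_le_mult_iff not_less)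
  have "\<bar>m / u\<bar> \<le> c * sqrt z" using m u by (simp add: field_simps abs_mult)
  hence xb: "\<bar>x\<bar> \<le> c * (sqrt z + z + z\<^sup>2)"
  proof -
    have "0 \<le> c * (z + z\<^sup>2)" using c z by simp
    moreover have "\<bar>x\<bar> \<le> \<bar>m / u\<bar> + \<bar>c * (z + z\<^sup>2)\<bar>" unfolding x_def by (rule abs_triangle_ineq)
    ultimately have "\<bar>x\<bar> \<le> c * sqrt z + c * (z + z\<^sup>2)" using \<open>\<bar>m / u\<bar> \<le> c * sqrt z\<close> by linarith
    thus ?thesis by (simp add: distrib_left)
  qed
  have Z: "z + z\<^sup>2 \<le> 2 * Z" "x\<^sup>2 * (1 + \<bar>x\<bar>) ^ q \<le> 9 * c\<^sup>2 * (1 + 3 * c) ^ q * Z"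
  proof -
    have "z + z\<^sup>2 \<le> 2 * Z \<and> x\<^sup>2 * (1 + \<bar>x\<bar>) ^ q \<le> 9 * c\<^sup>2 * (1 + 3 * c) ^ q * Z"
    proof (cases "z \<le> 1")
      case True
      have zz: "z\<^sup>2 \<le> z" using True z by (simp add: power2_eq_square mult_left_le)
      have zs: "z \<le> sqrt z" using zz z by (simp add: real_le_rsqrt)
      have s1: "sqrt z \<le> 1" using True by simp
      have "c * (sqrt z + z + z\<^sup>2) \<le> c * (3 * sqrt z)" using zz zs c by (intro mult_left_mono) auto
      hence xb': "\<bar>x\<bar> \<le> 3 * c * sqrt z" using xb by simp
      have "3 * c * sqrt z \<le> 3 * c * 1" using s1 c by (intro mult_left_mono) auto
      hence xb'': "\<bar>x\<bar> \<le> 3 * c" using xb' by simp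
      have "x\<^sup>2 * (1 + \<bar>x\<bar>) ^ q \<le> (3 * c * sqrt z)\<^sup>2 * (1 + 3 * c) ^ q"
      proof (rule mult_mono)
        show "x\<^sup>2 \<le> (3 * c * sqrt z)\<^sup>2" using power_mono[OF xb', of 2] by simp
        show "(1 + \<bar>x\<bar>) ^ q \<le> (1 + 3 * c) ^ q" using xb'' by (intro power_mono) auto
      qed auto
      also have "\<dots> = 9 * c\<^sup>2 * (1 + 3 * c) ^ q * z" using z by (simp add: power_mult_distrib)
      also have "\<dots> \<le> 9 * c\<^sup>2 * (1 + 3 * c) ^ q * Z" using z c by (intro mult_left_mono) (auto simp: Z_def)
      finally have 1: "x\<^sup>2 * (1 + \<bar>x\<bar>) ^ q \<le> 9 * c\<^sup>2 * (1 + 3 * c) ^ q * Z" .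
      have "0 \<le> z ^ (2 * p + 6)" using z by simp
      hence "z + z\<^sup>2 \<le> 2 * Z" using zz z unfolding Z_def distrib_left by linarith
      thus ?thesis using 1 by blast
    next
      case False
      hence z1: "1 \<le> z" by simp
      have sz: "sqrt z \<le> z" using z1 by (simp add: real_le_lsqrt power2_eq_square)
      have zz: "z \<le> z\<^sup>2" using z1 by (simp add: power2_eq_square)
      have "c * (sqrt z + z + z\<^sup>2) \<le> c * (3 * z\<^sup>2)" using zz sz c by (intro mult_left_mono) auto
      hence xb': "\<bar>x\<bar> \<le> 3 * c * z\<^sup>2" using xb by simp
      have "1 + 3 * c * z\<^sup>2 \<le> (1 + 3 * c) * z\<^sup>2" using z1 one_le_power[OF z1, of 2] by (simp add: algebra_simps)
      hence xb'': "1 + \<bar>x\<bar> \<le> (1 + 3 * c) * z\<^sup>2" using xb' by linarith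
      have "x\<^sup>2 * (1 + \<bar>x\<bar>) ^ q \<le> (3 * c * z\<^sup>2)\<^sup>2 * ((1 + 3 * c) * z\<^sup>2) ^ q"
      proof (rule mult_mono)
        show "x\<^sup>2 \<le> (3 * c * z\<^sup>2)\<^sup>2" using power_mono[OF xb', of 2] by simp
        show "(1 + \<bar>x\<bar>) ^ q \<le> ((1 + 3 * c) * z\<^sup>2) ^ q" using xb'' by (intro power_mono) auto
      qed auto
      also have "\<dots> = 9 * c\<^sup>2 * (1 + 3 * c) ^ q * z ^ (2 * p + 6)"
        by (simp add: power_mult_distrib power_mult[symmetric] power_add[symmetric] q_def mult_ac)
           (simp add: power_add[symmetric] eval_nat_numeral)
      also have "\<dots> \<le> 9 * c\<^sup>2 * (1 + 3 * c) ^ q * Z" using z c by (intro mult_left_mono) (auto simp: Z_def)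
      finally have 1: "x\<^sup>2 * (1 + \<bar>x\<bar>) ^ q \<le> 9 * c\<^sup>2 * (1 + 3 * c) ^ q * Z" .
      have "z\<^sup>2 \<le> z ^ (2 * p + 6)" using z1 by (intro power_increasing) auto
      hence "z + z\<^sup>2 \<le> 2 * Z" using z1 zero_le_power2[of z] unfolding Z_def distrib_left by linarith
      thus ?thesis using 1 by blast
    qed
    thus "z + z\<^sup>2 \<le> 2 * Z" "x\<^sup>2 * (1 + \<bar>x\<bar>) ^ q \<le> 9 * c\<^sup>2 * (1 + 3 * c) ^ q * Z" by auto
  qed
  have "s ^ q \<le> (u * (1 + x)) ^ q" using s unfolding ux by (intro power_mono) auto
  also have "\<dots> = u ^ q * (1 + x) ^ q" by (simp add: power_mult_distrib)
  also have "\<dots> \<le> u ^ q * (1 + real q * x + (real q)\<^sup>2 * x\<^sup>2 * (1 + \<bar>x\<bar>) ^ q)"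
    using u by (intro mult_left_mono bernoulli_upper x1) auto
  also have "\<dots> \<le> u ^ q * (1 + real q * (m / u) + gr_H c q * Z)"
  proof (rule mult_left_mono)
    have "real q * x = real q * (m / u) + real q * c * (z + z\<^sup>2)" by (simp add: x_def algebra_simps)
    also have "\<dots> \<le> real q * (m / u) + real q * c * (2 * Z)" using c Z by (intro add_left_mono mult_left_mono) auto
    finally have 1: "real q * x \<le> real q * (m / u) + 2 * real q * c * Z" by simp
    have "(real q)\<^sup>2 * x\<^sup>2 * (1 + \<bar>x\<bar>) ^ q = (real q)\<^sup>2 * (x\<^sup>2 * (1 + \<bar>x\<bar>) ^ q)" by simp
    also have "\<dots> \<le> (real q)\<^sup>2 * (9 * c\<^sup>2 * (1 + 3 * c) ^ q * Z)" by (intro mult_left_mono Z) auto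
    finally have 2: "(real q)\<^sup>2 * x\<^sup>2 * (1 + \<bar>x\<bar>) ^ q \<le> 9 * (real q)\<^sup>2 * c\<^sup>2 * (1 + 3 * c) ^ q * Z" by simp
    have "gr_H c q * Z = 2 * real q * c * Z + 9 * (real q)\<^sup>2 * c\<^sup>2 * (1 + 3 * c) ^ q * Z" by (simp add: gr_H_def distrib_right)
    thus "1 + real q * x + (real q)\<^sup>2 * x\<^sup>2 * (1 + \<bar>x\<bar>) ^ q \<le> 1 + real q * (m / u) + gr_H c q * Z"
      using 1 2 by linarith
  qed (use u in auto)
  also have "\<dots> = u ^ q + real q * u ^ p * m + gr_H c q * (u ^ q * Z)"
    using u by (simp add: q_def field_simps)
  finally show ?thesis by (simp add: q_def Z_def)
qed

text \<open>\<open>Z n\<close> and \<open>m n\<close> belong to the step from \<open>n\<close> to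
  \<open>n + 1\<close>, so \<open>m n\<close> is measurable with respect to
  \<open>Fm (Suc n)\<close>. The martingale property is stated without conditional expectations, as
  orthogonality to variables \<open>V\<close> of the past.\<close>

locale noise_steps = prob_space M for M :: "'w measure" +
  fixes Fm :: "nat \<Rightarrow> 'w measure" and Z m S :: "nat \<Rightarrow> 'w \<Rightarrow> real" and N :: nat and c k s0 :: real and \<kappa> :: "nat \<Rightarrow> real"
  assumes sub: "\<And>n. n \<le> N \<Longrightarrow> subalgebra M (Fm n)"
    and mono: "\<And>n. n < N \<Longrightarrow> subalgebra (Fm (Suc n)) (Fm n)"
    and S_adapted: "\<And>n. n \<le> N \<Longrightarrow> S n \<in> borel_measurable (Fm n)"
    and m_adapted: "\<And>n. n < N \<Longrightarrow> m n \<in> borel_measurable (Fm (Suc n))"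
    and Z_measurable: "\<And>n. n < N \<Longrightarrow> Z n \<in> borel_measurable M"
    and S_ge_1: "\<And>n \<omega>. 1 \<le> S n \<omega>" and Z_nonneg: "\<And>n \<omega>. 0 \<le> Z n \<omega>"
    and indep: "\<And>n V i. n < N \<Longrightarrow> V \<in> borel_measurable (Fm n) \<Longrightarrow> 
       (\<integral>\<^sup>+\<omega>. V \<omega> * ennreal (Z n \<omega> ^ i) \<partial>M) = (\<integral>\<^sup>+\<omega>. V \<omega> \<partial>M) * (\<integral>\<^sup>+\<omega>. ennreal (Z n \<omega> ^ i) \<partial>M)"
    and mart: "\<And>n V. n < N \<Longrightarrow> V \<in> borel_measurable (Fm n) \<Longrightarrow> integrable M (\<lambda>\<omega>. V \<omega> * S n \<omega>) \<Longrightarrow> 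
       integral\<^sup>L M (\<lambda>\<omega>. V \<omega> * m n \<omega>) = 0"
    and m_bound: "\<And>n. n < N \<Longrightarrow> AE \<omega> in M. \<bar>m n \<omega>\<bar> \<le> c * sqrt (Z n \<omega>) * S n \<omega>"
    and step: "\<And>n. n < N \<Longrightarrow> AE \<omega> in M. S (Suc n) \<omega> \<le> S n \<omega> + m n \<omega> + c * (Z n \<omega> + (Z n \<omega>)\<^sup>2) * S n \<omega>"
    and Z_moment: "\<And>n i. n < N \<Longrightarrow> 1 \<le> i \<Longrightarrow> (\<integral>\<^sup>+\<omega>. ennreal (Z n \<omega> ^ i) \<partial>M) \<le> ennreal (\<kappa> i * k)"
    and S_0: "AE \<omega> in M. S 0 \<omega> \<le> s0" and s0: "1 \<le> s0" and c: "0 \<le> c" and k: "0 < k" and \<kappa>: "\<And>i. 0 \<le> \<kappa> i"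
begin

section \<open>Moments by induction on the time step\<close>

lemma sub_mono: "j \<le> n \<Longrightarrow> n \<le> N \<Longrightarrow> subalgebra (Fm n) (Fm j)"
proof (induction n rule: dec_induct)
  case (step n)
  thus ?case using mono[of n] unfolding subalgebra_def by auto
qed (simp add: subalgebra_def)

lemma adapted_mono: "j \<le> n \<Longrightarrow> n \<le> N \<Longrightarrow> V \<in> borel_measurable (Fm j) \<Longrightarrow> V \<in> borel_measurable (Fm n)"
  using measurable_from_subalg sub_mono by blast

lemma adapted_M: "n \<le> N \<Longrightarrow> V \<in> borel_measurable (Fm n) \<Longrightarrow> V \<in> borel_measurable M"
  using measurable_from_subalg sub by blast

lemma S_M: "n \<le> N \<Longrightarrow> S n \<in> borel_measurable M"
  using S_adapted adapted_M by blast

lemma m_M: "n < N \<Longrightarrow> m n \<in> borel_measurable M"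
  using m_adapted adapted_M[of "Suc n"] by auto

lemma indep_moment:
  assumes n: "n < N" and V: "V \<in> borel_measurable (Fm n)" and V0: "\<And>\<omega>. 0 \<le> V \<omega>" and Vi: "integrable M V" and i: "1 \<le> i"
  shows "integrable M (\<lambda>\<omega>. V \<omega> * Z n \<omega> ^ i)" "integral\<^sup>L M (\<lambda>\<omega>. V \<omega> * Z n \<omega> ^ i) \<le> \<kappa> i * k * integral\<^sup>L M V"
proof -
  have VM: "V \<in> borel_measurable M" using V n by (intro adapted_M) auto
  have Vnn: "0 \<le> integral\<^sup>L M V" using V0 by simp
  have ZM[measurable]: "Z n \<in> borel_measurable M" using Z_measurable n by blast
  have "(\<integral>\<^sup>+\<omega>. ennreal (V \<omega> * Z n \<omega> ^ i) \<partial>M) = (\<integral>\<^sup>+\<omega>. ennreal (V \<omega>) * ennreal (Z n \<omega> ^ i) \<partial>M)"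
    using V0 Z_nonneg by (simp add: ennreal_mult)
  also have "\<dots> = (\<integral>\<^sup>+\<omega>. ennreal (V \<omega>) \<partial>M) * (\<integral>\<^sup>+\<omega>. ennreal (Z n \<omega> ^ i) \<partial>M)"
    using V by (intro indep n) auto
  also have "(\<integral>\<^sup>+\<omega>. ennreal (V \<omega>) \<partial>M) = ennreal (integral\<^sup>L M V)"
    using V0 by (intro nn_integral_eq_integral Vi) auto
  also have "ennreal (integral\<^sup>L M V) * (\<integral>\<^sup>+\<omega>. ennreal (Z n \<omega> ^ i) \<partial>M) \<le> ennreal (integral\<^sup>L M V) * ennreal (\<kappa> i * k)"
    by (intro mult_left_mono Z_moment n i) auto
  also have "\<dots> = ennreal (\<kappa> i * k * integral\<^sup>L M V)"
    using Vnn by (simp add: ennreal_mult[symmetric] \<kappa> k less_imp_le mult.commute)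
  finally have le: "(\<integral>\<^sup>+\<omega>. ennreal (V \<omega> * Z n \<omega> ^ i) \<partial>M) \<le> ennreal (\<kappa> i * k * integral\<^sup>L M V)" .
  show I: "integrable M (\<lambda>\<omega>. V \<omega> * Z n \<omega> ^ i)"
  proof (rule integrableI_nonneg)
    show "(\<integral>\<^sup>+\<omega>. ennreal (V \<omega> * Z n \<omega> ^ i) \<partial>M) < \<infinity>" using le by (auto intro: le_less_trans)
  qed (use VM V0 Z_nonneg in auto)
  have "ennreal (integral\<^sup>L M (\<lambda>\<omega>. V \<omega> * Z n \<omega> ^ i)) \<le> ennreal (\<kappa> i * k * integral\<^sup>L M V)"
    using le V0 Z_nonneg by (subst nn_integral_eq_integral[symmetric]) (auto intro!: I)
  thus "integral\<^sup>L M (\<lambda>\<omega>. V \<omega> * Z n \<omega> ^ i) \<le> \<kappa> i * k * integral\<^sup>L M V"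
    using Vnn \<kappa> k by (subst (asm) ennreal_le_iff) auto
qed

text \<open>The square root of \<open>Z\<close> is at most \<open>1 + Z\<close>, and
  \<open>Z\<close> is integrable against integrable functions of the past by independence.\<close>

lemma mart_integrable:
  assumes n: "n < N" and V: "V \<in> borel_measurable (Fm n)" and VS: "integrable M (\<lambda>\<omega>. V \<omega> * S n \<omega>)"
  shows "integrable M (\<lambda>\<omega>. V \<omega> * m n \<omega>)"
proof (rule Bochner_Integration.integrable_bound)
  have n': "n \<le> N" using n by simp
  have i1: "integrable M (\<lambda>\<omega>. \<bar>V \<omega> * S n \<omega>\<bar>)" using VS by simp
  have "integrable M (\<lambda>\<omega>. \<bar>V \<omega> * S n \<omega>\<bar> * Z n \<omega> ^ 1)"
    using V S_adapted[OF n'] by (intro indep_moment(1) n i1) auto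
  thus "integrable M (\<lambda>\<omega>. c * (\<bar>V \<omega> * S n \<omega>\<bar> + \<bar>V \<omega> * S n \<omega>\<bar> * Z n \<omega> ^ 1))"
    using i1 by (intro integrable_mult_right Bochner_Integration.integrable_add)
  show "AE \<omega> in M. norm (V \<omega> * m n \<omega>) \<le> norm (c * (\<bar>V \<omega> * S n \<omega>\<bar> + \<bar>V \<omega> * S n \<omega>\<bar> * Z n \<omega> ^ 1))"
    using m_bound[OF n]
  proof eventually_elim
    case (elim \<omega>)
    have sq: "sqrt (Z n \<omega>) \<le> 1 + Z n \<omega>"
      using Z_nonneg[of n \<omega>] by (intro real_le_lsqrt) (auto simp: power2_eq_square algebra_simps)
    have "\<bar>V \<omega> * m n \<omega>\<bar> \<le> \<bar>V \<omega>\<bar> * (c * sqrt (Z n \<omega>) * S n \<omega>)" unfolding abs_mult by (intro mult_left_mono elim) auto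
    also have "\<dots> \<le> \<bar>V \<omega>\<bar> * (c * (1 + Z n \<omega>) * S n \<omega>)"
      using c sq S_ge_1[of n \<omega>] by (intro mult_left_mono mult_right_mono) auto
    also have "\<dots> = c * (\<bar>V \<omega> * S n \<omega>\<bar> + \<bar>V \<omega> * S n \<omega>\<bar> * Z n \<omega> ^ 1)"
      using S_ge_1[of n \<omega>] by (simp add: abs_mult algebra_simps)
    finally show ?case by simp
  qed
  show "(\<lambda>\<omega>. V \<omega> * m n \<omega>) \<in> borel_measurable M"
    using adapted_M[OF n' V] m_M[OF n] by simp
qed

abbreviation "r p \<equiv> 2 * p + 6"

text \<open>Rate of the recursion for the moment of order \<open>p + 1\<close>: \<open>gr_H\<close>
  times the moment constants of \<open>Z\<close> and of its power \<open>r p\<close>.\<close>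

definition "Kq p = gr_H c (Suc p) * (\<kappa> 1 + \<kappa> (r p))"

lemma Kq_nonneg: "0 \<le> Kq p"
  unfolding Kq_def using \<kappa> c by (intro mult_nonneg_nonneg gr_H_nonneg add_nonneg_nonneg)

lemma step_AE:
  assumes "n < N"
  shows "AE \<omega> in M. S (Suc n) \<omega> ^ Suc p \<le> S n \<omega> ^ Suc p + real (Suc p) * S n \<omega> ^ p * m n \<omega> 
     + gr_H c (Suc p) * (S n \<omega> ^ Suc p * (Z n \<omega> + Z n \<omega> ^ r p))"
  using m_bound[OF assms] step[OF assms]
proof eventually_elim
  case (elim \<omega>)
  show ?case
    using S_ge_1[of n \<omega>] S_ge_1[of "Suc n" \<omega>] Z_nonneg[of n \<omega>] elim c by (intro power_step) auto
qed

lemma rest_integral: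
  assumes n: "n < N" and Si: "integrable M (\<lambda>\<omega>. S n \<omega> ^ Suc p)"
  shows "integrable M (\<lambda>\<omega>. gr_H c (Suc p) * (S n \<omega> ^ Suc p * (Z n \<omega> + Z n \<omega> ^ r p)))"
    "integral\<^sup>L M (\<lambda>\<omega>. gr_H c (Suc p) * (S n \<omega> ^ Suc p * (Z n \<omega> + Z n \<omega> ^ r p))) \<le> Kq p * k * integral\<^sup>L M (\<lambda>\<omega>. S n \<omega> ^ Suc p)"
proof -
  have S0: "0 \<le> S n \<omega>" for \<omega> using S_ge_1[of n \<omega>] by simp
  have ad: "(\<lambda>\<omega>. S n \<omega> ^ Suc p) \<in> borel_measurable (Fm n)" using S_adapted[of n] n by auto
  have eq: "(\<lambda>\<omega>. S n \<omega> ^ Suc p * (Z n \<omega> + Z n \<omega> ^ r p)) = (\<lambda>\<omega>. S n \<omega> ^ Suc p * Z n \<omega> ^ 1 + S n \<omega> ^ Suc p * Z n \<omega> ^ r p)"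
    by (auto simp: distrib_left)
  have I: "integrable M (\<lambda>\<omega>. S n \<omega> ^ Suc p * Z n \<omega> ^ i)" "integral\<^sup>L M (\<lambda>\<omega>. S n \<omega> ^ Suc p * Z n \<omega> ^ i) \<le> \<kappa> i * k * integral\<^sup>L M (\<lambda>\<omega>. S n \<omega> ^ Suc p)"
    if "1 \<le> i" for i using indep_moment[OF n ad _ Si that] S0 by simp_all
  have I2: "integrable M (\<lambda>\<omega>. S n \<omega> ^ Suc p * (Z n \<omega> + Z n \<omega> ^ r p))"
    unfolding eq by (intro Bochner_Integration.integrable_add I) auto
  thus "integrable M (\<lambda>\<omega>. gr_H c (Suc p) * (S n \<omega> ^ Suc p * (Z n \<omega> + Z n \<omega> ^ r p)))" by simp
  have "integral\<^sup>L M (\<lambda>\<omega>. S n \<omega> ^ Suc p * (Z n \<omega> + Z n \<omega> ^ r p)) 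
     = integral\<^sup>L M (\<lambda>\<omega>. S n \<omega> ^ Suc p * Z n \<omega> ^ 1) + integral\<^sup>L M (\<lambda>\<omega>. S n \<omega> ^ Suc p * Z n \<omega> ^ r p)"
    unfolding eq by (intro Bochner_Integration.integral_add I) auto
  also have "\<dots> \<le> \<kappa> 1 * k * integral\<^sup>L M (\<lambda>\<omega>. S n \<omega> ^ Suc p) + \<kappa> (r p) * k * integral\<^sup>L M (\<lambda>\<omega>. S n \<omega> ^ Suc p)"
    by (intro add_mono I) auto
  finally have "integral\<^sup>L M (\<lambda>\<omega>. S n \<omega> ^ Suc p * (Z n \<omega> + Z n \<omega> ^ r p)) \<le> (\<kappa> 1 + \<kappa> (r p)) * k * integral\<^sup>L M (\<lambda>\<omega>. S n \<omega> ^ Suc p)"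
    by (simp add: algebra_simps)
  hence "gr_H c (Suc p) * integral\<^sup>L M (\<lambda>\<omega>. S n \<omega> ^ Suc p * (Z n \<omega> + Z n \<omega> ^ r p)) \<le> gr_H c (Suc p) * ((\<kappa> 1 + \<kappa> (r p)) * k * integral\<^sup>L M (\<lambda>\<omega>. S n \<omega> ^ Suc p))"
    by (intro mult_left_mono gr_H_nonneg c)
  thus "integral\<^sup>L M (\<lambda>\<omega>. gr_H c (Suc p) * (S n \<omega> ^ Suc p * (Z n \<omega> + Z n \<omega> ^ r p))) \<le> Kq p * k * integral\<^sup>L M (\<lambda>\<omega>. S n \<omega> ^ Suc p)"
    by (simp add: Kq_def mult.assoc)
qed

text \<open>The martingale term drops out in the mean, so each step multiplies the bound by
  \<open>1 + Kq p * k\<close>. Integrability is carried through the same induction, because the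
  martingale property presupposes it.\<close>

lemma moment:
  assumes "n \<le> N"
  shows "integrable M (\<lambda>\<omega>. S n \<omega> ^ Suc p)" "integral\<^sup>L M (\<lambda>\<omega>. S n \<omega> ^ Suc p) \<le> s0 ^ Suc p * (1 + Kq p * k) ^ n"
proof -
  have "integrable M (\<lambda>\<omega>. S n \<omega> ^ Suc p) \<and> integral\<^sup>L M (\<lambda>\<omega>. S n \<omega> ^ Suc p) \<le> s0 ^ Suc p * (1 + Kq p * k) ^ n"
    using assms
  proof (induction n)
    case 0
    have b: "AE \<omega> in M. S 0 \<omega> ^ Suc p \<le> s0 ^ Suc p" using S_0
    proof eventually_elim
      case (elim \<omega>) thus ?case using S_ge_1[of 0 \<omega>] by (intro power_mono) auto
    qed
    have I: "integrable M (\<lambda>\<omega>. S 0 \<omega> ^ Suc p)"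
    proof (rule integrable_const_bound[where B = "s0 ^ Suc p"])
      show "AE \<omega> in M. norm (S 0 \<omega> ^ Suc p) \<le> s0 ^ Suc p" using b
      proof eventually_elim
        case (elim \<omega>)
        have "0 \<le> S 0 \<omega>" using S_ge_1[of 0 \<omega>] by linarith
        thus ?case using elim by simp
      qed
    qed (use S_M[of 0] in auto)
    have "integral\<^sup>L M (\<lambda>\<omega>. S 0 \<omega> ^ Suc p) \<le> integral\<^sup>L M (\<lambda>\<omega>. s0 ^ Suc p)"
      by (intro integral_mono_AE I b) auto
    also have "\<dots> = s0 ^ Suc p" by (simp add: prob_space)
    finally show ?case using I by simp
  next
    case (Suc n)
    hence n: "n < N" and IH: "integrable M (\<lambda>\<omega>. S n \<omega> ^ Suc p)" "integral\<^sup>L M (\<lambda>\<omega>. S n \<omega> ^ Suc p) \<le> s0 ^ Suc p * (1 + Kq p * k) ^ n" by auto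
    have V: "(\<lambda>\<omega>. real (Suc p) * S n \<omega> ^ p) \<in> borel_measurable (Fm n)" using S_adapted[of n] n by auto
    have VS: "integrable M (\<lambda>\<omega>. (real (Suc p) * S n \<omega> ^ p) * S n \<omega>)"
      using integrable_mult_right[OF IH(1), of "real (Suc p)"] by (simp add: mult_ac)
    note mi = mart_integrable[OF n V VS] and m0 = mart[OF n V VS] and ri = rest_integral[OF n IH(1)]
    define R where "R = (\<lambda>\<omega>. S n \<omega> ^ Suc p + real (Suc p) * S n \<omega> ^ p * m n \<omega> 
     + gr_H c (Suc p) * (S n \<omega> ^ Suc p * (Z n \<omega> + Z n \<omega> ^ r p)))"
    have Ri: "integrable M R" unfolding R_def by (intro Bochner_Integration.integrable_add IH mi ri)
    have I: "integrable M (\<lambda>\<omega>. S (Suc n) \<omega> ^ Suc p)"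
    proof (rule Bochner_Integration.integrable_bound[OF Ri])
      show "AE \<omega> in M. norm (S (Suc n) \<omega> ^ Suc p) \<le> norm (R \<omega>)"
        using step_AE[OF n, of p]
      proof eventually_elim
        case (elim \<omega>)
        have "0 \<le> S (Suc n) \<omega> ^ Suc p" using S_ge_1[of "Suc n" \<omega>] by simp
        thus ?case using elim unfolding R_def by simp
      qed
    qed (use S_M[OF Suc.prems] in auto)
    have "integral\<^sup>L M (\<lambda>\<omega>. S (Suc n) \<omega> ^ Suc p) \<le> integral\<^sup>L M R"
      using step_AE[OF n, of p] by (intro integral_mono_AE I Ri) (auto simp: R_def)
    also have "\<dots> = integral\<^sup>L M (\<lambda>\<omega>. S n \<omega> ^ Suc p) + 0 + integral\<^sup>L M (\<lambda>\<omega>. gr_H c (Suc p) * (S n \<omega> ^ Suc p * (Z n \<omega> + Z n \<omega> ^ r p)))"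
      unfolding R_def using IH(1) mi ri(1) m0 by (simp only: Bochner_Integration.integral_add Bochner_Integration.integrable_add)
    also have "\<dots> \<le> (1 + Kq p * k) * integral\<^sup>L M (\<lambda>\<omega>. S n \<omega> ^ Suc p)" using ri(2) by (simp add: algebra_simps)
    also have "\<dots> \<le> (1 + Kq p * k) * (s0 ^ Suc p * (1 + Kq p * k) ^ n)"
      using Kq_nonneg[of p] k by (intro mult_left_mono IH) auto
    also have "\<dots> = s0 ^ Suc p * (1 + Kq p * k) ^ Suc n" by simp
    finally show ?case using I by blast
  qed
  thus "integrable M (\<lambda>\<omega>. S n \<omega> ^ Suc p)" "integral\<^sup>L M (\<lambda>\<omega>. S n \<omega> ^ Suc p) \<le> s0 ^ Suc p * (1 + Kq p * k) ^ n" by auto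
qed

text \<open>Besides the fixed data, \<open>N\<close> and \<open>k\<close> enter only through
  \<open>N * k\<close>, the length of the time interval.\<close>

definition "Cq p = s0 ^ Suc p * exp (Kq p * (real N * k))"

lemma moment_uniform:
  assumes "n \<le> N"
  shows "integral\<^sup>L M (\<lambda>\<omega>. S n \<omega> ^ Suc p) \<le> Cq p"
proof -
  have "(1 + Kq p * k) ^ n \<le> exp (Kq p * k) ^ n" using Kq_nonneg[of p] k by (intro power_mono exp_ge_add_one_self) auto
  also have "\<dots> = exp (Kq p * k * real n)" by (simp add: exp_of_nat_mult[symmetric] mult.commute)
  also have "\<dots> \<le> exp (Kq p * (real N * k))" using assms Kq_nonneg[of p] k by (auto intro!: mult_mono simp: mult.assoc mult.commute)
  finally have "s0 ^ Suc p * (1 + Kq p * k) ^ n \<le> Cq p" unfolding Cq_def using s0 by (intro mult_left_mono) auto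
  thus ?thesis using moment(2)[OF assms, of p] by linarith
qed

section \<open>Martingale part and its running maximum\<close>

definition "dM p n \<omega> = real (Suc p) * S n \<omega> ^ p * m n \<omega>"
definition "Mt p n \<omega> = (\<Sum>i<n. dM p i \<omega>)"
text \<open>The start at 0 makes the running maximum nonnegative, and both sides of the pathwise
  inequality vanish initially.\<close>

fun Ms :: "nat \<Rightarrow> nat \<Rightarrow> 'w \<Rightarrow> real" where
  "Ms p 0 \<omega> = 0"
| "Ms p (Suc n) \<omega> = max (Ms p n \<omega>) (Mt p (Suc n) \<omega>)"

lemma Ms_nonneg: "0 \<le> Ms p n \<omega>" by (induction n) auto

lemma Ms_mono: "i \<le> n \<Longrightarrow> Ms p i \<omega> \<le> Ms p n \<omega>" by (induction n rule: dec_induct) auto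

lemma Mt_le_Ms: "i \<le> n \<Longrightarrow> Mt p i \<omega> \<le> Ms p n \<omega>"
proof -
  assume "i \<le> n"
  have "Mt p i \<omega> \<le> Ms p i \<omega>" by (cases i) (auto simp: Mt_def)
  thus ?thesis using Ms_mono[OF \<open>i \<le> n\<close>, of p \<omega>] by linarith
qed

(* Pathwise Doob inequality, by summation by parts. *)
lemma doob_pathwise: "(Ms p n \<omega>)\<^sup>2 \<le> 4 * (Mt p n \<omega>)\<^sup>2 - 4 * (\<Sum>i<n. Ms p i \<omega> * dM p i \<omega>)"
proof -
  define \<Sigma> where "\<Sigma> n = (\<Sum>i<n. Ms p i \<omega> * dM p i \<omega>)" for n
  have "(Ms p n \<omega>)\<^sup>2 / 2 \<le> Ms p n \<omega> * Mt p n \<omega> - \<Sigma> n"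
  proof (induction n)
    case (Suc n)
    define a b s d where "a = Ms p n \<omega>" and "b = Ms p (Suc n) \<omega>" and "s = Mt p n \<omega>" and "d = dM p n \<omega>"
    have M: "Mt p (Suc n) \<omega> = s + d" by (simp add: Mt_def s_def d_def)
    have Sg: "\<Sigma> (Suc n) = \<Sigma> n + a * d" by (simp add: \<Sigma>_def a_def d_def)
    have IH: "a\<^sup>2 / 2 \<le> a * s - \<Sigma> n" using Suc by (simp add: a_def s_def)
    \<comment> \<open>If the maximum stays, the new terms cancel; if it is renewed,
      \<open>a * b \<le> a^2 / 2 + b^2 / 2\<close> completes the step.\<close>
    have "b = a \<or> b = s + d" by (auto simp: b_def a_def M max_def)
    hence "b\<^sup>2 / 2 \<le> b * (s + d) - (\<Sigma> n + a * d)"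
    proof
      assume "b = a" thus ?thesis using IH by (simp add: algebra_simps)
    next
      assume b: "b = s + d"
      have "0 \<le> (b - a)\<^sup>2" by simp
      hence "a * b \<le> a\<^sup>2 / 2 + b\<^sup>2 / 2" by (simp add: power2_diff field_simps)
      moreover have "a * b = a * s + a * d" by (simp add: b distrib_left)
      moreover have "b * (s + d) = b\<^sup>2" by (simp add: b power2_eq_square)
      ultimately show ?thesis using IH by linarith
    qed
    thus ?case unfolding M Sg b_def by simp
  qed (simp add: \<Sigma>_def)
  moreover have "Ms p n \<omega> * Mt p n \<omega> \<le> (Ms p n \<omega>)\<^sup>2 / 4 + (Mt p n \<omega>)\<^sup>2"
  proof -
    have "0 \<le> (Ms p n \<omega> / 2 - Mt p n \<omega>)\<^sup>2" by simp
    thus ?thesis by (simp add: power2_diff power_divide)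
  qed
  ultimately show ?thesis unfolding \<Sigma>_def by linarith
qed

lemma dM_adapted: "n < N \<Longrightarrow> dM p n \<in> borel_measurable (Fm (Suc n))"
  unfolding dM_def using m_adapted[of n] adapted_mono[of n "Suc n" "S n"] S_adapted[of n] by auto

lemma Mt_adapted: "n \<le> N \<Longrightarrow> Mt p n \<in> borel_measurable (Fm n)"
  unfolding Mt_def
proof (intro borel_measurable_sum)
  fix i assume n: "n \<le> N" and "i \<in> {..<n}"
  hence i: "Suc i \<le> n" "i < N" by auto
  show "dM p i \<in> borel_measurable (Fm n)" by (rule adapted_mono[OF i(1) n dM_adapted[OF i(2)]])
qed

lemma Ms_adapted: "n \<le> N \<Longrightarrow> Ms p n \<in> borel_measurable (Fm n)"
proof (induction n)
  case 0
  have "Ms p 0 = (\<lambda>\<omega>. 0)" by auto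
  thus ?case by simp
next
  case (Suc n)
  have "Ms p n \<in> borel_measurable (Fm (Suc n))" using adapted_mono[of n "Suc n"] Suc by auto
  moreover have "Mt p (Suc n) \<in> borel_measurable (Fm (Suc n))" using Mt_adapted Suc by auto
  moreover have "Ms p (Suc n) = (\<lambda>\<omega>. max (Ms p n \<omega>) (Mt p (Suc n) \<omega>))" by auto
  ultimately show ?case by (simp del: Ms.simps)
qed

text \<open>The squared difference is at most a multiple of a past power of order
  \<open>2 * p + 2\<close> times \<open>Z n\<close>. Independence and the uniform moment of doubled
  order make its mean of order \<open>k\<close>, so the sum over all steps stays bounded.\<close>

lemma dM_sq:
  assumes n: "n < N"
  shows "integrable M (\<lambda>\<omega>. (dM p n \<omega>)\<^sup>2)" "integral\<^sup>L M (\<lambda>\<omega>. (dM p n \<omega>)\<^sup>2) \<le> (real (Suc p) * c)\<^sup>2 * (\<kappa> 1 * k * Cq (Suc (2 * p)))"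
proof -
  have n': "n \<le> N" using n by simp
  note mo = moment(1)[OF n', of "Suc (2 * p)"]
  have ad: "(\<lambda>\<omega>. S n \<omega> ^ Suc (Suc (2 * p))) \<in> borel_measurable (Fm n)" using S_adapted[OF n'] by auto
  have S0: "0 \<le> S n \<omega>" for \<omega> using S_ge_1[of n \<omega>] by simp
  have I: "integrable M (\<lambda>\<omega>. S n \<omega> ^ Suc (Suc (2 * p)) * Z n \<omega> ^ 1)" 
    "integral\<^sup>L M (\<lambda>\<omega>. S n \<omega> ^ Suc (Suc (2 * p)) * Z n \<omega> ^ 1) \<le> \<kappa> 1 * k * integral\<^sup>L M (\<lambda>\<omega>. S n \<omega> ^ Suc (Suc (2 * p)))"
    using indep_moment[OF n ad _ mo, of 1] S0 by simp_all
  have b: "AE \<omega> in M. (dM p n \<omega>)\<^sup>2 \<le> (real (Suc p) * c)\<^sup>2 * (S n \<omega> ^ Suc (Suc (2 * p)) * Z n \<omega> ^ 1)"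
    using m_bound[OF n]
  proof eventually_elim
    case (elim \<omega>)
    have "\<bar>dM p n \<omega>\<bar> = real (Suc p) * S n \<omega> ^ p * \<bar>m n \<omega>\<bar>" using S0[of \<omega>] by (simp add: dM_def abs_mult)
    also have "\<dots> \<le> real (Suc p) * S n \<omega> ^ p * (c * sqrt (Z n \<omega>) * S n \<omega>)" using S0[of \<omega>] by (intro mult_left_mono elim) auto
    finally have "\<bar>dM p n \<omega>\<bar> \<le> real (Suc p) * c * (S n \<omega> ^ Suc p * sqrt (Z n \<omega>))" by (simp add: mult_ac)
    hence "\<bar>dM p n \<omega>\<bar>\<^sup>2 \<le> (real (Suc p) * c * (S n \<omega> ^ Suc p * sqrt (Z n \<omega>)))\<^sup>2" by (intro power_mono) auto
    also have "\<dots> = (real (Suc p) * c)\<^sup>2 * ((S n \<omega> ^ Suc p)\<^sup>2 * Z n \<omega>)" using Z_nonneg[of n \<omega>] by (simp add: power_mult_distrib)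
    also have "(S n \<omega> ^ Suc p)\<^sup>2 = S n \<omega> ^ Suc (Suc (2 * p))" by (rule power_double_Suc[symmetric])
    finally show ?case by simp
  qed
  have I2: "integrable M (\<lambda>\<omega>. (real (Suc p) * c)\<^sup>2 * (S n \<omega> ^ Suc (Suc (2 * p)) * Z n \<omega> ^ 1))"
    by (rule integrable_mult_right[OF I(1)])
  have dm: "dM p n \<in> borel_measurable M" using dM_adapted[OF n] adapted_M[of "Suc n"] n by auto
  show I3: "integrable M (\<lambda>\<omega>. (dM p n \<omega>)\<^sup>2)"
  proof (rule Bochner_Integration.integrable_bound[OF I2])
    show "AE \<omega> in M. norm ((dM p n \<omega>)\<^sup>2) \<le> norm ((real (Suc p) * c)\<^sup>2 * (S n \<omega> ^ Suc (Suc (2 * p)) * Z n \<omega> ^ 1))"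
      using b by eventually_elim (metis norm_ge_zero real_norm_def abs_of_nonneg zero_le_power2 order_trans abs_ge_self)
  qed (use dm in auto)
  have "integral\<^sup>L M (\<lambda>\<omega>. (dM p n \<omega>)\<^sup>2) \<le> integral\<^sup>L M (\<lambda>\<omega>. (real (Suc p) * c)\<^sup>2 * (S n \<omega> ^ Suc (Suc (2 * p)) * Z n \<omega> ^ 1))"
    by (intro integral_mono_AE I3 I2 b)
  also have "\<dots> = (real (Suc p) * c)\<^sup>2 * integral\<^sup>L M (\<lambda>\<omega>. S n \<omega> ^ Suc (Suc (2 * p)) * Z n \<omega> ^ 1)" by simp
  also have "\<dots> \<le> (real (Suc p) * c)\<^sup>2 * (\<kappa> 1 * k * Cq (Suc (2 * p)))"
    using I(2) moment_uniform[OF n', of "Suc (2 * p)"] \<kappa> k by (intro mult_left_mono order_trans[OF I(2)]) auto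
  finally show "integral\<^sup>L M (\<lambda>\<omega>. (dM p n \<omega>)\<^sup>2) \<le> (real (Suc p) * c)\<^sup>2 * (\<kappa> 1 * k * Cq (Suc (2 * p)))" .
qed

text \<open>Square integrability of \<open>V\<close> makes its product with the power of order
  \<open>p + 1\<close> integrable, as the martingale property requires.\<close>

lemma dM_orthogonal:
  assumes n: "n < N" and V: "V \<in> borel_measurable (Fm n)" and V2: "integrable M (\<lambda>\<omega>. (V \<omega>)\<^sup>2)"
  shows "integrable M (\<lambda>\<omega>. V \<omega> * dM p n \<omega>)" "integral\<^sup>L M (\<lambda>\<omega>. V \<omega> * dM p n \<omega>) = 0"
proof -
  have n': "n \<le> N" using n by simp
  have W: "(\<lambda>\<omega>. V \<omega> * (real (Suc p) * S n \<omega> ^ p)) \<in> borel_measurable (Fm n)" using V S_adapted[OF n'] by auto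
  have WS: "integrable M (\<lambda>\<omega>. (V \<omega> * (real (Suc p) * S n \<omega> ^ p)) * S n \<omega>)"
  proof (rule Bochner_Integration.integrable_bound)
    show "integrable M (\<lambda>\<omega>. real (Suc p) * ((V \<omega>)\<^sup>2 + S n \<omega> ^ Suc (Suc (2 * p))))"
      using V2 moment(1)[OF n', of "Suc (2 * p)"] by (intro integrable_mult_right Bochner_Integration.integrable_add)
    show "(\<lambda>\<omega>. (V \<omega> * (real (Suc p) * S n \<omega> ^ p)) * S n \<omega>) \<in> borel_measurable M"
      using adapted_M[OF n' W] S_M[OF n'] by simp
    show "AE \<omega> in M. norm ((V \<omega> * (real (Suc p) * S n \<omega> ^ p)) * S n \<omega>) \<le> norm (real (Suc p) * ((V \<omega>)\<^sup>2 + S n \<omega> ^ Suc (Suc (2 * p))))"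
    proof (intro AE_I2)
      fix \<omega>
      have S0: "0 \<le> S n \<omega>" using S_ge_1[of n \<omega>] by simp
      have e: "S n \<omega> ^ Suc (Suc (2 * p)) = (S n \<omega> ^ Suc p)\<^sup>2" by (rule power_double_Suc)
      have "0 \<le> (\<bar>V \<omega>\<bar> - S n \<omega> ^ Suc p)\<^sup>2" by simp
      hence "2 * (\<bar>V \<omega>\<bar> * S n \<omega> ^ Suc p) \<le> (V \<omega>)\<^sup>2 + (S n \<omega> ^ Suc p)\<^sup>2" by (simp add: power2_diff del: power_Suc)
      moreover have "0 \<le> \<bar>V \<omega>\<bar> * S n \<omega> ^ Suc p" using S0 by (intro mult_nonneg_nonneg zero_le_power) auto
      ultimately have "\<bar>V \<omega>\<bar> * S n \<omega> ^ Suc p \<le> (V \<omega>)\<^sup>2 + (S n \<omega> ^ Suc p)\<^sup>2" by linarith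
      hence "real (Suc p) * (\<bar>V \<omega>\<bar> * S n \<omega> ^ Suc p) \<le> real (Suc p) * ((V \<omega>)\<^sup>2 + S n \<omega> ^ Suc (Suc (2 * p)))"
        unfolding e by (intro mult_left_mono) auto
      also have "real (Suc p) * (\<bar>V \<omega>\<bar> * S n \<omega> ^ Suc p) = norm ((V \<omega> * (real (Suc p) * S n \<omega> ^ p)) * S n \<omega>)"
        using S0 by (simp add: abs_mult mult_ac)
      finally show "norm ((V \<omega> * (real (Suc p) * S n \<omega> ^ p)) * S n \<omega>) \<le> norm (real (Suc p) * ((V \<omega>)\<^sup>2 + S n \<omega> ^ Suc (Suc (2 * p))))"
        by (simp only: real_norm_def abs_ge_self order_trans)
    qed
  qed
  have eq: "(\<lambda>\<omega>. V \<omega> * dM p n \<omega>) = (\<lambda>\<omega>. (V \<omega> * (real (Suc p) * S n \<omega> ^ p)) * m n \<omega>)" by (simp add: dM_def mult.assoc)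
  show "integrable M (\<lambda>\<omega>. V \<omega> * dM p n \<omega>)" unfolding eq by (rule mart_integrable[OF n W WS])
  show "integral\<^sup>L M (\<lambda>\<omega>. V \<omega> * dM p n \<omega>) = 0" unfolding eq by (rule mart[OF n W WS])
qed

lemma Mt_sq:
  assumes "n \<le> N"
  shows "integrable M (\<lambda>\<omega>. (Mt p n \<omega>)\<^sup>2) \<and> integral\<^sup>L M (\<lambda>\<omega>. (Mt p n \<omega>)\<^sup>2) \<le> real n * ((real (Suc p) * c)\<^sup>2 * (\<kappa> 1 * k * Cq (Suc (2 * p))))"
  using assms
proof (induction n)
  case (Suc n)
  hence n: "n < N" and IH: "integrable M (\<lambda>\<omega>. (Mt p n \<omega>)\<^sup>2)" "integral\<^sup>L M (\<lambda>\<omega>. (Mt p n \<omega>)\<^sup>2) \<le> real n * ((real (Suc p) * c)\<^sup>2 * (\<kappa> 1 * k * Cq (Suc (2 * p))))" by auto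
  have eq: "(\<lambda>\<omega>. (Mt p (Suc n) \<omega>)\<^sup>2) = (\<lambda>\<omega>. ((Mt p n \<omega>)\<^sup>2 + 2 * (Mt p n \<omega> * dM p n \<omega>)) + (dM p n \<omega>)\<^sup>2)"
    by (auto simp: Mt_def power2_sum)
  note o = dM_orthogonal[OF n Mt_adapted[of n p] IH(1), of p]
  have o1: "integrable M (\<lambda>\<omega>. Mt p n \<omega> * dM p n \<omega>)" and o2: "integral\<^sup>L M (\<lambda>\<omega>. Mt p n \<omega> * dM p n \<omega>) = 0" using o n by auto
  have "integral\<^sup>L M (\<lambda>\<omega>. (Mt p (Suc n) \<omega>)\<^sup>2) = integral\<^sup>L M (\<lambda>\<omega>. (Mt p n \<omega>)\<^sup>2) + integral\<^sup>L M (\<lambda>\<omega>. (dM p n \<omega>)\<^sup>2)"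
    unfolding eq using IH(1) o1 o2 dM_sq(1)[OF n, of p] by simp
  also have "\<dots> \<le> real (Suc n) * ((real (Suc p) * c)\<^sup>2 * (\<kappa> 1 * k * Cq (Suc (2 * p))))"
    using IH(2) dM_sq(2)[OF n, of p] unfolding of_nat_Suc by (simp only: distrib_right mult_1)
  finally show ?case unfolding eq using IH(1) o1 dM_sq(1)[OF n, of p] by auto
qed (simp add: Mt_def)

text \<open>Has to be known before the pathwise inequality can be integrated.\<close>

lemma Ms_sq_integrable: "n \<le> N \<Longrightarrow> integrable M (\<lambda>\<omega>. (Ms p n \<omega>)\<^sup>2)"
proof (induction n)
  case (Suc n)
  show ?case
  proof (rule Bochner_Integration.integrable_bound)
    show "integrable M (\<lambda>\<omega>. (Ms p n \<omega>)\<^sup>2 + (Mt p (Suc n) \<omega>)\<^sup>2)" using Suc Mt_sq[of "Suc n" p] by auto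
    show "(\<lambda>\<omega>. (Ms p (Suc n) \<omega>)\<^sup>2) \<in> borel_measurable M" 
      by (intro borel_measurable_power adapted_M[OF Suc.prems] Ms_adapted[OF Suc.prems])
    show "AE \<omega> in M. norm ((Ms p (Suc n) \<omega>)\<^sup>2) \<le> norm ((Ms p n \<omega>)\<^sup>2 + (Mt p (Suc n) \<omega>)\<^sup>2)"
      by (intro AE_I2) (auto simp: max_def)
  qed
qed simp

text \<open>In the pathwise inequality each martingale difference is multiplied by a maximum known
  before it, so the sum has mean zero.\<close>

lemma Ms_sq:
  "integral\<^sup>L M (\<lambda>\<omega>. (Ms p N \<omega>)\<^sup>2) \<le> 4 * (real N * ((real (Suc p) * c)\<^sup>2 * (\<kappa> 1 * k * Cq (Suc (2 * p)))))"
proof -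
  have o: "integrable M (\<lambda>\<omega>. Ms p i \<omega> * dM p i \<omega>)" "integral\<^sup>L M (\<lambda>\<omega>. Ms p i \<omega> * dM p i \<omega>) = 0" if "i < N" for i
    using dM_orthogonal[OF that Ms_adapted[of i p] Ms_sq_integrable[of i p], of p] that by auto
  have I: "integrable M (\<lambda>\<omega>. \<Sum>i<N. Ms p i \<omega> * dM p i \<omega>)" using o by auto
  have "integral\<^sup>L M (\<lambda>\<omega>. \<Sum>i<N. Ms p i \<omega> * dM p i \<omega>) = (\<Sum>i<N. integral\<^sup>L M (\<lambda>\<omega>. Ms p i \<omega> * dM p i \<omega>))"
    using o by (intro Bochner_Integration.integral_sum) auto
  hence z: "integral\<^sup>L M (\<lambda>\<omega>. \<Sum>i<N. Ms p i \<omega> * dM p i \<omega>) = 0" using o by simp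
  have "integral\<^sup>L M (\<lambda>\<omega>. (Ms p N \<omega>)\<^sup>2) \<le> integral\<^sup>L M (\<lambda>\<omega>. 4 * (Mt p N \<omega>)\<^sup>2 - 4 * (\<Sum>i<N. Ms p i \<omega> * dM p i \<omega>))"
    using Mt_sq[of N p] I Ms_sq_integrable[of N p] by (intro integral_mono doob_pathwise) auto
  also have "\<dots> = 4 * integral\<^sup>L M (\<lambda>\<omega>. (Mt p N \<omega>)\<^sup>2)" using Mt_sq[of N p] I z by simp
  finally show ?thesis using Mt_sq[of N p] by simp
qed

text \<open>Summing the expansion bounds each power by the initial value, the martingale part and
  nonnegative remainders, uniformly in the time index. The martingale enters through
  \<open>1 + (Ms p N)^2\<close>, which is why a moment of doubled order appears.\<close>

theorem sup_moment:
  "(\<integral>\<^sup>+\<omega>. ennreal (Max ((\<lambda>n. S n \<omega> ^ Suc p) ` {..N})) \<partial>M) 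
    \<le> ennreal (s0 ^ Suc p + 1 + 4 * (real (Suc p) * c)\<^sup>2 * \<kappa> 1 * (real N * k) * Cq (Suc (2 * p)) + Kq p * (real N * k) * Cq p)"
proof -
  define R where "R n \<omega> = gr_H c (Suc p) * (S n \<omega> ^ Suc p * (Z n \<omega> + Z n \<omega> ^ r p))" for n \<omega>
  have R0: "0 \<le> R n \<omega>" for n \<omega>
    unfolding R_def using c S_ge_1[of n \<omega>] Z_nonneg[of n \<omega>] by (intro mult_nonneg_nonneg gr_H_nonneg add_nonneg_nonneg zero_le_power) auto
  define U where "U \<omega> = s0 ^ Suc p + (1 + (Ms p N \<omega>)\<^sup>2) + (\<Sum>i<N. R i \<omega>)" for \<omega>
  have "AE \<omega> in M. \<forall>n\<in>{..<N}. S (Suc n) \<omega> ^ Suc p \<le> S n \<omega> ^ Suc p + real (Suc p) * S n \<omega> ^ p * m n \<omega> + R n \<omega>"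
    unfolding R_def using step_AE by (intro AE_finite_allI) auto
  hence max: "AE \<omega> in M. Max ((\<lambda>n. S n \<omega> ^ Suc p) ` {..N}) \<le> U \<omega>" using S_0
  proof eventually_elim
    case (elim \<omega>)
    have b: "S n \<omega> ^ Suc p \<le> s0 ^ Suc p + Mt p n \<omega> + (\<Sum>i<n. R i \<omega>)" if "n \<le> N" for n
      using that
    proof (induction n)
      case 0
      have "S 0 \<omega> ^ Suc p \<le> s0 ^ Suc p" using elim(2) S_ge_1[of 0 \<omega>] by (intro power_mono) auto
      thus ?case by (simp add: Mt_def)
    next
      case (Suc n)
      hence "S (Suc n) \<omega> ^ Suc p \<le> S n \<omega> ^ Suc p + dM p n \<omega> + R n \<omega>" using elim(1) unfolding dM_def by (auto simp del: power_Suc)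
      moreover have "S n \<omega> ^ Suc p \<le> s0 ^ Suc p + Mt p n \<omega> + (\<Sum>i<n. R i \<omega>)" using Suc by auto
      moreover have "Mt p (Suc n) \<omega> = Mt p n \<omega> + dM p n \<omega>" by (simp add: Mt_def)
      ultimately show ?case by simp
    qed
    have "S n \<omega> ^ Suc p \<le> U \<omega>" if "n \<le> N" for n
    proof -
      have "(\<Sum>i<n. R i \<omega>) \<le> (\<Sum>i<N. R i \<omega>)" using that R0 by (intro sum_mono2) auto
      moreover have "Mt p n \<omega> \<le> Ms p N \<omega>" by (rule Mt_le_Ms[OF that])
      moreover have "Ms p N \<omega> \<le> 1 + (Ms p N \<omega>)\<^sup>2"
      proof -
        have "0 \<le> (Ms p N \<omega> - 1)\<^sup>2" by simp
        thus ?thesis using Ms_nonneg[of p N \<omega>] by (simp add: power2_diff) 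
      qed
      ultimately show ?thesis using b[OF that] unfolding U_def by linarith
    qed
    thus ?case by (intro Max.boundedI) auto
  qed
  have Ri: "integrable M (R n)" "integral\<^sup>L M (R n) \<le> Kq p * k * Cq p" if "n < N" for n
  proof -
    have n': "n \<le> N" using that by simp
    note ri = rest_integral[OF that moment(1)[OF n']]
    show "integrable M (R n)" unfolding R_def by (rule ri(1))
    have "integral\<^sup>L M (R n) \<le> Kq p * k * integral\<^sup>L M (\<lambda>\<omega>. S n \<omega> ^ Suc p)" unfolding R_def by (rule ri(2))
    also have "\<dots> \<le> Kq p * k * Cq p" using Kq_nonneg[of p] k by (intro mult_left_mono moment_uniform n') auto
    finally show "integral\<^sup>L M (R n) \<le> Kq p * k * Cq p" .
  qed
  have Ui: "integrable M U" unfolding U_def using Ri(1) Ms_sq_integrable[of N p]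
    by (intro Bochner_Integration.integrable_add Bochner_Integration.integrable_sum integrable_const) auto
  have U0: "0 \<le> U \<omega>" for \<omega> unfolding U_def using s0 R0 by (intro add_nonneg_nonneg sum_nonneg) auto
  have "(\<integral>\<^sup>+\<omega>. ennreal (Max ((\<lambda>n. S n \<omega> ^ Suc p) ` {..N})) \<partial>M) \<le> (\<integral>\<^sup>+\<omega>. ennreal (U \<omega>) \<partial>M)"
    using max by (intro nn_integral_mono_AE) (auto elim!: eventually_mono intro: ennreal_leI)
  also have "\<dots> = ennreal (integral\<^sup>L M U)" using U0 by (intro nn_integral_eq_integral Ui) auto
  also have "\<dots> \<le> ennreal (s0 ^ Suc p + 1 + 4 * (real (Suc p) * c)\<^sup>2 * \<kappa> 1 * (real N * k) * Cq (Suc (2 * p)) + Kq p * (real N * k) * Cq p)"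
  proof (rule ennreal_leI)
    have "integral\<^sup>L M U = s0 ^ Suc p + (1 + integral\<^sup>L M (\<lambda>\<omega>. (Ms p N \<omega>)\<^sup>2)) + (\<Sum>i<N. integral\<^sup>L M (R i))"
    proof -
      have "integrable M (\<lambda>\<omega>. \<Sum>i<N. R i \<omega>)" by (intro Bochner_Integration.integrable_sum Ri) auto
      moreover have "integral\<^sup>L M (\<lambda>\<omega>. \<Sum>i<N. R i \<omega>) = (\<Sum>i<N. integral\<^sup>L M (R i))"
        by (intro Bochner_Integration.integral_sum Ri) auto
      ultimately show ?thesis
        unfolding U_def using Ms_sq_integrable[of N p] by (simp add: prob_space del: power_Suc)
    qed
    also have "\<dots> \<le> s0 ^ Suc p + (1 + 4 * (real N * ((real (Suc p) * c)\<^sup>2 * (\<kappa> 1 * k * Cq (Suc (2 * p)))))) + (\<Sum>i<N. Kq p * k * Cq p)"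
      by (intro add_mono sum_mono Ri(2) Ms_sq order_refl) auto
    also have "\<dots> = s0 ^ Suc p + 1 + 4 * (real (Suc p) * c)\<^sup>2 * \<kappa> 1 * (real N * k) * Cq (Suc (2 * p)) + Kq p * (real N * k) * Cq p"
      by (simp add: mult_ac del: power_Suc)
    finally show "integral\<^sup>L M U \<le> s0 ^ Suc p + 1 + 4 * (real (Suc p) * c)\<^sup>2 * \<kappa> 1 * (real N * k) * Cq (Suc (2 * p)) + Kq p * (real N * k) * Cq p" .
  qed
  finally show ?thesis .
qed

end

section \<open>Gaussian moments\<close>

text \<open>Tangent line below a convex power; each induction step gains a nonnegative multiple of
  \<open>(x - t)^2\<close>.\<close>

lemma power_tangent:
  fixes x t :: real
  assumes "0 \<le> x" "0 \<le> t"
  shows "t ^ Suc i + real (Suc i) * t ^ i * (x - t) \<le> x ^ Suc i"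
proof (induction i)
  case (Suc i)
  have "0 \<le> real (Suc i) * t ^ i * (x - t)\<^sup>2" using assms by simp
  also have "\<dots> = x * (t ^ Suc i + real (Suc i) * t ^ i * (x - t)) - (t ^ Suc (Suc i) + real (Suc (Suc i)) * t ^ Suc i * (x - t))"
    by (simp add: power2_eq_square algebra_simps)
  also have "\<dots> \<le> x * x ^ Suc i - (t ^ Suc (Suc i) + real (Suc (Suc i)) * t ^ Suc i * (x - t))"
    using assms Suc.IH by (intro diff_right_mono mult_left_mono) auto
  finally show ?case by simp
qed simp

text \<open>Jensen's inequality with weights that need not sum to 1; the tangent is taken at the
  weighted mean.\<close>

lemma weighted_power_mean:
  fixes w x :: "'i \<Rightarrow> real"
  assumes "\<And>j. j \<in> J \<Longrightarrow> 0 \<le> w j" "\<And>j. j \<in> J \<Longrightarrow> 0 \<le> x j"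
  shows "(\<Sum>j\<in>J. w j * x j) ^ Suc i \<le> (\<Sum>j\<in>J. w j) ^ i * (\<Sum>j\<in>J. w j * x j ^ Suc i)"
proof (cases "(\<Sum>j\<in>J. w j) = 0")
  case True
  hence "\<forall>j\<in>J. w j = 0 \<or> infinite J" using assms by (cases "finite J") (auto simp: sum_nonneg_eq_0_iff)
  hence "(\<Sum>j\<in>J. w j * x j) = 0" by (cases "finite J") auto
  thus ?thesis using True assms by (auto intro!: mult_nonneg_nonneg sum_nonneg)
next
  case False
  define W where "W = (\<Sum>j\<in>J. w j)"
  have W: "0 < W" using False assms unfolding W_def by (simp add: sum_nonneg less_le)
  define t where "t = (\<Sum>j\<in>J. w j * x j) / W"
  have t: "0 \<le> t" unfolding t_def using assms W by (intro divide_nonneg_pos sum_nonneg) auto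
  have Wt: "(\<Sum>j\<in>J. w j * x j) = W * t" using W by (simp add: t_def)
  have "(\<Sum>j\<in>J. w j * (t ^ Suc i + real (Suc i) * t ^ i * (x j - t))) \<le> (\<Sum>j\<in>J. w j * x j ^ Suc i)"
    using assms t by (intro sum_mono mult_left_mono power_tangent) auto
  also have "(\<Sum>j\<in>J. w j * (t ^ Suc i + real (Suc i) * t ^ i * (x j - t))) 
     = W * t ^ Suc i + real (Suc i) * t ^ i * ((\<Sum>j\<in>J. w j * x j) - W * t)"
    unfolding W_def by (simp add: algebra_simps sum.distrib sum_distrib_left sum_subtractf sum_distrib_right)
  finally have "W * t ^ Suc i \<le> (\<Sum>j\<in>J. w j * x j ^ Suc i)" unfolding Wt by simp
  hence "W ^ i * (W * t ^ Suc i) \<le> W ^ i * (\<Sum>j\<in>J. w j * x j ^ Suc i)" using W by (intro mult_left_mono) auto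
  moreover have "(\<Sum>j\<in>J. w j * x j) ^ Suc i = W ^ i * (W * t ^ Suc i)" unfolding Wt by (simp add: power_mult_distrib)
  ultimately show ?thesis by (simp add: W_def)
qed

text \<open>The moment of order \<open>2 * i\<close> of a standard normal variable, that is, the
  double factorial of \<open>2 * i - 1\<close>.\<close>

definition gauss_moment :: "nat \<Rightarrow> real" where
  "gauss_moment i = fact (2 * i) / (2 ^ i * fact i)"

lemma gauss_moment_nonneg: "0 \<le> gauss_moment i"
  by (simp add: gauss_moment_def)

lemma nn_integral_gauss_power:
  assumes "0 \<le> s2" "1 \<le> i"
  shows "(\<integral>\<^sup>+x. ennreal (x ^ (2 * i)) \<partial>gauss s2) = ennreal (gauss_moment i * s2 ^ i)"
proof (cases "s2 = 0")
  case True
  thus ?thesis using assms by (simp add: gauss_def nn_integral_return zero_power)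
next
  case False
  hence s: "0 < s2" "0 < sqrt s2" using assms by auto
  note hb = normal_moment_even[OF s(2), of 0 i]
  have "(\<integral>\<^sup>+x. ennreal (x ^ (2 * i)) \<partial>gauss s2) = (\<integral>\<^sup>+x. ennreal (normal_density 0 (sqrt s2) x * (x - 0) ^ (2 * i)) \<partial>lborel)"
    using False by (simp add: gauss_def nn_integral_density ennreal_mult)
  also have "\<dots> = ennreal (fact (2 * i) / ((2 / (sqrt s2)\<^sup>2) ^ i * fact i))"
    using hb by (subst nn_integral_eq_integral) (auto simp: has_bochner_integral_iff)
  also have "fact (2 * i) / ((2 / (sqrt s2)\<^sup>2) ^ i * fact i) = gauss_moment i * s2 ^ i"
    using s by (simp add: gauss_moment_def power_divide)
  finally show ?thesis .
qed

lemma gauss_mean: 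
  assumes "0 \<le> s2"
  shows "integrable (gauss s2) (\<lambda>x. x)" "integral\<^sup>L (gauss s2) (\<lambda>x. x) = 0"
proof -
  have "integrable (gauss s2) (\<lambda>x. x) \<and> integral\<^sup>L (gauss s2) (\<lambda>x. x) = 0"
  proof (cases "s2 = 0")
    case True
    have "(\<integral>\<^sup>+x. ennreal (norm x) \<partial>return borel (0::real)) = 0" by (simp add: nn_integral_return)
    hence "integrable (return borel (0::real)) (\<lambda>x. x)" by (intro integrableI_bounded) auto
    moreover have "integral\<^sup>L (return borel (0::real)) (\<lambda>x. x) = 0" by (subst integral_return) auto
    ultimately show ?thesis using True by (simp only: gauss_def if_True simp_thms)
  next
    case False
    hence s: "0 < sqrt s2" using assms by auto
    note hb = normal_moment_odd[OF s, of 0 0]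
    thus ?thesis using False unfolding gauss_def
      by (auto simp: has_bochner_integral_iff integrable_real_density integral_real_density)
  qed
  thus "integrable (gauss s2) (\<lambda>x. x)" "integral\<^sup>L (gauss s2) (\<lambda>x. x) = 0" by auto
qed

section \<open>Expansion in the eigenbasis\<close>

locale eigenbasis = bounded_domain D for D :: "(real^'n::finite) set" +
  fixes \<phi> :: "nat \<Rightarrow> 'n fn" and lam :: "nat \<Rightarrow> real"
  assumes eigen: "neumann_eigenbasis D \<phi> lam"
begin

lemma phi_H1: "\<phi> j \<in> H1 D" and phi_gip: "v \<in> H1 D \<Longrightarrow> gip D (\<phi> j) v = lam j * ip D (\<phi> j) v"
  and phi_on: "ip D (\<phi> i) (\<phi> j) = (if i = j then 1 else 0)"
  and parseval: "v \<in> L2 D \<Longrightarrow> (\<lambda>j. (ip D v (\<phi> j))\<^sup>2) sums ip D v v"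
  and lam_0: "lam 0 = 0" and lam_pos: "0 < lam (Suc j)"
  using eigen unfolding neumann_eigenbasis_def by auto

lemma phi_L2: "\<phi> j \<in> L2 D" by (rule H1_L2[OF phi_H1])

lemma lam_nonneg: "0 \<le> lam j"
  using lam_0 lam_pos by (cases j) (auto intro: less_imp_le)

lemma ip_one: "ip D u (\<lambda>x. 1) = integral\<^sup>L \<mu> u" by (simp add: ip_def)

text \<open>The eigenvalue equation is tested with a constant, whose weak gradient is zero, and the
  eigenvalue is positive.\<close>

lemma phi_mean_zero: "ip D (\<phi> (Suc j)) (\<lambda>x. 1) = 0"
  using phi_gip[OF H1_const, of "Suc j" 1] gip_const_right[OF phi_H1, of "Suc j" 1] lam_pos[of j] by simp

text \<open>The definition of the eigenbasis does not say that \<open>\<phi> 0\<close> is constant.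
  Parseval for the constant function shows that the latter is a nonzero multiple of
  \<open>\<phi> 0\<close> in \<open>L2\<close>, so orthogonality to constants passes to
  \<open>\<phi> 0\<close>.\<close>

lemma ip_phi_0:
  assumes u: "u \<in> L2 D" and mz: "mean_zero D u"
  shows "ip D u (\<phi> 0) = 0"
proof -
  define c where "c = ip D (\<lambda>x. 1) (\<phi> 0)"
  have "(\<lambda>j. (ip D (\<lambda>x. 1) (\<phi> j))\<^sup>2) = (\<lambda>j. if j = 0 then c\<^sup>2 else 0)"
  proof
    fix j show "(ip D (\<lambda>x. 1) (\<phi> j))\<^sup>2 = (if j = 0 then c\<^sup>2 else 0)"
      using phi_mean_zero by (cases j) (auto simp: c_def ip_commute)
  qed
  hence "(\<lambda>j. if j = 0 then c\<^sup>2 else 0) sums ip D (\<lambda>x. 1) (\<lambda>x. 1)"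
    using parseval[OF L2_const, of 1] by simp
  moreover have "(\<lambda>j. if j = 0 then c\<^sup>2 else 0) sums c\<^sup>2" using sums_single[of 0 "\<lambda>j. c\<^sup>2"] by simp
  ultimately have c2: "ip D (\<lambda>x. 1) (\<lambda>x. 1) = c\<^sup>2" by (rule sums_unique2)
  have "ip D (\<lambda>x. 1) (\<lambda>x. 1) = measure lebesgue D" by (simp add: ip_def measure_restrict_space)
  hence c0: "c \<noteq> 0" using c2 measure_D_pos by auto
  \<comment> \<open>The constant function minus its projection on \<open>\<phi> 0\<close>; its norm
    turns out to be zero.\<close>
  define d where "d = (\<lambda>x. 1 * 1 + (- c) * \<phi> 0 x)"
  have dL: "d \<in> L2 D" unfolding d_def by (intro L2_lincomb L2_const phi_L2)
  have dv: "ip D d v = ip D (\<lambda>x. 1) v - c * ip D (\<phi> 0) v" if "v \<in> L2 D" for v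
    unfolding d_def using ip_lincomb[OF L2_const phi_L2 that, of 1 1 "- c" 0] by simp
  have "ip D d d = ip D (\<lambda>x. 1) d - c * ip D (\<phi> 0) d" by (rule dv[OF dL])
  also have "ip D (\<lambda>x. 1) d = c\<^sup>2 - c * c" 
    unfolding ip_commute[of D "\<lambda>x. 1" d] using dv[OF L2_const, of 1] c2 by (simp add: c_def ip_commute)
  also have "ip D (\<phi> 0) d = c - c" 
    unfolding ip_commute[of D "\<phi> 0" d] using dv[OF phi_L2, of 0] phi_on[of 0 0] by (simp add: c_def)
  finally have "ip D d d = 0" by (simp add: power2_eq_square)
  hence "(ip D d u)\<^sup>2 \<le> 0" using ip_cauchy_schwarz[OF dL u] by simp
  hence "ip D (\<lambda>x. 1) u = c * ip D (\<phi> 0) u" using dv[OF u] by simp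
  moreover have "ip D (\<lambda>x. 1) u = 0" using mz by (simp add: ip_commute[of D "\<lambda>x. 1"] ip_one mean_zero_def)
  ultimately show ?thesis using c0 by (simp add: ip_commute)
qed

text \<open>Partial sums of the expansion lie in \<open>H1\<close> even when \<open>u\<close> is
  only known to lie in \<open>L2\<close>.\<close>

definition trunc :: "nat \<Rightarrow> 'n fn \<Rightarrow> 'n fn" where
  "trunc n u = (\<lambda>x. \<Sum>j<n. ip D u (\<phi> j) * \<phi> j x)"

lemma trunc_L2: "trunc n u \<in> L2 D"
  unfolding trunc_def by (intro L2_sum phi_L2)

lemma ip_trunc: "v \<in> L2 D \<Longrightarrow> ip D (trunc n u) v = (\<Sum>j<n. ip D u (\<phi> j) * ip D (\<phi> j) v)"
  unfolding trunc_def by (intro ip_sum phi_L2)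

lemma trunc_H1: "trunc n u \<in> H1 D \<and> (\<forall>v\<in>H1 D. gip D (trunc n u) v = (\<Sum>j<n. ip D u (\<phi> j) * gip D (\<phi> j) v))"
  using bilinear_sum[where V = "H1 D" and B = "gip D" and I = "{..<n}" and e = \<phi> and c = "\<lambda>j. ip D u (\<phi> j)", 
    OF H1_lincomb gip_lincomb phi_H1] H1_const[of 0] unfolding trunc_def by blast

lemma gip_trunc: "gip D (trunc n u) (trunc n u) = (\<Sum>j<n. lam j * (ip D u (\<phi> j))\<^sup>2)"
proof -
  have "gip D (trunc n u) (trunc n u) = (\<Sum>j<n. ip D u (\<phi> j) * gip D (\<phi> j) (trunc n u))"
    using trunc_H1 by blast
  also have "\<dots> = (\<Sum>j<n. lam j * (ip D u (\<phi> j))\<^sup>2)"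
  proof (rule sum.cong[OF refl])
    fix j assume j: "j \<in> {..<n}"
    have "ip D (trunc n u) (\<phi> j) = (\<Sum>i<n. if i = j then ip D u (\<phi> i) else 0)"
      unfolding ip_trunc[OF phi_L2] by (intro sum.cong) (auto simp: phi_on)
    hence "ip D (\<phi> j) (trunc n u) = ip D u (\<phi> j)" using j by (simp add: ip_commute[of D "\<phi> j"])
    thus "ip D u (\<phi> j) * gip D (\<phi> j) (trunc n u) = lam j * (ip D u (\<phi> j))\<^sup>2"
      using phi_gip[of "trunc n u" j] trunc_H1 by (simp add: power2_eq_square)
  qed
  finally show ?thesis .
qed

lemma trunc_mean_zero:
  assumes "u \<in> L2 D" "mean_zero D u"
  shows "mean_zero D (trunc n u)"
proof -
  have "ip D u (\<phi> j) * ip D (\<phi> j) (\<lambda>x. 1) = 0" for j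
    using ip_phi_0[OF assms] phi_mean_zero by (cases j) auto
  hence "ip D (trunc n u) (\<lambda>x. 1) = 0" unfolding ip_trunc[OF L2_const] by (intro sum.neutral) auto
  thus ?thesis by (simp add: ip_one mean_zero_def)
qed

text \<open>Parseval makes the norm of the remainder tend to zero, and Cauchy-Schwarz carries this
  over to inner products.\<close>

lemma trunc_tendsto:
  assumes u: "u \<in> L2 D" and v: "v \<in> L2 D"
  shows "(\<lambda>n. ip D (trunc n u) v) \<longlonglongrightarrow> ip D u v"
proof -
  define e where "e n = (\<lambda>x. 1 * u x + (-1) * trunc n u x)" for n
  have eL: "e n \<in> L2 D" for n unfolding e_def by (intro L2_lincomb u trunc_L2)
  have ev: "ip D (e n) w = ip D u w - ip D (trunc n u) w" if "w \<in> L2 D" for n w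
    unfolding e_def using ip_lincomb[OF u trunc_L2 that, of 1 "-1"] by simp
  have ut: "ip D (trunc n u) u = (\<Sum>j<n. (ip D u (\<phi> j))\<^sup>2)" for n
    unfolding ip_trunc[OF u] by (simp add: power2_eq_square ip_commute[of D "\<phi> _" u])
  have tt: "ip D (trunc n u) (trunc n u) = (\<Sum>j<n. (ip D u (\<phi> j))\<^sup>2)" for n
    unfolding ip_trunc[OF trunc_L2]
  proof (rule sum.cong[OF refl])
    fix j assume j: "j \<in> {..<n}"
    have "ip D (trunc n u) (\<phi> j) = (\<Sum>i<n. if i = j then ip D u (\<phi> i) else 0)"
      unfolding ip_trunc[OF phi_L2] by (intro sum.cong) (auto simp: phi_on)
    thus "ip D u (\<phi> j) * ip D (\<phi> j) (trunc n u) = (ip D u (\<phi> j))\<^sup>2" 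
      using j by (simp add: ip_commute[of D "\<phi> j"] power2_eq_square)
  qed
  have ee: "ip D (e n) (e n) = ip D u u - (\<Sum>j<n. (ip D u (\<phi> j))\<^sup>2)" for n
  proof -
    have "ip D (e n) (e n) = ip D (e n) u - ip D (e n) (trunc n u)"
      using ev[OF eL, of n n] by (simp add: ip_commute[of D u "e n"] ip_commute[of D "trunc n u" "e n"])
    also have "\<dots> = ip D u u - (\<Sum>j<n. (ip D u (\<phi> j))\<^sup>2)"
      using ev[OF u, of n] ev[OF trunc_L2, of n n u] ut[of n] tt[of n] by (simp add: ip_commute[of D u "trunc n u"])
    finally show ?thesis .
  qed
  have "(\<lambda>n. \<Sum>j<n. (ip D u (\<phi> j))\<^sup>2) \<longlonglongrightarrow> ip D u u" using parseval[OF u] by (simp add: sums_def)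
  hence "(\<lambda>n. ip D u u - (\<Sum>j<n. (ip D u (\<phi> j))\<^sup>2)) \<longlonglongrightarrow> ip D u u - ip D u u" by (intro tendsto_intros)
  hence "(\<lambda>n. ip D (e n) (e n)) \<longlonglongrightarrow> 0" by (simp add: ee)
  hence "(\<lambda>n. sqrt (ip D (e n) (e n) * ip D v v)) \<longlonglongrightarrow> sqrt (0 * ip D v v)" by (intro tendsto_intros)
  hence "(\<lambda>n. sqrt (ip D (e n) (e n) * ip D v v)) \<longlonglongrightarrow> 0" by simp
  hence "(\<lambda>n. ip D (e n) v) \<longlonglongrightarrow> 0"
    by (rule Lim_null_comparison[rotated]) (auto intro!: always_eventually real_le_rsqrt ip_cauchy_schwarz eL v)
  hence "(\<lambda>n. ip D u v - ip D (e n) v) \<longlonglongrightarrow> ip D u v - 0" by (intro tendsto_intros)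
  thus ?thesis using ev[OF v] by simp
qed

end

locale eigen_mesh = fe_mesh3 D \<T> + eigenbasis D \<phi> lam for D :: "(real^'n::finite) set" and \<T> \<phi> lam
begin

text \<open>The stability assumption speaks of \<open>H1\<close> functions, while a noise increment
  is only known to lie in \<open>L2\<close>. It is applied to truncations; the gradient norm of the
  projection depends on finitely many functionals \<open>ip D u (A (g i))\<close>, so the bound
  survives the limit.\<close>

lemma gip_Ph_le:
  assumes stab: "\<And>v. v \<in> H1 D \<Longrightarrow> mean_zero D v \<Longrightarrow> sn1 D (proj v) \<le> C * sn1 D v"
    and u: "u \<in> L2 D" "mean_zero D u" and B: "\<And>n. (\<Sum>j<n. lam j * (ip D u (\<phi> j))\<^sup>2) \<le> B"
  shows "gip D (proj u) (proj u) \<le> C\<^sup>2 * B"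
proof -
  obtain m :: nat and g where g': "\<forall>i<m. g i \<in> S0" "\<forall>i<m. \<forall>j<m. gip D (g i) (g j) = (if i = j then 1 else 0)" 
    "\<forall>v\<in>S0. v = (\<lambda>x. \<Sum>i<m. gip D v (g i) * g i x)" using S0_basis by (elim exE conjE)
  note g = g'(1)[rule_format] g'(2) g'(3)[rule_format]
  have eq: "gip D (proj v) (proj v) = (\<Sum>i<m. (ip D v (A (g i)))\<^sup>2)" if v: "v \<in> L2 D" "mean_zero D v" for v
  proof -
    let ?w = "proj v"
    have w: "?w \<in> S0" using v by (rule Ph_S0)
    have c: "gip D ?w (g i) = ip D v (A (g i))" if "i < m" for i
      using gip_ip[OF S0_S[OF g(1)[OF that]] S0_S[OF w]] ip_Ph[OF v(1) Ah_S[OF S0_S[OF g(1)[OF that]]]] by simp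
    have "gip D ?w ?w = gip D (\<lambda>x. \<Sum>i<m. gip D ?w (g i) * g i x) ?w" using g(3)[OF w] by simp
    also have "\<dots> = (\<Sum>i<m. gip D ?w (g i) * gip D (g i) ?w)"
      by (rule bilinear_sum[where V = "H1 D", OF H1_lincomb gip_lincomb, THEN conjunct2]) (use g(1) w in \<open>auto intro: S_H1 S0_S\<close>)
    also have "\<dots> = (\<Sum>i<m. (ip D v (A (g i)))\<^sup>2)"
      by (intro sum.cong refl) (simp add: gip_commute[of "g _" ?w] c power2_eq_square)
    finally show ?thesis .
  qed
  have "(\<lambda>n. \<Sum>i<m. (ip D (trunc n u) (A (g i)))\<^sup>2) \<longlonglongrightarrow> (\<Sum>i<m. (ip D u (A (g i)))\<^sup>2)"
    using g(1) by (intro tendsto_sum tendsto_power trunc_tendsto u S_L2 Ah_S S0_S) auto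
  moreover have "(\<Sum>i<m. (ip D (trunc n u) (A (g i)))\<^sup>2) \<le> C\<^sup>2 * B" for n
  proof -
    have tm: "mean_zero D (trunc n u)" by (rule trunc_mean_zero[OF u])
    have th: "trunc n u \<in> H1 D" using trunc_H1 by blast
    have "(\<Sum>i<m. (ip D (trunc n u) (A (g i)))\<^sup>2) = (sn1 D (proj (trunc n u)))\<^sup>2"
      by (simp add: eq[OF trunc_L2 tm] sn1_sq)
    also have "\<dots> \<le> (C * sn1 D (trunc n u))\<^sup>2" by (intro power_mono stab th tm sn1_nonneg)
    also have "\<dots> = C\<^sup>2 * (\<Sum>j<n. lam j * (ip D u (\<phi> j))\<^sup>2)" by (simp add: power_mult_distrib sn1_sq gip_trunc)
    also have "\<dots> \<le> C\<^sup>2 * B" by (intro mult_left_mono B) auto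
    finally show ?thesis .
  qed
  ultimately have "(\<Sum>i<m. (ip D u (A (g i)))\<^sup>2) \<le> C\<^sup>2 * B" by (intro LIMSEQ_le_const2) auto
  thus ?thesis using eq[OF u] by simp
qed

end

section \<open>The noise increments\<close>

lemma (in prob_space) indep_subalgebras:
  assumes X: "X \<in> borel_measurable A" "subalgebra M A" and Y: "Y \<in> borel_measurable B" "subalgebra M B"
    and AB: "indep_set (sets A) (sets B)"
  shows "indep_var borel X borel Y"
proof -
  have "random_variable borel X" "random_variable borel Y"
    using X Y measurable_from_subalg by blast+
  moreover have "indep_set (sigma_sets (space M) {X -` U \<inter> space M |U. U \<in> sets borel}) 
      (sigma_sets (space M) {Y -` U \<inter> space M |U. U \<in> sets borel})"
    unfolding indep_set_def
  proof (rule indep_sets_mono_sets[OF AB[unfolded indep_set_def]])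
    fix b :: bool
    have sp: "space A = space M" "space B = space M" using X(2) Y(2) by (auto simp: subalgebra_def)
    have "sigma_sets (space M) {X -` U \<inter> space M |U. U \<in> sets borel} \<subseteq> sets A"
      unfolding sp(1)[symmetric] by (rule sets.sigma_sets_subset) (use X in auto)
    moreover have "sigma_sets (space M) {Y -` U \<inter> space M |U. U \<in> sets borel} \<subseteq> sets B"
      unfolding sp(2)[symmetric] by (rule sets.sigma_sets_subset) (use Y in auto)
    ultimately show "case_bool (sigma_sets (space M) {X -` U \<inter> space M |U. U \<in> sets borel})
        (sigma_sets (space M) {Y -` U \<inter> space M |U. U \<in> sets borel}) b \<subseteq> case_bool (sets A) (sets B) b"
      by (cases b) auto
  qed
  ultimately show ?thesis by (simp add: indep_var_eq)
qed

lemma (in prob_space) indep_var_nn_integral: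
  fixes X Y :: "'a \<Rightarrow> ennreal"
  assumes "indep_var borel X borel Y"
  shows "(\<integral>\<^sup>+\<omega>. X \<omega> * Y \<omega> \<partial>M) = (\<integral>\<^sup>+\<omega>. X \<omega> \<partial>M) * (\<integral>\<^sup>+\<omega>. Y \<omega> \<partial>M)"
proof -
  have "(\<lambda>_. borel) = case_bool borel (borel :: ennreal measure)" by (auto split: bool.split)
  hence "indep_vars (\<lambda>_. borel) (case_bool X Y) UNIV" using assms by (simp add: indep_var_def)
  hence "(\<integral>\<^sup>+\<omega>. (\<Prod>i\<in>UNIV. case_bool X Y i \<omega>) \<partial>M) = (\<Prod>i\<in>UNIV. \<integral>\<^sup>+\<omega>. case_bool X Y i \<omega> \<partial>M)"
    by (intro indep_vars_nn_integral) auto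
  thus ?thesis by (simp add: UNIV_bool mult.commute)
qed

section \<open>Increments of the Wiener process\<close>

locale wiener_noise = prob_space M + eigenbasis D \<phi> lam for M :: "'w measure" and D :: "(real^'n::finite) set" and \<phi> lam +
  fixes Fl :: "real \<Rightarrow> 'w set set" and Q :: "'n fn \<Rightarrow> 'n fn" and W :: "real \<Rightarrow> 'w \<Rightarrow> 'n fn" and K :: real
  assumes filtration: "normal_filtration M Fl" and Q: "selfadj_psd D Q" and wiener: "Q_wiener D M Fl Q W"
    and W_mean: "\<And>t \<omega>. 0 \<le> t \<Longrightarrow> \<omega> \<in> space M \<Longrightarrow> mean_zero D (W t \<omega>)"
    and HS: "HS_sq D \<phi> lam Q \<le> ennreal (K\<^sup>2)"
begin

definition incr :: "real \<Rightarrow> real \<Rightarrow> 'w \<Rightarrow> 'n fn" where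
  "incr s t \<omega> = (\<lambda>x. W t \<omega> x - W s \<omega> x)"

definition Zn :: "real \<Rightarrow> real \<Rightarrow> nat \<Rightarrow> 'w \<Rightarrow> real" where
  "Zn s t n \<omega> = (\<Sum>j<n. lam j * (ip D (incr s t \<omega>) (\<phi> j))\<^sup>2)"

text \<open>The squared gradient norm of the increment; as an extended real it requires no
  finiteness in advance.\<close>

definition Zinf :: "real \<Rightarrow> real \<Rightarrow> 'w \<Rightarrow> ennreal" where
  "Zinf s t \<omega> = (\<Sum>j. ennreal (lam j * (ip D (incr s t \<omega>) (\<phi> j))\<^sup>2))"

text \<open>\<open>enn2real\<close> sends infinity to 0, so the comparison with the partial sums
  \<open>Zn\<close> is made where \<open>Zinf\<close> is finite, which is almost surely the
  case.\<close>

definition Zr :: "real \<Rightarrow> real \<Rightarrow> 'w \<Rightarrow> real" where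
  "Zr s t \<omega> = enn2real (Zinf s t \<omega>)"

definition Fm :: "real \<Rightarrow> 'w measure" where "Fm t = sigma (space M) (Fl t)"

text \<open>Generated by the scalar products of the increment with \<open>L2\<close> functions, the
  family in the independence clause of \<open>Q_wiener\<close>.\<close>

definition Gm :: "real \<Rightarrow> real \<Rightarrow> 'w measure" where
  "Gm s t = sigma (space M) {{\<omega> \<in> space M. ip D (incr s t \<omega>) v \<in> U} | v U. v \<in> L2 D \<and> U \<in> sets borel}"

lemmas W_L2 = wiener[unfolded Q_wiener_def, THEN conjunct1, rule_format]
lemmas W_adapted = wiener[unfolded Q_wiener_def, THEN conjunct2, THEN conjunct2, THEN conjunct2, THEN conjunct1, rule_format]
lemmas W_law = wiener[unfolded Q_wiener_def, THEN conjunct2, THEN conjunct2, THEN conjunct2, THEN conjunct2, THEN conjunct1, rule_format]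
lemmas W_indep = wiener[unfolded Q_wiener_def, THEN conjunct2, THEN conjunct2, THEN conjunct2, THEN conjunct2, THEN conjunct2, rule_format]

lemma incr_L2: "0 \<le> s \<Longrightarrow> s \<le> t \<Longrightarrow> \<omega> \<in> space M \<Longrightarrow> incr s t \<omega> \<in> L2 D"
  unfolding incr_def by (intro L2_diff W_L2) auto

lemma incr_mean_zero: "0 \<le> s \<Longrightarrow> s \<le> t \<Longrightarrow> \<omega> \<in> space M \<Longrightarrow> mean_zero D (incr s t \<omega>)"
  using W_mean[of t \<omega>] W_mean[of s \<omega>] L2_integrable[OF W_L2[of t \<omega>]] L2_integrable[OF W_L2[of s \<omega>]]
  by (simp add: incr_def mean_zero_def)

lemma Fl_sigma: "sigma_algebra (space M) (Fl t)" and Fl_M: "Fl t \<subseteq> sets M"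
  using filtration[unfolded normal_filtration_def, THEN conjunct1, rule_format] by auto

lemma Fl_mono: "0 \<le> s \<Longrightarrow> s \<le> t \<Longrightarrow> Fl s \<subseteq> Fl t"
  by (rule filtration[unfolded normal_filtration_def, THEN conjunct2, THEN conjunct1, rule_format])

lemma Fl_null: "0 \<le> t \<Longrightarrow> N \<in> null_sets M \<Longrightarrow> B \<subseteq> N \<Longrightarrow> B \<in> Fl t"
  using filtration[unfolded normal_filtration_def, THEN conjunct2, THEN conjunct2, THEN conjunct2, rule_format, of N B] Fl_mono[of 0 t]
  by auto

lemma sets_Fm: "sets (Fm t) = Fl t" and space_Fm: "space (Fm t) = space M"
  using Fl_sigma[of t] by (simp_all add: Fm_def sigma_algebra.sets_measure_of_eq space_measure_of_conv)

lemma Fm_sub: "subalgebra M (Fm t)"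
  using Fl_M by (simp add: subalgebra_def sets_Fm space_Fm)

lemma Fm_mono: "0 \<le> s \<Longrightarrow> s \<le> t \<Longrightarrow> subalgebra (Fm t) (Fm s)"
  using Fl_mono by (simp add: subalgebra_def sets_Fm space_Fm)

lemma ip_W_Fm: 
  assumes "0 \<le> t" "v \<in> L2 D" shows "(\<lambda>\<omega>. ip D (W t \<omega>) v) \<in> borel_measurable (Fm t)"
proof (rule measurableI)
  fix U :: "real set" assume "U \<in> sets borel"
  hence "{\<omega> \<in> space M. ip D (W t \<omega>) v \<in> U} \<in> Fl t" by (intro W_adapted assms)
  moreover have "(\<lambda>\<omega>. ip D (W t \<omega>) v) -` U \<inter> space (Fm t) = {\<omega> \<in> space M. ip D (W t \<omega>) v \<in> U}"
    by (auto simp: space_Fm)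
  ultimately show "(\<lambda>\<omega>. ip D (W t \<omega>) v) -` U \<inter> space (Fm t) \<in> sets (Fm t)" by (simp add: sets_Fm)
qed auto

lemma ip_incr_Fm:
  assumes "0 \<le> s" "s \<le> t" "v \<in> L2 D" shows "(\<lambda>\<omega>. ip D (incr s t \<omega>) v) \<in> borel_measurable (Fm t)"
proof -
  have "(\<lambda>\<omega>. ip D (W s \<omega>) v) \<in> borel_measurable (Fm t)"
    using ip_W_Fm[OF assms(1,3)] measurable_from_subalg[OF Fm_mono[OF assms(1,2)]] by blast
  hence "(\<lambda>\<omega>. ip D (W t \<omega>) v - ip D (W s \<omega>) v) \<in> borel_measurable (Fm t)"
    using ip_W_Fm[of t v] assms by auto
  thus ?thesis
    by (rule measurable_cong[THEN iffD1, rotated]) (use assms in \<open>auto simp: incr_def ip_diff W_L2 space_Fm\<close>)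
qed

lemma ip_incr_M: "0 \<le> s \<Longrightarrow> s \<le> t \<Longrightarrow> v \<in> L2 D \<Longrightarrow> (\<lambda>\<omega>. ip D (incr s t \<omega>) v) \<in> borel_measurable M"
  using ip_incr_Fm measurable_from_subalg[OF Fm_sub] by blast

lemma Gm_sub: "0 \<le> s \<Longrightarrow> s \<le> t \<Longrightarrow> subalgebra M (Gm s t)"
proof -
  assume st: "0 \<le> s" "s \<le> t"
  have "{\<omega> \<in> space M. ip D (incr s t \<omega>) v \<in> U} \<in> sets M" if "v \<in> L2 D" "U \<in> sets borel" for v U
    using measurable_sets[OF ip_incr_M[OF st that(1)] that(2)] by (simp add: vimage_def Int_def conj_commute)
  hence *: "{{\<omega> \<in> space M. ip D (incr s t \<omega>) v \<in> U} | v U. v \<in> L2 D \<and> U \<in> sets borel} \<subseteq> sets M" by blast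
  have "sets (Gm s t) = sigma_sets (space M) {{\<omega> \<in> space M. ip D (incr s t \<omega>) v \<in> U} | v U. v \<in> L2 D \<and> U \<in> sets borel}"
    unfolding Gm_def by (rule sets_measure_of) auto
  also have "\<dots> \<subseteq> sets M" by (rule sets.sigma_sets_subset[OF *])
  finally show ?thesis by (simp add: subalgebra_def Gm_def space_measure_of_conv)
qed

lemma ip_incr_Gm: 
  assumes "v \<in> L2 D" shows "(\<lambda>\<omega>. ip D (incr s t \<omega>) v) \<in> borel_measurable (Gm s t)"
proof (rule measurableI)
  fix U :: "real set" assume U: "U \<in> sets borel"
  have "{\<omega> \<in> space M. ip D (incr s t \<omega>) v \<in> U} \<in> sets (Gm s t)"
  proof -
    have "sets (Gm s t) = sigma_sets (space M) {{\<omega> \<in> space M. ip D (incr s t \<omega>) v \<in> U} | v U. v \<in> L2 D \<and> U \<in> sets borel}"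
      unfolding Gm_def by (rule sets_measure_of) auto
    moreover have "{\<omega> \<in> space M. ip D (incr s t \<omega>) v \<in> U} \<in> {{\<omega> \<in> space M. ip D (incr s t \<omega>) v \<in> U} | v U. v \<in> L2 D \<and> U \<in> sets borel}"
      using assms U by blast
    ultimately show ?thesis by (simp only: sigma_sets.Basic)
  qed
  moreover have "(\<lambda>\<omega>. ip D (incr s t \<omega>) v) -` U \<inter> space (Gm s t) = {\<omega> \<in> space M. ip D (incr s t \<omega>) v \<in> U}"
    by (auto simp: Gm_def space_measure_of_conv)
  ultimately show "(\<lambda>\<omega>. ip D (incr s t \<omega>) v) -` U \<inter> space (Gm s t) \<in> sets (Gm s t)" by simp
qed auto

lemma indep_Fm_Gm:
  assumes st: "0 \<le> s" "s < t"
  shows "indep_set (sets (Fm s)) (sets (Gm s t))"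
proof -
  have "indep_set (Fl s) (sigma_sets (space M) {{\<omega> \<in> space M. ip D (\<lambda>x. W t \<omega> x - W s \<omega> x) v \<in> U} | v U. v \<in> L2 D \<and> U \<in> sets borel})"
    by (rule W_indep[OF st])
  moreover have "sets (Gm s t) = sigma_sets (space M) {{\<omega> \<in> space M. ip D (\<lambda>x. W t \<omega> x - W s \<omega> x) v \<in> U} | v U. v \<in> L2 D \<and> U \<in> sets borel}"
    unfolding Gm_def incr_def by (rule sets_measure_of) auto
  ultimately show ?thesis by (simp add: sets_Fm)
qed

lemma Q_nonneg: "v \<in> L2 D \<Longrightarrow> 0 \<le> ip D (Q v) v"
  using Q unfolding selfadj_psd_def by blast

lemma ip_incr_distr: "0 \<le> s \<Longrightarrow> s < t \<Longrightarrow> v \<in> L2 D \<Longrightarrow> distr M borel (\<lambda>\<omega>. ip D (incr s t \<omega>) v) = gauss ((t - s) * ip D (Q v) v)"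
  unfolding incr_def by (rule W_law)

lemma ip_incr_moment:
  assumes st: "0 \<le> s" "s < t" and v: "v \<in> L2 D" and i: "1 \<le> i"
  shows "(\<integral>\<^sup>+\<omega>. ennreal ((ip D (incr s t \<omega>) v) ^ (2 * i)) \<partial>M) = ennreal (gauss_moment i * ((t - s) * ip D (Q v) v) ^ i)"
proof -
  have "(\<integral>\<^sup>+\<omega>. ennreal ((ip D (incr s t \<omega>) v) ^ (2 * i)) \<partial>M) = (\<integral>\<^sup>+x. ennreal (x ^ (2 * i)) \<partial>distr M borel (\<lambda>\<omega>. ip D (incr s t \<omega>) v))"
    using ip_incr_M[of s t v] st v by (subst nn_integral_distr) auto
  also have "\<dots> = ennreal (gauss_moment i * ((t - s) * ip D (Q v) v) ^ i)"
    unfolding ip_incr_distr[OF st v] using st Q_nonneg[OF v] i by (intro nn_integral_gauss_power) auto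
  finally show ?thesis .
qed

lemma ip_incr_mean:
  assumes st: "0 \<le> s" "s < t" and v: "v \<in> L2 D"
  shows "integrable M (\<lambda>\<omega>. ip D (incr s t \<omega>) v)" "integral\<^sup>L M (\<lambda>\<omega>. ip D (incr s t \<omega>) v) = 0"
proof -
  have m: "(\<lambda>\<omega>. ip D (incr s t \<omega>) v) \<in> borel_measurable M" using ip_incr_M st v by auto
  have g: "integrable (distr M borel (\<lambda>\<omega>. ip D (incr s t \<omega>) v)) (\<lambda>x. x)" "integral\<^sup>L (distr M borel (\<lambda>\<omega>. ip D (incr s t \<omega>) v)) (\<lambda>x. x) = 0"
    unfolding ip_incr_distr[OF st v] using st Q_nonneg[OF v] by (auto intro!: gauss_mean)
  show "integrable M (\<lambda>\<omega>. ip D (incr s t \<omega>) v)" using g(1) m by (subst (asm) integrable_distr_eq) auto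
  show "integral\<^sup>L M (\<lambda>\<omega>. ip D (incr s t \<omega>) v) = 0" using g(2) m by (subst (asm) integral_distr) auto
qed

section \<open>Moments of the gradient norm of an increment\<close>

lemma Zn_nonneg: "0 \<le> Zn s t n \<omega>"
  unfolding Zn_def using lam_nonneg by (intro sum_nonneg) auto

lemma trace_partial: "(\<Sum>j<n. lam j * ip D (Q (\<phi> j)) (\<phi> j)) \<le> K\<^sup>2"
proof -
  have nn: "0 \<le> lam j * ip D (Q (\<phi> j)) (\<phi> j)" for j using lam_nonneg Q_nonneg[OF phi_L2] by simp
  have "ennreal (\<Sum>j<n. lam j * ip D (Q (\<phi> j)) (\<phi> j)) = (\<Sum>j<n. ennreal (lam j * ip D (Q (\<phi> j)) (\<phi> j)))"
    using nn by (simp add: sum_ennreal)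
  also have "\<dots> \<le> HS_sq D \<phi> lam Q" unfolding HS_sq_def by (rule sum_le_suminf) auto
  also have "\<dots> \<le> ennreal (K\<^sup>2)" by (rule HS)
  finally show ?thesis by (subst (asm) ennreal_le_iff) auto
qed

text \<open>Power mean inequality with weights \<open>lam j * q j\<close> and points
  \<open>(\<beta> j)^2 / q j\<close>, where \<open>q j\<close> is the variance of the coefficient
  \<open>\<beta> j\<close>. The weights sum to at most the Hilbert-Schmidt bound times the time
  step, and only moments of single Gaussian coefficients remain.\<close>

lemma Zn_moment:
  assumes st: "0 \<le> s" "s < t" and i: "1 \<le> i"
  shows "(\<integral>\<^sup>+\<omega>. ennreal (Zn s t n \<omega> ^ i) \<partial>M) \<le> ennreal (gauss_moment i * ((t - s) * K\<^sup>2) ^ i)"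
proof -
  obtain i' where i': "i = Suc i'" using i by (cases i) auto
  define q where "q j = (t - s) * ip D (Q (\<phi> j)) (\<phi> j)" for j
  have q0: "0 \<le> q j" for j unfolding q_def using st Q_nonneg[OF phi_L2] by simp
  define \<beta> where "\<beta> j \<omega> = ip D (incr s t \<omega>) (\<phi> j)" for j \<omega>
  have bm: "\<beta> j \<in> borel_measurable M" for j unfolding \<beta>_def using st by (intro ip_incr_M phi_L2) auto
  define T where "T = (\<Sum>j<n. lam j * q j)"
  have T0: "0 \<le> T" unfolding T_def using lam_nonneg q0 by (intro sum_nonneg) auto
  have Tle: "T \<le> (t - s) * K\<^sup>2"
  proof -
    have "T = (t - s) * (\<Sum>j<n. lam j * ip D (Q (\<phi> j)) (\<phi> j))" by (simp add: T_def q_def sum_distrib_left mult_ac)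
    also have "\<dots> \<le> (t - s) * K\<^sup>2" using st by (intro mult_left_mono trace_partial) auto
    finally show ?thesis .
  qed
  \<comment> \<open>Division by \<open>q j = 0\<close> yields 0 in the formulas below, which is
    correct because such a coefficient vanishes almost surely.\<close>
  have z: "AE \<omega> in M. \<forall>j\<in>{..<n}. q j = 0 \<longrightarrow> \<beta> j \<omega> = 0"
  proof (intro AE_finite_allI)
    fix j
    show "AE \<omega> in M. q j = 0 \<longrightarrow> \<beta> j \<omega> = 0"
    proof (cases "q j = 0")
      case True
      have "(\<integral>\<^sup>+\<omega>. ennreal (\<beta> j \<omega> ^ (2 * 1)) \<partial>M) = 0"
        unfolding \<beta>_def ip_incr_moment[OF st phi_L2 order_refl] using True by (simp only: q_def[symmetric]) simp
      hence "AE \<omega> in M. ennreal (\<beta> j \<omega> ^ (2 * 1)) = 0" using bm[of j] by (subst (asm) nn_integral_0_iff_AE) auto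
      thus ?thesis by eventually_elim (auto simp: ennreal_eq_0_iff)
    qed simp
  qed simp
  have "AE \<omega> in M. Zn s t n \<omega> ^ i \<le> T ^ i' * (\<Sum>j<n. lam j * q j * ((\<beta> j \<omega>)\<^sup>2 / q j) ^ i)"
    using z
  proof eventually_elim
    case (elim \<omega>)
    have "Zn s t n \<omega> = (\<Sum>j<n. (lam j * q j) * ((\<beta> j \<omega>)\<^sup>2 / q j))"
      unfolding Zn_def \<beta>_def[symmetric] by (intro sum.cong) (use elim in auto)
    thus ?case unfolding i' T_def using lam_nonneg q0 
      by (simp only:) (intro weighted_power_mean, auto)
  qed
  hence "(\<integral>\<^sup>+\<omega>. ennreal (Zn s t n \<omega> ^ i) \<partial>M) \<le> (\<integral>\<^sup>+\<omega>. ennreal (T ^ i' * (\<Sum>j<n. lam j * q j * ((\<beta> j \<omega>)\<^sup>2 / q j) ^ i)) \<partial>M)"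
    by (intro nn_integral_mono_AE) (auto elim!: eventually_mono intro: ennreal_leI)
  also have "\<dots> = (\<integral>\<^sup>+\<omega>. (\<Sum>j<n. ennreal (T ^ i' * (lam j * q j / q j ^ i)) * ennreal (\<beta> j \<omega> ^ (2 * i))) \<partial>M)"
  proof (intro nn_integral_cong)
    fix \<omega>
    have "T ^ i' * (\<Sum>j<n. lam j * q j * ((\<beta> j \<omega>)\<^sup>2 / q j) ^ i) = (\<Sum>j<n. T ^ i' * (lam j * q j / q j ^ i) * \<beta> j \<omega> ^ (2 * i))"
      unfolding sum_distrib_left by (intro sum.cong refl) (simp add: power_divide power_mult[symmetric] mult_ac)
    also have "ennreal \<dots> = (\<Sum>j<n. ennreal (T ^ i' * (lam j * q j / q j ^ i) * \<beta> j \<omega> ^ (2 * i)))"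
      using T0 lam_nonneg q0 by (intro sum_ennreal[symmetric]) auto
    also have "\<dots> = (\<Sum>j<n. ennreal (T ^ i' * (lam j * q j / q j ^ i)) * ennreal (\<beta> j \<omega> ^ (2 * i)))"
      using T0 lam_nonneg q0 by (intro sum.cong refl ennreal_mult) auto
    finally show "ennreal (T ^ i' * (\<Sum>j<n. lam j * q j * ((\<beta> j \<omega>)\<^sup>2 / q j) ^ i)) 
      = (\<Sum>j<n. ennreal (T ^ i' * (lam j * q j / q j ^ i)) * ennreal (\<beta> j \<omega> ^ (2 * i)))" .
  qed
  also have "\<dots> = (\<Sum>j<n. ennreal (T ^ i' * (lam j * q j / q j ^ i)) * (\<integral>\<^sup>+\<omega>. ennreal (\<beta> j \<omega> ^ (2 * i)) \<partial>M))"
    using bm by (simp add: nn_integral_sum nn_integral_cmult)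
  also have "\<dots> = (\<Sum>j<n. ennreal (T ^ i' * (lam j * q j / q j ^ i) * (gauss_moment i * q j ^ i)))"
  proof (intro sum.cong refl)
    fix j
    have e: "(\<integral>\<^sup>+\<omega>. ennreal (\<beta> j \<omega> ^ (2 * i)) \<partial>M) = ennreal (gauss_moment i * q j ^ i)"
      unfolding \<beta>_def q_def by (rule ip_incr_moment[OF st phi_L2 i])
    show "ennreal (T ^ i' * (lam j * q j / q j ^ i)) * (\<integral>\<^sup>+\<omega>. ennreal (\<beta> j \<omega> ^ (2 * i)) \<partial>M)
      = ennreal (T ^ i' * (lam j * q j / q j ^ i) * (gauss_moment i * q j ^ i))"
      unfolding e using T0 lam_nonneg[of j] q0[of j] gauss_moment_nonneg[of i] by (intro ennreal_mult[symmetric]) auto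
  qed
  also have "\<dots> = ennreal (\<Sum>j<n. T ^ i' * (lam j * q j / q j ^ i) * (gauss_moment i * q j ^ i))"
    using T0 lam_nonneg q0 gauss_moment_nonneg by (intro sum_ennreal) auto
  also have "(\<Sum>j<n. T ^ i' * (lam j * q j / q j ^ i) * (gauss_moment i * q j ^ i)) = (\<Sum>j<n. (T ^ i' * gauss_moment i) * (lam j * q j))"
    by (intro sum.cong) (auto simp: i')
  also have "\<dots> = gauss_moment i * T ^ i"
    unfolding sum_distrib_left[symmetric] T_def[symmetric] i' by simp
  also have "ennreal \<dots> \<le> ennreal (gauss_moment i * ((t - s) * K\<^sup>2) ^ i)"
    using Tle T0 gauss_moment_nonneg by (intro ennreal_leI mult_left_mono power_mono) auto
  finally show ?thesis .
qed

lemma Zinf_Gm: "Zinf s t \<in> borel_measurable (Gm s t)"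
  unfolding Zinf_def using ip_incr_Gm[OF phi_L2] by measurable

lemma Zr_Gm: "Zr s t \<in> borel_measurable (Gm s t)"
  unfolding Zr_def using Zinf_Gm by measurable

lemma Zr_M: "0 \<le> s \<Longrightarrow> s \<le> t \<Longrightarrow> Zr s t \<in> borel_measurable M"
  using Zr_Gm measurable_from_subalg[OF Gm_sub] by blast

lemma Zr_nonneg: "0 \<le> Zr s t \<omega>" by (simp add: Zr_def)

lemma Zn_tendsto_Zinf: "(\<lambda>n. ennreal (Zn s t n \<omega>)) \<longlonglongrightarrow> Zinf s t \<omega>"
proof -
  have "ennreal (Zn s t n \<omega>) = (\<Sum>j<n. ennreal (lam j * (ip D (incr s t \<omega>) (\<phi> j))\<^sup>2))" for n
    unfolding Zn_def using lam_nonneg by (intro sum_ennreal[symmetric]) auto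
  moreover have "(\<lambda>j. ennreal (lam j * (ip D (incr s t \<omega>) (\<phi> j))\<^sup>2)) sums Zinf s t \<omega>"
    unfolding Zinf_def by (intro summable_sums) simp
  ultimately show ?thesis by (simp add: sums_def)
qed

lemma Zn_M: "0 \<le> s \<Longrightarrow> s \<le> t \<Longrightarrow> Zn s t n \<in> borel_measurable M"
  unfolding Zn_def using ip_incr_M[OF _ _ phi_L2] by measurable

text \<open>Fatou's lemma, with first moments of the partial sums bounded uniformly in
  \<open>n\<close>.\<close>

lemma Zinf_finite:
  assumes st: "0 \<le> s" "s < t"
  shows "AE \<omega> in M. Zinf s t \<omega> \<noteq> \<infinity>"
proof -
  have m: "Zinf s t \<in> borel_measurable M"
    using st by (intro measurable_from_subalg[OF Gm_sub Zinf_Gm]) auto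
  have "(\<integral>\<^sup>+\<omega>. Zinf s t \<omega> \<partial>M) = (\<integral>\<^sup>+\<omega>. liminf (\<lambda>n. ennreal (Zn s t n \<omega>)) \<partial>M)"
    by (intro nn_integral_cong lim_imp_Liminf[symmetric] Zn_tendsto_Zinf) simp
  also have "\<dots> \<le> liminf (\<lambda>n. \<integral>\<^sup>+\<omega>. ennreal (Zn s t n \<omega>) \<partial>M)"
    using Zn_M[of s t] st by (intro nn_integral_liminf) auto
  also have "\<dots> \<le> liminf (\<lambda>n. ennreal (gauss_moment 1 * ((t - s) * K\<^sup>2) ^ 1))"
    using Zn_moment[OF st, of 1] by (intro Liminf_mono always_eventually) auto
  also have "\<dots> < \<infinity>" by (simp add: Liminf_const)
  finally show ?thesis using nn_integral_noteq_infinite[OF m] by (simp add: less_top)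
qed

lemma Zn_tendsto_Zr: 
  assumes "Zinf s t \<omega> \<noteq> \<infinity>" shows "(\<lambda>n. Zn s t n \<omega>) \<longlonglongrightarrow> Zr s t \<omega>"
proof -
  have "Zinf s t \<omega> = ennreal (Zr s t \<omega>)" using assms by (simp add: Zr_def less_top)
  thus ?thesis using Zn_tendsto_Zinf[of s t \<omega>] Zn_nonneg Zr_nonneg
    by (auto intro!: tendsto_ennrealD)
qed

lemma Zn_le_Zr: 
  assumes "Zinf s t \<omega> \<noteq> \<infinity>" shows "Zn s t n \<omega> \<le> Zr s t \<omega>"
proof (rule incseq_le[OF _ Zn_tendsto_Zr[OF assms]])
  show "incseq (\<lambda>n. Zn s t n \<omega>)"
    by (rule incseq_SucI) (simp add: Zn_def lam_nonneg)
qed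

text \<open>Fatou's lemma again. For a time step of at most 1 its powers of order at least 1 are at
  most the step itself, so all these moments are linear in the step.\<close>

lemma Zr_moment:
  assumes st: "0 \<le> s" "s < t" "t - s \<le> 1" and i: "1 \<le> i"
  shows "(\<integral>\<^sup>+\<omega>. ennreal (Zr s t \<omega> ^ i) \<partial>M) \<le> ennreal (gauss_moment i * (K\<^sup>2) ^ i * (t - s))"
proof -
  have "(\<integral>\<^sup>+\<omega>. ennreal (Zr s t \<omega> ^ i) \<partial>M) = (\<integral>\<^sup>+\<omega>. liminf (\<lambda>n. ennreal (Zn s t n \<omega> ^ i)) \<partial>M)"
  proof (rule nn_integral_cong_AE)
    show "AE \<omega> in M. ennreal (Zr s t \<omega> ^ i) = liminf (\<lambda>n. ennreal (Zn s t n \<omega> ^ i))"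
      using Zinf_finite[OF st(1,2)]
    proof eventually_elim
      case (elim \<omega>)
      have "(\<lambda>n. ennreal (Zn s t n \<omega> ^ i)) \<longlonglongrightarrow> ennreal (Zr s t \<omega> ^ i)"
        by (intro tendsto_ennrealI tendsto_power Zn_tendsto_Zr elim)
      thus ?case by (simp add: lim_imp_Liminf)
    qed
  qed
  also have "\<dots> \<le> liminf (\<lambda>n. \<integral>\<^sup>+\<omega>. ennreal (Zn s t n \<omega> ^ i) \<partial>M)"
    using Zn_M[of s t] st by (intro nn_integral_liminf) auto
  also have "\<dots> \<le> liminf (\<lambda>n. ennreal (gauss_moment i * ((t - s) * K\<^sup>2) ^ i))"
    using Zn_moment[OF st(1,2) i] by (intro Liminf_mono always_eventually) auto
  also have "\<dots> = ennreal (gauss_moment i * ((t - s) * K\<^sup>2) ^ i)" by (simp add: Liminf_const)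
  also have "\<dots> \<le> ennreal (gauss_moment i * (K\<^sup>2) ^ i * (t - s))"
  proof (rule ennreal_leI)
    have "(t - s) ^ i \<le> (t - s) ^ 1" using st i by (intro power_decreasing) auto
    hence "(gauss_moment i * (K\<^sup>2) ^ i) * (t - s) ^ i \<le> (gauss_moment i * (K\<^sup>2) ^ i) * (t - s)"
      using gauss_moment_nonneg by (intro mult_left_mono) auto
    thus "gauss_moment i * ((t - s) * K\<^sup>2) ^ i \<le> gauss_moment i * (K\<^sup>2) ^ i * (t - s)"
      by (simp add: power_mult_distrib mult_ac)
  qed
  finally show ?thesis .
qed

text \<open>The filtration contains all subsets of null sets. The scheme holds almost surely only,
  so measurability must survive changes on such sets.\<close>

lemma Fm_AE_eq:
  fixes f g :: "'w \<Rightarrow> real"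
  assumes t: "0 \<le> t" and g: "g \<in> borel_measurable (Fm t)" and eq: "AE \<omega> in M. f \<omega> = g \<omega>"
  shows "f \<in> borel_measurable (Fm t)"
proof (rule measurableI)
  fix U :: "real set" assume U: "U \<in> sets borel"
  obtain N where N: "N \<in> null_sets M" "{\<omega> \<in> space M. f \<omega> \<noteq> g \<omega>} \<subseteq> N" using eq by (rule AE_E) (auto simp: null_sets_def)
  have "N \<inter> space M \<in> Fl t" "(f -` U \<inter> space M) \<inter> N \<in> Fl t" using N(1) t by (auto intro: Fl_null)
  moreover have "g -` U \<inter> space M \<in> Fl t" using measurable_sets[OF g U] by (simp add: sets_Fm space_Fm)
  ultimately have "((g -` U \<inter> space M) - (N \<inter> space M)) \<union> ((f -` U \<inter> space M) \<inter> N) \<in> sets (Fm t)"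
    by (metis sets.Diff sets.Un sets_Fm)
  moreover have "f -` U \<inter> space M = ((g -` U \<inter> space M) - (N \<inter> space M)) \<union> ((f -` U \<inter> space M) \<inter> N)"
    using N(2) by auto
  ultimately show "f -` U \<inter> space (Fm t) \<in> sets (Fm t)" by (simp add: space_Fm)
qed auto

end

section \<open>The scheme\<close>

(* McShane extension: a Lipschitz function of a measurable vector is measurable. *)
lemma lipschitz_factor_measurable:
  fixes R :: "'w \<Rightarrow> nat \<Rightarrow> real" and y :: "'w \<Rightarrow> real"
  assumes L: "0 \<le> L" and lip: "\<And>\<omega> \<omega>'. \<omega> \<in> H \<Longrightarrow> \<omega>' \<in> H \<Longrightarrow> y \<omega> \<le> y \<omega>' + L * (\<Sum>i<m. \<bar>R \<omega> i - R \<omega>' i\<bar>)"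
    and R: "\<And>i. i < m \<Longrightarrow> (\<lambda>\<omega>. R \<omega> i) \<in> borel_measurable A"
  shows "\<exists>g. g \<in> borel_measurable A \<and> (\<forall>\<omega>\<in>H. y \<omega> = g \<omega>)"
proof (cases "H = {}")
  case True thus ?thesis by (intro exI[of _ "\<lambda>_. 0"]) auto
next
  case False
  define d where "d r r' = (\<Sum>i<m. \<bar>r i - r' i\<bar>)" for r r' :: "nat \<Rightarrow> real"
  have d_tri: "d r r'' \<le> d r r' + d r' r''" for r r' r''
    unfolding d_def sum.distrib[symmetric] by (intro sum_mono) auto
  have d_sym: "d r r' = d r' r" for r r' unfolding d_def by (simp add: abs_minus_commute)
  define h where "h r = (INF \<omega>\<in>H. y \<omega> + L * d r (R \<omega>))" for r
  have lip': "y \<omega> \<le> y \<omega>' + L * d (R \<omega>) (R \<omega>')" if "\<omega> \<in> H" "\<omega>' \<in> H" for \<omega> \<omega>'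
    using lip[OF that] by (simp add: d_def)
  have low: "y \<omega>0 - L * d r (R \<omega>0) \<le> y \<omega> + L * d r (R \<omega>)" if "\<omega>0 \<in> H" "\<omega> \<in> H" for \<omega>0 \<omega> r
  proof -
    have "L * d (R \<omega>0) (R \<omega>) \<le> L * (d r (R \<omega>0) + d r (R \<omega>))"
      using d_tri[of "R \<omega>0" "R \<omega>" r] L by (intro mult_left_mono) (auto simp: d_sym)
    thus ?thesis using lip'[OF that] by (simp add: distrib_left)
  qed
  have bdd: "bdd_below ((\<lambda>\<omega>. y \<omega> + L * d r (R \<omega>)) ` H)" for r
  proof -
    obtain \<omega>0 where w0: "\<omega>0 \<in> H" using False by auto
    show ?thesis using low[OF w0] by (intro bdd_belowI2[where m = "y \<omega>0 - L * d r (R \<omega>0)"])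
  qed
  have hR: "h (R \<omega>) = y \<omega>" if w: "\<omega> \<in> H" for \<omega>
  proof (rule antisym)
    have "h (R \<omega>) \<le> y \<omega> + L * d (R \<omega>) (R \<omega>)" unfolding h_def by (rule cINF_lower[OF bdd w])
    thus "h (R \<omega>) \<le> y \<omega>" by (simp add: d_def)
    show "y \<omega> \<le> h (R \<omega>)" unfolding h_def using False lip'[OF w] by (intro cINF_greatest) auto
  qed
  have hlip: "h r \<le> h r' + L * d r r'" for r r'
  proof -
    have "h r - L * d r r' \<le> h r'"
      unfolding h_def[of r']
    proof (rule cINF_greatest[OF False])
      fix \<omega> assume w: "\<omega> \<in> H"
      have "h r \<le> y \<omega> + L * d r (R \<omega>)" unfolding h_def by (rule cINF_lower[OF bdd w])
      also have "\<dots> \<le> y \<omega> + L * (d r r' + d r' (R \<omega>))" using L by (intro add_left_mono mult_left_mono d_tri)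
      finally show "h r - L * d r r' \<le> y \<omega> + L * d r' (R \<omega>)" by (simp add: distrib_left)
    qed
    thus ?thesis by simp
  qed
  have "continuous_on UNIV h"
    unfolding continuous_on_def
  proof (intro ballI)
    fix r :: "nat \<Rightarrow> real"
    have c: "continuous_on UNIV (\<lambda>r'. L * d r r')"
      unfolding d_def by (intro continuous_intros continuous_on_product_coordinates)
    have "((\<lambda>r'. L * d r r') \<longlongrightarrow> L * d r r) (at r within UNIV)" using c unfolding continuous_on_def by blast
    hence z: "((\<lambda>r'. L * d r r') \<longlongrightarrow> 0) (at r within UNIV)" by (simp add: d_def)
    have "((\<lambda>r'. h r' - h r) \<longlongrightarrow> 0) (at r within UNIV)"
    proof (rule Lim_null_comparison[OF _ z])
      have "norm (h r' - h r) \<le> L * d r r'" for r' using hlip[of r r'] hlip[of r' r] d_sym[of r r'] by (simp add: abs_le_iff)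
      thus "\<forall>\<^sub>F r' in at r within UNIV. norm (h r' - h r) \<le> L * d r r'" by (intro always_eventually) auto
    qed
    thus "(h \<longlongrightarrow> h r) (at r within UNIV)" by (simp add: LIM_zero_iff)
  qed
  hence hm: "h \<in> borel_measurable borel" by (rule borel_measurable_continuous_onI)
  \<comment> \<open>Coordinates from \<open>m\<close> on are set to 0 so that \<open>R'\<close> is
    measurable into the product space; \<open>h\<close> does not see them.\<close>
  define R' where "R' \<omega> = (\<lambda>i. if i < m then R \<omega> i else 0)" for \<omega>
  have "R' \<in> borel_measurable A"
  proof (rule measurable_coordinatewise_then_product)
    fix i show "(\<lambda>\<omega>. R' \<omega> i) \<in> borel_measurable A" using R by (cases "i < m") (auto simp: R'_def)
  qed
  hence "(\<lambda>\<omega>. h (R' \<omega>)) \<in> borel_measurable A" using hm by (rule measurable_compose)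
  moreover have "h (R' \<omega>) = h (R \<omega>)" for \<omega> unfolding h_def d_def R'_def by simp
  ultimately show ?thesis using hR by (intro exI[of _ "\<lambda>\<omega>. h (R \<omega>)"]) simp
qed

section \<open>Measurability through coordinates\<close>

context ch_mesh begin

lemma measurable_ip_poly:
  fixes x :: "nat \<Rightarrow> 'b \<Rightarrow> real" and p :: "real poly"
  assumes x: "\<And>i. i < (m::nat) \<Longrightarrow> (\<lambda>\<omega>. x i \<omega>) \<in> borel_measurable NM" and g: "\<And>i. i < m \<Longrightarrow> g i \<in> borel_measurable \<mu>" 
    and z: "z \<in> borel_measurable \<mu>"
  shows "(\<lambda>\<omega>. integral\<^sup>L \<mu> (\<lambda>t. poly p (\<Sum>i<m. x i \<omega> * g i t) * z t)) \<in> borel_measurable NM"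
proof (rule sigma_finite_measure.borel_measurable_lebesgue_integral[OF sigma_finite_measure_axioms])
  have pm: "poly p \<in> borel_measurable borel" by (intro borel_measurable_continuous_onI continuous_intros)
  have "(\<lambda>q. x i (fst q) * g i (snd q)) \<in> borel_measurable (NM \<Otimes>\<^sub>M \<mu>)" if "i < m" for i
    by (intro borel_measurable_times measurable_compose[OF measurable_fst x[OF that]] measurable_compose[OF measurable_snd g[OF that]])
  hence "(\<lambda>q. \<Sum>i<m. x i (fst q) * g i (snd q)) \<in> borel_measurable (NM \<Otimes>\<^sub>M \<mu>)" by (intro borel_measurable_sum) auto
  hence "(\<lambda>q. poly p (\<Sum>i<m. x i (fst q) * g i (snd q)) * z (snd q)) \<in> borel_measurable (NM \<Otimes>\<^sub>M \<mu>)"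
    by (intro borel_measurable_times measurable_compose[OF _ pm] measurable_compose[OF measurable_snd z])
  thus "(\<lambda>(\<omega>, t). poly p (\<Sum>i<m. x i \<omega> * g i t) * z t) \<in> borel_measurable (NM \<Otimes>\<^sub>M \<mu>)" by (simp add: case_prod_beta')
qed

lemma gip_sum_left:
  assumes "\<And>i. i \<in> I \<Longrightarrow> e i \<in> S" "z \<in> S"
  shows "gip D (\<lambda>x. \<Sum>i\<in>I. c i * e i x) z = (\<Sum>i\<in>I. c i * gip D (e i) z)"
  by (rule bilinear_sum[where V = S and B = "gip D", THEN conjunct2]) (use assms in \<open>auto intro: Sh_lincomb gip_lincomb S_H1\<close>)

text \<open>No sigma-algebra is placed on the function space. In coordinates the three quantities
  are built from polynomials in the coordinates and from parameter integrals.\<close>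

lemma Y_measurable:
  fixes x :: "nat \<Rightarrow> 'b \<Rightarrow> real"
  assumes x: "\<And>i. i < (m::nat) \<Longrightarrow> (\<lambda>\<omega>. x i \<omega>) \<in> borel_measurable NM" and g: "\<And>i. i < m \<Longrightarrow> g i \<in> S"
  shows "z \<in> S \<Longrightarrow> (\<lambda>\<omega>. ip D z (Y (\<lambda>t. \<Sum>i<m. x i \<omega> * g i t))) \<in> borel_measurable NM"
    and "(\<lambda>\<omega>. gip D (Y (\<lambda>t. \<Sum>i<m. x i \<omega> * g i t)) (Y (\<lambda>t. \<Sum>i<m. x i \<omega> * g i t))) \<in> borel_measurable NM"
    and "(\<lambda>\<omega>. \<Phi> (\<lambda>t. \<Sum>i<m. x i \<omega> * g i t)) \<in> borel_measurable NM"
proof -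
  define V where "V \<omega> = (\<lambda>t. \<Sum>i<m. x i \<omega> * g i t)" for \<omega>
  have VS: "V \<omega> \<in> S" for \<omega> unfolding V_def using g by (intro S_sum) auto
  have gm: "\<And>i. i < m \<Longrightarrow> g i \<in> borel_measurable \<mu>" using g Sh_measurable by blast
  have 1: "(\<lambda>\<omega>. ip D (Y (V \<omega>)) z) \<in> borel_measurable NM" if z: "z \<in> S" for z
  proof -
    have "ip D (Y (V \<omega>)) z = (\<Sum>i<m. x i \<omega> * gip D (g i) z) + integral\<^sup>L \<mu> (\<lambda>t. f (\<Sum>i<m. x i \<omega> * g i t) * z t)" for \<omega>
      unfolding ip_Y[OF VS z] unfolding V_def ip_def using g z by (subst gip_sum_left) auto
    moreover have "(\<lambda>\<omega>. (\<Sum>i<m. x i \<omega> * gip D (g i) z) + integral\<^sup>L \<mu> (\<lambda>t. f (\<Sum>i<m. x i \<omega> * g i t) * z t)) \<in> borel_measurable NM"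
      using x by (intro borel_measurable_add borel_measurable_sum borel_measurable_times measurable_ip_poly gm Sh_measurable z) auto
    ultimately show ?thesis by simp
  qed
  thus "z \<in> S \<Longrightarrow> (\<lambda>\<omega>. ip D z (Y (\<lambda>t. \<Sum>i<m. x i \<omega> * g i t))) \<in> borel_measurable NM"
    unfolding V_def by (simp add: ip_commute)
  obtain l :: nat and e where e': "\<forall>i<l. e i \<in> S" "\<forall>i<l. \<forall>j<l. ip D (e i) (e j) = (if i = j then 1 else 0)" 
    "\<forall>v\<in>S. v = (\<lambda>x. \<Sum>i<l. ip D v (e i) * e i x)" using S_basis by (elim exE conjE)
  note e = e'(1)[rule_format] e'(2) e'(3)[rule_format]
  have "gip D (Y (V \<omega>)) (Y (V \<omega>)) = (\<Sum>i<l. ip D (Y (V \<omega>)) (e i) * (\<Sum>j<l. ip D (Y (V \<omega>)) (e j) * gip D (e j) (e i)))" for \<omega>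
  proof -
    have y: "Y (V \<omega>) \<in> S" by (intro Y_S VS)
    have s: "gip D (Y (V \<omega>)) z = (\<Sum>i<l. ip D (Y (V \<omega>)) (e i) * gip D (e i) z)" if "z \<in> S" for z
    proof -
      have "gip D (Y (V \<omega>)) z = gip D (\<lambda>x. \<Sum>i<l. ip D (Y (V \<omega>)) (e i) * e i x) z" using e(3)[OF y] by simp
      also have "\<dots> = (\<Sum>i<l. ip D (Y (V \<omega>)) (e i) * gip D (e i) z)" using e(1) that by (intro gip_sum_left) auto
      finally show ?thesis .
    qed
    show ?thesis unfolding s[OF y] 
      by (intro sum.cong refl) (use e(1) s in \<open>auto simp: gip_commute[of "e _" "Y (V \<omega>)"]\<close>)
  qed
  moreover have "(\<lambda>\<omega>. \<Sum>i<l. ip D (Y (V \<omega>)) (e i) * (\<Sum>j<l. ip D (Y (V \<omega>)) (e j) * gip D (e j) (e i))) \<in> borel_measurable NM"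
    by (intro borel_measurable_sum borel_measurable_times borel_measurable_const 1) (use e(1) in auto)
  ultimately show "(\<lambda>\<omega>. gip D (Y (\<lambda>t. \<Sum>i<m. x i \<omega> * g i t)) (Y (\<lambda>t. \<Sum>i<m. x i \<omega> * g i t))) \<in> borel_measurable NM"
    unfolding V_def by simp
  have "\<Phi> (V \<omega>) = (\<Sum>i<m. x i \<omega> * (\<Sum>j<m. x j \<omega> * gip D (g j) (g i))) / 2 
      + integral\<^sup>L \<mu> (\<lambda>t. poly F (\<Sum>i<m. x i \<omega> * g i t) * 1) + c_\<Phi>" for \<omega>
  proof -
    have s: "gip D (V \<omega>) z = (\<Sum>i<m. x i \<omega> * gip D (g i) z)" if "z \<in> S" for z
      unfolding V_def using g that by (intro gip_sum_left) auto
    have "gip D (V \<omega>) (V \<omega>) = (\<Sum>i<m. x i \<omega> * (\<Sum>j<m. x j \<omega> * gip D (g j) (g i)))"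
      unfolding s[OF VS] by (intro sum.cong refl) (use g s in \<open>auto simp: gip_commute[of "g _" "V \<omega>"]\<close>)
    thus ?thesis by (simp add: \<Phi>_def Jfun_def sn1_sq V_def)
  qed
  moreover have "(\<lambda>\<omega>. (\<Sum>i<m. x i \<omega> * (\<Sum>j<m. x j \<omega> * gip D (g j) (g i))) / 2 
      + integral\<^sup>L \<mu> (\<lambda>t. poly F (\<Sum>i<m. x i \<omega> * g i t) * 1) + c_\<Phi>) \<in> borel_measurable NM"
    using x by (intro borel_measurable_add borel_measurable_divide borel_measurable_sum borel_measurable_times measurable_ip_poly gm borel_measurable_const) auto
  ultimately show "(\<lambda>\<omega>. \<Phi> (\<lambda>t. \<Sum>i<m. x i \<omega> * g i t)) \<in> borel_measurable NM" unfolding V_def by simp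
qed

text \<open>Coordinate form of \<open>solution_stability\<close>. The constant depends on mesh and
  basis, which is harmless because only measurability is drawn from it.\<close>

lemma solution_lipschitz:
  assumes g: "\<And>i. i < m \<Longrightarrow> g i \<in> S0" and gs: "\<And>v. v \<in> S0 \<Longrightarrow> v = (\<lambda>x. \<Sum>i<m. gip D v (g i) * g i x)" 
    and k: "0 < k" "k \<le> k_1" and j: "j < (m::nat)"
  shows "\<exists>L\<ge>0. \<forall>a\<in>S0. \<forall>a'\<in>S0. \<forall>r\<in>S0. \<forall>r'\<in>S0. (\<forall>z\<in>S. ip D a z + k * gip D (Y a) z = ip D r z) \<longrightarrow> 
      (\<forall>z\<in>S. ip D a' z + k * gip D (Y a') z = ip D r' z) \<longrightarrow>
      gip D a (g j) \<le> gip D a' (g j) + L * (\<Sum>i<m. \<bar>gip D r (g i) - gip D r' (g i)\<bar>)"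
proof -
  \<comment> \<open>\<open>s i\<close> bounds the functional \<open>ip D (g i)\<close> on
    \<open>S0\<close> in the gradient norm.\<close>
  define s where "s i = sn1 D (Ah_inv D \<T> (g i))" for i
  have s0: "0 \<le> s i" for i by (simp add: s_def sn1_nonneg)
  define L where "L = 2 * (\<Sum>i<m. s i) * sn1 D (A (g j))"
  have L0: "0 \<le> L" unfolding L_def using s0 sn1_nonneg by (intro mult_nonneg_nonneg sum_nonneg) auto
  have "gip D a (g j) \<le> gip D a' (g j) + L * (\<Sum>i<m. \<bar>gip D r (g i) - gip D r' (g i)\<bar>)"
    if a: "a \<in> S0" "a' \<in> S0" and r: "r \<in> S0" "r' \<in> S0" and 
      w: "\<forall>z\<in>S. ip D a z + k * gip D (Y a) z = ip D r z" "\<forall>z\<in>S. ip D a' z + k * gip D (Y a') z = ip D r' z" for a a' r r'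
  proof -
    define G where "G = Ah_inv D \<T> (\<lambda>x. a x - a' x)"
    define \<rho> where "\<rho> = (\<lambda>x. r x - r' x)"
    have d0: "(\<lambda>x. a x - a' x) \<in> S0" using S0_lincomb[OF a, of 1 "-1"] by simp
    have r0: "\<rho> \<in> S0" unfolding \<rho>_def using S0_lincomb[OF r, of 1 "-1"] by simp
    have G: "G \<in> S0" "A G = (\<lambda>x. a x - a' x)" using Ah_inv[OF d0] by (auto simp: G_def)
    have GS: "G \<in> S" using G(1) by (rule S0_S)
    have sG: "0 \<le> sn1 D G" by (rule sn1_nonneg)
    have gS: "g i \<in> S" if "i < m" for i using g[OF that] by (rule S0_S)
    have \<rho>c: "gip D \<rho> (g i) = gip D r (g i) - gip D r' (g i)" if "i < m" for i
      unfolding \<rho>_def using gip_lincomb[OF S_H1[OF S0_S[OF r(1)]] S_H1[OF S0_S[OF r(2)]] S_H1[OF gS[OF that]], of 1 "-1"] by simp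
    have ac: "gip D (\<lambda>x. a x - a' x) (g j) = gip D a (g j) - gip D a' (g j)"
      using gip_lincomb[OF S_H1[OF S0_S[OF a(1)]] S_H1[OF S0_S[OF a(2)]] S_H1[OF gS[OF j]], of 1 "-1"] by simp
    define R where "R = (\<Sum>i<m. \<bar>gip D r (g i) - gip D r' (g i)\<bar>)"
    have "(sn1 D G)\<^sup>2 \<le> 2 * ip D \<rho> G"
      unfolding sn1_sq G_def \<rho>_def using w by (intro solution_stability[OF a r k]) auto
    also have "ip D \<rho> G = ip D (\<lambda>x. \<Sum>i<m. gip D \<rho> (g i) * g i x) G" using gs[OF r0] by simp
    also have "\<dots> = (\<Sum>i<m. gip D \<rho> (g i) * ip D (g i) G)" using gS GS by (intro ip_sum S_L2) auto
    also have "\<dots> \<le> (\<Sum>i<m. \<bar>gip D r (g i) - gip D r' (g i)\<bar> * ((\<Sum>i<m. s i) * sn1 D G))"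
    proof (intro sum_mono)
      fix i assume "i \<in> {..<m}"
      hence i: "i < m" by simp
      have "ip D (g i) G = gip D (Ah_inv D \<T> (g i)) G"
        using ip_Ah[OF S0_S[OF Ah_inv(1)[OF g[OF i]]] GS] Ah_inv(2)[OF g[OF i]] by simp
      hence "\<bar>ip D (g i) G\<bar> \<le> s i * sn1 D G"
        unfolding s_def using gip_le_sn1[OF S_H1[OF S0_S[OF Ah_inv(1)[OF g[OF i]]]] S_H1[OF GS]] by simp
      also have "\<dots> \<le> (\<Sum>i<m. s i) * sn1 D G" using i s0 by (intro mult_right_mono sG member_le_sum) auto
      finally have b: "\<bar>ip D (g i) G\<bar> \<le> (\<Sum>i<m. s i) * sn1 D G" .
      have "gip D \<rho> (g i) * ip D (g i) G \<le> \<bar>gip D \<rho> (g i)\<bar> * \<bar>ip D (g i) G\<bar>" by (metis abs_ge_self abs_mult)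
      also have "\<dots> \<le> \<bar>gip D \<rho> (g i)\<bar> * ((\<Sum>i<m. s i) * sn1 D G)" by (intro mult_left_mono b) auto
      finally show "gip D \<rho> (g i) * ip D (g i) G \<le> \<bar>gip D r (g i) - gip D r' (g i)\<bar> * ((\<Sum>i<m. s i) * sn1 D G)"
        by (simp add: \<rho>c[OF i])
    qed
    also have "\<dots> = R * ((\<Sum>i<m. s i) * sn1 D G)" by (simp add: R_def sum_distrib_right)
    finally have "sn1 D G * sn1 D G \<le> (2 * (\<Sum>i<m. s i) * R) * sn1 D G" by (simp add: power2_eq_square mult_ac)
    hence GR: "sn1 D G \<le> 2 * (\<Sum>i<m. s i) * R"
    proof (cases "sn1 D G = 0")
      case True
      have "0 \<le> 2 * (\<Sum>i<m. s i) * R" unfolding R_def using s0 by (intro mult_nonneg_nonneg sum_nonneg) auto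
      thus ?thesis using True by simp
    qed (use sG in auto)
    \<comment> \<open>Two integrations by parts put \<open>A\<close> on \<open>g j\<close>, so that
      the gradient norm of \<open>G\<close> controls the coordinate.\<close>
    have "gip D a (g j) - gip D a' (g j) = ip D (A G) (A (g j))"
      unfolding ac[symmetric] G(2) by (rule gip_ip[OF gS[OF j] S0_S[OF d0]])
    also have "\<dots> = gip D G (A (g j))" by (rule ip_Ah[OF GS Ah_S[OF gS[OF j]]])
    also have "\<dots> \<le> sn1 D G * sn1 D (A (g j))" using gip_le_sn1[OF S_H1[OF GS] S_H1[OF Ah_S[OF gS[OF j]]]] by simp
    also have "\<dots> \<le> (2 * (\<Sum>i<m. s i) * R) * sn1 D (A (g j))" by (intro mult_right_mono GR sn1_nonneg)
    finally show ?thesis by (simp add: L_def R_def mult_ac)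
  qed
  thus ?thesis using L0 by blast
qed

end

section \<open>The scheme as an instance of the stochastic inequality\<close>

locale ch_scheme = ch_mesh D \<T> F + wiener_noise M D \<phi> lam Fl Q W K 
  for D :: "(real^'n::finite) set" and \<T> F and M :: "'w measure" and \<phi> lam Fl Q W K +
  fixes X0 :: "'n fn" and Cs k :: real and N :: nat and X :: "nat \<Rightarrow> 'w \<Rightarrow> 'n fn" and L :: real
  assumes Cs: "0 \<le> Cs" and stab: "\<And>v. v \<in> H1 D \<Longrightarrow> mean_zero D v \<Longrightarrow> sn1 D (proj v) \<le> Cs * sn1 D v"
    and X0: "X0 \<in> L2 D" "mean_zero D X0" and scheme: "scheme D \<T> F M W X0 k N X"
    and k: "0 < k" "k \<le> k_1" "k \<le> 1" and L: "Jfun D F (proj X0) \<le> L" "0 < L"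
begin

sublocale eigen_mesh D \<T> \<phi> lam ..

definition "tt n = real n * k"
text \<open>Index shift against the scheme: \<open>w n\<close> and \<open>Z n\<close> belong to the
  increment from \<open>tt n\<close> to \<open>tt (Suc n)\<close>, which drives
  \<open>X (Suc n)\<close>.\<close>

definition "w n \<omega> = proj (incr (tt n) (tt (Suc n)) \<omega>)"
definition "Z n \<omega> = Zr (tt n) (tt (Suc n)) \<omega>"
definition "m n \<omega> = ip D (w n \<omega>) (Y (X n \<omega>))"
text \<open>The value 1 outside the time range and the sample space makes \<open>Sp\<close> at least
  1 everywhere.\<close>

definition "Sp n \<omega> = (if n \<le> N \<and> \<omega> \<in> space M then \<Phi> (X n \<omega>) + (\<Sum>i=1..n. k / 2 * gip D (Y (X i \<omega>)) (Y (X i \<omega>))) else 1)"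
definition "Fn n = Fm (tt n)"
text \<open>One constant for both estimates: the first summand serves the martingale bound, the
  second the remainder, where the squared gradient norm of the projected noise is at most
  \<open>Cs^2\<close> times \<open>Z\<close>.\<close>

definition "cc = C_m * Cs + C_r * (Cs\<^sup>2 + Cs ^ 4)"

lemma tt: "0 \<le> tt n" "tt n < tt (Suc n)" "tt n \<le> tt (Suc n)" "tt (Suc n) - tt n = k"
  using k by (auto simp: tt_def algebra_simps)

lemma cc_nonneg: "0 \<le> cc"
  unfolding cc_def using Cs c_nonneg by (intro add_nonneg_nonneg mult_nonneg_nonneg) auto

lemma X_S: "n \<le> N \<Longrightarrow> \<omega> \<in> space M \<Longrightarrow> X n \<omega> \<in> S"
  using scheme unfolding scheme_def by blast

lemma X_0: "\<omega> \<in> space M \<Longrightarrow> X 0 \<omega> = proj X0"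
  using scheme unfolding scheme_def by blast

lemma w_S0: "\<omega> \<in> space M \<Longrightarrow> w n \<omega> \<in> S0"
  unfolding w_def using tt by (intro Ph_S0 incr_L2 incr_mean_zero) auto

lemma X_weak:
  assumes n: "n < N"
  shows "AE \<omega> in M. \<forall>z\<in>S. ip D (\<lambda>x. X (Suc n) \<omega> x - X n \<omega> x) z + k * gip D (Y (X (Suc n) \<omega>)) z = ip D (w n \<omega>) z"
proof -
  have "Suc n \<in> {1..N}" using n by auto
  hence "AE \<omega> in M. \<forall>x. X (Suc n) \<omega> x - X (Suc n - 1) \<omega> x + k * A (A (X (Suc n) \<omega>)) x
          + k * A (proj (\<lambda>y. f (X (Suc n) \<omega> y))) x
        = proj (\<lambda>y. W (real (Suc n) * k) \<omega> y - W (real (Suc n - 1) * k) \<omega> y) x"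
    using scheme unfolding scheme_def by blast
  thus ?thesis
  proof (rule AE_mp, intro AE_I2 impI ballI)
    fix \<omega> z assume w: "\<omega> \<in> space M" and z: "z \<in> S" and
      eq: "\<forall>x. X (Suc n) \<omega> x - X (Suc n - 1) \<omega> x + k * A (A (X (Suc n) \<omega>)) x
          + k * A (proj (\<lambda>y. f (X (Suc n) \<omega> y))) x
        = proj (\<lambda>y. W (real (Suc n) * k) \<omega> y - W (real (Suc n - 1) * k) \<omega> y) x"
    show "ip D (\<lambda>x. X (Suc n) \<omega> x - X n \<omega> x) z + k * gip D (Y (X (Suc n) \<omega>)) z = ip D (w n \<omega>) z"
    proof (rule scheme_weak[OF _ _ z])
      show "X (Suc n) \<omega> \<in> S" "X n \<omega> \<in> S" using n w by (auto intro: X_S)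
      fix x show "X (Suc n) \<omega> x - X n \<omega> x + k * A (A (X (Suc n) \<omega>)) x + k * A (proj (\<lambda>y. f (X (Suc n) \<omega> y))) x = w n \<omega> x"
        using eq[rule_format, of x] by (simp add: w_def incr_def tt_def)
    qed
  qed
qed

text \<open>\<open>scheme\<close> places the iterates in \<open>Sh\<close>. Testing with the
  constant, to which neither the gradient of \<open>Y\<close> nor the noise contributes, shows that
  the mean is conserved.\<close>

lemma X_S0: "n \<le> N \<Longrightarrow> AE \<omega> in M. X n \<omega> \<in> S0"
proof (induction n)
  case 0
  show ?case using Ph_S0[OF X0] by (intro AE_I2) (simp add: X_0)
next
  case (Suc n)
  hence n: "n < N" and IH: "AE \<omega> in M. X n \<omega> \<in> S0" by auto
  from X_weak[OF n] IH AE_space show ?case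
  proof eventually_elim
    case (elim \<omega>)
    let ?o = "indicat_real (closure D)"
    have XS: "X (Suc n) \<omega> \<in> S" "X n \<omega> \<in> S" using n elim(3) by (auto intro: X_S)
    have "ip D (\<lambda>x. X (Suc n) \<omega> x - X n \<omega> x) ?o + k * gip D (Y (X (Suc n) \<omega>)) ?o = ip D (w n \<omega>) ?o"
      using elim(1) Sh_indicator by blast
    moreover have "gip D (Y (X (Suc n) \<omega>)) ?o = 0" by (intro gip_indicator_closure S_H1 Y_S XS)
    moreover have "ip D (w n \<omega>) ?o = 0" using w_S0[OF elim(3)] by (simp add: S0_def mean_zero_ip)
    moreover have "ip D (X n \<omega>) ?o = 0" using elim(2) by (simp add: S0_def mean_zero_ip)
    ultimately have "ip D (X (Suc n) \<omega>) ?o = 0" using ip_diff[OF S_L2[OF XS(1)] S_L2[OF XS(2)] L2_indicator_closure] by simp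
    thus ?case using XS by (simp add: S0_def mean_zero_ip)
  qed
qed

lemma w_bound: "AE \<omega> in M. gip D (w n \<omega>) (w n \<omega>) \<le> Cs\<^sup>2 * Z n \<omega>"
  using Zinf_finite[OF tt(1,2)[of n]] AE_space
proof eventually_elim
  case (elim \<omega>)
  show ?case unfolding w_def Z_def
  proof (rule gip_Ph_le[OF stab])
    fix l show "(\<Sum>j<l. lam j * (ip D (incr (tt n) (tt (Suc n)) \<omega>) (\<phi> j))\<^sup>2) \<le> Zr (tt n) (tt (Suc n)) \<omega>"
      using Zn_le_Zr[OF elim(1)] by (simp add: Zn_def)
  qed (use elim tt in \<open>auto intro: incr_L2 incr_mean_zero\<close>)
qed

lemma Phi_le_Sp: "n \<le> N \<Longrightarrow> \<omega> \<in> space M \<Longrightarrow> \<Phi> (X n \<omega>) \<le> Sp n \<omega>"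
  unfolding Sp_def using k gip_self_nonneg by (auto intro!: sum_nonneg)

lemma Sp_ge_1: "1 \<le> Sp n \<omega>"
proof (cases "n \<le> N \<and> \<omega> \<in> space M")
  case True
  have "1 \<le> \<Phi> (X n \<omega>)" using True by (intro Phi_bounds S_bm X_S) auto
  thus ?thesis using Phi_le_Sp[of n \<omega>] True by simp
qed (auto simp: Sp_def)

lemma Z_nonneg: "0 \<le> Z n \<omega>" by (simp add: Z_def Zr_nonneg)

lemma sn1_w_bound: "AE \<omega> in M. sn1 D (w n \<omega>) \<le> Cs * sqrt (Z n \<omega>)"
  using w_bound[of n]
proof eventually_elim
  case (elim \<omega>)
  have "sn1 D (w n \<omega>) \<le> sqrt (Cs\<^sup>2 * Z n \<omega>)" unfolding sn1_def using elim by (rule real_sqrt_le_mono)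
  thus ?case using Cs by (simp add: real_sqrt_mult)
qed

lemma m_bound: "n < N \<Longrightarrow> AE \<omega> in M. \<bar>m n \<omega>\<bar> \<le> cc * sqrt (Z n \<omega>) * Sp n \<omega>"
proof -
  assume n: "n < N"
  from sn1_w_bound[of n] AE_space show ?thesis
  proof eventually_elim
    case (elim \<omega>)
    have XS: "X n \<omega> \<in> S" using n elim by (intro X_S) auto
    have P: "0 \<le> \<Phi> (X n \<omega>)" using Phi_bounds(1)[OF S_bm[OF XS]] by simp
    have z: "0 \<le> sqrt (Z n \<omega>)" using Z_nonneg by simp
    have "\<bar>m n \<omega>\<bar> \<le> C_m * sn1 D (w n \<omega>) * \<Phi> (X n \<omega>)" unfolding m_def by (intro abs_ip_Y_le w_S0 elim XS)
    also have "\<dots> \<le> C_m * (Cs * sqrt (Z n \<omega>)) * Sp n \<omega>"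
      using c_nonneg P elim n Cs z Phi_le_Sp[of n \<omega>] by (intro mult_mono mult_left_mono) auto
    also have "\<dots> = (C_m * Cs) * (sqrt (Z n \<omega>) * Sp n \<omega>)" by simp
    also have "\<dots> \<le> cc * (sqrt (Z n \<omega>) * Sp n \<omega>)"
    proof (rule mult_right_mono)
      show "C_m * Cs \<le> cc" unfolding cc_def using c_nonneg by simp
      show "0 \<le> sqrt (Z n \<omega>) * Sp n \<omega>" using z Sp_ge_1[of n \<omega>] by (intro mult_nonneg_nonneg) auto
    qed
    finally show ?case by (simp add: mult.assoc)
  qed
qed

lemma Sp_step: "n < N \<Longrightarrow> AE \<omega> in M. Sp (Suc n) \<omega> \<le> Sp n \<omega> + m n \<omega> + cc * (Z n \<omega> + (Z n \<omega>)\<^sup>2) * Sp n \<omega>"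
proof -
  assume n: "n < N"
  from w_bound[of n] X_weak[OF n] AE_space show ?thesis
  proof eventually_elim
    case (elim \<omega>)
    have XS: "X (Suc n) \<omega> \<in> S" "X n \<omega> \<in> S" using n elim by (auto intro: X_S)
    have w0: "w n \<omega> \<in> S0" by (intro w_S0 elim)
    have st: "\<Phi> (X (Suc n) \<omega>) + k / 2 * gip D (Y (X (Suc n) \<omega>)) (Y (X (Suc n) \<omega>)) 
      \<le> \<Phi> (X n \<omega>) + m n \<omega> + C_r * (gip D (w n \<omega>) (w n \<omega>) + (gip D (w n \<omega>) (w n \<omega>))\<^sup>2) * \<Phi> (X n \<omega>)"
      unfolding m_def using elim(2) by (intro energy_step XS w0 k) blast
    have P: "0 \<le> \<Phi> (X n \<omega>)" "\<Phi> (X n \<omega>) \<le> Sp n \<omega>" using Phi_bounds(1)[OF S_bm[OF XS(2)]] Phi_le_Sp[of n \<omega>] n elim by auto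
    have z: "0 \<le> Z n \<omega>" by (rule Z_nonneg)
    have g: "0 \<le> gip D (w n \<omega>) (w n \<omega>)" by (rule gip_self_nonneg)
    have "gip D (w n \<omega>) (w n \<omega>) + (gip D (w n \<omega>) (w n \<omega>))\<^sup>2 \<le> Cs\<^sup>2 * Z n \<omega> + (Cs\<^sup>2 * Z n \<omega>)\<^sup>2"
      using elim(1) g by (intro add_mono power_mono) auto
    also have "\<dots> = Cs\<^sup>2 * Z n \<omega> + Cs ^ 4 * (Z n \<omega>)\<^sup>2" by (simp add: power_mult_distrib power_mult[symmetric])
    also have "\<dots> \<le> (Cs\<^sup>2 + Cs ^ 4) * (Z n \<omega> + (Z n \<omega>)\<^sup>2)" using z by (simp add: algebra_simps)
    finally have "C_r * (gip D (w n \<omega>) (w n \<omega>) + (gip D (w n \<omega>) (w n \<omega>))\<^sup>2) * \<Phi> (X n \<omega>)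
       \<le> C_r * ((Cs\<^sup>2 + Cs ^ 4) * (Z n \<omega> + (Z n \<omega>)\<^sup>2)) * Sp n \<omega>"
      using c_nonneg P z by (intro mult_mono mult_left_mono) auto
    also have "\<dots> = (C_r * (Cs\<^sup>2 + Cs ^ 4)) * ((Z n \<omega> + (Z n \<omega>)\<^sup>2) * Sp n \<omega>)" by simp
    also have "\<dots> \<le> cc * ((Z n \<omega> + (Z n \<omega>)\<^sup>2) * Sp n \<omega>)"
    proof (rule mult_right_mono)
      show "C_r * (Cs\<^sup>2 + Cs ^ 4) \<le> cc" unfolding cc_def using c_nonneg Cs by simp
      show "0 \<le> (Z n \<omega> + (Z n \<omega>)\<^sup>2) * Sp n \<omega>" using z Sp_ge_1[of n \<omega>] by (intro mult_nonneg_nonneg) auto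
    qed
    finally have R: "C_r * (gip D (w n \<omega>) (w n \<omega>) + (gip D (w n \<omega>) (w n \<omega>))\<^sup>2) * \<Phi> (X n \<omega>) \<le> cc * (Z n \<omega> + (Z n \<omega>)\<^sup>2) * Sp n \<omega>" by (simp add: mult.assoc)
    have "Sp (Suc n) \<omega> = \<Phi> (X (Suc n) \<omega>) + ((\<Sum>i=1..n. k / 2 * gip D (Y (X i \<omega>)) (Y (X i \<omega>))) + k / 2 * gip D (Y (X (Suc n) \<omega>)) (Y (X (Suc n) \<omega>)))"
      using n elim(3) by (simp add: Sp_def)
    moreover have "Sp n \<omega> = \<Phi> (X n \<omega>) + (\<Sum>i=1..n. k / 2 * gip D (Y (X i \<omega>)) (Y (X i \<omega>)))"
      using n elim(3) by (simp add: Sp_def)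
    ultimately show ?case using st R by linarith
  qed
qed

section \<open>Adaptedness and the martingale property\<close>

definition basis where "basis = (SOME p. case p of (l::nat, g) \<Rightarrow> (\<forall>i<l. g i \<in> S0) \<and> 
  (\<forall>i<l. \<forall>j<l. gip D (g i) (g j) = (if i = j then 1 else 0)) \<and> (\<forall>v\<in>S0. v = (\<lambda>x. \<Sum>i<l. gip D v (g i) * g i x)))"
definition "l = fst basis"
definition "g = snd basis"

lemma g_S0: "i < l \<Longrightarrow> g i \<in> S0" and g_on: "i < l \<Longrightarrow> j < l \<Longrightarrow> gip D (g i) (g j) = (if i = j then 1 else 0)"
  and g_span: "v \<in> S0 \<Longrightarrow> v = (\<lambda>x. \<Sum>i<l. gip D v (g i) * g i x)"
proof -
  have "\<exists>p. case p of (l'::nat, g') \<Rightarrow> (\<forall>i<l'. g' i \<in> S0) \<and> 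
  (\<forall>i<l'. \<forall>j<l'. gip D (g' i) (g' j) = (if i = j then 1 else 0)) \<and> (\<forall>v\<in>S0. v = (\<lambda>x. \<Sum>i<l'. gip D v (g' i) * g' i x))"
    using S0_basis by simp
  from someI_ex[OF this] have "(\<forall>i<l. g i \<in> S0) \<and> 
  (\<forall>i<l. \<forall>j<l. gip D (g i) (g j) = (if i = j then 1 else 0)) \<and> (\<forall>v\<in>S0. v = (\<lambda>x. \<Sum>i<l. gip D v (g i) * g i x))"
    unfolding basis_def[symmetric] l_def g_def by (simp add: case_prod_beta)
  note * = this[THEN conjunct1, rule_format] this[THEN conjunct2, THEN conjunct1, rule_format] this[THEN conjunct2, THEN conjunct2, rule_format]
  show "i < l \<Longrightarrow> g i \<in> S0" by (rule *(1))
  show "i < l \<Longrightarrow> j < l \<Longrightarrow> gip D (g i) (g j) = (if i = j then 1 else 0)" by (rule *(2))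
  show "v \<in> S0 \<Longrightarrow> v = (\<lambda>x. \<Sum>i<l. gip D v (g i) * g i x)" by (rule *(3))
qed

lemma g_S: "i < l \<Longrightarrow> g i \<in> S" using g_S0 S0_S by blast

text \<open>The coordinates of the projected noise become scalar products of the increment with
  fixed \<open>L2\<close> functions, hence Gaussian and measurable with respect to
  \<open>Gm\<close>.\<close>

lemma w_coord: "\<omega> \<in> space M \<Longrightarrow> i < l \<Longrightarrow> gip D (w n \<omega>) (g i) = ip D (incr (tt n) (tt (Suc n)) \<omega>) (A (g i))"
proof -
  assume w: "\<omega> \<in> space M" and i: "i < l"
  have "gip D (w n \<omega>) (g i) = ip D (w n \<omega>) (A (g i))" by (rule gip_ip[OF g_S[OF i] S0_S[OF w_S0[OF w]]])
  also have "\<dots> = ip D (incr (tt n) (tt (Suc n)) \<omega>) (A (g i))"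
    unfolding w_def using tt w i by (intro ip_Ph incr_L2 Ah_S g_S) auto
  finally show ?thesis .
qed

lemma A_g_L2: "i < l \<Longrightarrow> A (g i) \<in> L2 D"
  by (intro S_L2 Ah_S g_S)

lemma Fn_mono: "subalgebra (Fn (Suc n)) (Fn n)"
  unfolding Fn_def using tt by (intro Fm_mono) auto

lemma X_adapted: "n \<le> N \<Longrightarrow> i < l \<Longrightarrow> (\<lambda>\<omega>. gip D (X n \<omega>) (g i)) \<in> borel_measurable (Fn n)"
proof (induction n arbitrary: i)
  case 0
  have "(\<lambda>\<omega>. gip D (proj X0) (g i)) \<in> borel_measurable (Fn 0)" by simp
  thus ?case by (rule measurable_cong[THEN iffD1, rotated]) (simp add: Fn_def space_Fm X_0)
next
  case (Suc n)
  hence n: "n < N" "n \<le> N" by auto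
  \<comment> \<open>A set of full measure on which the step equation holds. The Lipschitz relation
    is established between pairs of its points and then extended.\<close>
  define H where "H = {\<omega> \<in> space M. X n \<omega> \<in> S0 \<and> X (Suc n) \<omega> \<in> S0 \<and> 
    (\<forall>z\<in>S. ip D (\<lambda>x. X (Suc n) \<omega> x - X n \<omega> x) z + k * gip D (Y (X (Suc n) \<omega>)) z = ip D (w n \<omega>) z)}"
  define r where "r \<omega> = (\<lambda>x. 1 * X n \<omega> x + 1 * w n \<omega> x)" for \<omega>
  define R where "R \<omega> j = gip D (X n \<omega>) (g j) + gip D (w n \<omega>) (g j)" for \<omega> j
  obtain L where L: "0 \<le> L" and lip: "\<forall>a\<in>S0. \<forall>a'\<in>S0. \<forall>r\<in>S0. \<forall>r'\<in>S0. (\<forall>z\<in>S. ip D a z + k * gip D (Y a) z = ip D r z) \<longrightarrow> 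
      (\<forall>z\<in>S. ip D a' z + k * gip D (Y a') z = ip D r' z) \<longrightarrow>
      gip D a (g i) \<le> gip D a' (g i) + L * (\<Sum>j<l. \<bar>gip D r (g j) - gip D r' (g j)\<bar>)"
    using solution_lipschitz[of l g k i, OF g_S0 g_span k(1,2) Suc.prems(2)] by auto
  have Hd: "X n \<omega> \<in> S0" "X (Suc n) \<omega> \<in> S0" "w n \<omega> \<in> S0" "r \<omega> \<in> S0" if "\<omega> \<in> H" for \<omega>
    using that w_S0[of \<omega> n] S0_lincomb[of "X n \<omega>" "w n \<omega>" 1 1] by (auto simp: H_def r_def)
  have Hw: "\<forall>z\<in>S. ip D (X (Suc n) \<omega>) z + k * gip D (Y (X (Suc n) \<omega>)) z = ip D (r \<omega>) z" if "\<omega> \<in> H" for \<omega>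
  proof
    fix z assume z: "z \<in> S"
    note d = Hd[OF that, THEN S0_S]
    have "ip D (r \<omega>) z = ip D (X n \<omega>) z + ip D (w n \<omega>) z"
      unfolding r_def using ip_lincomb[OF S_L2[OF d(1)] S_L2[OF d(3)] S_L2[OF z], of 1 1] by simp
    moreover have "ip D (\<lambda>x. X (Suc n) \<omega> x - X n \<omega> x) z + k * gip D (Y (X (Suc n) \<omega>)) z = ip D (w n \<omega>) z"
      using that z by (simp add: H_def)
    ultimately show "ip D (X (Suc n) \<omega>) z + k * gip D (Y (X (Suc n) \<omega>)) z = ip D (r \<omega>) z"
      using ip_diff[OF S_L2[OF d(2)] S_L2[OF d(1)] S_L2[OF z]] by simp
  qed
  have Hr: "gip D (r \<omega>) (g j) = R \<omega> j" if "\<omega> \<in> H" "j < l" for \<omega> j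
    unfolding r_def R_def using gip_lincomb[OF S_H1[OF S0_S[OF Hd(1)[OF that(1)]]] S_H1[OF S0_S[OF Hd(3)[OF that(1)]]] S_H1[OF g_S[OF that(2)]], of 1 1] by simp
  have "\<exists>h. h \<in> borel_measurable (Fn (Suc n)) \<and> (\<forall>\<omega>\<in>H. gip D (X (Suc n) \<omega>) (g i) = h \<omega>)"
  proof (rule lipschitz_factor_measurable[OF L])
    fix \<omega> \<omega>' assume H: "\<omega> \<in> H" "\<omega>' \<in> H"
    have "gip D (X (Suc n) \<omega>) (g i) \<le> gip D (X (Suc n) \<omega>') (g i) + L * (\<Sum>j<l. \<bar>gip D (r \<omega>) (g j) - gip D (r \<omega>') (g j)\<bar>)"
      using lip[rule_format, OF Hd(2)[OF H(1)] Hd(2)[OF H(2)] Hd(4)[OF H(1)] Hd(4)[OF H(2)] Hw[OF H(1), rule_format] Hw[OF H(2), rule_format]] by simp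
    also have "(\<Sum>j<l. \<bar>gip D (r \<omega>) (g j) - gip D (r \<omega>') (g j)\<bar>) = (\<Sum>j<l. \<bar>R \<omega> j - R \<omega>' j\<bar>)"
      by (intro sum.cong refl) (simp add: Hr H)
    finally show "gip D (X (Suc n) \<omega>) (g i) \<le> gip D (X (Suc n) \<omega>') (g i) + L * (\<Sum>j<l. \<bar>R \<omega> j - R \<omega>' j\<bar>)" .
  next
    fix j assume j: "j < l"
    have "(\<lambda>\<omega>. gip D (X n \<omega>) (g j)) \<in> borel_measurable (Fn (Suc n))"
      by (rule measurable_from_subalg[OF Fn_mono Suc.IH[OF n(2) j]])
    moreover have "(\<lambda>\<omega>. ip D (incr (tt n) (tt (Suc n)) \<omega>) (A (g j))) \<in> borel_measurable (Fn (Suc n))"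
      unfolding Fn_def using tt j by (intro ip_incr_Fm A_g_L2) auto
    hence "(\<lambda>\<omega>. gip D (w n \<omega>) (g j)) \<in> borel_measurable (Fn (Suc n))"
      by (rule measurable_cong[THEN iffD1, rotated]) (simp add: Fn_def space_Fm w_coord j)
    ultimately show "(\<lambda>\<omega>. R \<omega> j) \<in> borel_measurable (Fn (Suc n))" unfolding R_def by (rule borel_measurable_add)
  qed
  then obtain h where h: "h \<in> borel_measurable (Fn (Suc n))" "\<And>\<omega>. \<omega> \<in> H \<Longrightarrow> gip D (X (Suc n) \<omega>) (g i) = h \<omega>" by blast
  \<comment> \<open>Off \<open>H\<close> the equality with \<open>h\<close> may fail; the null sets
    in the filtration absorb this.\<close>
  have "AE \<omega> in M. \<omega> \<in> H" using X_S0[OF n(2)] X_S0[OF Suc.prems(1)] X_weak[OF n(1)] AE_space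
    by eventually_elim (simp add: H_def)
  hence "AE \<omega> in M. gip D (X (Suc n) \<omega>) (g i) = h \<omega>" by eventually_elim (rule h(2))
  thus ?case unfolding Fn_def by (rule Fm_AE_eq[OF tt(1) h(1)[unfolded Fn_def]])
qed

lemma X_coord: "n \<le> N \<Longrightarrow> AE \<omega> in M. X n \<omega> = (\<lambda>x. \<Sum>i<l. gip D (X n \<omega>) (g i) * g i x)"
proof -
  assume "n \<le> N"
  from X_S0[OF this] show ?thesis by eventually_elim (rule g_span)
qed

lemma adapted_of_X:
  assumes n: "n \<le> N" and h: "(\<lambda>\<omega>. h (\<lambda>x. \<Sum>i<l. gip D (X n \<omega>) (g i) * g i x)) \<in> borel_measurable (Fn n)"
  shows "(\<lambda>\<omega>. h (X n \<omega>) :: real) \<in> borel_measurable (Fn n)"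
  unfolding Fn_def
proof (rule Fm_AE_eq[OF tt(1) h[unfolded Fn_def]])
  show "AE \<omega> in M. h (X n \<omega>) = h (\<lambda>x. \<Sum>i<l. gip D (X n \<omega>) (g i) * g i x)"
    using X_coord[OF n] by eventually_elim simp
qed

lemma adapted_Fn_mono: "i \<le> n \<Longrightarrow> h \<in> borel_measurable (Fn i) \<Longrightarrow> h \<in> borel_measurable (Fn n)"
proof -
  assume "i \<le> n" and h: "h \<in> borel_measurable (Fn i)"
  hence "tt i \<le> tt n" using k by (simp add: tt_def)
  from measurable_from_subalg[OF Fm_mono[OF tt(1) this]] h show ?thesis unfolding Fn_def by blast
qed

lemma h_adapted: "n \<le> N \<Longrightarrow> z \<in> S \<Longrightarrow> (\<lambda>\<omega>. ip D z (Y (X n \<omega>))) \<in> borel_measurable (Fn n)"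
  by (rule adapted_of_X) (auto intro!: Y_measurable X_adapted g_S)

lemma Sp_adapted: 
  assumes n: "n \<le> N" shows "Sp n \<in> borel_measurable (Fn n)"
proof -
  have P: "(\<lambda>\<omega>. \<Phi> (X n \<omega>)) \<in> borel_measurable (Fn n)"
    by (rule adapted_of_X[OF n]) (auto intro!: Y_measurable X_adapted g_S n)
  have G: "(\<lambda>\<omega>. gip D (Y (X i \<omega>)) (Y (X i \<omega>))) \<in> borel_measurable (Fn n)" if "i \<in> {1..n}" for i
  proof -
    have i: "i \<le> N" "i \<le> n" using that n by auto
    have "(\<lambda>\<omega>. gip D (Y (X i \<omega>)) (Y (X i \<omega>))) \<in> borel_measurable (Fn i)"
      by (rule adapted_of_X[OF i(1), of "\<lambda>v. gip D (Y v) (Y v)"]) (auto intro!: Y_measurable X_adapted g_S i)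
    thus ?thesis by (rule adapted_Fn_mono[OF i(2)])
  qed
  have "(\<lambda>\<omega>. \<Phi> (X n \<omega>) + (\<Sum>i=1..n. k / 2 * gip D (Y (X i \<omega>)) (Y (X i \<omega>)))) \<in> borel_measurable (Fn n)"
    by (intro borel_measurable_add P borel_measurable_sum borel_measurable_times borel_measurable_const G)
  thus ?thesis
    by (rule measurable_cong[THEN iffD1, rotated]) (simp add: Sp_def n Fn_def space_Fm)
qed

lemma m_expand:
  assumes "\<omega> \<in> space M" and that: "n \<le> N"
  shows "m n \<omega> = (\<Sum>i<l. ip D (incr (tt n) (tt (Suc n)) \<omega>) (A (g i)) * ip D (g i) (Y (X n \<omega>)))"
proof -
  have "m n \<omega> = ip D (\<lambda>x. \<Sum>i<l. gip D (w n \<omega>) (g i) * g i x) (Y (X n \<omega>))"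
    unfolding m_def using g_span[OF w_S0[OF assms(1)]] by simp
  also have "\<dots> = (\<Sum>i<l. gip D (w n \<omega>) (g i) * ip D (g i) (Y (X n \<omega>)))"
    using g_S assms by (intro ip_sum S_L2 Y_S X_S) auto
  also have "\<dots> = (\<Sum>i<l. ip D (incr (tt n) (tt (Suc n)) \<omega>) (A (g i)) * ip D (g i) (Y (X n \<omega>)))"
    using assms(1) by (intro sum.cong refl) (simp add: w_coord)
  finally show ?thesis .
qed

lemma m_adapted: "n < N \<Longrightarrow> m n \<in> borel_measurable (Fn (Suc n))"
proof -
  assume n: "n < N"
  have "(\<lambda>\<omega>. ip D (incr (tt n) (tt (Suc n)) \<omega>) (A (g i)) * ip D (g i) (Y (X n \<omega>))) \<in> borel_measurable (Fn (Suc n))" if i: "i < l" for i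
  proof (rule borel_measurable_times)
    show "(\<lambda>\<omega>. ip D (incr (tt n) (tt (Suc n)) \<omega>) (A (g i))) \<in> borel_measurable (Fn (Suc n))"
      unfolding Fn_def using tt i by (intro ip_incr_Fm A_g_L2) auto
    show "(\<lambda>\<omega>. ip D (g i) (Y (X n \<omega>))) \<in> borel_measurable (Fn (Suc n))"
      using n i by (intro adapted_Fn_mono[of n "Suc n"] h_adapted g_S) auto
  qed
  hence "(\<lambda>\<omega>. \<Sum>i<l. ip D (incr (tt n) (tt (Suc n)) \<omega>) (A (g i)) * ip D (g i) (Y (X n \<omega>))) \<in> borel_measurable (Fn (Suc n))"
    by (intro borel_measurable_sum) auto
  thus ?thesis
    by (rule measurable_cong[THEN iffD1, rotated]) (use n in \<open>simp add: m_expand Fn_def space_Fm\<close>)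
qed

text \<open>In coordinates \<open>m n\<close> is a finite sum of products of a variable of the past
  with an independent centred Gaussian. Multiplied by \<open>V\<close>, the past factors are
  integrable because \<open>ip D (g i) (Y (X n \<omega>))\<close> is at most
  \<open>C_m * Sp n \<omega>\<close> in absolute value.\<close>

lemma martingale:
  assumes n: "n < N" and V: "V \<in> borel_measurable (Fn n)" and VS: "integrable M (\<lambda>\<omega>. V \<omega> * Sp n \<omega>)"
  shows "integral\<^sup>L M (\<lambda>\<omega>. V \<omega> * m n \<omega>) = 0"
proof -
  have n': "n \<le> N" using n by simp
  define \<gamma> where "\<gamma> i \<omega> = ip D (incr (tt n) (tt (Suc n)) \<omega>) (A (g i))" for i \<omega>
  define h where "h i \<omega> = V \<omega> * ip D (g i) (Y (X n \<omega>))" for i \<omega>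
  have sub: "subalgebra M (Fn n)" by (simp add: Fn_def Fm_sub)
  have hm: "h i \<in> borel_measurable (Fn n)" if "i < l" for i
    unfolding h_def using that n by (intro borel_measurable_times V h_adapted g_S) auto
  have hi: "integrable M (h i)" if i: "i < l" for i
  proof (rule Bochner_Integration.integrable_bound)
    show "integrable M (\<lambda>\<omega>. C_m * (V \<omega> * Sp n \<omega>))" using VS by simp
    show "h i \<in> borel_measurable M" using measurable_from_subalg[OF sub hm[OF i]] .
    show "AE \<omega> in M. norm (h i \<omega>) \<le> norm (C_m * (V \<omega> * Sp n \<omega>))"
    proof (rule AE_I2)
      fix \<omega> assume w: "\<omega> \<in> space M"
      have XS: "X n \<omega> \<in> S" by (rule X_S[OF n' w])
      have "\<bar>ip D (g i) (Y (X n \<omega>))\<bar> \<le> C_m * sn1 D (g i) * \<Phi> (X n \<omega>)" by (intro abs_ip_Y_le g_S0 i XS)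
      also have "sn1 D (g i) = 1" using g_on[OF i i] by (simp add: sn1_def)
      also have "C_m * 1 * \<Phi> (X n \<omega>) \<le> C_m * Sp n \<omega>" using c_nonneg Phi_le_Sp[OF n' w] by (simp add: mult_left_mono)
      finally have "\<bar>V \<omega>\<bar> * \<bar>ip D (g i) (Y (X n \<omega>))\<bar> \<le> \<bar>V \<omega>\<bar> * (C_m * Sp n \<omega>)" by (intro mult_left_mono) auto
      also have "\<dots> = norm (C_m * (V \<omega> * Sp n \<omega>))" using c_nonneg Sp_ge_1[of n \<omega>] by (simp add: abs_mult)
      finally show "norm (h i \<omega>) \<le> norm (C_m * (V \<omega> * Sp n \<omega>))" by (simp add: h_def abs_mult)
    qed
  qed
  have iv: "indep_var borel (h i) borel (\<gamma> i)" if i: "i < l" for i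
    unfolding \<gamma>_def
    by (rule indep_subalgebras[OF hm[OF i] sub ip_incr_Gm[OF A_g_L2[OF i]] Gm_sub])
       (use tt indep_Fm_Gm in \<open>auto simp: Fn_def\<close>)
  have gi: "integrable M (\<gamma> i)" "integral\<^sup>L M (\<gamma> i) = 0" if "i < l" for i
    unfolding \<gamma>_def using ip_incr_mean[OF tt(1,2) A_g_L2[OF that]] by auto
  have 0: "integrable M (\<lambda>\<omega>. h i \<omega> * \<gamma> i \<omega>)" "integral\<^sup>L M (\<lambda>\<omega>. h i \<omega> * \<gamma> i \<omega>) = 0" if "i < l" for i
    using indep_var_integrable[OF iv[OF that] hi[OF that] gi(1)[OF that]]
      indep_var_lebesgue_integral[OF iv[OF that] hi[OF that] gi(1)[OF that]] gi(2)[OF that] by auto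
  have "integral\<^sup>L M (\<lambda>\<omega>. V \<omega> * m n \<omega>) = integral\<^sup>L M (\<lambda>\<omega>. \<Sum>i<l. h i \<omega> * \<gamma> i \<omega>)"
    by (intro Bochner_Integration.integral_cong refl)
       (simp add: m_expand[OF _ n'] h_def \<gamma>_def sum_distrib_left mult_ac)
  also have "\<dots> = (\<Sum>i<l. integral\<^sup>L M (\<lambda>\<omega>. h i \<omega> * \<gamma> i \<omega>))" using 0(1) by (intro Bochner_Integration.integral_sum) auto
  also have "\<dots> = 0" using 0(2) by simp
  finally show ?thesis .
qed

text \<open>At time 0 the sum in \<open>Sp\<close> is empty, so its value is the shifted initial
  energy, at most \<open>L + c_\<Phi>\<close>. The moment constants are those of
  \<open>Zr_moment\<close>.\<close>

sublocale noise_steps M Fn Z m Sp N cc k "L + c_\<Phi>" "\<lambda>i. gauss_moment i * (K\<^sup>2) ^ i"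
proof
  show "subalgebra M (Fn n)" for n by (simp add: Fn_def Fm_sub)
  show "subalgebra (Fn (Suc n)) (Fn n)" for n by (rule Fn_mono)
  show "Sp n \<in> borel_measurable (Fn n)" if "n \<le> N" for n using that by (rule Sp_adapted)
  show "m n \<in> borel_measurable (Fn (Suc n))" if "n < N" for n using that by (rule m_adapted)
  show "Z n \<in> borel_measurable M" for n unfolding Z_def using tt by (intro Zr_M) auto
  show "1 \<le> Sp n \<omega>" for n \<omega> by (rule Sp_ge_1)
  show "0 \<le> Z n \<omega>" for n \<omega> by (rule Z_nonneg)
  show "(\<integral>\<^sup>+\<omega>. V \<omega> * ennreal (Z n \<omega> ^ i) \<partial>M) = (\<integral>\<^sup>+\<omega>. V \<omega> \<partial>M) * (\<integral>\<^sup>+\<omega>. ennreal (Z n \<omega> ^ i) \<partial>M)"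
    if V: "V \<in> borel_measurable (Fn n)" for n V i
  proof (rule indep_var_nn_integral, rule indep_subalgebras[OF V _ _ Gm_sub])
    show "subalgebra M (Fn n)" by (simp add: Fn_def Fm_sub)
    show "(\<lambda>\<omega>. ennreal (Z n \<omega> ^ i)) \<in> borel_measurable (Gm (tt n) (tt (Suc n)))"
      unfolding Z_def using Zr_Gm by measurable
    show "indep_set (sets (Fn n)) (sets (Gm (tt n) (tt (Suc n))))" unfolding Fn_def using tt by (intro indep_Fm_Gm) auto
  qed (use tt in auto)
  show "integral\<^sup>L M (\<lambda>\<omega>. V \<omega> * m n \<omega>) = 0" 
    if "n < N" "V \<in> borel_measurable (Fn n)" "integrable M (\<lambda>\<omega>. V \<omega> * Sp n \<omega>)" for n V using that by (rule martingale)
  show "AE \<omega> in M. \<bar>m n \<omega>\<bar> \<le> cc * sqrt (Z n \<omega>) * Sp n \<omega>" if "n < N" for n using that by (rule m_bound)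
  show "AE \<omega> in M. Sp (Suc n) \<omega> \<le> Sp n \<omega> + m n \<omega> + cc * (Z n \<omega> + (Z n \<omega>)\<^sup>2) * Sp n \<omega>" if "n < N" for n using that by (rule Sp_step)
  show "(\<integral>\<^sup>+\<omega>. ennreal (Z n \<omega> ^ i) \<partial>M) \<le> ennreal (gauss_moment i * (K\<^sup>2) ^ i * k)" if "1 \<le> i" for n i
    using Zr_moment[OF tt(1,2) _ that, of n] tt(4)[of n] k(3) by (simp add: Z_def)
  show "AE \<omega> in M. Sp 0 \<omega> \<le> L + c_\<Phi>" using L by (intro AE_I2) (simp add: Sp_def \<Phi>_def X_0)
  show "1 \<le> L + c_\<Phi>" using L c_nonneg by simp
  show "0 \<le> cc" by (rule cc_nonneg)
  show "0 < k" by (rule k)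
  show "0 \<le> gauss_moment i * (K\<^sup>2) ^ i" for i by (simp add: gauss_moment_nonneg)
qed

section \<open>Transfer to the claimed quantities\<close>

definition "smax q \<omega> = Max ((\<lambda>n. Sp n \<omega> ^ q) ` {..N})"

lemma Sp_le_smax: "n \<le> N \<Longrightarrow> Sp n \<omega> ^ q \<le> smax q \<omega>"
  unfolding smax_def by (intro Max_ge) auto

text \<open>Passes from the real exponent of the claim to a natural exponent; monotonicity in the
  exponent needs a base of at least 1.\<close>

lemma powr_le_power: "0 \<le> x \<Longrightarrow> x \<le> y \<Longrightarrow> 1 \<le> y \<Longrightarrow> 0 \<le> p \<Longrightarrow> p \<le> real q \<Longrightarrow> x powr p \<le> y ^ q" for x y :: real
proof -
  assume h: "0 \<le> x" "x \<le> y" "1 \<le> y" "0 \<le> p" "p \<le> real q"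
  have "x powr p \<le> y powr p" using h by (intro powr_mono2) auto
  also have "\<dots> \<le> y powr real q" using h by (intro powr_mono) auto
  also have "\<dots> = y ^ q" using h by (simp add: powr_realpow)
  finally show ?thesis .
qed

lemma J_smax:
  assumes w: "\<omega> \<in> space M" and N: "0 < N" and p: "0 \<le> p" "p \<le> real q"
  shows "Max ((\<lambda>j. \<bar>Jfun D F (X j \<omega>)\<bar> powr p) ` {1..N}) \<le> c_\<Phi> ^ q * smax q \<omega>"
proof (intro Max.boundedI)
  fix y assume "y \<in> (\<lambda>j. \<bar>Jfun D F (X j \<omega>)\<bar> powr p) ` {1..N}"
  then obtain j where j: "j \<le> N" "y = \<bar>Jfun D F (X j \<omega>)\<bar> powr p" by auto
  have "\<bar>Jfun D F (X j \<omega>)\<bar> \<le> c_\<Phi> * \<Phi> (X j \<omega>)" by (intro abs_J_le S_bm X_S j w)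
  also have "\<dots> \<le> c_\<Phi> * Sp j \<omega>" using c_nonneg by (intro mult_left_mono Phi_le_Sp j w) auto
  finally have b: "\<bar>Jfun D F (X j \<omega>)\<bar> \<le> c_\<Phi> * Sp j \<omega>" .
  have "1 * 1 \<le> c_\<Phi> * Sp j \<omega>" using c_nonneg Sp_ge_1[of j \<omega>] by (intro mult_mono) auto
  hence "y \<le> (c_\<Phi> * Sp j \<omega>) ^ q" unfolding j(2) using b p by (intro powr_le_power) auto
  also have "\<dots> = c_\<Phi> ^ q * Sp j \<omega> ^ q" by (rule power_mult_distrib)
  also have "\<dots> \<le> c_\<Phi> ^ q * smax q \<omega>" using c_nonneg by (intro mult_left_mono Sp_le_smax j) auto
  finally show "y \<le> c_\<Phi> ^ q * smax q \<omega>" .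
qed (use N in auto)

text \<open>The factor 2 undoes the \<open>k / 2\<close> in \<open>Sp\<close>; the whole sum is
  contained in \<open>Sp N\<close>.\<close>

lemma Y_smax:
  assumes w: "\<omega> \<in> space M" and p: "0 \<le> p" "p \<le> real q"
  shows "(\<Sum>j = 1..N. k * (sn1 D (Y (X j \<omega>)))\<^sup>2) powr p \<le> 2 ^ q * smax q \<omega>"
proof -
  have P: "1 \<le> \<Phi> (X N \<omega>)" using w by (intro Phi_bounds S_bm X_S) auto
  have "(\<Sum>j = 1..N. k * (sn1 D (Y (X j \<omega>)))\<^sup>2) = 2 * (\<Sum>j = 1..N. k / 2 * gip D (Y (X j \<omega>)) (Y (X j \<omega>)))"
    by (simp add: sn1_sq sum_distrib_left)
  also have "\<dots> \<le> 2 * Sp N \<omega>" using P w by (simp add: Sp_def)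
  finally have b: "(\<Sum>j = 1..N. k * (sn1 D (Y (X j \<omega>)))\<^sup>2) \<le> 2 * Sp N \<omega>" .
  have "0 \<le> (\<Sum>j = 1..N. k * (sn1 D (Y (X j \<omega>)))\<^sup>2)" using k by (intro sum_nonneg) auto
  hence "(\<Sum>j = 1..N. k * (sn1 D (Y (X j \<omega>)))\<^sup>2) powr p \<le> (2 * Sp N \<omega>) ^ q"
    using b p Sp_ge_1[of N \<omega>] by (intro powr_le_power) auto
  also have "\<dots> = 2 ^ q * Sp N \<omega> ^ q" by (rule power_mult_distrib)
  also have "\<dots> \<le> 2 ^ q * smax q \<omega>" by (intro mult_left_mono Sp_le_smax) auto
  finally show ?thesis .
qed

text \<open>The right-hand side of \<open>sup_moment\<close> for this instance.\<close>

definition "B p' = (L + c_\<Phi>) ^ Suc p' + 1 + 4 * (real (Suc p') * cc)\<^sup>2 * (gauss_moment 1 * (K\<^sup>2) ^ 1) * (real N * k) * Cq (Suc (2 * p')) + Kq p' * (real N * k) * Cq p'"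

lemma final_bound:
  assumes N: "0 < N" and p: "0 \<le> p" "p \<le> real (Suc p')"
  shows "(\<integral>\<^sup>+ \<omega>. ennreal (Max ((\<lambda>j. \<bar>Jfun D F (X j \<omega>)\<bar> powr p) ` {1..N})) \<partial>M)
         + (\<integral>\<^sup>+ \<omega>. ennreal ((\<Sum>j = 1..N. k * (sn1 D (Y (X j \<omega>)))\<^sup>2) powr p) \<partial>M)
      \<le> ennreal ((c_\<Phi> ^ Suc p' + 2 ^ Suc p') * B p')"
proof -
  have sm: "smax (Suc p') \<in> borel_measurable M"
    unfolding smax_def by (intro borel_measurable_Max borel_measurable_power S_M) auto
  have s0: "0 \<le> smax q \<omega>" for q \<omega>
    using Sp_le_smax[of 0 \<omega> q] Sp_ge_1[of 0 \<omega>] zero_le_power[of "Sp 0 \<omega>" q] by linarith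
  have I: "(\<integral>\<^sup>+\<omega>. ennreal (smax (Suc p') \<omega>) \<partial>M) \<le> ennreal (B p')"
    unfolding smax_def B_def by (rule sup_moment)
  have c0: "0 \<le> c_\<Phi> ^ Suc p'" using c_nonneg by (intro zero_le_power) auto
  have "(\<integral>\<^sup>+ \<omega>. ennreal (Max ((\<lambda>j. \<bar>Jfun D F (X j \<omega>)\<bar> powr p) ` {1..N})) \<partial>M) \<le> (\<integral>\<^sup>+\<omega>. ennreal (c_\<Phi> ^ Suc p') * ennreal (smax (Suc p') \<omega>) \<partial>M)"
    using J_smax[OF _ N p] s0 c0 by (intro nn_integral_mono) (simp add: ennreal_mult[symmetric] ennreal_leI del: power_Suc)
  also have "\<dots> = ennreal (c_\<Phi> ^ Suc p') * (\<integral>\<^sup>+\<omega>. ennreal (smax (Suc p') \<omega>) \<partial>M)" using sm by (intro nn_integral_cmult) auto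
  finally have 1: "(\<integral>\<^sup>+ \<omega>. ennreal (Max ((\<lambda>j. \<bar>Jfun D F (X j \<omega>)\<bar> powr p) ` {1..N})) \<partial>M) \<le> ennreal (c_\<Phi> ^ Suc p') * (\<integral>\<^sup>+\<omega>. ennreal (smax (Suc p') \<omega>) \<partial>M)" .
  have "(\<integral>\<^sup>+ \<omega>. ennreal ((\<Sum>j = 1..N. k * (sn1 D (Y (X j \<omega>)))\<^sup>2) powr p) \<partial>M) \<le> (\<integral>\<^sup>+\<omega>. ennreal (2 ^ Suc p') * ennreal (smax (Suc p') \<omega>) \<partial>M)"
    using Y_smax[OF _ p] s0 by (intro nn_integral_mono) (simp add: ennreal_mult[symmetric] ennreal_leI del: power_Suc)
  also have "\<dots> = ennreal (2 ^ Suc p') * (\<integral>\<^sup>+\<omega>. ennreal (smax (Suc p') \<omega>) \<partial>M)" using sm by (intro nn_integral_cmult) auto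
  finally have "(\<integral>\<^sup>+ \<omega>. ennreal ((\<Sum>j = 1..N. k * (sn1 D (Y (X j \<omega>)))\<^sup>2) powr p) \<partial>M) \<le> ennreal (2 ^ Suc p') * (\<integral>\<^sup>+\<omega>. ennreal (smax (Suc p') \<omega>) \<partial>M)" .
  hence "(\<integral>\<^sup>+ \<omega>. ennreal (Max ((\<lambda>j. \<bar>Jfun D F (X j \<omega>)\<bar> powr p) ` {1..N})) \<partial>M)
         + (\<integral>\<^sup>+ \<omega>. ennreal ((\<Sum>j = 1..N. k * (sn1 D (Y (X j \<omega>)))\<^sup>2) powr p) \<partial>M)
      \<le> ennreal (c_\<Phi> ^ Suc p') * (\<integral>\<^sup>+\<omega>. ennreal (smax (Suc p') \<omega>) \<partial>M) + ennreal (2 ^ Suc p') * (\<integral>\<^sup>+\<omega>. ennreal (smax (Suc p') \<omega>) \<partial>M)"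
    by (intro add_mono 1)
  also have "\<dots> = ennreal (c_\<Phi> ^ Suc p' + 2 ^ Suc p') * (\<integral>\<^sup>+\<omega>. ennreal (smax (Suc p') \<omega>) \<partial>M)"
    using c0 by (simp add: ennreal_plus distrib_right del: power_Suc)
  also have "\<dots> \<le> ennreal (c_\<Phi> ^ Suc p' + 2 ^ Suc p') * ennreal (B p')" by (intro mult_left_mono I) auto
  also have "\<dots> \<le> ennreal ((c_\<Phi> ^ Suc p' + 2 ^ Suc p') * B p')" using c0 by (subst ennreal_mult') auto
  finally show ?thesis .
qed

end

section \<open>The moment bound\<close>

theorem theorem4p3:
  fixes D P :: "(real^'n) set" and Hs :: "real set"
    and Tr :: "real \<Rightarrow> (real^'n) set set"
    and F :: "real poly" and T p K L :: real
  assumes "CARD('n) \<le> 3"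
    and "polytope P" and "D = interior P" and "D \<noteq> {}"
    and "regular_family D Hs Tr"
    and "\<exists>C. \<forall>h \<in> Hs. \<forall>v \<in> H1 D. mean_zero D v \<longrightarrow> sn1 D (Ph D (Tr h) v) \<le> C * sn1 D v"
    and "degree F = 4" and "lead_coeff F > 0"
    and "T > 0" and "p \<ge> 1" and "K > 0" and "L > 0"
  shows "\<exists>C k0. C > 0 \<and> k0 > 0 \<and>
    (\<forall>(M :: 'w measure) Fl Q W X0 \<phi> lam.
       prob_space M \<and> normal_filtration M Fl \<and> selfadj_psd D Q \<and> Q_wiener D M Fl Q W \<and>
       (\<forall>t \<ge> 0. \<forall>\<omega> \<in> space M. mean_zero D (W t \<omega>)) \<and>
       neumann_eigenbasis D \<phi> lam \<and> HS_sq D \<phi> lam Q \<le> ennreal (K\<^sup>2) \<and>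
       X0 \<in> L2 D \<and> mean_zero D X0 \<and>
       (\<forall>h \<in> Hs. dnorm_m1 D (Tr h) (Ph D (Tr h) X0) + Jfun D F (Ph D (Tr h) X0)
                  + sn1 D (Yh D (Tr h) F (Ph D (Tr h) X0)) \<le> L)
     \<longrightarrow> (\<forall>h \<in> Hs. \<forall>N :: nat. \<forall>X. 0 < N \<and> T / real N < k0 \<and>
              scheme D (Tr h) F M W X0 (T / real N) N X \<longrightarrow>
           (\<integral>\<^sup>+ \<omega>. ennreal (Max ((\<lambda>j. \<bar>Jfun D F (X j \<omega>)\<bar> powr p) ` {1..N})) \<partial>M)
         + (\<integral>\<^sup>+ \<omega>. ennreal ((\<Sum>j = 1..N. (T / real N) * (sn1 D (Yh D (Tr h) F (X j \<omega>)))\<^sup>2) powr p) \<partial>M)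
           \<le> ennreal C))"
proof -
  have D: "open D" "bounded D" "convex D"
    using assms(2,3) by (auto intro: bounded_subset[OF polytope_imp_bounded interior_subset] convex_interior polytope_imp_convex)
  interpret bounded_domain D
    using D assms(4) by unfold_locales
  interpret quartic F
    using assms(7,8) by unfold_locales
  interpret ch_domain D F ..
  obtain C0 where C0: "\<And>h v. h \<in> Hs \<Longrightarrow> v \<in> H1 D \<Longrightarrow> mean_zero D v \<Longrightarrow> sn1 D (Ph D (Tr h) v) \<le> C0 * sn1 D v"
    using assms(6) by blast
  \<comment> \<open>A nonnegative stability constant, as \<open>ch_scheme\<close> asks for.\<close>
  define Cs where "Cs = max C0 0"
  have Cs: "sn1 D (Ph D (Tr h) v) \<le> Cs * sn1 D v" if "h \<in> Hs" "v \<in> H1 D" "mean_zero D v" for h v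
  proof -
    have "C0 * sn1 D v \<le> Cs * sn1 D v" by (intro mult_right_mono sn1_nonneg) (simp add: Cs_def)
    thus ?thesis using C0[OF that] by linarith
  qed
  \<comment> \<open>The moments of natural order \<open>Suc p'\<close> dominate those of order
    \<open>p\<close>.\<close>
  obtain p' where p': "p \<le> real p'" using real_arch_simple by blast
  \<comment> \<open>From here on the constants of the locales are repeated with \<open>T\<close> in
    place of \<open>N * k\<close>, so that they exist before mesh, number of steps and noise are
    introduced.\<close>
  define c where "c = C_m * Cs + C_r * (Cs\<^sup>2 + Cs ^ 4)"
  define \<kappa> where "\<kappa> i = gauss_moment i * (K\<^sup>2) ^ i" for i
  define G where "G q = gr_H c (Suc q) * (\<kappa> 1 + \<kappa> (2 * q + 6))" for q
  define E where "E q = (L + c_\<Phi>) ^ Suc q * exp (G q * T)" for q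
  define bound where "bound = (c_\<Phi> ^ Suc p' + 2 ^ Suc p') * ((L + c_\<Phi>) ^ Suc p' + 1 
    + 4 * (real (Suc p') * c)\<^sup>2 * \<kappa> 1 * T * E (Suc (2 * p')) + G p' * T * E p')"
  \<comment> \<open>The bound 1 on the step size serves the moments of \<open>Z\<close>. Adding 1 to
    the absolute value makes the constant positive.\<close>
  show ?thesis
  proof (rule exI[of _ "\<bar>bound\<bar> + 1"], rule exI[of _ "min k_1 1"], intro conjI allI impI ballI)
    show "0 < \<bar>bound\<bar> + 1" by simp
    show "0 < min k_1 1" using k_1_pos by simp
  next
    fix M :: "'w measure" and Fl Q W X0 \<phi> lam h and N :: nat and X
    assume A: "prob_space M \<and> normal_filtration M Fl \<and> selfadj_psd D Q \<and> Q_wiener D M Fl Q W \<and>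
       (\<forall>t \<ge> 0. \<forall>\<omega> \<in> space M. mean_zero D (W t \<omega>)) \<and>
       neumann_eigenbasis D \<phi> lam \<and> HS_sq D \<phi> lam Q \<le> ennreal (K\<^sup>2) \<and>
       X0 \<in> L2 D \<and> mean_zero D X0 \<and>
       (\<forall>h \<in> Hs. dnorm_m1 D (Tr h) (Ph D (Tr h) X0) + Jfun D F (Ph D (Tr h) X0)
                  + sn1 D (Yh D (Tr h) F (Ph D (Tr h) X0)) \<le> L)"
      and h: "h \<in> Hs" and S: "0 < N \<and> T / real N < min k_1 1 \<and> scheme D (Tr h) F M W X0 (T / real N) N X"
    have tri: "triangulation D (Tr h)" using assms(5) h by (simp add: regular_family_def)
    interpret ch_mesh D "Tr h" F
      using tri assms(1) by unfold_locales
    have X0: "X0 \<in> L2 D" "mean_zero D X0" using A by blast+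
    have "dnorm_m1 D (Tr h) (Ph D (Tr h) X0) + Jfun D F (Ph D (Tr h) X0) + sn1 D (Yh D (Tr h) F (Ph D (Tr h) X0)) \<le> L"
      using A h by blast
    hence J0: "Jfun D F (Ph D (Tr h) X0) \<le> L"
      using dnorm_m1_nonneg[OF Ph_S0[OF X0]] sn1_nonneg[of "Yh D (Tr h) F (Ph D (Tr h) X0)"] by linarith
    interpret prob_space M using A by blast
    interpret ch_scheme D "Tr h" F M \<phi> lam Fl Q W K X0 Cs "T / real N" N X L
    proof unfold_locales
      show "sn1 D (Ph D (Tr h) v) \<le> Cs * sn1 D v" if "v \<in> H1 D" "mean_zero D v" for v
        using Cs[OF h that] .
      show "0 \<le> Cs" by (simp add: Cs_def)
    qed (use A S X0 J0 assms in auto)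
    have NT: "real N * (T / real N) = T" using S by simp
    have "B p' = (L + c_\<Phi>) ^ Suc p' + 1 + 4 * (real (Suc p') * c)\<^sup>2 * \<kappa> 1 * T * E (Suc (2 * p')) + G p' * T * E p'"
      unfolding B_def Cq_def Kq_def NT unfolding cc_def E_def G_def \<kappa>_def c_def ..
    hence eq: "(c_\<Phi> ^ Suc p' + 2 ^ Suc p') * B p' = bound" by (simp add: bound_def)
    show "(\<integral>\<^sup>+ \<omega>. ennreal (Max ((\<lambda>j. \<bar>Jfun D F (X j \<omega>)\<bar> powr p) ` {1..N})) \<partial>M)
         + (\<integral>\<^sup>+ \<omega>. ennreal ((\<Sum>j = 1..N. (T / real N) * (sn1 D (Yh D (Tr h) F (X j \<omega>)))\<^sup>2) powr p) \<partial>M)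
           \<le> ennreal (\<bar>bound\<bar> + 1)"
    proof (rule order_trans[OF final_bound[of p p']])
      show "ennreal ((c_\<Phi> ^ Suc p' + 2 ^ Suc p') * B p') \<le> ennreal (\<bar>bound\<bar> + 1)"
        unfolding eq by (intro ennreal_leI) simp
    qed (use S assms(10) p' in auto)
  qed
qed

end
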